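(* Let $T>0$, $Q_T=(0,T)\times(0,1)$. Assume that $$a\in W^{1,\infty}(Q_T),\quad a(t,x)\ge\alpha_0>0\ \text{ a.e. in }Q_T,\quad b\in L^\infty(0,T;W^{1,\infty}(0,1)),\quad q\in L^\infty(0,1),\quad f\in L^2(Q_T),$$ $$u_0\in H^1(0,1),\qquad g_0,g_1\in H^1(0,T),\qquad u_0(0)=g_0(0),\quad u_0(1)=g_1(0).$$ Let $u$ be the unique solution of $$\begin{cases}\partial_tu-\partial_x(a(t,x)\partial_xu)+b(t,x)\partial_xu+q(x)u=f(t,x), & (t,x)\in Q_T,\\ u(0,x)=u_0(x), & x\in(0,1),\\ u(t,0)=g_0(t),\quad u(t,1)=g_1(t), & t\in(0,T),\end{cases}$$ satisfying $u\in H^1(0,T;L^2(0,1))\cap L^2(0,T;H^2(0,1))$. Suppose that the regularising families $(a_\varepsilon),(b_\varepsilon),(q_\varepsilon),(f_\varepsilon),(u_{0,\varepsilon}),(g_{0,\varepsilon}),(g_{1,\varepsilon})$, $\varepsilon\in(0,1]$, satisfy, for some $0<\alpha\le\alpha_0$, $a_\varepsilon\ge\alpha$ uniformly in $\varepsilon$, and, as $\varepsilon\to0$, $$a_\varepsilon\to a\ \text{in }W^{1,\infty}(Q_T),\quad b_\varepsilon\to b\ \text{in }L^\infty(0,T;W^{1,\infty}(0,1)),\quad q_\varepsilon\to q\ \text{in }L^\infty(0,1),$$ $$f_\varepsilon\to f\ \text{in }L^2(Q_T),\quad u_{0,\varepsilon}\to u_0\ \text{in }H^1(0,1),\quad g_{j,\varepsilon}\to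 g_j\ \text{in }H^1(0,T),\ j=0,1.$$ Assume additionally that, for every $\varepsilon\in(0,1]$, $u_{0,\varepsilon}(0)=g_{0,\varepsilon}(0)$ and $u_{0,\varepsilon}(1)=g_{1,\varepsilon}(0)$. Then the corresponding regularised solutions $u_\varepsilon$ (see context) satisfy $u_\varepsilon\to u$ in $H^1(0,T;L^2(0,1))\cap L^2(0,T;H^2(0,1))$ as $\varepsilon\to0$.
   Context: All coefficients $a,b,q$ and their regularisations $a_\varepsilon,b_\varepsilon,q_\varepsilon$ are real-valued; solutions may be complex-valued. For each $\varepsilon\in(0,1]$ the regularised coefficients and data lie in the spaces $a_\varepsilon\in W^{1,\infty}(Q_T)$, $b_\varepsilon\in L^\infty(0,T;W^{1,\infty}(0,1))$, $q_\varepsilon\in L^\infty(0,1)$, $f_\varepsilon\in L^2(Q_T)$, $u_{0,\varepsilon}\in H^1(0,1)$, $g_{j,\varepsilon}\in H^1(0,T)$. The space $H^1(0,T;L^2(0,1))\cap L^2(0,T;H^2(0,1))$ carries the sum norm. The regularised solution $u_\varepsilon$ is the unique weak solution of $$\begin{cases}\partial_tu_\varepsilon-\partial_x(a_\varepsilon\partial_xu_\varepsilon)+b_\varepsilon\partial_xu_\varepsilon+q_\varepsilon u_\varepsilon=f_\varepsilon & \text{in }Q_T,\\ u_\varepsilon(0,x)=u_{0,\varepsilon}(x), & x\in(0,1),\\ u_\varepsilon(t,0)=g_{0,\varepsilon}(t),\quad u_\varepsilon(t,1)=g_{1,\varepsilon}(t), & t\in(0,T),\end{cases}$$ meaning: with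 $\psi_\varepsilon(t,x):=(1-x)g_{0,\varepsilon}(t)+xg_{1,\varepsilon}(t)$, one has $u_\varepsilon\in L^2(0,T;H^1(0,1))$, $u_\varepsilon-\psi_\varepsilon\in L^2(0,T;H_0^1(0,1))$, $\partial_tu_\varepsilon\in L^2(0,T;H^{-1}(0,1))$ (where $H^{-1}(0,1)$ is the dual of $H_0^1(0,1)$), $u_\varepsilon(0)=u_{0,\varepsilon}$ in $L^2(0,1)$, and for every $\varphi\in H_0^1(0,1)$ and a.e. $t\in(0,T)$, $\langle\partial_tu_\varepsilon(t),\varphi\rangle_{H^{-1},H_0^1}+\int_0^1a_\varepsilon\,\partial_xu_\varepsilon\,\overline{\partial_x\varphi}\,dx+\int_0^1b_\varepsilon\,\partial_xu_\varepsilon\,\overline{\varphi}\,dx+\int_0^1q_\varepsilon u_\varepsilon\overline{\varphi}\,dx=\int_0^1f_\varepsilon\overline{\varphi}\,dx$. *)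

theory Defs
  imports "HOL-Analysis.Analysis" "HOL-Probability.Essential_Supremum"
begin

text \<open>
  Elements of Lebesgue, Sobolev and Bochner spaces are represented by functions, identified when
  they agree almost everywhere. Every norm is an extended norm with values in \<^typ>\<open>ereal\<close>: it is
  \<^term>\<open>\<infinity>\<close> exactly outside the space, so that membership in a space is finiteness of its norm.
\<close>

section \<open>Lebesgue spaces\<close>

definition L2_norm :: "'a::euclidean_space set \<Rightarrow> ('a \<Rightarrow> 'b::euclidean_space) \<Rightarrow> ereal" where
  "L2_norm S f =
    (if f \<in> borel_measurable (lebesgue_on S) \<and> integrable (lebesgue_on S) (\<lambda>x. (norm (f x))\<^sup>2)
     then ereal (sqrt (\<integral>x. (norm (f x))\<^sup>2 \<partial>lebesgue_on S)) else \<infinity>)"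

text \<open>The library's \<^const>\<open>esssup\<close> is \<^term>\<open>\<infinity>\<close> on functions that are not measurable.\<close>

definition Linf_norm :: "'a::euclidean_space set \<Rightarrow> ('a \<Rightarrow> 'b::euclidean_space) \<Rightarrow> ereal" where
  "Linf_norm S f =
    (if f \<in> borel_measurable (lebesgue_on S)
     then esssup (lebesgue_on S) (\<lambda>x. ereal (norm (f x))) else \<infinity>)"

section \<open>Weak derivatives and Sobolev spaces\<close>

text \<open>
  A function is smooth if it belongs to a set of differentiable functions that is closed under all
  directional derivatives.
\<close>

definition smooth_fun :: "('a::euclidean_space \<Rightarrow> 'b::euclidean_space) \<Rightarrow> bool" where
  "smooth_fun \<phi> \<longleftrightarrow>
    (\<exists>F. \<phi> \<in> F \<and>
      (\<forall>g\<in>F. (\<forall>x. g differentiable (at x)) \<and> (\<forall>v. (\<lambda>x. frechet_derivative g (at x) v) \<in> F)))"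

definition test_fun :: "'a::euclidean_space set \<Rightarrow> ('a \<Rightarrow> 'b::euclidean_space) \<Rightarrow> bool" where
  "test_fun S \<phi> \<longleftrightarrow>
    smooth_fun \<phi> \<and> (\<exists>K. compact K \<and> K \<subseteq> S \<and> (\<forall>x. x \<notin> K \<longrightarrow> \<phi> x = 0))"

definition locally_integrable :: "'a::euclidean_space set \<Rightarrow> ('a \<Rightarrow> 'b::euclidean_space) \<Rightarrow> bool" where
  "locally_integrable S f \<longleftrightarrow> (\<forall>K. compact K \<and> K \<subseteq> S \<longrightarrow> integrable (lebesgue_on K) f)"

text \<open>The weak derivative of \<open>f\<close> in direction \<open>v\<close> on the open set \<open>S\<close>.\<close>

definition has_weak_deriv ::
    "'a::euclidean_space set \<Rightarrow> 'a \<Rightarrow> ('a \<Rightarrow> 'b::euclidean_space) \<Rightarrow> ('a \<Rightarrow> 'b) \<Rightarrow> bool" where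
  "has_weak_deriv S v f g \<longleftrightarrow>
    locally_integrable S f \<and> locally_integrable S g \<and>
    (\<forall>\<phi>::'a \<Rightarrow> real. test_fun S \<phi> \<longrightarrow>
      (\<integral>x. frechet_derivative \<phi> (at x) v *\<^sub>R f x \<partial>lebesgue_on S) =
      - (\<integral>x. \<phi> x *\<^sub>R g x \<partial>lebesgue_on S))"

definition weak_deriv ::
    "'a::euclidean_space set \<Rightarrow> 'a \<Rightarrow> ('a \<Rightarrow> 'b::euclidean_space) \<Rightarrow> 'a \<Rightarrow> 'b" where
  "weak_deriv S v f = (SOME g. has_weak_deriv S v f g)"

definition H_norm :: "nat \<Rightarrow> real set \<Rightarrow> (real \<Rightarrow> 'b::euclidean_space) \<Rightarrow> ereal" where
  "H_norm k S f =
    (let D = (\<lambda>j. (weak_deriv S 1 ^^ j) f) in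
     if (\<forall>j<k. \<exists>g. has_weak_deriv S 1 (D j) g) \<and> (\<forall>j\<le>k. L2_norm S (D j) < \<infinity>)
     then ereal (sqrt (\<Sum>j\<le>k. (real_of_ereal (L2_norm S (D j)))\<^sup>2)) else \<infinity>)"

definition W1inf_norm :: "'a::euclidean_space set \<Rightarrow> ('a \<Rightarrow> 'b::euclidean_space) \<Rightarrow> ereal" where
  "W1inf_norm S f =
    (if \<forall>v\<in>Basis. \<exists>g. has_weak_deriv S v f g
     then Linf_norm S f + (\<Sum>v\<in>Basis. Linf_norm S (weak_deriv S v f)) else \<infinity>)"

abbreviation unit_iv :: "real set" where
  "unit_iv \<equiv> {0<..<1}"

text \<open>\<open>H\<^sub>0\<^sup>1(0,1)\<close> is the closure of the test functions in \<open>H\<^sup>1(0,1)\<close>.\<close>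

definition H10_norm :: "(real \<Rightarrow> 'b::euclidean_space) \<Rightarrow> ereal" where
  "H10_norm f =
    (if \<forall>e>0. \<exists>\<phi>. test_fun unit_iv \<phi> \<and> H_norm 1 unit_iv (\<lambda>x. f x - \<phi> x) < ereal e
     then H_norm 1 unit_iv f else \<infinity>)"

text \<open>
  The dual \<open>H\<^sup>-\<^sup>1(0,1)\<close> of \<open>H\<^sub>0\<^sup>1(0,1)\<close>. The duality pairing extends the inner product
  \<open>(u, \<phi>) = \<integral> u cnj \<phi>\<close>, hence the functionals are antilinear. Finiteness of the norm makes them
  independent of the representative of the argument.
\<close>

definition Hm1_norm :: "((real \<Rightarrow> complex) \<Rightarrow> complex) \<Rightarrow> ereal" where
  "Hm1_norm \<xi> =
    (if (\<forall>\<phi> \<eta>. H10_norm \<phi> < \<infinity> \<and> H10_norm \<eta> < \<infinity> \<longrightarrow> \<xi> (\<lambda>x. \<phi> x + \<eta> x) = \<xi> \<phi> + \<xi> \<eta>) \<and>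
        (\<forall>c \<phi>. H10_norm \<phi> < \<infinity> \<longrightarrow> \<xi> (\<lambda>x. c * \<phi> x) = cnj c * \<xi> \<phi>)
     then (SUP \<phi>\<in>{\<phi>. H10_norm \<phi> \<le> 1}. ereal (norm (\<xi> \<phi>))) else \<infinity>)"

text \<open>
  The continuous representative on \<open>[l,r]\<close> of a function in \<open>H\<^sup>1(l,r)\<close>, through which
  point values at the end points are defined.
\<close>

definition cont_rep :: "real \<Rightarrow> real \<Rightarrow> (real \<Rightarrow> 'b::euclidean_space) \<Rightarrow> real \<Rightarrow> 'b" where
  "cont_rep l r f =
    (SOME w. continuous_on {l..r} w \<and> (AE x in lebesgue_on {l<..<r}. w x = f x))"

section \<open>Spaces of functions of time and space\<close>

definition QT :: "real \<Rightarrow> (real \<times> real) set" where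
  "QT T = {0<..<T} \<times> unit_iv"

definition L2_time_norm :: "real \<Rightarrow> (real \<Rightarrow> ereal) \<Rightarrow> ereal" where
  "L2_time_norm T g =
    (if AE t in lebesgue_on {0<..<T}. g t < \<infinity>
     then L2_norm {0<..<T} (\<lambda>t. real_of_ereal (g t)) else \<infinity>)"

text \<open>
  The norms of \<open>L\<^sup>2(0,T;X)\<close> and \<open>L\<^sup>\<infinity>(0,T;X)\<close> for a space \<open>X\<close> of functions on \<open>(0,1)\<close> with
  extended norm \<open>N\<close>. A map \<open>u\<close> from \<open>(0,T)\<close> to \<open>X\<close> is given by a jointly measurable function
  \<open>u t x\<close>. For the separable spaces \<open>X = L\<^sup>2, H\<^sup>1, H\<^sup>2, H\<^sub>0\<^sup>1\<close> this amounts to Bochner measurability;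
  for \<open>X = W\<^sup>1\<^sup>,\<^sup>\<infinity>\<close> it is weaker than Bochner measurability.
\<close>

definition L2_bochner_norm ::
    "real \<Rightarrow> ((real \<Rightarrow> 'b::euclidean_space) \<Rightarrow> ereal) \<Rightarrow> (real \<Rightarrow> real \<Rightarrow> 'b) \<Rightarrow> ereal" where
  "L2_bochner_norm T N u =
    (if case_prod u \<in> borel_measurable (lebesgue_on (QT T))
     then L2_time_norm T (\<lambda>t. N (u t)) else \<infinity>)"

definition Linf_bochner_norm ::
    "real \<Rightarrow> ((real \<Rightarrow> 'b::euclidean_space) \<Rightarrow> ereal) \<Rightarrow> (real \<Rightarrow> real \<Rightarrow> 'b) \<Rightarrow> ereal" where
  "Linf_bochner_norm T N u =
    (if case_prod u \<in> borel_measurable (lebesgue_on (QT T))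
     then esssup (lebesgue_on {0<..<T}) (\<lambda>t. N (u t)) else \<infinity>)"

text \<open>
  \<open>v\<close> is the weak time derivative of \<open>u\<close>, both in \<open>L\<^sup>2(0,T;L\<^sup>2(0,1))\<close>: the integrals
  \<open>\<integral> \<theta>' u dt\<close> and \<open>- \<integral> \<theta> v dt\<close> coincide as elements of \<open>L\<^sup>2(0,1)\<close>.
\<close>

definition has_time_deriv ::
    "real \<Rightarrow> (real \<Rightarrow> real \<Rightarrow> 'b::euclidean_space) \<Rightarrow> (real \<Rightarrow> real \<Rightarrow> 'b) \<Rightarrow> bool" where
  "has_time_deriv T u v \<longleftrightarrow>
    L2_bochner_norm T (L2_norm unit_iv) u < \<infinity> \<and> L2_bochner_norm T (L2_norm unit_iv) v < \<infinity> \<and>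
    (\<forall>\<theta>::real \<Rightarrow> real. test_fun {0<..<T} \<theta> \<longrightarrow>
      (AE x in lebesgue_on unit_iv.
        (\<integral>t. deriv \<theta> t *\<^sub>R u t x \<partial>lebesgue_on {0<..<T}) =
        - (\<integral>t. \<theta> t *\<^sub>R v t x \<partial>lebesgue_on {0<..<T})))"

definition H1L2_norm :: "real \<Rightarrow> (real \<Rightarrow> real \<Rightarrow> 'b::euclidean_space) \<Rightarrow> ereal" where
  "H1L2_norm T u =
    (if \<exists>v. has_time_deriv T u v
     then ereal (sqrt
       ((real_of_ereal (L2_bochner_norm T (L2_norm unit_iv) u))\<^sup>2 +
        (real_of_ereal (L2_bochner_norm T (L2_norm unit_iv) (SOME v. has_time_deriv T u v)))\<^sup>2))
     else \<infinity>)"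

text \<open>The sum norm of \<open>H\<^sup>1(0,T;L\<^sup>2(0,1)) \<inter> L\<^sup>2(0,T;H\<^sup>2(0,1))\<close>.\<close>

definition H1L2_L2H2_norm :: "real \<Rightarrow> (real \<Rightarrow> real \<Rightarrow> 'b::euclidean_space) \<Rightarrow> ereal" where
  "H1L2_L2H2_norm T u = H1L2_norm T u + L2_bochner_norm T (H_norm 2 unit_iv) u"

text \<open>
  \<open>u(0) = u\<^sub>0\<close> in \<open>L\<^sup>2(0,1)\<close>, where \<open>u(0)\<close> is the value at time 0 of the representative \<open>U\<close> of
  \<open>u\<close> in \<open>C([0,T];L\<^sup>2(0,1))\<close>.
\<close>

definition has_initial_value ::
    "real \<Rightarrow> (real \<Rightarrow> real \<Rightarrow> 'b::euclidean_space) \<Rightarrow> (real \<Rightarrow> 'b) \<Rightarrow> bool" where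
  "has_initial_value T u u0 \<longleftrightarrow>
    (\<exists>U. (\<forall>t\<in>{0..T}. L2_norm unit_iv (U t) < \<infinity>) \<and>
         (\<forall>s\<in>{0..T}. ((\<lambda>t. L2_norm unit_iv (\<lambda>x. U t x - U s x)) \<longlongrightarrow> 0) (at s within {0..T})) \<and>
         (AE t in lebesgue_on {0<..<T}. AE x in lebesgue_on unit_iv. U t x = u t x) \<and>
         (AE x in lebesgue_on unit_iv. U 0 x = u0 x))"

text \<open>\<open>\<xi>\<close> belongs to \<open>L\<^sup>2(0,T;H\<^sup>-\<^sup>1(0,1))\<close>; as \<open>H\<^sup>-\<^sup>1(0,1)\<close> is separable and reflexive, Bochner
  measurability of \<open>\<xi>\<close> is measurability of all the pairings \<open>\<xi> t \<phi>\<close>.\<close>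

definition L2_Hm1 :: "real \<Rightarrow> (real \<Rightarrow> (real \<Rightarrow> complex) \<Rightarrow> complex) \<Rightarrow> bool" where
  "L2_Hm1 T \<xi> \<longleftrightarrow>
    (\<forall>\<phi>. H10_norm \<phi> < \<infinity> \<longrightarrow> (\<lambda>t. \<xi> t \<phi>) \<in> borel_measurable (lebesgue_on {0<..<T})) \<and>
    L2_time_norm T (\<lambda>t. Hm1_norm (\<xi> t)) < \<infinity>"

text \<open>\<open>\<xi>\<close> is the weak time derivative of \<open>u\<close> as an element of \<open>L\<^sup>2(0,T;H\<^sup>-\<^sup>1(0,1))\<close>.\<close>

definition has_time_deriv_Hm1 ::
    "real \<Rightarrow> (real \<Rightarrow> real \<Rightarrow> complex) \<Rightarrow> (real \<Rightarrow> (real \<Rightarrow> complex) \<Rightarrow> complex) \<Rightarrow> bool" where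
  "has_time_deriv_Hm1 T u \<xi> \<longleftrightarrow>
    L2_bochner_norm T (L2_norm unit_iv) u < \<infinity> \<and> L2_Hm1 T \<xi> \<and>
    (\<forall>(\<theta>::real \<Rightarrow> real) \<phi>. test_fun {0<..<T} \<theta> \<and> H10_norm \<phi> < \<infinity> \<longrightarrow>
      (\<integral>t. deriv \<theta> t *\<^sub>R (\<integral>x. u t x * cnj (\<phi> x) \<partial>lebesgue_on unit_iv) \<partial>lebesgue_on {0<..<T}) =
      - (\<integral>t. \<theta> t *\<^sub>R \<xi> t \<phi> \<partial>lebesgue_on {0<..<T}))"

section \<open>The initial boundary value problem\<close>

text \<open>
  The spatial derivatives are those of the functions \<open>u t\<close>, chosen separately for each \<open>t\<close>; the
  equation is therefore required for a.e. \<open>t\<close> and then a.e. \<open>x\<close>. The function \<open>z\<close> is the weak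
  derivative of \<open>a(t,\<cdot>) \<partial>\<^sub>x u(t,\<cdot>)\<close>, and the boundary values are those of the continuous
  representative of \<open>u t\<close>.
\<close>

definition strong_solution ::
    "real \<Rightarrow> (real \<Rightarrow> real \<Rightarrow> real) \<Rightarrow> (real \<Rightarrow> real \<Rightarrow> real) \<Rightarrow> (real \<Rightarrow> real) \<Rightarrow>
     (real \<Rightarrow> real \<Rightarrow> complex) \<Rightarrow> (real \<Rightarrow> complex) \<Rightarrow> (real \<Rightarrow> complex) \<Rightarrow> (real \<Rightarrow> complex) \<Rightarrow>
     (real \<Rightarrow> real \<Rightarrow> complex) \<Rightarrow> bool" where
  "strong_solution T a b q f u0 g0 g1 u \<longleftrightarrow>
    H1L2_L2H2_norm T u < \<infinity> \<and>
    (\<exists>v. has_time_deriv T u v \<and>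
      (AE t in lebesgue_on {0<..<T}.
        \<exists>z. has_weak_deriv unit_iv 1 (\<lambda>x. complex_of_real (a t x) * weak_deriv unit_iv 1 (u t) x) z \<and>
          (AE x in lebesgue_on unit_iv.
            v t x - z x + complex_of_real (b t x) * weak_deriv unit_iv 1 (u t) x
              + complex_of_real (q x) * u t x = f t x))) \<and>
    has_initial_value T u u0 \<and>
    (AE t in lebesgue_on {0<..<T}. cont_rep 0 1 (u t) 0 = g0 t) \<and>
    (AE t in lebesgue_on {0<..<T}. cont_rep 0 1 (u t) 1 = g1 t)"

definition weak_solution ::
    "real \<Rightarrow> (real \<Rightarrow> real \<Rightarrow> real) \<Rightarrow> (real \<Rightarrow> real \<Rightarrow> real) \<Rightarrow> (real \<Rightarrow> real) \<Rightarrow>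
     (real \<Rightarrow> real \<Rightarrow> complex) \<Rightarrow> (real \<Rightarrow> complex) \<Rightarrow> (real \<Rightarrow> complex) \<Rightarrow> (real \<Rightarrow> complex) \<Rightarrow>
     (real \<Rightarrow> real \<Rightarrow> complex) \<Rightarrow> bool" where
  "weak_solution T a b q f u0 g0 g1 u \<longleftrightarrow>
    L2_bochner_norm T (H_norm 1 unit_iv) u < \<infinity> \<and>
    L2_bochner_norm T H10_norm
      (\<lambda>t x. u t x - (complex_of_real (1 - x) * g0 t + complex_of_real x * g1 t)) < \<infinity> \<and>
    has_initial_value T u u0 \<and>
    (\<exists>\<xi>. has_time_deriv_Hm1 T u \<xi> \<and>
      (\<forall>\<phi>. H10_norm \<phi> < \<infinity> \<longrightarrow>
        (AE t in lebesgue_on {0<..<T}.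
          \<xi> t \<phi>
          + (\<integral>x. complex_of_real (a t x) * weak_deriv unit_iv 1 (u t) x
                  * cnj (weak_deriv unit_iv 1 \<phi> x) \<partial>lebesgue_on unit_iv)
          + (\<integral>x. complex_of_real (b t x) * weak_deriv unit_iv 1 (u t) x
                  * cnj (\<phi> x) \<partial>lebesgue_on unit_iv)
          + (\<integral>x. complex_of_real (q x) * u t x * cnj (\<phi> x) \<partial>lebesgue_on unit_iv)
          = (\<integral>x. f t x * cnj (\<phi> x) \<partial>lebesgue_on unit_iv))))"

end

theory Submission
 imports Defs
begin

text \<open>
  The difference \<open>u\<^sub>\<epsilon> - u\<close>, corrected by a lifting that is affine in space, is a weak solution \<open>z\<close> of the
  perturbed equation with zero boundary values and small data. Testing with \<open>z(t) - z(0)\<close> on a short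
  initial layer and with time difference quotients bounds the difference quotients of \<open>z\<close> in
  \<open>L\<^sup>2\<close>; weak compactness yields \<open>\<partial>\<^sub>t z \<in> L\<^sup>2\<close> with a quantitative bound, and the equation then
  controls \<open>\<partial>\<^sub>x (a\<^sub>\<epsilon> \<partial>\<^sub>x z)\<close>, hence \<open>\<partial>\<^sub>x\<^sup>2 z\<close>. An energy estimate closes the argument: all constants
  depend only on the ellipticity and the sup norms of the coefficients. Sobolev functions of one
  variable are handled as primitives of integrable functions, without Galerkin approximation.
\<close>

text \<open>The weak equation places the time derivative of \<open>z\<close> only in
  \<open>H^-1\<close>, so it is no admissible test function; the increments
  \<open>z(t + h) - z(t)\<close> are. The equation is used only after integration in time, which
  keeps the dual space out of all estimates: with \<open>p\<close> the spatial derivative of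
  \<open>z\<close>, the principal term pairs an increment of the time primitive of
  \<open>a p\<close> with the increment of \<open>p\<close>. Let \<open>P(t)\<close> be the integral
  of \<open>p\<close> over \<open>(t, t + h)\<close>. As \<open>a\<close> is Lipschitz in time, this
  pairing is, up to errors of order \<open>h^2\<close>, governed by half the derivative of
  \<open>a |P|^2\<close>. The boundary term at \<open>t = 0\<close> has the unfavourable sign; the
  initial layer shows that it is of order \<open>h^2\<close> too, and needs \<open>z(0)\<close> in
  \<open>H_0^1\<close>, which is what the compatibility conditions supply. The resulting bound of
  the time derivative still contains \<open>z\<close> and \<open>p\<close>, because the lower-order
  terms are counted as a source. The energy estimate removes them. It comes after the regularity:
  once the time derivative is a function, the energy identity is the product rule on almost every
  line of constant \<open>x\<close>.\<close>

abbreviation (input) intg where "intg == integrable"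
abbreviation (input) leb where "leb == lebesgue_on"
abbreviation (input) fd where "fd == frechet_derivative"
abbreviation (input) wd where "wd == weak_deriv unit_iv 1"
abbreviation (input) bm where "bm == borel_measurable"
abbreviation (input) cp where "cp == case_prod"
abbreviation (input) inn (infix "*I" 70) where "inn == inner"
abbreviation (input) sR (infixr "*R" 75) where "sR == scaleR"
abbreviation (input) D1 :: "(real => 'b::euclidean_space) => real => 'b" where "D1 f x == frechet_derivative f (at x) 1"

lemmas int_cong = Bochner_Integration.integral_cong and int_add = Bochner_Integration.integral_add
 and intg_add = Bochner_Integration.integrable_add and int_diff = Bochner_Integration.integral_diff
 and intg_diff = Bochner_Integration.integrable_diff and intg_bound = Bochner_Integration.integrable_bound
 and bm_intg = borel_measurable_integrable and intg_mult = integrable_mult_right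
 and bb_inner = bounded_bilinear_inner
 and m_comp = measurable_compose and mult_r_mono = mult_right_mono and int_blin = integral_bounded_linear
 and bm_scal = borel_measurable_scaleR and bm_inner = borel_measurable_inner and bm_diff = borel_measurable_diff
 and cont_imp_meas = continuous_imp_measurable_on_sets_lebesgue and set_int_def = set_lebesgue_integral_def
 and fm_intg_const = finite_measure.integrable_const and bm_cont = borel_measurable_continuous_onI
 and real_deriv_iff = has_real_derivative_iff_has_vector_derivative and int_mono_AE = integral_mono_AE
 and int_cong_AE = integral_cong_AE

section \<open>Square-integrable functions\<close>

definition sqi :: "'a measure => ('a => 'b::euclidean_space) => bool" where
 "sqi M f \<longleftrightarrow> f : bm M & intg M (%x. (norm (f x))^2)"

text \<open>The square of the \<open>L^2\<close> norm. Unlike the norm itself it is additive over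
  slices of the space-time cylinder, so nearly all estimates are carried out for squares.\<close>

definition n2 :: "'a measure => ('a => 'b::euclidean_space) => real" where
 "n2 M f = (LINT x|M. (norm (f x))^2)"

lemma sqi_meas: "sqi M f ==> f : bm M"
 by (simp add: sqi_def)

lemma sqi_norm2: "sqi M f ==> intg M (%x. (norm (f x))^2)"
 by (simp add: sqi_def)

lemma n2_nonneg[simp]: "0 <= n2 M f"
 by (simp add: n2_def)

lemma norm_add_sq_le: "(norm (x + y))^2 <= 2 * (norm x)^2 + 2 * (norm (y::'a::real_normed_vector))^2"
proof -
 have "(norm (x + y))^2 <= (norm x + norm y)^2"
 by (simp add: norm_triangle_ineq power_mono)
 also have "... <= 2 * (norm x)^2 + 2 * (norm y)^2"
 using sum_squares_bound[of "norm x" "norm y"] by (simp add: power2_sum)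
 finally show ?thesis .
qed

lemma sqi_bound:
 assumes "sqi M f" "g : bm M" "AE x in M. norm (g x) <= B * norm (f x)"
 shows "sqi M g" "n2 M g <= B^2 * n2 M f"
proof -
 have i: "intg M (%x. B^2 * (norm (f x))^2)"
 using assms(1) by (auto simp: sqi_def)
 have le: "AE x in M. (norm (g x))^2 <= B^2 * (norm (f x))^2"
 using assms(3)
 proof eventually_elim
 case (elim x)
 thus ?case
 using power_mono[OF elim, of 2] by (simp add: power_mult_distrib)
 qed
 show s: "sqi M g"
 unfolding sqi_def using assms(2)
 by (auto intro!: intg_bound[OF i] le simp: power_mult_distrib)
 show "n2 M g <= B^2 * n2 M f"
 unfolding n2_def using int_mono_AE[OF _ i, of "%x. (norm (g x))^2"] s le
 by (simp add: sqi_def)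
qed

lemma sqi_add: assumes "sqi M f" "sqi M g" shows "sqi M (%x. f x + g x)"
proof -
 have "intg M (%x. (norm (f x + g x))^2)"
 by (rule intg_bound
 [of M "%x. 2 * (norm (f x))^2 + 2 * (norm (g x))^2"]) (use assms in "auto simp: sqi_def norm_add_sq_le")
 thus ?thesis using assms by (auto simp: sqi_def)
qed

lemma sqi_scaleR: "sqi M f ==> sqi M (%x. c *R f x)"
 by (auto simp: sqi_def power_mult_distrib)

lemma sqi_minus: "sqi M f ==> sqi M (%x. - f x)"
 by (auto simp: sqi_def)

lemma sqi_diff: "sqi M f ==> sqi M g ==> sqi M (%x. f x - g x)"
 using sqi_add[of M f "%x. - g x"] by (simp add: sqi_minus)

lemma sqi_zero[simp]: "sqi M (%x. 0)"
 by (simp add: sqi_def)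

lemma sqi_norm: "sqi M f ==> sqi M (%x. norm (f x))"
 by (auto simp: sqi_def)

lemma n2_cong: "(AE x in M. f x = g x) ==> f : bm M ==> g : bm M ==> n2 M f = n2 M g"
 unfolding n2_def by (intro int_cong_AE) auto

lemma sqi_cong: "(AE x in M. f x = g x) ==> sqi M f ==> g : bm M ==> sqi M g"
 by (rule sqi_bound(1)[of M f g 1]) (auto elim: eventually_mono)

lemma sqi_integrable_norm_mult:
 assumes "sqi M f" "sqi M g"
 shows "intg M (%x. norm (f x) * norm (g x))"
proof -
 have *: "norm (f x) * norm (g x) <= (norm (f x))^2 + (norm (g x))^2" for x
 using sum_squares_bound[of "norm (f x)" "norm (g x)"]
 mult_nonneg_nonneg[OF norm_ge_zero[of "f x"] norm_ge_zero[of "g x"]] by linarith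
 show ?thesis
 by (rule intg_bound
 [of M "%x. (norm (f x))^2 + (norm (g x))^2"]) (use assms in "auto simp: sqi_def *")
qed

lemma sqi_bilin:
 fixes f :: "'a => 'b::euclidean_space" and g :: "'a => 'c::euclidean_space"
 and pr :: "'b => 'c => 'd::euclidean_space"
 assumes "sqi M f" "sqi M g" "bounded_bilinear pr"
 shows "intg M (%x. pr (f x) (g x))"
proof -
 obtain K where K: "!!a b. norm (pr a b) <= norm a * norm b * K"
 using bounded_bilinear.bounded[OF assms(3)] by blast
 have [measurable]: "(%x. pr (f x) (g x)) : bm M"
 proof -
 have c: "continuous_on UNIV (%p. pr (fst p) (snd p))"
 by (intro bounded_bilinear.continuous_on[OF assms(3)] continuous_intros)
 have "(%x. (f x, g x)) : bm M"
 using assms by (auto simp: sqi_def)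
 from m_comp[OF this bm_cont[OF c]] show ?thesis by simp
 qed
 show ?thesis
 by (rule intg_bound[of M "%x. norm (f x) * norm (g x) * K"])
 (use sqi_integrable_norm_mult[OF assms(1,2)] K in "auto intro!: AE_I2 order_trans[OF _ abs_ge_self]")
qed

lemma sqi_inner: "sqi M f ==> sqi M g ==> intg M (%x. f x *I g x)"
 by (rule sqi_bilin[OF _ _ bb_inner])

lemma sqi_scal: "sqi M f ==> sqi M g ==> intg M (%x. f x *R g x)"
 by (rule sqi_bilin[OF _ _ bounded_bilinear_scaleR])

lemma n2_young:
 assumes "sqi M f" "sqi M g"
 shows "2 * (LINT x|M. norm (f x) * norm (g x)) <= n2 M f + n2 M g"
proof -
 have "(LINT x|M. 2 * (norm (f x) * norm (g x))) <= (LINT x|M. (norm (f x))^2 + (norm (g x))^2)"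
 proof (rule integral_mono)
 show "2 * (norm (f x) * norm (g x)) <= (norm (f x))^2 + (norm (g x))^2" for x
 using sum_squares_bound[of "norm (f x)" "norm (g x)"] by (simp add: mult.assoc)
 qed (use assms sqi_integrable_norm_mult[OF assms] in "auto simp: sqi_def")
 thus ?thesis
 using assms by (simp add: n2_def sqi_def)
qed

lemma n2_scaleR: "n2 M (%x. c *R f x) = c^2 * n2 M f"
 by (simp add: n2_def power_mult_distrib)

lemma n2_minus: "n2 M (%x. - f x) = n2 M f"
 by (simp add: n2_def)

lemma n2_minus_commute: "n2 M (%x. f x - g x) = n2 M (%x. g x - f x)"
 by (simp add: n2_def norm_minus_commute)

text \<open>Young's inequality for \<open>s f\<close> and \<open>g\<close> holds for every real
  \<open>s\<close>; optimising in \<open>s\<close> gives the product of the norms.\<close>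

lemma Cauchy_Schwarz_n2:
 assumes "sqi M f" "sqi M g"
 shows "(LINT x|M. norm (f x) * norm (g x)) <= sqrt (n2 M f) * sqrt (n2 M g)"
proof -
 define I where "I = (LINT x|M. norm (f x) * norm (g x))"
 have y: "2 * (s * I) <= s^2 * n2 M f + n2 M g" for s
 proof (cases "s >= 0")
 case True
 thus ?thesis
 using n2_young[OF sqi_scaleR[OF assms(1), of s] assms(2)]
 by (simp add: I_def n2_scaleR mult.assoc)
 next
 case False
 have "I >= 0" unfolding I_def by simp
 with False have "s * I <= 0" by (simp add: mult_nonpos_nonneg)
 moreover have "0 <= s^2 * n2 M f + n2 M g" by simp
 ultimately show ?thesis by linarith
 qed
 have "I^2 <= n2 M f * n2 M g"
 proof (cases "n2 M f = 0")
 case True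
 have "I <= 0"
 proof (rule ccontr)
 assume "\<not> I <= 0"
 thus False
 \<comment> \<open>With this \<open>s\<close> the inequality reads
   \<open>n2 M g + 1 <= n2 M g\<close>.\<close>
 using y[of "(n2 M g + 1) / (2 * I)"] True by (simp add: field_simps)
 qed
 moreover have "I >= 0" unfolding I_def by simp
 ultimately show ?thesis using True by simp
 next
 case False
 hence p: "n2 M f > 0" by (simp add: less_le)
 show ?thesis
 using y[of "I / n2 M f"] p by (simp add: field_simps power2_eq_square)
 qed
 hence "I <= sqrt (n2 M f * n2 M g)"
 by (rule real_le_rsqrt)
 thus ?thesis by (simp add: I_def real_sqrt_mult)
qed

lemma norm_integral_inner_le:
 assumes "sqi M f" "sqi M g"
 shows "\<bar>\<integral>x. f x *I g x \<partial>M\<bar> <= sqrt (n2 M f) * sqrt (n2 M g)"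
proof -
 have "\<bar>\<integral>x. f x *I g x \<partial>M\<bar> <= (LINT x|M. \<bar>f x *I g x\<bar>)"
 by (rule integral_abs_bound)
 also have "... <= (LINT x|M. norm (f x) * norm (g x))"
 by (intro integral_mono) (use assms in "auto intro!: sqi_inner integrable_abs sqi_integrable_norm_mult Cauchy_Schwarz_ineq2")
 also note Cauchy_Schwarz_n2[OF assms]
 finally show ?thesis .
qed

lemma sqrt_n2_triangle:
 assumes "sqi M f" "sqi M g"
 shows "sqrt (n2 M (%x. f x + g x)) <= sqrt (n2 M f) + sqrt (n2 M g)"
proof (rule real_le_lsqrt)
 have "n2 M (%x. f x + g x) <= (LINT x|M. (norm (f x))^2 + (norm (g x))^2 + 2 * (norm (f x) * norm (g x)))"
 unfolding n2_def
 proof (intro integral_mono)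
 show "intg M (%x. (norm (f x + g x))^2)"
 using sqi_add[OF assms] by (simp add: sqi_def)
 show "intg M (%x. (norm (f x))^2 + (norm (g x))^2 + 2 * (norm (f x) * norm (g x)))"
 using assms sqi_integrable_norm_mult[OF assms] by (simp add: sqi_def)
 show "(norm (f x + g x))^2 <= (norm (f x))^2 + (norm (g x))^2 + 2 * (norm (f x) * norm (g x))" for x
 using power_mono[OF norm_triangle_ineq[of "f x" "g x"], of 2] by (simp add: power2_sum mult.assoc)
 qed
 also have "... = n2 M f + n2 M g + 2 * (LINT x|M. norm (f x) * norm (g x))"
 using assms sqi_integrable_norm_mult[OF assms] by (simp add: sqi_def n2_def)
 also have "... <= (sqrt (n2 M f) + sqrt (n2 M g))^2"
 using Cauchy_Schwarz_n2[OF assms] by (simp add: power2_sum)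
 finally show "n2 M (%x. f x + g x) <= (sqrt (n2 M f) + sqrt (n2 M g))^2" .
qed auto

lemma n2_add_le:
 assumes "sqi M f" "sqi M g"
 shows "n2 M (%x. f x + g x) <= 2 * n2 M f + 2 * n2 M g"
proof -
 have "n2 M (%x. f x + g x) <= (LINT x|M. 2 * (norm (f x))^2 + 2 * (norm (g x))^2)"
 unfolding n2_def using assms sqi_add[OF assms]
 by (intro integral_mono) (auto simp: sqi_def norm_add_sq_le)
 thus ?thesis using assms by (simp add: sqi_def n2_def)
qed

lemma n2_diff_le:
 assumes "sqi M f" "sqi M g"
 shows "n2 M (%x. f x - g x) <= 2 * n2 M f + 2 * n2 M g"
 using n2_add_le[OF assms(1) sqi_minus[OF assms(2)]] by (simp add: n2_minus)

text \<open>The midpoint form is the one needed for minimising sequences: a lower bound of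
  \<open>n2\<close> at the midpoint bounds the distance of two almost minimal elements.\<close>

lemma parallelogram_n2:
 assumes "sqi M f" "sqi M g"
 shows "n2 M (%x. f x - g x) = 2 * n2 M f + 2 * n2 M g - 4 * n2 M (%x. (1/2) *R f x + (1/2) *R g x)"
proof -
 have s: "sqi M (%x. (1/2) *R f x + (1/2) *R g x)"
 by (intro sqi_add sqi_scaleR assms)
 have "(norm (a - b))^2 = 2 * (norm a)^2 + 2 * (norm b)^2 - 4 * (norm ((1/2) *R a + (1/2) *R b))^2" for a b :: 'b
 unfolding power2_norm_eq_inner by (simp add: inner_simps inner_commute) 
 hence "n2 M (%x. f x - g x) = (LINT x|M. 2 * (norm (f x))^2 + 2 * (norm (g x))^2 - 4 * (norm ((1/2) *R f x + (1/2) *R g x))^2)"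
 unfolding n2_def by presburger
 thus ?thesis
 using assms s by (simp add: sqi_def n2_def)
qed

section \<open>Finite measures, completeness and weak compactness\<close>

lemma (in finite_measure) sqi_const: "sqi M (%x. c)"
 by (simp add: sqi_def)

lemma (in finite_measure) sqi_bounded:
 assumes "f : bm M" "AE x in M. norm (f x) <= B"
 shows "sqi M f"
 using sqi_bound(1)[OF sqi_const[of "1::real"] assms(1), of B] assms(2) by auto

lemma (in finite_measure) sqi_integrable: "sqi M f ==> intg M f"
 using sqi_scal[OF sqi_const[of "1::real"]] by simp

lemma (in finite_measure) integral_norm_le_n2:
 assumes "sqi M f"
 shows "(LINT x|M. norm (f x)) <= sqrt (measure M (space M)) * sqrt (n2 M f)"
 using Cauchy_Schwarz_n2[OF sqi_const[of "1::real"] assms] by (simp add: n2_def)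

text \<open>On a finite measure space an \<open>L^2\<close> Cauchy sequence is Cauchy in
  \<open>L^1\<close>, so a subsequence converges almost everywhere. Fatou's lemma along this
  subsequence bounds the distance of each late \<open>f n\<close> to the limit, which gives
  convergence of the whole sequence.\<close>

lemma sqi_complete:
 fixes f :: "nat => 'a => 'b::euclidean_space"
 assumes "finite_measure M" "!!n. sqi M (f n)"
 and Cauchy: "!!e. e > 0 ==> EX N. ALL m>=N. ALL n>=N. n2 M (%x. f m x - f n x) < e"
 shows "EX g. sqi M g & (%n. n2 M (%x. f n x - g x)) \<longlonglongrightarrow> 0"
proof -
 interpret finite_measure M by fact
 have [measurable]: "f n : bm M" for n
 using assms(2) by (simp add: sqi_def)
 have L1: "EX N. ALL i>=N. ALL j>=N. (LINT x|M. norm (f i x - f j x)) < e" if e: "e > 0" for e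
 proof -
 define m where "m = sqrt (measure M (space M)) + 1"
 have m: "m > 0" "sqrt (measure M (space M)) <= m" by (auto simp: m_def add_nonneg_pos)
 obtain N where N: "!!i j. i >= N ==> j >= N ==> n2 M (%x. f i x - f j x) < (e / m)^2"
 using Cauchy[of "(e/m)^2"] e m by auto
 have "(LINT x|M. norm (f i x - f j x)) < e" if "i >= N" "j >= N" for i j
 proof -
 have "(LINT x|M. norm (f i x - f j x)) <= sqrt (measure M (space M)) * sqrt (n2 M (%x. f i x - f j x))"
 by (rule integral_norm_le_n2) (intro sqi_diff assms)
 also have "... <= m * sqrt (n2 M (%x. f i x - f j x))"
 using m by (intro mult_r_mono) auto
 also have "sqrt (n2 M (%x. f i x - f j x)) < e / m"
 using real_sqrt_less_mono[OF N[OF that]] e m by (simp add: real_sqrt_unique)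
 finally show ?thesis using m by (simp add: field_simps)
 qed
 thus ?thesis by blast
 qed
 obtain r where r: "strict_mono r" "AE x in M. Cauchy (%i. f (r i) x)"
 by (rule cauchy_L1_AE_cauchy_subseq[of M f, OF sqi_integrable[OF assms(2)] L1])
 define g where "g x = lim (%i. f (r i) x)" for x
 have [measurable]: "g : bm M"
 unfolding g_def by (rule borel_measurable_lim_metric) simp
 have lim: "AE x in M. (%i. f (r i) x) \<longlonglongrightarrow> g x"
 using r(2) by eventually_elim (auto simp: g_def Cauchy_convergent_iff convergent_LIMSEQ_iff)
 have main: "sqi M (%x. f n x - g x) & n2 M (%x. f n x - g x) <= e"
 if e: "e > 0" and N: "!!m n. m >= N ==> n >= N ==> n2 M (%x. f m x - f n x) < e" "n >= N" for e N n
 proof -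
 have "(\<integral>\<^sup>+x. ennreal ((norm (f n x - g x))^2) \<partial>M) = (\<integral>\<^sup>+x. liminf (%i. ennreal ((norm (f n x - f (r i) x))^2)) \<partial>M)"
 proof (intro nn_integral_cong_AE)
 show "AE x in M. ennreal ((norm (f n x - g x))^2) = liminf (%i. ennreal ((norm (f n x - f (r i) x))^2))"
 using lim
 proof eventually_elim
 case (elim x)
 hence "(%i. ennreal ((norm (f n x - f (r i) x))^2)) \<longlonglongrightarrow> ennreal ((norm (f n x - g x))^2)"
 by (intro tendsto_intros)
 thus ?case by (intro lim_imp_Liminf[symmetric]) auto
 qed
 qed
 also have "... <= liminf (%i. \<integral>\<^sup>+x. ennreal ((norm (f n x - f (r i) x))^2) \<partial>M)"
 by (intro nn_integral_liminf) simp
 also have "... <= liminf (%i. ennreal e)"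
 proof (intro Liminf_mono eventually_sequentiallyI)
 fix i assume "i >= N"
 hence ri: "r i >= N" using seq_suble[OF r(1), of i] by linarith
 have s: "sqi M (%x. f n x - f (r i) x)" by (intro sqi_diff assms)
 have "(\<integral>\<^sup>+x. ennreal ((norm (f n x - f (r i) x))^2) \<partial>M) = ennreal (n2 M (%x. f n x - f (r i) x))"
 unfolding n2_def using s by (intro nn_integral_eq_integral) (auto simp: sqi_def)
 also have "... <= ennreal e"
 using N(1)[OF N(2) ri] by (intro ennreal_leI) simp
 finally show "(\<integral>\<^sup>+x. ennreal ((norm (f n x - f (r i) x))^2) \<partial>M) <= ennreal e" .
 qed
 finally have le: "(\<integral>\<^sup>+x. ennreal ((norm (f n x - g x))^2) \<partial>M) <= ennreal e"
 by (simp add: Liminf_const)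
 have i: "intg M (%x. (norm (f n x - g x))^2)"
 using le by (intro integrableI_bounded) (auto simp: top.extremum_strict intro: le_less_trans)
 have "ennreal (n2 M (%x. f n x - g x)) <= ennreal e"
 unfolding n2_def using le by (subst nn_integral_eq_integral[OF i, symmetric]) auto
 thus ?thesis using i e by (simp add: sqi_def)
 qed
 show ?thesis
 proof (intro exI conjI)
 obtain N where "!!m n. m >= N ==> n >= N ==> n2 M (%x. f m x - f n x) < 1"
 using Cauchy[of 1] by auto
 hence "sqi M (%x. f N x - g x)" using main[of 1 N N] by auto
 from sqi_diff[OF assms(2)[of N] this] show "sqi M g" by simp
 show "(%n. n2 M (%x. f n x - g x)) \<longlonglongrightarrow> 0"
 proof (rule LIMSEQ_I)
 fix e :: real assume e: "e > 0"
 then obtain N where "!!m n. m >= N ==> n >= N ==> n2 M (%x. f m x - f n x) < e/2"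
 using Cauchy[of "e/2"] by auto
 hence "n2 M (%x. f n x - g x) <= e/2" if "n >= N" for n
 using main[of "e/2" N n] e that by auto
 thus "EX no. ALL n>=no. norm (n2 M (%x. f n x - g x) - 0) < e"
 using e by (intro exI[of _ N]) (fastforce)
 qed
 qed
qed

lemma tendsto_integral_scaleR_n2:
 assumes "!!n. sqi M (f n)" "sqi M g" "(%n. n2 M (%x. f n x - g x)) \<longlonglongrightarrow> 0" "sqi M ph"
 shows "(%n. LINT x|M. ph x *R f n x) \<longlonglongrightarrow> (LINT x|M. ph x *R g x)"
proof (rule Lim_null_comparison[where f="%n. (LINT x|M. ph x *R f n x) - (LINT x|M. ph x *R g x)", THEN LIM_zero_cancel])
 show "\<forall>\<^sub>F n in sequentially. norm ((LINT x|M. ph x *R f n x) - (LINT x|M. ph x *R g x))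
 <= sqrt (n2 M ph) * sqrt (n2 M (%x. f n x - g x))"
 proof (intro always_eventually allI)
 fix n
 have s: "sqi M (%x. f n x - g x)" by (intro sqi_diff assms)
 have "(LINT x|M. ph x *R f n x) - (LINT x|M. ph x *R g x) = (LINT x|M. ph x *R (f n x - g x))"
 using assms by (subst int_diff[symmetric])
 (auto intro: sqi_scal simp: scaleR_diff_right)
 also have "norm ... <= (LINT x|M. norm (ph x) * norm (f n x - g x))"
 using integral_norm_bound[of M "%x. ph x *R (f n x - g x)"] by simp
 also note Cauchy_Schwarz_n2[OF assms(4) s]
 finally show "norm ((LINT x|M. ph x *R f n x) - (LINT x|M. ph x *R g x))
 <= sqrt (n2 M ph) * sqrt (n2 M (%x. f n x - g x))" .
 qed
 show "(%n. sqrt (n2 M ph) * sqrt (n2 M (%x. f n x - g x))) \<longlonglongrightarrow> 0"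
 using tendsto_mult_right_zero[OF tendsto_real_sqrt[OF assms(3), simplified]] by simp
qed

lemma tendsto_n2:
 assumes "!!n. sqi M (f n)" "sqi M g" "(%n. n2 M (%x. f n x - g x)) \<longlonglongrightarrow> 0"
 shows "(%n. n2 M (f n)) \<longlonglongrightarrow> n2 M g"
proof -
 have "(%n. sqrt (n2 M (f n))) \<longlonglongrightarrow> sqrt (n2 M g)"
 proof (rule Lim_null_comparison[where f="%n. sqrt (n2 M (f n)) - sqrt (n2 M g)", THEN LIM_zero_cancel])
 show "\<forall>\<^sub>F n in sequentially. norm (sqrt (n2 M (f n)) - sqrt (n2 M g)) <= sqrt (n2 M (%x. f n x - g x))"
 proof (intro always_eventually allI)
 fix n
 have "sqrt (n2 M (f n)) <= sqrt (n2 M (%x. f n x - g x)) + sqrt (n2 M g)"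
 using sqrt_n2_triangle[OF sqi_diff[OF assms(1)[of n] assms(2)] assms(2)] by simp
 moreover have "sqrt (n2 M g) <= sqrt (n2 M (%x. g x - f n x)) + sqrt (n2 M (f n))"
 using sqrt_n2_triangle[OF sqi_diff[OF assms(2) assms(1)[of n]] assms(1)[of n]] by simp
 ultimately show "norm (sqrt (n2 M (f n)) - sqrt (n2 M g)) <= sqrt (n2 M (%x. f n x - g x))"
 by (simp add: n2_minus_commute[of M g])
 qed
 show "(%n. sqrt (n2 M (%x. f n x - g x))) \<longlonglongrightarrow> 0"
 using tendsto_real_sqrt[OF assms(3)] by simp
 qed
 from tendsto_power[OF this, of 2] show ?thesis by simp
qed

text \<open>
 A minimising sequence of a midpoint-convex set is Cauchy by the parallelogram identity.
\<close>

lemma minimising_sequence_converges: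
 fixes v :: "nat => 'a => 'b::euclidean_space"
 assumes "finite_measure M" "!!n. sqi M (v n)" "mu \<longlonglongrightarrow> c"
 and lower: "!!m n. m <= n ==> mu m <= n2 M (%x. (1/2) *R v m x + (1/2) *R v n x)"
 and upper: "!!n. n2 M (v n) <= mu n + 1 / Suc n"
 shows "EX g. sqi M g & (%n. n2 M (%x. v n x - g x)) \<longlonglongrightarrow> 0"
proof (rule sqi_complete[OF assms(1,2)])
 fix e :: real assume e: "e > 0"
 have "(%n. 1 / real (Suc n)) \<longlonglongrightarrow> 0"
 using LIMSEQ_inverse_real_of_nat by (simp add: inverse_eq_divide)
 from order_tendstoD(2)[OF this, of "e/16"] e
 obtain N1 where N1: "!!n. n >= N1 ==> 1 / real (Suc n) < e/16"
 by (auto simp: eventually_sequentially)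
 define de where "de n = 1 / real (Suc n)" for n
 have upper': "n2 M (v n) <= mu n + de n" and N1': "n >= N1 ==> de n < e/16" for n
 using upper[of n] N1[of n] by (simp_all add: de_def)
 from LIMSEQ_D[OF assms(3), of "e/16"] e
 obtain N2 where N2: "!!n. n >= N2 ==> \<bar>mu n - c\<bar> < e/16" by auto
 have *: "n2 M (%x. v m x - v n x) < e" if "m >= max N1 N2" "n >= max N1 N2" "m <= n" for m n
 proof -
 have "n2 M (%x. v m x - v n x) <= 2 * (mu m + de m) + 2 * (mu n + de n) - 4 * mu m"
 proof -
 have "A = 2 * B + 2 * C - 4 * X ==> mu m <= X ==> B <= mu m + de m ==> C <= mu n + de n ==>
 A <= 2 * (mu m + de m) + 2 * (mu n + de n) - 4 * mu m" for A B C X :: real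
 by (smt (verit))
 from this[OF parallelogram_n2[OF assms(2)[of m] assms(2)[of n]] lower[OF that(3)] upper' upper']
 show ?thesis .
 qed
 also have "... < e"
 proof -
 have "m >= N1" "n >= N1" "m >= N2" "n >= N2" using that by auto
 note b = N1'[OF this(1)] N1'[OF this(2)] N2[OF this(3)] N2[OF this(4)]
 have "mu n - mu m < e/8" using b(3,4) unfolding abs_less_iff by argo
 thus ?thesis using b(1,2) e by (simp add: algebra_simps)
 qed
 finally show ?thesis .
 qed
 show "EX N. ALL m>=N. ALL n>=N. n2 M (%x. v m x - v n x) < e"
 proof (intro exI allI impI)
 fix m n assume "max N1 N2 <= m" "max N1 N2 <= n"
 thus "n2 M (%x. v m x - v n x) < e"
 using *[of m n] *[of n m] n2_minus_commute[of M "v m" "v n"] by (cases "m <= n") auto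
 qed
qed

text \<open>A substitute for weak sequential compactness without weak topologies and without
  extracting a subsequence: the limit is identified only against those \<open>ph\<close> for which
  the integrals already converge. It is the strong limit of elements of almost minimal norm in
  decreasing convex sets.\<close>

lemma L2_weakly_compact:
 fixes d :: "nat => 'a => 'b::euclidean_space"
 assumes fin: "finite_measure M" and d: "!!n. sqi M (d n)" "!!n. n2 M (d n) <= K"
 shows "EX v. sqi M v & n2 M v <= K &
 (ALL ph::'a => real. ALL l. sqi M ph --> (%n. LINT x|M. ph x *R d n x) \<longlonglongrightarrow> l --> (LINT x|M. ph x *R v x) = l)"
proof -
 \<comment> \<open>\<open>C n\<close> plays the role of the closed convex hull of the tail of
   \<open>d\<close> from index \<open>n\<close>: it consists of the functions that satisfy every
   ball constraint on integrals which holds along the whole tail.\<close>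
 define C where "C n = {f. sqi M f & n2 M f <= K &
 (ALL (ph::'a=>real) l e. sqi M ph --> (ALL m>=n. norm ((LINT x|M. ph x *R d m x) - l) <= e) -->
 norm ((LINT x|M. ph x *R f x) - l) <= e)}" for n
 have dC: "d n : C n" for n using d by (auto simp: C_def)
 have mono: "C n \<subseteq> C m" if "m <= n" for m n
 unfolding C_def using that by (auto dest: order_trans)
 have conv: "(%x. (1/2) *R f x + (1/2) *R g x) : C n" if "f : C n" "g : C n" for f g n
 proof -
 have s: "sqi M f" "sqi M g" using that by (auto simp: C_def)
 have s2: "sqi M (%x. (1/2) *R f x + (1/2) *R g x)" by (intro sqi_add sqi_scaleR s)
 have "n2 M (%x. (1/2) *R f x + (1/2) *R g x) <= K"
 using parallelogram_n2[OF s] that n2_nonneg[of M "%x. f x - g x"] by (simp add: C_def)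
 moreover have "norm ((LINT x|M. ph x *R ((1/2) *R f x + (1/2) *R g x)) - l) <= e"
 if "sqi M ph" "norm ((LINT x|M. ph x *R f x) - l) <= e" "norm ((LINT x|M. ph x *R g x) - l) <= e" for ph :: "'a => real" and l e
 proof -
 have "(LINT x|M. ph x *R ((1/2) *R f x + (1/2) *R g x)) = (LINT x|M. (1/2) *R (ph x *R f x) + (1/2) *R (ph x *R g x))"
 by (simp add: algebra_simps)
 also have "... = (1/2) *R (LINT x|M. ph x *R f x) + (1/2) *R (LINT x|M. ph x *R g x)"
 using sqi_scal[OF that(1) s(1)] sqi_scal[OF that(1) s(2)]
 by (subst int_add) (auto simp del: scaleR_scaleR)
 finally have "(LINT x|M. ph x *R ((1/2) *R f x + (1/2) *R g x)) - l =
 (1/2) *R ((LINT x|M. ph x *R f x) - l) + (1/2) *R ((LINT x|M. ph x *R g x) - l)"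
 by (simp add: algebra_simps flip: scaleR_add_left)
 also have "norm ... <= (1/2) * e + (1/2) * e"
 by (rule norm_triangle_mono) (use that in auto)
 finally show ?thesis by simp
 qed
 ultimately show ?thesis using that s2 by (auto simp: C_def)
 qed
 define mu where "mu n = Inf (n2 M ` C n)" for n
 have bdd: "bdd_below (n2 M ` C n)" for n
 by (rule bdd_belowI[of _ 0]) auto
 have ne: "C n ~= {}" for n using dC by blast
 have "EX f:C n. n2 M f < mu n + 1 / Suc n" for n
 using cInf_lessD[of "n2 M ` C n" "mu n + 1 / Suc n"] ne unfolding mu_def by auto
 then obtain v where v: "!!n. v n : C n" "!!n. n2 M (v n) < mu n + 1 / Suc n" by metis
 have inc: "incseq mu"
 unfolding mu_def incseq_def using mono bdd ne by (auto intro!: cInf_superset_mono image_mono)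
 have up: "mu n <= K" for n
 using cInf_lower[OF imageI[OF dC] bdd, of n] d(2)[of n] by (simp add: mu_def)
 obtain c where c: "mu \<longlonglongrightarrow> c"
 using incseq_convergent[OF inc, of K] up by blast
 have sv: "sqi M (v n)" for n using v(1)[of n] by (auto simp: C_def)
 have "EX g. sqi M g & (%n. n2 M (%x. v n x - g x)) \<longlonglongrightarrow> 0"
 proof (rule minimising_sequence_converges[OF fin sv c])
 \<comment> \<open>As \<open>C\<close> decreases, the midpoint of \<open>v m\<close> and
   \<open>v n\<close> still lies in \<open>C m\<close>.\<close>
 show "mu m <= n2 M (%x. (1/2) *R v m x + (1/2) *R v n x)" if "m <= n" for m n
 unfolding mu_def using conv[OF v(1)[of m] subsetD[OF mono[OF that] v(1)[of n]]]
 by (intro cInf_lower bdd imageI)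
 show "n2 M (v n) <= mu n + 1 / Suc n" for n using v(2)[of n] by simp
 qed
 then obtain g where g: "sqi M g" "(%n. n2 M (%x. v n x - g x)) \<longlonglongrightarrow> 0" by blast
 have "n2 M g <= K"
 by (rule LIMSEQ_le_const2[OF tendsto_n2[OF sv g]]) (use v(1) in "auto simp: C_def")
 moreover have "(LINT x|M. ph x *R g x) = l"
 if ph: "sqi M ph" "(%n. LINT x|M. ph x *R d n x) \<longlonglongrightarrow> l" for ph :: "'a => real" and l
 proof -
 have "(%n. LINT x|M. ph x *R v n x) \<longlonglongrightarrow> l"
 proof (rule LIMSEQ_I)
 fix e :: real assume e: "e > 0"
 obtain N where N: "!!n. n >= N ==> norm ((LINT x|M. ph x *R d n x) - l) < e/2"
 using LIMSEQ_D[OF ph(2), of "e/2"] e by auto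
 have "norm ((LINT x|M. ph x *R v n x) - l) <= e/2" if "n >= N" for n
 proof -
 have "ALL m>=n. norm ((LINT x|M. ph x *R d m x) - l) <= e/2"
 using N that by (meson less_imp_le order_trans)
 thus ?thesis
 using v(1)[of n] ph(1) unfolding C_def by blast
 qed
 thus "EX no. ALL n>=no. norm ((LINT x|M. ph x *R v n x) - l) < e"
 using e by (intro exI[of _ N]) fastforce
 qed
 with tendsto_integral_scaleR_n2[OF sv g ph(1)] show ?thesis
 using LIMSEQ_unique by blast
 qed
 ultimately show ?thesis using g(1) by blast
qed

section \<open>Smooth functions\<close>

text \<open>The union of \<open>F\<close> with the set of all smooth functions is closed under
  derivatives. Hence derivatives may leave \<open>F\<close> as long as they are already known to be
  smooth.\<close>

lemma smooth_funI:
 assumes "ph : F" and "!!g x. g : F ==> g differentiable (at x)"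
 and "!!g v. g : F ==> (%x. fd g (at x) v) : F \<or> smooth_fun (%x. fd g (at x) v)"
 shows "smooth_fun ph"
proof -
 define S where "S = {f. smooth_fun (f :: 'a => 'b)}"
 have S1: "g differentiable (at x)" and S2: "(%x. fd g (at x) v) : S" if "g : S" for g x v
 using that unfolding S_def smooth_fun_def by blast+
 show ?thesis
 unfolding smooth_fun_def
 proof (intro exI[of _ "F \<union> S"] conjI ballI allI)
 fix g x assume "g : F \<union> S"
 thus "g differentiable at x" using assms(2) S1 by blast
 next
 fix g v assume "g : F \<union> S"
 thus "(%x. fd g (at x) v) : F \<union> S"
 using assms(3) S2 unfolding S_def by blast
 qed (use assms(1) in auto)
qed

lemma smooth_fun_differentiable: "smooth_fun f ==> f differentiable (at x)"
 unfolding smooth_fun_def by blast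

lemma smooth_fun_frechet: "smooth_fun f ==> smooth_fun (%x. fd f (at x) v)"
 unfolding smooth_fun_def by blast

lemma smooth_fun_has_derivative: "smooth_fun f ==> (f has_derivative fd f (at x)) (at x)"
 using smooth_fun_differentiable frechet_derivative_works by blast

lemma smooth_cont: "smooth_fun f ==> continuous_on A f"
 by (meson differentiable_imp_continuous_within differentiable_within_subset smooth_fun_differentiable
 continuous_at_imp_continuous_on)

lemma smooth_fun_const: "smooth_fun (%x. c)"
 by (rule smooth_funI[of _ "range (%c x. c)"]) auto

lemma smooth_fun_bounded_linear:
 assumes "bounded_linear L" "smooth_fun f"
 shows "smooth_fun (%x. L (f x))"
proof (rule smooth_funI[of _ "{%x. L (f x) |f. smooth_fun f}"])
 have D: "((%x. L (f x)) has_derivative (%v. L (fd f (at x) v))) (at x)" if "smooth_fun f" for f x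
 by (rule bounded_linear.has_derivative[OF assms(1) smooth_fun_has_derivative[OF that]])
 fix g assume "g : {%x. L (f x) |f. smooth_fun f}"
 then obtain f where f: "smooth_fun f" "g = (%x. L (f x))" by blast
 show "g differentiable (at x)" for x using D[OF f(1)] f(2) unfolding differentiable_def by blast
 have "fd g (at x) v = L (fd f (at x) v)" for x v
 using frechet_derivative_at[OF D[OF f(1)]] f(2) by metis
 thus "(%x. fd g (at x) v) : {%x. L (f x) |f. smooth_fun f} \<or> smooth_fun (%x. fd g (at x) v)" for v
 using smooth_fun_frechet[OF f(1)] by auto
qed (use assms in auto)

lemma smooth_fun_add:
 assumes "smooth_fun f" "smooth_fun g"
 shows "smooth_fun (%x. f x + g x)"
proof (rule smooth_funI[of _ "{%x. f x + g x |f g. smooth_fun f & smooth_fun g}"])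
 fix h assume "h : {%x. f x + g x |f g. smooth_fun f & smooth_fun (g :: 'a => 'b)}"
 then obtain f g where h: "smooth_fun f" "smooth_fun g" "h = (%x. f x + g x)" by blast
 have D: "(h has_derivative (%v. fd f (at x) v + fd g (at x) v)) (at x)" for x
 unfolding h(3) by (intro has_derivative_add smooth_fun_has_derivative h)
 show "h differentiable (at x)" for x using D unfolding differentiable_def by blast
 have "fd h (at x) v = fd f (at x) v + fd g (at x) v" for x v
 using frechet_derivative_at[OF D] by metis
 thus "(%x. fd h (at x) v) : {%x. f x + g x |f g. smooth_fun f & smooth_fun g} \<or> smooth_fun (%x. fd h (at x) v)" for v
 using smooth_fun_frechet[OF h(1), of v] smooth_fun_frechet[OF h(2), of v]
 by (intro disjI1 CollectI exI[of _ "%x. fd f (at x) v"] exI[of _ "%x. fd g (at x) v"]) auto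
qed (use assms in auto)

text \<open>By the Leibniz rule the derivative of a product is a sum of two products, so products
  alone do not form a family closed under derivatives, but their finite sums do.\<close>

inductive_set smooth_products :: "('a::euclidean_space => real) set" where
 prod: "smooth_fun f ==> smooth_fun g ==> (%x. f x * g x) : smooth_products"
| sum: "f : smooth_products ==> g : smooth_products ==> (%x. f x + g x) : smooth_products"

lemma smooth_products_derivative:
 assumes "h : smooth_products"
 shows "EX h'. (ALL x. (h has_derivative (%v. h' v x)) (at x)) & (ALL v. h' v : smooth_products)"
 using assms
proof induction
 case (prod f g)
 have "((%x. f x * g x) has_derivative (%v. f x * fd g (at x) v + fd f (at x) v * g x)) (at x)" for x
 by (intro has_derivative_mult smooth_fun_has_derivative prod)
 moreover have "(%x. f x * fd g (at x) v + fd f (at x) v * g x) : smooth_products" for v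
 by (intro smooth_products.intros smooth_fun_frechet prod)
 ultimately show ?case
 by (intro exI[of _ "%v x. f x * fd g (at x) v + fd f (at x) v * g x"]) auto
next
 case (sum f g)
 then obtain f' g' where *: "!!x. (f has_derivative (%v. f' v x)) (at x)" "!!v. f' v : smooth_products"
 "!!x. (g has_derivative (%v. g' v x)) (at x)" "!!v. g' v : smooth_products" by blast
 show ?case
 by (intro exI[of _ "%v x. f' v x + g' v x"] conjI allI has_derivative_add smooth_products.sum *)
qed

lemma smooth_fun_mult:
 fixes f g :: "'a::euclidean_space => real"
 assumes "smooth_fun f" "smooth_fun g"
 shows "smooth_fun (%x. f x * g x)"
proof (rule smooth_funI[of _ smooth_products])
 fix h :: "'a => real" assume "h : smooth_products"
 then obtain h' where h': "!!x. (h has_derivative (%v. h' v x)) (at x)" "!!v. h' v : smooth_products"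
 using smooth_products_derivative by blast
 show "h differentiable (at x)" for x using h' unfolding differentiable_def by blast
 have "fd h (at x) v = h' v x" for x v
 using frechet_derivative_at[OF h'(1)] by metis
 thus "(%x. fd h (at x) v) : smooth_products \<or> smooth_fun (%x. fd h (at x) v)" for v
 using h'(2)[of v] by simp
qed (use assms smooth_products.prod in auto)

lemma smooth_fun_comp_linear:
 assumes L: "bounded_linear L" and "smooth_fun f"
 shows "smooth_fun (%x. f (L x + c))"
proof (rule smooth_funI[of _ "{%x. f (L x + c) |f. smooth_fun f}"])
 fix g assume "g : {%x. f (L x + c) |f. smooth_fun f}"
 then obtain f where f: "smooth_fun f" "g = (%x. f (L x + c))" by blast
 have D: "(g has_derivative (%v. fd f (at (L x + c)) (L v))) (at x)" for x
 unfolding f(2)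
 by (rule has_derivative_compose[of "%x. L x + c" L, OF _ smooth_fun_has_derivative[OF f(1)]])
 (auto intro!: has_derivative_add_const bounded_linear_imp_has_derivative L)
 show "g differentiable (at x)" for x using D unfolding differentiable_def by blast
 have "fd g (at x) v = fd f (at (L x + c)) (L v)" for x v
 using frechet_derivative_at[OF D] by metis
 thus "(%x. fd g (at x) v) : {%x. f (L x + c) |f. smooth_fun f} \<or> smooth_fun (%x. fd g (at x) v)" for v
 using smooth_fun_frechet[OF f(1), of "L v"] by auto
qed (use assms in auto)

section \<open>Smooth functions of one real variable and bump functions\<close>

lemma frechet_derivative_real: "f differentiable (at x) ==> fd f (at x) v = v *R vector_derivative f (at (x::real))"
 by (metis frechet_derivative_works has_vector_derivative_def vector_derivative_works frechet_derivative_at)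

lemma smooth_fun_antiderivative:
 fixes Ph :: "real => 'b::euclidean_space"
 assumes D: "!!x. (Ph has_vector_derivative ph x) (at x)" and "smooth_fun ph"
 shows "smooth_fun Ph"
proof (rule smooth_funI[of _ "{Ph}"])
 have "fd Ph (at x) v = v *R ph x" for x v
 using frechet_derivative_at[OF D[unfolded has_vector_derivative_def]] by metis
 thus "(%x. fd g (at x) v) : {Ph} \<or> smooth_fun (%x. fd g (at x) v)"
 if "g : {Ph}" for g v
 using that smooth_fun_bounded_linear[OF bounded_linear_scaleR_right assms(2)] by auto
 show "g differentiable at x" if "g : {Ph}" for g x
 using that D[of x] unfolding has_vector_derivative_def differentiable_def by blast
qed auto

text \<open>The classical flat function \<open>exp (- 1 / x)\<close> with a polynomial factor in
  \<open>y = 1 / x\<close>. The factor makes the family closed under differentiation, which sends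
  \<open>P\<close> to \<open>y^2 (P - P')\<close>.\<close>

definition flat_exp :: "real poly => real => real" where
 "flat_exp P x = (if x > 0 then poly P (inverse x) * exp (- inverse x) else 0)"

lemma poly_times_exp_tendsto_0: "((%y. poly P y * exp (- y)) \<longlongrightarrow> (0::real)) at_top"
proof -
 have "((%y. \<Sum>i\<le>degree P. coeff P i * (y ^ i / exp y)) \<longlongrightarrow> (\<Sum>i\<le>degree P. coeff P i * 0)) at_top"
 by (intro tendsto_sum tendsto_mult tendsto_const tendsto_power_div_exp_0)
 moreover have "(%y. \<Sum>i\<le>degree P. coeff P i * (y ^ i / exp y)) = (%y. poly P y * exp (- y))"
 by (rule ext) (simp add: poly_altdef sum_distrib_right exp_minus divide_inverse mult.assoc)
 ultimately show ?thesis by simp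
qed

lemma flat_exp_has_derivative:
 "(flat_exp P has_vector_derivative flat_exp ([:0, 0, 1:] * (P - pderiv P)) x) (at x)"
proof (cases x "0::real" rule: linorder_cases)
 case less
 have "((%x. 0::real) has_vector_derivative 0) (at x)" by simp
 moreover have "\<forall>\<^sub>F y in nhds x. flat_exp P y = 0"
 using eventually_nhds_in_open[of "{..<0}" x] less
 by (auto elim!: eventually_mono simp: flat_exp_def)
 ultimately show ?thesis
 using less by (subst has_vector_derivative_cong_ev[where g="%x. 0"]) (auto simp: flat_exp_def)
next
 case equal
 have "((%h. flat_exp P h / h) \<longlongrightarrow> 0) (at 0)"
 proof (rule filterlim_split_at)
 show "((%h. flat_exp P h / h) \<longlongrightarrow> 0) (at_left 0)"
 by (rule tendsto_eventually) (auto simp: eventually_at_filter flat_exp_def)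
 \<comment> \<open>Dividing by \<open>h\<close> multiplies the polynomial in
   \<open>inverse h\<close> by its variable, and the exponential still dominates.\<close>
 have "((%h. poly ([:0,1:] * P) (inverse h) * exp (- inverse h)) \<longlongrightarrow> 0) (at_right (0::real))"
 by (rule filterlim_compose[OF poly_times_exp_tendsto_0 filterlim_inverse_at_top_right])
 thus "((%h. flat_exp P h / h) \<longlongrightarrow> 0) (at_right 0)"
 by (rule Lim_transform_eventually)
 (auto simp: eventually_at_filter flat_exp_def field_simps)
 qed
 hence "(flat_exp P has_real_derivative 0) (at 0)"
 by (simp add: DERIV_def flat_exp_def)
 thus ?thesis
 using equal by (simp add: flat_exp_def real_deriv_iff)
next
 case greater
 have "((%x. poly P (inverse x) * exp (- inverse x)) has_real_derivative
 poly ([:0, 0, 1:] * (P - pderiv P)) (inverse x) * exp (- inverse x)) (at x)"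
 using greater
 by (auto intro!: derivative_eq_intros simp: algebra_simps power2_eq_square)
 moreover have "\<forall>\<^sub>F y in nhds x. flat_exp P y = poly P (inverse y) * exp (- inverse y)"
 using eventually_nhds_in_open[of "{0<..}" x] greater
 by (auto elim!: eventually_mono simp: flat_exp_def)
 ultimately show ?thesis
 using greater unfolding real_deriv_iff
 by (subst has_vector_derivative_cong_ev[where g="%y. poly P (inverse y) * exp (- inverse y)"])
 (auto simp: flat_exp_def)
qed

text \<open>Scalar multiples are included in the family because the derivative in direction
  \<open>v\<close> carries the factor \<open>v\<close>.\<close>

lemma smooth_fun_flat_exp: "smooth_fun (flat_exp P)"
proof (rule smooth_funI[of _ "range (%(c, P) x. c * flat_exp P x)"])
 show "flat_exp P : range (%(c, P) x. c * flat_exp P x)"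
 by (rule image_eqI[of _ _ "(1, P)"]) auto
 fix g assume "g : range (%(c, P) x. c * flat_exp P x)"
 then obtain c P where g: "g = (%x. c * flat_exp P x)" by auto
 have D: "(g has_vector_derivative c * flat_exp ([:0, 0, 1:] * (P - pderiv P)) x) (at x)" for x
 unfolding g using has_vector_derivative_mult_right[OF flat_exp_has_derivative] by blast
 thus "g differentiable at x" for x
 unfolding has_vector_derivative_def differentiable_def by blast
 have "fd g (at x) v = (v * c) * flat_exp ([:0, 0, 1:] * (P - pderiv P)) x" for x v
 using frechet_derivative_at[OF D[unfolded has_vector_derivative_def]] by (metis mult.assoc real_scaleR_def)
 thus "(%x. fd g (at x) v) : range (%(c, P) x. c * flat_exp P x) \<or> smooth_fun (%x. fd g (at x) v)" for v
 by (intro disjI1 image_eqI[of _ _ "(v * c, [:0, 0, 1:] * (P - pderiv P))"]) auto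
qed

text \<open>As \<open>n\<close> grows, \<open>bump n c d\<close> increases to the indicator function of \<open>(c, d)\<close>.\<close>

definition bump :: "real => real => real => real => real" where
 "bump n c d x = flat_exp 1 (n * (x - c)) * flat_exp 1 (n * (d - x))"

lemma smooth_fun_bump: "smooth_fun (bump n c d)"
proof -
 have 1: "smooth_fun (%x::real. flat_exp 1 (n * x + - n * c))"
 by (rule smooth_fun_comp_linear[OF bounded_linear_mult_right smooth_fun_flat_exp])
 have 2: "smooth_fun (%x::real. flat_exp 1 ((-n) * x + n * d))"
 by (rule smooth_fun_comp_linear[OF bounded_linear_mult_right smooth_fun_flat_exp])
 show ?thesis
 using smooth_fun_mult[OF 1 2] unfolding bump_def by (simp add: algebra_simps)
qed

lemma bump_outside: "n > 0 ==> x \<notin> {c<..<d} ==> bump n c d x = 0"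
 by (auto simp: bump_def flat_exp_def zero_less_mult_iff)

lemma bump_pos: "n > 0 ==> x : {c<..<d} ==> bump n c d x > 0"
 by (auto simp: bump_def flat_exp_def)

lemma bump_nonneg: "0 <= bump n c d x"
 by (auto simp: bump_def flat_exp_def)

lemma bump_le_1: "bump n c d x <= 1"
proof -
 have "0 <= flat_exp 1 y" "flat_exp 1 y <= 1" for y by (auto simp: flat_exp_def)
 thus ?thesis unfolding bump_def by (intro mult_le_one)
qed

lemma bump_tendsto: "(%n. bump (real (Suc n)) c d x) \<longlonglongrightarrow> indicator {c<..<d} x"
proof (cases "x : {c<..<d}")
 case True
 have "(%n. exp (- (inverse (real (Suc n)) * inverse (x - c))) * exp (- (inverse (real (Suc n)) * inverse (d - x))))
 \<longlonglongrightarrow> exp (- (0 * inverse (x - c))) * exp (- (0 * inverse (d - x)))"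
 by (intro tendsto_intros LIMSEQ_inverse_real_of_nat)
 thus ?thesis
 using True by (simp add: bump_def flat_exp_def)
qed (use bump_outside[of "real (Suc _)"] in auto)

lemma test_fun_bump: "n > 0 ==> {c..d} \<subseteq> S ==> test_fun S (bump n c d)"
 unfolding test_fun_def using smooth_fun_bump bump_outside
 by (auto intro!: exI[of _ "{c..d}"])

lemma test_fun_real_support:
 fixes ph :: "real => 'b::euclidean_space"
 assumes "test_fun {l<..<r} ph" "l < r"
 obtains c d where "l < c" "c < d" "d < r" "!!x. x \<notin> {c..d} ==> ph x = 0"
proof -
 obtain K where K: "compact K" "K \<subseteq> {l<..<r}" "!!x. x \<notin> K ==> ph x = 0"
 using assms unfolding test_fun_def by blast
 show ?thesis
 proof (cases "K = {}")
 case True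
 thus ?thesis
 using K assms(2) by (intro that[of "(2*l + r)/3" "(l + 2*r)/3"]) auto
 next
 case False
 obtain a b where ab: "a : K" "!!x. x : K ==> a <= x" "b : K" "!!x. x : K ==> x <= b"
 using compact_attains_inf[OF K(1) False] compact_attains_sup[OF K(1) False] by metis
 have *: "l < a" "a <= b" "b < r" using ab K(2) by auto
 show ?thesis
 proof (rule that[of "(l + a)/2" "(b + r)/2"])
 show "ph x = 0" if "x \<notin> {(l + a)/2..(b + r)/2}" for x
 proof (rule K(3), rule notI)
 assume "x : K"
 thus False using ab(2,4)[of x] * that by auto
 qed
 qed (use * in auto)
 qed
qed

lemma smooth_fun_real_derivative:
 "smooth_fun ph ==> (ph has_vector_derivative D1 ph x) (at (x::real))"
 by (simp add: frechet_derivative_real smooth_fun_differentiable vector_derivative_works[symmetric])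

lemma smooth_fun_deriv_continuous: "smooth_fun ph ==> continuous_on A (%x. fd ph (at x) v)"
 by (rule smooth_cont[OF smooth_fun_frechet])

lemma test_fun_linear_combination:
 fixes f g :: "real => real"
 assumes "test_fun {l<..<r} f" "test_fun {l<..<r} g" "l < r"
 shows "test_fun {l<..<r} (%x. f x - c * g x)"
proof -
 obtain a b where ab: "l < a" "a < b" "b < r" "!!x. x \<notin> {a..b} ==> f x = 0"
 using test_fun_real_support[OF assms(1,3)] by metis
 obtain a' b' where ab': "l < a'" "a' < b'" "b' < r" "!!x. x \<notin> {a'..b'} ==> g x = 0"
 using test_fun_real_support[OF assms(2,3)] by metis
 have "smooth_fun (%x. f x + (- c) * g x)"
 by (intro smooth_fun_add smooth_fun_bounded_linear[OF bounded_linear_mult_right])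
 (use assms in "auto simp: test_fun_def")
 moreover have "f x - c * g x = 0" if "x \<notin> {min a a'..max b b'}" for x
 proof -
 have "x \<notin> {a..b}" "x \<notin> {a'..b'}" using that by auto
 thus ?thesis using ab(4) ab'(4) by simp
 qed
 moreover have "{min a a'..max b b'} \<subseteq> {l<..<r}" using ab ab' by auto
 ultimately show ?thesis
 unfolding test_fun_def by (intro conjI exI[of _ "{min a a'..max b b'}"]) auto
qed

text \<open>Weak derivatives on the cylinder are tested with tensor products only. This is enough to
  split them into derivatives along almost every line.\<close>

lemma test_fun_tensor:
 fixes th ph :: "real => real"
 assumes "test_fun A th" "test_fun B ph"
 shows "test_fun (A \<times> B) (%p. th (fst p) * ph (snd p))"
 and "fd (%p. th (fst p) * ph (snd p)) (at (t, x)) v =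
 fst v * D1 th t * ph x + snd v * th t * D1 ph x"
proof -
 obtain K where K: "compact K" "K \<subseteq> A" "!!x. x \<notin> K ==> th x = 0"
 using assms unfolding test_fun_def by blast
 obtain L where L: "compact L" "L \<subseteq> B" "!!x. x \<notin> L ==> ph x = 0"
 using assms unfolding test_fun_def by blast
 have s: "smooth_fun th" "smooth_fun ph" using assms by (auto simp: test_fun_def)
 have "smooth_fun (%p::real\<times>real. th (fst p + 0))" "smooth_fun (%p::real\<times>real. ph (snd p + 0))"
 by (intro smooth_fun_comp_linear bounded_linear_fst bounded_linear_snd s)+
 hence "smooth_fun (%p::real\<times>real. th (fst p) * ph (snd p))"
 using smooth_fun_mult by fastforce
 thus "test_fun (A \<times> B) (%p. th (fst p) * ph (snd p))"
 unfolding test_fun_def using K L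
 by (intro conjI exI[of _ "K \<times> L"]) (auto simp: compact_Times)
 have d: "(th has_derivative (%v. v * D1 th t)) (at t)"
 "(ph has_derivative (%v. v * D1 ph x)) (at x)"
 using s[THEN smooth_fun_real_derivative] by (auto simp: has_vector_derivative_def)
 have "((%p. th (fst p) * ph (snd p)) has_derivative
 (%v. th (fst (t,x)) * (snd v * D1 ph x) + (fst v * D1 th t) * ph (snd (t,x)))) (at (t, x))"
 by (intro has_derivative_mult has_derivative_compose[of fst fst _ _ th] has_derivative_compose[of snd snd _ _ ph]
 bounded_linear_imp_has_derivative bounded_linear_fst bounded_linear_snd) (use d in auto)
 from frechet_derivative_at[OF this, symmetric]
 show "fd (%p. th (fst p) * ph (snd p)) (at (t, x)) v =
 fst v * D1 th t * ph x + snd v * th t * D1 ph x"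
 by (cases v) (simp add: fun_eq_iff algebra_simps)
qed

section \<open>Primitives on intervals\<close>

abbreviation LL :: "real => real => real measure" where
 "LL l r == leb {l<..<r}"

abbreviation (input) LI where "LI == LL 0 1"

lemma fin_LL: "finite_measure (LL l r)"
 by (rule finite_measure_lebesgue_on) (metis box_real(1) lmeasurable_box)

lemma measure_LL: "l <= r ==> measure (LL l r) (space (LL l r)) = r - l"
 by (simp add: measure_restrict_space)

text \<open>Absolutely continuous functions are represented throughout as a constant plus such a
  primitive. For \<open>x <= l\<close> the interval is empty and the value is 0.\<close>

definition prim :: "real => (real => 'b::euclidean_space) => real => 'b" where
 "prim l g x = (LINT y:{l<..<x}|lebesgue. g y)"

lemma LL_integrable_iff:
 fixes g :: "real => 'b::euclidean_space"
 shows "intg (LL l r) g \<longleftrightarrow> set_integrable lebesgue {l<..<r} g"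
 unfolding set_integrable_def by (rule integrable_restrict_space) auto

lemma LL_integral_eq:
 fixes g :: "real => 'b::euclidean_space"
 shows "integral\<^sup>L (LL l r) g = (LINT y:{l<..<r}|lebesgue. g y)"
 unfolding set_int_def by (rule integral_restrict_space) auto

lemma LL_prim: "integral\<^sup>L (LL l r) g = prim l g r"
 unfolding prim_def by (rule LL_integral_eq)

lemma AE_LL_iff: "(AE x in LL l r. P x) \<longleftrightarrow> (AE x in lebesgue. x : {l<..<r} --> P x)"
 by (subst AE_restrict_space_iff) auto

lemma intg_subset:
 fixes g :: "real => 'b::euclidean_space"
 shows "intg (LL l r) g ==> l <= l' ==> r' <= r ==> intg (LL l' r') g"
 unfolding LL_integrable_iff by (rule set_integrable_subset) auto

lemma prim_cong_AE: "(AE x in LL l r. f x = g x) ==> f : bm (LL l r) ==> g : bm (LL l r) ==>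
 x <= r ==> prim l f x = prim l g x"
 unfolding LL_prim[symmetric]
proof (rule int_cong_AE)
 assume m: "f : bm (LL l r)" "g : bm (LL l r)" and "x <= r"
 hence s: "{l<..<x} \<subseteq> {l<..<r}" by auto
 show "f : bm (LL l x)" "g : bm (LL l x)"
 using measurable_restrict_mono[OF _ s] m by auto
 assume "AE x in LL l r. f x = g x"
 thus "AE x in LL l x. f x = g x"
 unfolding AE_LL_iff using s by (auto elim!: eventually_mono)
qed

lemma AE_lebesgue_neq: "AE y in lebesgue. y ~= (x::real)"
 using AE_completion[OF AE_lborel_singleton[of x]] by simp

lemma prim_diff:
 assumes "intg (LL l r) g" "l <= x" "x <= y" "y <= r"
 shows "prim l g y - prim l g x = prim x g y"
proof -
 have i: "set_integrable lebesgue {l<..<r} g" using assms by (simp add: LL_integrable_iff)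
 have "prim l g y = (LINT t:{l<..<x} \<union> {x<..<y}|lebesgue. g t)"
 unfolding prim_def set_int_def
 proof (rule int_cong_AE)
 show "AE t in lebesgue. indicat_real {l<..<y} t *R g t = indicat_real ({l<..<x} \<union> {x<..<y}) t *R g t"
 using AE_lebesgue_neq[of x] by eventually_elim (use assms in "auto simp: indicator_def")
 have "set_integrable lebesgue {l<..<y} g" "set_integrable lebesgue ({l<..<x} \<union> {x<..<y}) g"
 by (rule set_integrable_subset[OF i]; use assms in auto)+
 thus "(%t. indicat_real {l<..<y} t *R g t) : bm lebesgue"
 "(%t. indicat_real ({l<..<x} \<union> {x<..<y}) t *R g t) : bm lebesgue"
 unfolding set_integrable_def by auto
 qed
 also have "... = prim l g x + prim x g y"
 unfolding prim_def
 proof (rule set_integral_Un)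
 show "set_integrable lebesgue {l<..<x} g" "set_integrable lebesgue {x<..<y} g"
 by (rule set_integrable_subset[OF i]; use assms in auto)+
 qed auto
 finally show ?thesis by simp
qed

lemma norm_prim_le:
 "norm (prim l g x) <= prim l (%y. norm (g y)) x"
 unfolding LL_prim[symmetric] by (rule integral_norm_bound)

lemma prim_nonneg: "(!!y. 0 <= g y) ==> (0::real) <= prim l g x"
 unfolding LL_prim[symmetric] by simp

lemma prim_refl[simp]: "x <= l ==> prim l g x = 0"
 by (simp add: prim_def set_int_def)

lemma prim_mono:
 assumes "intg (LL l r) (g::real=>real)" "!!y. 0 <= g y" "l <= x" "x <= y" "y <= r"
 shows "prim l g x <= prim l g y"
 using prim_diff[OF assms(1,3-5)] prim_nonneg[of "g" x y] assms(2) by simp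

lemma norm_prim_bound:
 assumes "intg (LL l r) g" "l <= x" "x <= r"
 shows "norm (prim l g x) <= (LINT y|LL l r. norm (g y))"
 using order_trans[OF norm_prim_le prim_mono[of l r "%y. norm (g y)" x r]] assms
 by (simp add: LL_prim)

lemma prim_add:
 assumes "intg (LL l r) f" "intg (LL l r) g" "x <= r"
 shows "prim l (%y. f y + g y) x = prim l f x + prim l g x"
 unfolding LL_prim[symmetric]
 by (rule int_add) (use assms in "auto intro: intg_subset")

lemma prim_subtract:
 assumes "intg (LL l r) f" "intg (LL l r) g" "x <= r"
 shows "prim l (%y. f y - g y) x = prim l f x - prim l g x"
 unfolding LL_prim[symmetric]
 by (rule int_diff) (use assms in "auto intro: intg_subset")

lemma prim_scaleR: "prim l (%y. c *R f y) x = c *R prim l f x"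
 unfolding LL_prim[symmetric] by simp

lemma prim_bounded_linear:
 assumes "bounded_linear L" "intg (LL l r) f" "x <= r"
 shows "prim l (%y. L (f y)) x = L (prim l f x)"
 unfolding LL_prim[symmetric]
 by (rule int_blin[OF assms(1)]) (use assms in "auto intro: intg_subset")

lemma prim_const: "l <= x ==> prim l (%y. c) x = (x - l) *R c"
 unfolding LL_prim[symmetric] by (simp add: measure_restrict_space)

lemma prim_indicator:
 assumes "l <= x" "x <= r"
 shows "prim l g x = (LINT y|LL l r. indicator {..<x} y *R g y)"
 unfolding LL_integral_eq prim_def set_int_def
 by (rule int_cong) (use assms in "auto simp: indicator_def")

text \<open>After extension by zero outside \<open>{l<..<r}\<close> the primitive is an indefinite
  gauge integral, which is continuous in its upper limit.\<close>

lemma continuous_on_prim: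
 assumes "intg (LL l r) g"
 shows "continuous_on {l..r} (prim l g)"
proof (cases "l <= r")
 case True
 have eq: "prim l g x = integral {l..x} (%y. indicator {l<..<r} y *R g y)" if "x : {l..r}" for x
 proof -
 have "set_integrable lebesgue {l<..<r} g" using assms by (simp add: LL_integrable_iff)
 hence "intg lebesgue (%y. indicat_real {l<..<r} y *R g y)"
 unfolding set_integrable_def by simp
 hence si: "set_integrable lebesgue {l..x} (%y. indicat_real {l<..<r} y *R g y)"
 unfolding set_integrable_def by (rule integrable_mult_indicator[rotated]) simp
 have "prim l g x = (LINT y:{l..x}|lebesgue. indicat_real {l<..<r} y *R g y)"
 unfolding prim_def set_int_def
 proof (rule int_cong_AE)
 show "AE t in lebesgue. indicat_real {l<..<x} t *R g t = indicat_real {l..x} t *R indicat_real {l<..<r} t *R g t"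
 using AE_lebesgue_neq[of x] by eventually_elim (use that in "auto simp: indicator_def")
 have "set_integrable lebesgue {l<..<x} g"
 using assms that by (intro LL_integrable_iff[THEN iffD1] intg_subset[of l r g l x]) auto
 thus "(%t. indicat_real {l<..<x} t *R g t) : bm lebesgue"
 unfolding set_integrable_def by auto
 show "(%t. indicat_real {l..x} t *R indicat_real {l<..<r} t *R g t) : bm lebesgue"
 using si unfolding set_integrable_def by auto
 qed
 also have "... = integral {l..x} (%y. indicat_real {l<..<r} y *R g y)"
 by (rule set_lebesgue_integral_eq_integral(2)[OF si])
 finally show ?thesis .
 qed
 have "(%y. indicat_real {l<..<r} y *R g y) integrable_on {l..r}"
 proof (rule set_lebesgue_integral_eq_integral(1))
 show "set_integrable lebesgue {l..r} (%y. indicat_real {l<..<r} y *R g y)"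
 unfolding set_integrable_def
 by (rule integrable_mult_indicator) (use assms in "auto simp: LL_integrable_iff set_integrable_def")
 qed
 from indefinite_integral_continuous_1[OF this] show ?thesis
 by (rule continuous_on_eq) (use eq in auto)
qed auto

lemma prim_FTC:
 assumes "!!x. (Ph has_vector_derivative ph x) (at x)" "continuous_on UNIV ph" "l <= x"
 shows "prim l ph x = Ph x - Ph l" and "intg (LL l x) ph"
proof -
 have "set_integrable lborel {l..x} ph"
 by (rule borel_integrable_atLeastAtMost') (use assms in "auto intro: continuous_on_subset")
 hence si: "set_integrable lebesgue {l..x} ph"
 unfolding set_integrable_def by (subst integrable_completion) (auto intro: bm_intg)
 show "intg (LL l x) ph"
 unfolding LL_integrable_iff by (rule set_integrable_subset[OF si]) auto
 have "prim l ph x = (LINT y:{l..x}|lebesgue. ph y)"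
 unfolding prim_def
 proof (rule set_integral_cong_set)
 show "set_borel_measurable lebesgue {l<..<x} ph" "set_borel_measurable lebesgue {l..x} ph"
 proof -
 have "set_integrable lebesgue {l<..<x} ph"
 by (rule set_integrable_subset[OF si]) auto
 thus "set_borel_measurable lebesgue {l<..<x} ph" "set_borel_measurable lebesgue {l..x} ph"
 using si unfolding set_integrable_def set_borel_measurable_def by auto
 qed
 show "AE y in lebesgue. (y : {l..x}) = (y : {l<..<x})"
 using AE_lebesgue_neq[of x] AE_lebesgue_neq[of l] by eventually_elim auto
 qed
 also have "... = integral {l..x} ph"
 by (rule set_lebesgue_integral_eq_integral(2)[OF si])
 also have "... = Ph x - Ph l"
 by (rule integral_unique[OF fundamental_theorem_of_calculus[OF assms(3)]])
 (auto intro: has_vector_derivative_at_within assms(1))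
 finally show "prim l ph x = Ph x - Ph l" .
qed

section \<open>The product rule\<close>

lemma measurable_bilinear:
 fixes pr :: "'b::euclidean_space => 'c::euclidean_space => 'd::euclidean_space"
 assumes "bounded_bilinear pr" "f : bm M" "g : bm M"
 shows "(%x. pr (f x) (g x)) : bm M"
proof -
 have c: "continuous_on UNIV (%p. pr (fst p) (snd p))"
 by (intro bounded_bilinear.continuous_on[OF assms(1)] continuous_intros)
 have "(%x. (f x, g x)) : bm M"
 using assms(2,3) by simp
 from m_comp[OF this bm_cont[OF c]] show ?thesis by simp
qed

text \<open>Integration by parts from Fubini's theorem alone: integrate
  \<open>pr (f x) (g y)\<close> over the square. The triangle \<open>U\<close> below the diagonal
  gives the first term, the triangle \<open>V\<close> above it the second, and the diagonal is a
  null set.\<close>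

lemma integral_prim_product:
 fixes pr :: "'b::euclidean_space => 'c::euclidean_space => 'd::euclidean_space"
 assumes pr: "bounded_bilinear pr" and f: "intg (LL l r) f" and g: "intg (LL l r) g" and "l <= r"
 shows "intg (LL l r) (%x. pr (f x) (prim l g x))" "intg (LL l r) (%x. pr (prim l f x) (g x))"
 "(LINT x|LL l r. pr (f x) (prim l g x)) + (LINT x|LL l r. pr (prim l f x) (g x)) = pr (prim l f r) (prim l g r)"
proof -
 define M where "M = LL l r"
 interpret finite_measure M unfolding M_def by (rule fin_LL)
 interpret P: pair_sigma_finite M M by unfold_locales
 note lin = bounded_bilinear.bounded_linear_right[OF pr] bounded_bilinear.bounded_linear_left[OF pr]
 have [measurable]: "f : bm M" "g : bm M"
 using f g by (auto simp: M_def)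
 have id[measurable]: "(%x. x) : bm M"
 unfolding M_def using id_borel_measurable_lebesgue_on[unfolded id_def] .
 obtain K where K: "!!a b. norm (pr a b) <= norm a * norm b * K"
 using bounded_bilinear.bounded[OF pr] by blast
 have N: "intg (M \<Otimes>\<^sub>M M) (%(x, y). norm (f x) * norm (g y))"
 by (rule P.Fubini_integrable) (use f g in "auto simp: M_def[symmetric]")
 have m: "(%(x, y). pr (f x) (g y)) : bm (M \<Otimes>\<^sub>M M)"
 unfolding split_def by (rule measurable_bilinear[OF pr]) auto
 have int: "intg (M \<Otimes>\<^sub>M M) (%(x, y). pr (f x) (g y))"
 proof (rule intg_bound[OF intg_mult[OF N, of K] m])
 show "AE z in M \<Otimes>\<^sub>M M. norm (case z of (x, y) => pr (f x) (g y)) <= norm (K * (case z of (x, y) => norm (f x) * norm (g y)))"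
 using K by (auto intro!: AE_I2 order_trans[OF _ abs_ge_self] simp: mult.commute split: prod.split)
 qed
 have intS: "intg (M \<Otimes>\<^sub>M M) (%(x, y). indicator S (x, y) *R pr (f x) (g y))" if "S : sets (M \<Otimes>\<^sub>M M)" for S
 using integrable_mult_indicator[OF that int] by (simp add: split_def)
 have spM: "space M = {l<..<r}" by (simp add: M_def)
 define U where "U = {z : space (M \<Otimes>\<^sub>M M). snd z < fst z}"
 define V where "V = {z : space (M \<Otimes>\<^sub>M M). fst z < snd z}"
 have U: "U : sets (M \<Otimes>\<^sub>M M)" unfolding U_def by measurable
 have V: "V : sets (M \<Otimes>\<^sub>M M)" unfolding V_def by measurable
 have gx: "intg M (%y. indicator {..<x} y *R g y)" "intg M (%y. indicator {..<x} y *R f y)" for x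
 proof -
 have [measurable]: "{y:space M. y < x} : sets M" by measurable
 have "intg M (%y. indicator {y:space M. y < x} y *R g y)" "intg M (%y. indicator {y:space M. y < x} y *R f y)"
 by (intro integrable_mult_indicator; use f g in "auto simp: M_def[symmetric]")+
 thus "intg M (%y. indicator {..<x} y *R g y)" "intg M (%y. indicator {..<x} y *R f y)"
 by (auto cong: Bochner_Integration.integrable_cong simp: indicator_def)
 qed
 have 1: "(LINT y|M. indicator U (x, y) *R pr (f x) (g y)) = pr (f x) (prim l g x)" if "x : space M" for x
 proof -
 have "(LINT y|M. indicator U (x, y) *R pr (f x) (g y)) = (LINT y|M. pr (f x) (indicator {..<x} y *R g y))"
 by (rule int_cong)
 (use that in "auto simp: U_def indicator_def space_pair_measure bounded_bilinear.zero_right[OF pr]")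
 also have "... = pr (f x) (LINT y|M. indicator {..<x} y *R g y)"
 by (rule int_blin[OF lin(1) gx(1)])
 also have "... = pr (f x) (prim l g x)"
 using that prim_indicator[of l x r g] by (simp add: M_def)
 finally show ?thesis .
 qed
 have 2: "(LINT x|M. indicator V (x, y) *R pr (f x) (g y)) = pr (prim l f y) (g y)" if "y : space M" for y
 proof -
 have "(LINT x|M. indicator V (x, y) *R pr (f x) (g y)) = (LINT x|M. pr (indicator {..<y} x *R f x) (g y))"
 by (rule int_cong)
 (use that in "auto simp: V_def indicator_def space_pair_measure bounded_bilinear.zero_left[OF pr]")
 also have "... = pr (LINT x|M. indicator {..<y} x *R f x) (g y)"
 by (rule int_blin[OF lin(2) gx(2)])
 also have "... = pr (prim l f y) (g y)"
 using that prim_indicator[of l y r f] by (simp add: M_def)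
 finally show ?thesis .
 qed
 have i1: "intg M (%x. pr (f x) (prim l g x))"
 using P.integrable_fst[OF intS[OF U]] 1 by (simp cong: Bochner_Integration.integrable_cong)
 thus "intg (LL l r) (%x. pr (f x) (prim l g x))" by (simp add: M_def)
 have i2: "intg M (%x. pr (prim l f x) (g x))"
 using P.integrable_snd[OF intS[OF V]] 2 by (simp cong: Bochner_Integration.integrable_cong)
 thus "intg (LL l r) (%x. pr (prim l f x) (g x))" by (simp add: M_def)
 have "(LINT x|M. pr (f x) (prim l g x)) + (LINT x|M. pr (prim l f x) (g x)) =
 (LINT x|M. (LINT y|M. indicator U (x, y) *R pr (f x) (g y))) + (LINT y|M. (LINT x|M. indicator V (x, y) *R pr (f x) (g y)))"
 using 1 2 by (simp cong: int_cong)
 also have "... = (\<integral>z. (case z of (x, y) => indicator U (x, y) *R pr (f x) (g y)) \<partial>(M \<Otimes>\<^sub>M M)) +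
 (\<integral>z. (case z of (x, y) => indicator V (x, y) *R pr (f x) (g y)) \<partial>(M \<Otimes>\<^sub>M M))"
 using P.integral_fst[OF intS[OF U]] P.integral_snd[OF intS[OF V]] by simp
 also have "... = (\<integral>z. (case z of (x, y) => indicator U (x, y) *R pr (f x) (g y)) + (case z of (x, y) => indicator V (x, y) *R pr (f x) (g y)) \<partial>(M \<Otimes>\<^sub>M M))"
 by (rule int_add[symmetric]) (intro intS U V)+
 also have "... = (\<integral>z. (case z of (x, y) => pr (f x) (g y)) \<partial>(M \<Otimes>\<^sub>M M))"
 proof (rule int_cong_AE)
 have eqm: "{z : space (M \<Otimes>\<^sub>M M). fst z ~= snd z} : sets (M \<Otimes>\<^sub>M M)" by measurable
 have "AE z in M \<Otimes>\<^sub>M M. fst z ~= snd z"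
 proof (rule P.AE_pair_measure[OF eqm])
 have "AE y in M. x ~= y" for x
 unfolding M_def AE_LL_iff using AE_lebesgue_neq[of x] by eventually_elim auto
 thus "AE x in M. AE y in M. fst (x, y) ~= snd (x, y)" by simp
 qed
 moreover have "AE z in M \<Otimes>\<^sub>M M. z : space (M \<Otimes>\<^sub>M M)" by (rule AE_space)
 ultimately show "AE z in M \<Otimes>\<^sub>M M. (case z of (x, y) => indicator U (x, y) *R pr (f x) (g y)) + (case z of (x, y) => indicator V (x, y) *R pr (f x) (g y)) = (case z of (x, y) => pr (f x) (g y))"
 proof eventually_elim
 case (elim z)
 thus ?case by (cases z) (auto simp: U_def V_def indicator_def)
 qed
 qed (use intS[OF U] intS[OF V] m in auto)
 also have "... = (LINT x|M. (LINT y|M. pr (f x) (g y)))"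
 using P.integral_fst[OF int] by simp
 also have "... = (LINT x|M. pr (f x) (LINT y|M. g y))"
 by (rule int_cong[OF refl], rule int_blin[OF lin(1)])
 (use g in "simp add: M_def")
 also have "... = pr (LINT x|M. f x) (LINT y|M. g y)"
 by (rule int_blin[OF lin(2)]) (use f in "simp add: M_def")
 finally show "(LINT x|LL l r. pr (f x) (prim l g x)) + (LINT x|LL l r. pr (prim l f x) (g x)) = pr (prim l f r) (prim l g r)"
 by (simp add: M_def LL_prim)
qed

text \<open>The initial values \<open>c\<close> and \<open>d\<close> contribute only terms linear in
  \<open>f\<close> or \<open>g\<close>; the rest is \<open>integral_prim_product\<close> on
  \<open>(l, x)\<close>. Products of absolutely continuous functions are differentiated through this
  rule below.\<close>

lemma prim_product:
 fixes pr :: "'b::euclidean_space => 'c::euclidean_space => 'd::euclidean_space"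
 assumes pr: "bounded_bilinear pr" and f: "intg (LL l r) f" and g: "intg (LL l r) g"
 and "l <= x" "x <= r"
 shows "intg (LL l r) (%x. pr (f x) (d + prim l g x) + pr (c + prim l f x) (g x))"
 and "prim l (%x. pr (f x) (d + prim l g x) + pr (c + prim l f x) (g x)) x =
 pr (c + prim l f x) (d + prim l g x) - pr c d"
proof -
 note lin = bounded_bilinear.bounded_linear_right[OF pr] bounded_bilinear.bounded_linear_left[OF pr]
 have lr: "l <= r" using assms by simp
 have I: "intg (LL l r') (%x. pr (f x) (d + prim l g x))" "intg (LL l r') (%x. pr (c + prim l f x) (g x))"
 if "l <= r'" "r' <= r" for r'
 proof -
 have f': "intg (LL l r') f" and g': "intg (LL l r') g"
 by (rule intg_subset[OF f order_refl that(2)], rule intg_subset[OF g order_refl that(2)])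
 show "intg (LL l r') (%x. pr (f x) (d + prim l g x))"
 unfolding bounded_bilinear.add_right[OF pr]
 by (intro intg_add integral_prim_product(1)[OF pr f' g' that(1)] integrable_bounded_linear[OF lin(2) f'])
 show "intg (LL l r') (%x. pr (c + prim l f x) (g x))"
 unfolding bounded_bilinear.add_left[OF pr]
 by (intro intg_add integral_prim_product(2)[OF pr f' g' that(1)] integrable_bounded_linear[OF lin(1) g'])
 qed
 show "intg (LL l r) (%x. pr (f x) (d + prim l g x) + pr (c + prim l f x) (g x))"
 using I[OF lr] by auto
 have f': "intg (LL l x) f" and g': "intg (LL l x) g"
 by (rule intg_subset[OF f order_refl assms(5)], rule intg_subset[OF g order_refl assms(5)])
 have "prim l (%x. pr (f x) (d + prim l g x) + pr (c + prim l f x) (g x)) x =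
 (LINT y|LL l x. pr (f y) (d + prim l g y)) + (LINT y|LL l x. pr (c + prim l f y) (g y))"
 by (rule trans[OF LL_prim[symmetric] int_add[OF I[OF assms(4,5)]]])
 also have "(LINT y|LL l x. pr (f y) (d + prim l g y)) = pr (prim l f x) d + (LINT y|LL l x. pr (f y) (prim l g y))"
 unfolding bounded_bilinear.add_right[OF pr]
 using int_blin[OF lin(2) f', of d]
 int_add[OF integrable_bounded_linear[OF lin(2) f', of d] integral_prim_product(1)[OF pr f' g' assms(4)]]
 by (simp add: LL_prim)
 also have "(LINT y|LL l x. pr (c + prim l f y) (g y)) = pr c (prim l g x) + (LINT y|LL l x. pr (prim l f y) (g y))"
 unfolding bounded_bilinear.add_left[OF pr]
 using int_blin[OF lin(1) g', of c]
 int_add[OF integrable_bounded_linear[OF lin(1) g', of c] integral_prim_product(2)[OF pr f' g' assms(4)]]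
 by (simp add: LL_prim)
 finally show "prim l (%x. pr (f x) (d + prim l g x) + pr (c + prim l f x) (g x)) x =
 pr (c + prim l f x) (d + prim l g x) - pr c d"
 using integral_prim_product(3)[OF pr f' g' assms(4)]
 by (simp add: bounded_bilinear.add_left[OF pr] bounded_bilinear.add_right[OF pr] algebra_simps)
qed

section \<open>The fundamental lemma of the calculus of variations\<close>

lemma integrable_LL_indicator:
 fixes f :: "real => 'b::euclidean_space"
 assumes "intg (LL l r) f" "A : sets lebesgue"
 shows "intg (LL l r) (%x. indicator A x *R f x)"
proof -
 have "intg (LL l r) (%x. indicator (A \<inter> {l<..<r}) x *R f x)"
 by (rule integrable_mult_indicator[OF _ assms(1)]) (use assms(2) in "auto simp: sets_restrict_space")
 thus ?thesis
 by (rule Bochner_Integration.integrable_cong[THEN iffD1, rotated -1]) (auto simp: indicator_def)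
qed

text \<open>The primitive gives the integrals of \<open>f\<close> over half-lines. These sets form
  an intersection-stable generator of the Borel sets, so the integral of \<open>f\<close> vanishes
  over every Borel set, and over every Lebesgue set up to a null set.\<close>

lemma AE_zero_if_prim_zero:
 fixes f :: "real => 'b::euclidean_space"
 assumes f: "intg (LL l r) f" and "l <= r" and z: "!!x. x : {l..r} ==> prim l f x = 0"
 shows "AE x in LL l r. f x = 0"
proof (rule sigma_finite_measure.density_zero[OF _ f])
 show "sigma_finite_measure (LL l r)" using fin_LL by (rule finite_measure.axioms)
 define I where "I A = (LINT x|LL l r. indicator A x *R f x)" for A
 have borel0: "I A = 0" if "A : sets borel" for A
 proof -
 have eq: "sets borel = sigma_sets UNIV (range (%a::real. {..<a}))"
 by (subst borel_eq_lessThan) (simp add: eucl_less_def lessThan_def)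
 have "Int_stable (range (%a::real. {..<a}))"
 unfolding Int_stable_def
 proof (intro ballI)
 fix A B assume "A : range (%a::real. {..<a})" "B : range (%a::real. {..<a})"
 then obtain a b where "A = {..<a}" "B = {..<b}" by auto
 hence "A \<inter> B = {..<min a b}" by auto
 thus "A \<inter> B : range (%a::real. {..<a})" by auto
 qed
 moreover have "range (%a::real. {..<a}) \<subseteq> Pow UNIV" by auto
 ultimately show ?thesis using that[unfolded eq]
 proof (induction rule: sigma_sets_induct_disjoint)
 case (basic A)
 then obtain a where A: "A = {..<a}" by auto
 define x where "x = max l (min a r)"
 have "I A = (LINT y|LL l r. indicator {..<x} y *R f y)"
 unfolding I_def A x_def by (rule int_cong) (use assms(2) in "auto simp: indicator_def")
 also have "... = prim l f x"
 using prim_indicator[of l x r f] assms(2) by (simp add: x_def)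
 finally show ?case using z[of x] assms(2) by (simp add: x_def)
 next
 case empty
 thus ?case by (simp add: I_def)
 next
 case (compl A)
 hence A: "A : sets lebesgue" using eq by auto
 have "I (UNIV - A) = (LINT x|LL l r. f x - indicator A x *R f x)"
 unfolding I_def by (rule int_cong) (auto simp: indicator_def)
 also have "... = integral\<^sup>L (LL l r) f - I A"
 unfolding I_def by (rule int_diff[OF f integrable_LL_indicator[OF f A]])
 also have "... = 0" using z[of r] assms(2) compl by (simp add: LL_prim)
 finally show ?case .
 next
 case (union A)
 hence Ab: "!!i. A i : sets borel" using eq by auto
 have A: "!!i. A i \<inter> {l<..<r} : sets (LL l r)" using Ab by (auto simp: sets_restrict_space)
 have I2: "I B = set_lebesgue_integral (LL l r) (B \<inter> {l<..<r}) f" for B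
 unfolding I_def set_int_def by (rule int_cong) (auto simp: indicator_def)
 have "set_lebesgue_integral (LL l r) (\<Union>i. A i \<inter> {l<..<r}) f = (\<Sum>i. set_lebesgue_integral (LL l r) (A i \<inter> {l<..<r}) f)"
 proof (rule lebesgue_integral_countable_add)
 show "set_integrable (LL l r) (\<Union>i. A i \<inter> {l<..<r}) f"
 unfolding set_integrable_def by (rule integrable_mult_indicator[OF sets.countable_UN f]) (use A in blast)
 qed (use A union.hyps in "auto simp: disjoint_family_on_def")
 thus ?case using union.IH by (simp add: I2)
 qed
 qed
 fix A assume "A : sets (LL l r)"
 then obtain B where B: "B : sets lebesgue" "A = B \<inter> {l<..<r}" by (auto simp: sets_restrict_space)
 obtain S N N' where S: "B = S \<union> N" "N \<subseteq> N'" "N' : null_sets lborel" "S : sets lborel"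
 using sets_completionE[OF B(1)] by metis
 have "set_lebesgue_integral (LL l r) A f = I S"
 unfolding I_def set_int_def
 proof (rule int_cong_AE)
 show "(%x. indicat_real A x *R f x) : bm (LL l r)"
 using \<open>A : sets (LL l r)\<close> f by measurable
 show "(%x. indicat_real S x *R f x) : bm (LL l r)"
 using integrable_LL_indicator[OF f, of S] S(4) by auto
 have "AE x in lebesgue. x \<notin> N'"
 by (rule AE_not_in[OF null_sets_completionI[OF S(3)]])
 thus "AE x in LL l r. indicat_real A x *R f x = indicat_real S x *R f x"
 unfolding AE_LL_iff by eventually_elim (use S B in "auto simp: indicator_def")
 qed
 thus "set_lebesgue_integral (LL l r) A f = 0" using borel0[of S] S(4) by simp
qed

lemma continuous_zero_on_rationals:
 fixes h :: "real => 'b::real_normed_vector"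
 assumes "continuous_on {a..b} h" "a < b" "!!y. y : \<rat> ==> a < y ==> y < b ==> h y = 0" "x : {a..b}"
 shows "h x = 0"
proof (rule ccontr)
 assume "h x ~= 0"
 then obtain d where d: "d > 0" "!!y. y : {a..b} ==> dist y x < d ==> dist (h y) (h x) < norm (h x)"
 using assms(1,4) unfolding continuous_on_iff by (metis zero_less_norm_iff)
 have "max a (x - d) < min b (x + d)" using d(1) assms(2,4) by auto
 then obtain y where y: "y : \<rat>" "max a (x - d) < y" "y < min b (x + d)"
 using Rats_dense_in_real by blast
 hence "dist (h y) (h x) < norm (h x)" by (intro d(2)) (auto simp: dist_real_def)
 thus False using assms(3)[of y] y by simp
qed

text \<open>The hypothesis allows the exceptional null set of parameters \<open>t\<close> to depend
  on the test function. Only the countably many bumps with rational end points and natural parameter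
  are used, so that one null set serves for all of them; their limits give the integrals over
  rational intervals.\<close>

lemma fundamental_lemma_AE:
 fixes f :: "'t => real => 'b::euclidean_space"
 assumes int: "AE t in N. ALL c d. l < c --> d < r --> intg (LL c d) (f t)"
 and z: "!!ph::real=>real. test_fun {l<..<r} ph ==> AE t in N. (LINT x|LL l r. ph x *R f t x) = 0"
 shows "AE t in N. AE x in LL l r. f t x = 0"
proof -
 have "AE t in N. ALL c:\<rat>. ALL d:\<rat>. ALL n::nat. l < c --> d < r --> (LINT x|LL l r. bump (real (Suc n)) c d x *R f t x) = 0"
 proof (intro AE_ball_countable[THEN iffD2] ballI countable_rat, subst AE_all_countable, rule allI)
 fix c d n
 show "AE t in N. l < c --> d < r --> (LINT x|LL l r. bump (real (Suc n)) c d x *R f t x) = 0"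
 proof (cases "l < c & d < r")
 case True
 hence "test_fun {l<..<r} (bump (real (Suc n)) c d)" by (intro test_fun_bump) auto
 from z[OF this] show ?thesis by eventually_elim simp
 qed auto
 qed
 with int show ?thesis
 proof eventually_elim
 case (elim t)
 have 1: "integral\<^sup>L (LL c d) (f t) = 0" if cd: "c : \<rat>" "d : \<rat>" "l < c" "d < r" for c d
 proof -
 have i: "intg (LL c d) (f t)" using elim cd by blast
 have "(%n. LINT x|LL c d. bump (real (Suc n)) c d x *R f t x) \<longlonglongrightarrow> (LINT x|LL c d. f t x)"
 proof (rule integral_dominated_convergence[where w="%x. norm (f t x)"])
 have "bump (real (Suc n)) c d : bm (LL c d)" for n
 by (rule cont_imp_meas[OF smooth_cont[OF smooth_fun_bump]]) auto
 thus "(%x. bump (real (Suc n)) c d x *R f t x) : bm (LL c d)" for n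
 using i by (intro bm_scal) auto
 show "AE x in LL c d. (%n. bump (real (Suc n)) c d x *R f t x) \<longlonglongrightarrow> f t x"
 proof (rule AE_I2)
 fix x assume "x : space (LL c d)"
 hence "x : {c<..<d}" by simp
 with tendsto_scaleR[OF bump_tendsto[of c d x] tendsto_const[of "f t x"]]
 show "(%n. bump (real (Suc n)) c d x *R f t x) \<longlonglongrightarrow> f t x" by simp
 qed
 show "AE x in LL c d. norm (bump (real (Suc n)) c d x *R f t x) <= norm (f t x)" for n
 by (rule AE_I2) (simp add: bump_nonneg bump_le_1 mult_left_le_one_le)
 qed (use i in auto)
 moreover have "(LINT x|LL c d. bump (real (Suc n)) c d x *R f t x) = 0" for n
 proof -
 have "(LINT x|LL c d. bump (real (Suc n)) c d x *R f t x) = (LINT x|LL l r. bump (real (Suc n)) c d x *R f t x)"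
 unfolding LL_integral_eq set_int_def
 by (rule int_cong[OF refl])
 (use cd bump_outside[of "real (Suc n)" _ c d] in "auto simp: indicator_def")
 thus ?thesis using elim cd by simp
 qed
 ultimately show ?thesis by (simp add: LIMSEQ_const_iff)
 qed
 have 2: "AE x in LL a b. f t x = 0" if ab: "a : \<rat>" "b : \<rat>" "l < a" "b < r" "a < b" for a b
 proof (rule AE_zero_if_prim_zero)
 show i: "intg (LL a b) (f t)" using elim ab by blast
 show "prim a (f t) x = 0" if "x : {a..b}" for x
 proof (rule continuous_zero_on_rationals[OF continuous_on_prim[OF i] ab(5) _ that])
 fix y assume "y : \<rat>" "a < y" "y < b"
 thus "prim a (f t) y = 0" using 1[of a y] ab by (simp add: LL_prim)
 qed
 qed (use ab in simp)
 have "AE x in lebesgue. ALL a:\<rat>. ALL b:\<rat>. l < a --> b < r --> a < b --> x : {a<..<b} --> f t x = 0"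
 proof (intro AE_ball_countable[THEN iffD2] ballI countable_rat)
 fix a b :: real assume "a : \<rat>" "b : \<rat>"
 thus "AE x in lebesgue. l < a --> b < r --> a < b --> x : {a<..<b} --> f t x = 0"
 using 2[of a b] unfolding AE_LL_iff by (cases "l < a & b < r & a < b") auto
 qed
 thus ?case
 unfolding AE_LL_iff
 proof eventually_elim
 case (elim x)
 show ?case
 proof
 assume x: "x : {l<..<r}"
 then obtain a b where "a : \<rat>" "l < a" "a < x" "b : \<rat>" "x < b" "b < r"
 using Rats_dense_in_real[of l x] Rats_dense_in_real[of x r] by auto
 thus "f t x = 0" using elim by auto
 qed
 qed
 qed
qed

section \<open>Weak derivatives on intervals\<close>

text \<open>\<open>f\<close> has an absolutely continuous representative with derivative
  \<open>g\<close>. The form with a primitive replaces the weak formulation wherever both functions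
  are integrable.\<close>

definition acd :: "real => real => (real => 'b::euclidean_space) => (real => 'b) => bool" where
 "acd l r f g \<longleftrightarrow> intg (LL l r) g & (EX c. AE x in LL l r. f x = c + prim l g x)"

lemma acdI: "intg (LL l r) g ==> (AE x in LL l r. f x = c + prim l g x) ==> acd l r f g"
 unfolding acd_def by blast

lemma prim_measurable: "intg (LL l r) g ==> (%x. c + prim l g x) : bm (LL l r)"
 by (rule cont_imp_meas)
 (auto intro!: continuous_intros continuous_on_subset[OF continuous_on_prim])

text \<open>Completeness of Lebesgue measure, applied to the extension by zero.\<close>

lemma AE_measurable_lebesgue_on:
 fixes f :: "'a::euclidean_space => 'b::euclidean_space"
 assumes "AE x in leb S. f x = g x" "g : bm (leb S)" "S : sets lebesgue"
 shows "f : bm (leb S)"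
proof -
 have "(%x. if x : S then g x else 0) : bm lebesgue"
 using assms(2,3) borel_measurable_if by blast
 moreover have "AE x in lebesgue. (if x : S then g x else 0) = (if x : S then f x else 0)"
 using assms(1,3) by (subst (asm) AE_restrict_space_iff) (auto elim: eventually_mono)
 ultimately have "(%x. if x : S then f x else 0) : bm lebesgue"
 by (rule borel_measurable_AE)
 thus ?thesis using assms(3) borel_measurable_if by blast
qed

lemma AE_measurable_LL:
 fixes f :: "real => 'b::euclidean_space"
 assumes "AE x in LL l r. f x = g x" "g : bm (LL l r)"
 shows "f : bm (LL l r)"
 by (rule AE_measurable_lebesgue_on[OF assms]) auto

lemma acd_integrable:
 assumes "acd l r f g"
 shows "intg (LL l r) f" "intg (LL l r) g" "f : bm (LL l r)"
proof -
 interpret finite_measure "LL l r" by (rule fin_LL)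
 obtain c where g: "intg (LL l r) g" and c: "AE x in LL l r. f x = c + prim l g x"
 using assms unfolding acd_def by blast
 show "intg (LL l r) g" by fact
 show m: "f : bm (LL l r)"
 by (rule AE_measurable_LL[OF c prim_measurable[OF g]])
 have "AE x in LL l r. norm (f x) <= norm c + (LINT y|LL l r. norm (g y))"
 using c AE_space
 proof eventually_elim
 case (elim x)
 thus ?case
 using norm_triangle_ineq[of c "prim l g x"] norm_prim_bound[OF g, of x] by simp
 qed
 from integrable_const_bound[OF this m] show "intg (LL l r) f" .
qed

lemma AE_LL_contradiction: "l < r ==> (AE x in LL l r. P) ==> P"
proof (rule ccontr)
 assume "l < r" "AE x in LL l r. P" "\<not> P"
 hence "AE x in LL l r. False" by (auto elim: eventually_mono)
 hence "emeasure (LL l r) (space (LL l r)) = 0"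
 unfolding ae_filter_eq_bot_iff[symmetric] trivial_limit_def .
 hence "measure (LL l r) (space (LL l r)) = 0" by (simp add: measure_def)
 thus False using measure_LL[of l r] \<open>l < r\<close> by simp
qed

lemma continuous_AE_eq:
 fixes u v :: "real => 'b::euclidean_space"
 assumes "continuous_on {l..r} u" "continuous_on {l..r} v" "AE x in LL l r. u x = v x" "l < r" "x : {l..r}"
 shows "u x = v x"
proof (rule ccontr)
 assume ne: "u x ~= v x"
 define h where "h y = norm (u y - v y)" for y
 have c: "continuous_on {l..r} h" unfolding h_def by (intro continuous_intros assms)
 then obtain d where d: "d > 0" "!!y. y : {l..r} ==> dist y x < d ==> dist (h y) (h x) < h x"
 using assms(5) ne unfolding continuous_on_iff h_def by (metis right_minus_eq zero_less_norm_iff)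
 define a b where "a = max l (x - d)" and "b = min r (x + d)"
 have ab: "a < b" "l <= a" "b <= r" using d(1) assms(4,5) by (auto simp: a_def b_def)
 have "AE y in LL a b. False"
 using assms(3) unfolding AE_LL_iff
 proof eventually_elim
 case (elim y)
 show ?case
 proof
 assume y: "y : {a<..<b}"
 hence "dist (h y) (h x) < h x" by (intro d(2)) (auto simp: a_def b_def dist_real_def)
 moreover have "h y = 0" using elim y ab by (auto simp: h_def)
 ultimately show False by (simp add: dist_real_def h_def)
 qed
 qed
 with AE_LL_contradiction[OF ab(1)] show False by blast
qed

lemma acd_unique:
 assumes "acd l r f g" "acd l r f g'" "l < r"
 shows "AE x in LL l r. g x = g' x"
proof -
 obtain c c' where g: "intg (LL l r) g" "AE x in LL l r. f x = c + prim l g x"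
 and g': "intg (LL l r) g'" "AE x in LL l r. f x = c' + prim l g' x"
 using assms unfolding acd_def by blast
 have "AE x in LL l r. c + prim l g x = c' + prim l g' x"
 using g(2) g'(2) by eventually_elim simp
 hence eq: "c + prim l g x = c' + prim l g' x" if "x : {l..r}" for x
 by (rule continuous_AE_eq[OF _ _ _ assms(3) that, rotated 2])
 (intro continuous_intros continuous_on_prim g g')+
 have "c = c'" using eq[of l] assms(3) by simp
 have "AE x in LL l r. g x - g' x = 0"
 by (rule AE_zero_if_prim_zero)
 (use g g' assms(3) eq \<open>c = c'\<close> in "auto simp: prim_subtract[OF g(1) g'(1)]")
 thus ?thesis by eventually_elim simp
qed

lemma acd_AE_cong: "acd l r f g ==> (AE x in LL l r. f x = f' x) ==> acd l r f' g"
 unfolding acd_def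
proof (elim conjE exE, intro conjI exI)
 fix c assume "AE x in LL l r. f x = c + prim l g x" "AE x in LL l r. f x = f' x"
 thus "AE x in LL l r. f' x = c + prim l g x" by eventually_elim simp
qed

lemma acd_AE_cong_deriv:
 assumes "acd l r f g" "AE x in LL l r. g x = g' x" "g' : bm (LL l r)"
 shows "acd l r f g'"
proof -
 obtain c where g: "intg (LL l r) g" "AE x in LL l r. f x = c + prim l g x"
 using assms unfolding acd_def by blast
 have "prim l g x = prim l g' x" if "x <= r" for x
 by (rule prim_cong_AE[OF assms(2) _ assms(3) that]) (use g in auto)
 moreover have "AE x in LL l r. x : space (LL l r)" by (rule AE_space)
 ultimately have "AE x in LL l r. f x = c + prim l g' x" using g(2) by (auto elim: eventually_elim2)
 moreover have "intg (LL l r) g'"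
 using integrable_cong_AE[of g "LL l r" g'] g assms by auto
 ultimately show ?thesis unfolding acd_def by blast
qed

lemma acd_const: "acd l r (%x. c) (%x. 0)"
 by (rule acdI[of _ _ _ _ c]) (auto simp: prim_def set_int_def)

lemma acd_product:
 fixes pr :: "'b::euclidean_space => 'c::euclidean_space => 'd::euclidean_space"
 assumes pr: "bounded_bilinear pr" and "acd l r F f" "acd l r G g"
 shows "acd l r (%x. pr (F x) (G x)) (%x. pr (f x) (G x) + pr (F x) (g x))"
proof -
 obtain c d where f: "intg (LL l r) f" "AE x in LL l r. F x = c + prim l f x"
 and g: "intg (LL l r) g" "AE x in LL l r. G x = d + prim l g x"
 using assms unfolding acd_def by blast
 have "AE x in LL l r. x : space (LL l r)" by (rule AE_space)
 with f(2) g(2) have "AE x in LL l r. pr (F x) (G x) = pr c d + prim l (%x. pr (f x) (d + prim l g x) + pr (c + prim l f x) (g x)) x"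
 proof eventually_elim
 case (elim x)
 thus ?case
 using prim_product(2)[OF pr f(1) g(1), of x d c] by (simp add: algebra_simps)
 qed
 moreover have "intg (LL l r) (%x. pr (f x) (d + prim l g x) + pr (c + prim l f x) (g x))"
 proof (cases "l <= r")
 case True
 thus ?thesis using prim_product(1)[OF pr f(1) g(1), of r d c] by simp
 next
 case False
 hence "{l<..<r} = {}" by auto
 thus ?thesis by simp
 qed
 ultimately have A: "acd l r (%x. pr (F x) (G x)) (%x. pr (f x) (d + prim l g x) + pr (c + prim l f x) (g x))"
 by (rule acdI[rotated])
 show ?thesis
 proof (rule acd_AE_cong_deriv[OF A])
 show "AE x in LL l r. pr (f x) (d + prim l g x) + pr (c + prim l f x) (g x) = pr (f x) (G x) + pr (F x) (g x)"
 using f(2) g(2) by eventually_elim simp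
 show "(%x. pr (f x) (G x) + pr (F x) (g x)) : bm (LL l r)"
 by (intro borel_measurable_add measurable_bilinear[OF pr]) (rule bm_intg[OF acd_integrable(2)[OF assms(2)]]
 acd_integrable(3)[OF assms(3)] acd_integrable(3)[OF assms(2)] bm_intg[OF acd_integrable(2)[OF assms(3)]])+
 qed
qed

lemma acd_add: "acd l r F f ==> acd l r G g ==> acd l r (%x. F x + G x) (%x. f x + g x)"
proof -
 assume "acd l r F f" "acd l r G g"
 then obtain c d where f: "intg (LL l r) f" "AE x in LL l r. F x = c + prim l f x"
 and g: "intg (LL l r) g" "AE x in LL l r. G x = d + prim l g x"
 unfolding acd_def by blast
 have "AE x in LL l r. F x + G x = (c + d) + prim l (%x. f x + g x) x"
 using f(2) g(2) AE_space by eventually_elim (simp add: prim_add[OF f(1) g(1)])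
 thus ?thesis by (rule acdI[rotated]) (use f g in auto)
qed

lemma acd_bounded_linear:
 assumes L: "bounded_linear L" and "acd l r F f"
 shows "acd l r (%x. L (F x)) (%x. L (f x))"
proof -
 obtain c where f: "intg (LL l r) f" "AE x in LL l r. F x = c + prim l f x"
 using assms unfolding acd_def by blast
 have "AE x in LL l r. L (F x) = L c + prim l (%x. L (f x)) x"
 using f(2) AE_space by eventually_elim (simp add: prim_bounded_linear[OF L f(1)] bounded_linear.linear[OF L] linear_add)
 thus ?thesis by (rule acdI[rotated]) (use integrable_bounded_linear[OF L f(1)] in auto)
qed

lemma acd_diff: "acd l r F f ==> acd l r G g ==> acd l r (%x. F x - G x) (%x. f x - g x)"
 using acd_add[of l r F f "%x. - G x" "%x. - g x"] acd_bounded_linear[OF bounded_linear_minus[OF bounded_linear_ident], of l r G g]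
 by simp

lemma acd_test_fun:
 assumes "test_fun {l<..<r} ph" "l < r"
 shows "intg (LL l r) (%x. D1 ph x)"
 "!!x. l <= x ==> prim l (%x. D1 ph x) x = ph x" "ph r = 0" "ph l = 0"
 "acd l r ph (%x. D1 ph x)"
proof -
 have s: "smooth_fun ph" using assms by (simp add: test_fun_def)
 show 0: "ph r = 0" "ph l = 0" using assms unfolding test_fun_def by auto
 note F = prim_FTC[OF smooth_fun_real_derivative[OF s] smooth_fun_deriv_continuous[OF s]]
 show 1: "intg (LL l r) (%x. D1 ph x)" using F(2)[of l r] assms(2) by simp
 show 2: "prim l (%x. D1 ph x) x = ph x" if "l <= x" for x
 using F(1)[OF that] 0 by simp
 show "acd l r ph (%x. D1 ph x)"
 proof (rule acdI[OF 1, of _ 0])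
 show "AE x in LL l r. ph x = 0 + prim l (%x. D1 ph x) x"
 using AE_space by eventually_elim (use 2 in auto)
 qed
qed

lemma integrable_LL_subset_closed:
 fixes g :: "real => 'b::euclidean_space"
 assumes "intg (LL l r) g"
 shows "ALL c d. l < c --> d < r --> intg (LL c d) g"
 by (intro allI impI) (rule intg_subset[OF assms], auto)

text \<open>The primitive of \<open>f\<close> vanishes at both end points, so neither a boundary
  term nor the traces of \<open>G\<close> occur.\<close>

lemma acd_integral_product_zero:
 fixes pr :: "'b::euclidean_space => 'c::euclidean_space => 'd::euclidean_space"
 assumes pr: "bounded_bilinear pr" and f: "intg (LL l r) f" "prim l f r = 0" and G: "acd l r G g" and "l <= r"
 shows "(LINT x|LL l r. pr (f x) (G x)) = - (LINT x|LL l r. pr (prim l f x) (g x))"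
 and "intg (LL l r) (%x. pr (f x) (G x))" "intg (LL l r) (%x. pr (prim l f x) (g x))"
proof -
 obtain c where g: "intg (LL l r) g" "AE x in LL l r. G x = c + prim l g x"
 using G unfolding acd_def by blast
 note lin = bounded_bilinear.bounded_linear_right[OF pr] bounded_bilinear.bounded_linear_left[OF pr]
 note ip = integral_prim_product[OF pr f(1) g(1) assms(5)]
 have i1: "intg (LL l r) (%x. pr (f x) (c + prim l g x))"
 unfolding bounded_bilinear.add_right[OF pr]
 by (intro intg_add ip(1) integrable_bounded_linear[OF lin(2) f(1)])
 have mG: "(%x. pr (f x) (G x)) : bm (LL l r)"
 by (intro measurable_bilinear[OF pr]) (use f acd_integrable[OF G] in auto)
 have ae: "AE x in LL l r. pr (f x) (c + prim l g x) = pr (f x) (G x)"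
 using g(2) by eventually_elim simp
 show "intg (LL l r) (%x. pr (f x) (G x))"
 using integrable_cong_AE_imp[OF i1 mG] ae by (auto elim: eventually_mono)
 show "intg (LL l r) (%x. pr (prim l f x) (g x))" by (rule ip(2))
 have "(LINT x|LL l r. pr (f x) (G x)) = (LINT x|LL l r. pr (f x) (c + prim l g x))"
 by (rule int_cong_AE[OF mG]) (use i1 ae in "auto elim: eventually_mono")
 also have "... = pr (prim l f r) c + (LINT x|LL l r. pr (f x) (prim l g x))"
 unfolding bounded_bilinear.add_right[OF pr]
 using int_blin[OF lin(2) f(1), of c]
 int_add[OF integrable_bounded_linear[OF lin(2) f(1), of c] ip(1)]
 by (simp add: LL_prim)
 finally show "(LINT x|LL l r. pr (f x) (G x)) = - (LINT x|LL l r. pr (prim l f x) (g x))"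
 using ip(3) f(2) by (simp add: bounded_bilinear.zero_left[OF pr] add_eq_0_iff)
qed

lemma integral_test_fun_acd:
 fixes F :: "real => 'b::euclidean_space"
 assumes "acd l r F f" "test_fun {l<..<r} ph" "l < r"
 shows "(LINT x|LL l r. D1 ph x *R F x) = - (LINT x|LL l r. ph x *R f x)"
proof -
 note t = acd_test_fun[OF assms(2,3)]
 have "prim l (%x. D1 ph x) r = 0" using t(2)[of r] t(3) assms(3) by simp
 from acd_integral_product_zero(1)[OF bounded_bilinear_scaleR t(1) this assms(1)] assms(3)
 have "(LINT x|LL l r. D1 ph x *R F x) = - (LINT x|LL l r. prim l (%x. D1 ph x) x *R f x)"
 by simp
 also have "(LINT x|LL l r. prim l (%x. D1 ph x) x *R f x) = (LINT x|LL l r. ph x *R f x)"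
 by (rule int_cong) (use t(2) in auto)
 finally show ?thesis .
qed

lemma integrable_test_fun_scaleR:
 fixes F :: "real => 'b::euclidean_space"
 assumes "continuous_on UNIV h" "intg (LL l r) F"
 shows "intg (LL l r) (%x. (h x::real) *R F x)"
proof -
 have "bounded (h ` {l..r})"
 by (intro compact_imp_bounded compact_continuous_image) (auto intro: continuous_on_subset[OF assms(1)])
 then obtain B where B: "!!x. x : {l..r} ==> \<bar>h x\<bar> <= B" unfolding bounded_iff by fastforce
 have hm: "h : bm (LL l r)"
 by (rule cont_imp_meas[OF continuous_on_subset[OF assms(1)]]) auto
 show ?thesis
 proof (rule intg_bound[OF integrable_scaleR_right[OF assms(2), of B]])
 show "AE x in LL l r. norm (h x *R F x) <= norm (B *R F x)"
 using AE_space
 proof eventually_elim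
 case (elim x)
 hence "\<bar>h x\<bar> <= \<bar>B\<bar>" using B[of x] by auto
 thus ?case by (simp add: mult_r_mono)
 qed
 qed (use hm assms in auto)
qed

lemma exists_test_fun_integral_1:
 assumes lr: "l < r"
 obtains et :: "real => real" where "test_fun {l<..<r} et" "integral\<^sup>L (LL l r) et = 1"
proof -
 define c where "c = (2 * l + r) / 3"
 define d where "d = (l + 2 * r) / 3"
 have cd: "l < c" "c < d" "d < r" using lr by (auto simp: c_def d_def)
 define et0 where "et0 = bump 1 c d"
 have t0: "test_fun {l<..<r} et0" unfolding et0_def by (rule test_fun_bump) (use cd in auto)
 define ka where "ka = integral\<^sup>L (LL l r) et0"
 have i0: "intg (LL l r) et0"
 by (rule acd_integrable(1)[OF acd_test_fun(5)[OF t0 lr]])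
 have "ka ~= 0"
 proof
 assume "ka = 0"
 hence "AE x in LL l r. et0 x = 0"
 using integral_nonneg_eq_0_iff_AE[OF i0] by (auto simp: ka_def et0_def bump_nonneg)
 hence "AE x in LL c d. False"
 unfolding AE_LL_iff
 proof eventually_elim
 case (elim x)
 thus ?case using bump_pos[of 1 x c d] cd by (auto simp: et0_def)
 qed
 thus False using AE_LL_contradiction[OF cd(2)] by blast
 qed
 define et where "et x = et0 x / ka" for x
 \<comment> \<open>\<open>et0 - (1 - 1 / ka) * et0\<close> equals \<open>et0 / ka\<close>.\<close>
 have te: "test_fun {l<..<r} et"
 using test_fun_linear_combination[OF t0 t0 lr, of "1 - 1/ka"] unfolding et_def by (simp add: algebra_simps)
 have ie: "integral\<^sup>L (LL l r) et = 1" unfolding et_def using \<open>ka ~= 0\<close> by (simp add: ka_def)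
 show ?thesis by (rule that[OF te ie])
qed

text \<open>To the right of the support of \<open>ps\<close> the antiderivative is constant, and the
  vanishing mean makes this constant 0. The antiderivative therefore has compact support as
  well.\<close>

lemma test_fun_antiderivative:
 fixes ps :: "real => 'b::euclidean_space"
 assumes tp: "test_fun {l<..<r} ps" and "integral\<^sup>L (LL l r) ps = 0" and lr: "l < r"
 obtains Ph where "test_fun {l<..<r} Ph" "!!x. (Ph has_vector_derivative ps x) (at x)"
 "!!x. l <= x ==> prim l ps x = Ph x"
proof -
 have sp: "smooth_fun ps" using tp by (simp add: test_fun_def)
 have ct: "continuous_on UNIV ps" "continuous_on UNIV ps"
 using smooth_cont[OF sp] by auto
 obtain a b where ab: "l < a" "a < b" "b < r" "!!x. x \<notin> {a..b} ==> ps x = 0"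
 using test_fun_real_support[OF tp lr] by metis
 define Ph where "Ph x = (if x < l then 0 else integral {l..x} ps)" for x
 have Ph0: "Ph x = 0" if "x < a" for x
 proof (cases "x < l")
 case False
 have "integral {l..x} ps = integral {l..x} (%x. 0)"
 by (rule integral_cong) (use ab(4) that in auto)
 thus ?thesis using False by (simp add: Ph_def)
 qed (simp add: Ph_def)
 have D0: "(Ph has_vector_derivative ps x) (at x)" if "x > l" for x
 proof -
 have "((%u. integral {l..u} ps) has_vector_derivative ps x) (at x within {l..x+1})"
 by (rule integral_has_vector_derivative[OF continuous_on_subset[OF ct(2)]]) (use that in auto)
 hence "((%u. integral {l..u} ps) has_vector_derivative ps x) (at x)"
 using at_within_interior[of x "{l..x+1}"] that by (simp add: interior_atLeastAtMost_real)
 moreover have "\<forall>\<^sub>F y in nhds x. integral {l..y} ps = Ph y"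
 using eventually_nhds_in_open[of "{l<..}" x] that by (auto elim!: eventually_mono simp: Ph_def)
 hence "\<forall>\<^sub>F y in nhds x. y : UNIV --> integral {l..y} ps = Ph y"
 by (rule eventually_mono) simp
 moreover have "integral {l..x} ps = Ph x" using that by (simp add: Ph_def)
 ultimately show ?thesis
 using has_vector_derivative_cong_ev[where x=x and S=UNIV and f="%u. integral {l..u} ps" and g=Ph and f'="ps x"] by blast
 qed
 have D: "(Ph has_vector_derivative ps x) (at x)" for x
 proof (cases "x < a")
 case True
 have "((%x. 0::'b) has_vector_derivative 0) (at x)" by simp
 moreover have "\<forall>\<^sub>F y in nhds x. Ph y = 0"
 using eventually_nhds_in_open[of "{..<a}" x] True Ph0 by (auto elim!: eventually_mono)
 ultimately show ?thesis
 using True ab(4)[of x] Ph0 by (subst has_vector_derivative_cong_ev[where g="%x. 0"]) auto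
 qed (use D0 ab in auto)
 have PF: "!!x. l <= x ==> prim l ps x = Ph x"
 using prim_FTC(1)[OF D ct(2)] Ph0[of l] ab by simp
 have Phr: "Ph r = 0" using PF[of r] assms(2) lr by (simp add: LL_prim)
 have Ph1: "Ph x = 0" if "x > b" for x
 proof -
 have "EX y. ALL x:{b<..}. Ph x = y"
 proof (rule has_vector_derivative_zero_constant)
 show "(Ph has_vector_derivative 0) (at x within {b<..})" if "x : {b<..}" for x
 using D[of x] ab(4)[of x] that by (auto intro: has_vector_derivative_at_within)
 qed auto
 then obtain y where "!!x. x > b ==> Ph x = y" by auto
 thus ?thesis using Phr ab(3) that by metis
 qed
 have sF: "smooth_fun Ph" by (rule smooth_fun_antiderivative[OF D sp])
 have tF: "test_fun {l<..<r} Ph"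
 unfolding test_fun_def using sF ab Ph0 Ph1 by (intro conjI exI[of _ "{a..b}"]) (auto simp: not_le)
 show ?thesis by (rule that[OF tF D PF])
qed

text \<open>
 Every test function \<open>ph\<close> is \<open>Ph' + (\<integral>ph) et\<close> with a test function \<open>Ph\<close> and a fixed bump \<open>et\<close> of
 integral 1, so the difference of \<open>f\<close> and the primitive of \<open>g\<close> is constant.
\<close>

lemma weak_derivative_imp_acd:
 fixes f g :: "'t => real => 'b::euclidean_space"
 assumes lr: "l < r" and int: "AE t in N. intg (LL l r) (f t)" "AE t in N. intg (LL l r) (g t)"
 and W: "!!ph::real=>real. test_fun {l<..<r} ph ==> AE t in N.
 (LINT x|LL l r. D1 ph x *R f t x) = - (LINT x|LL l r. ph x *R g t x)"
 shows "AE t in N. acd l r (f t) (g t)"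
proof -
 obtain et :: "real => real" where te: "test_fun {l<..<r} et" and ie: "integral\<^sup>L (LL l r) et = 1"
 using exists_test_fun_integral_1[OF lr] by metis
 have cte: "continuous_on UNIV et" using te smooth_cont unfolding test_fun_def by blast
 define h where "h t x = f t x - prim l (g t) x" for t x
 \<comment> \<open>The constant of integration is recovered as the mean of \<open>h t\<close> with
   weight \<open>et\<close>.\<close>
 define k where "k t = (LINT x|LL l r. et x *R h t x)" for t
 have hi: "intg (LL l r) (h t)" if "intg (LL l r) (f t)" "intg (LL l r) (g t)" for t
 proof -
 have "acd l r (%x. prim l (g t) x) (g t)"
 by (rule acdI[OF that(2), of _ 0]) simp
 from acd_integrable(1)[OF this] that show ?thesis unfolding h_def by auto
 qed
 have "AE t in N. AE x in LL l r. h t x - k t = 0"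
 proof (rule fundamental_lemma_AE)
 interpret finite_measure "LL l r" by (rule fin_LL)
 show "AE t in N. ALL c d. l < c --> d < r --> intg (LL c d) (%x. h t x - k t)"
 using int
 proof eventually_elim
 case (elim t)
 thus ?case using hi[of t] by (intro integrable_LL_subset_closed) auto
 qed
 fix ph :: "real => real" assume t: "test_fun {l<..<r} ph"
 define m where "m = integral\<^sup>L (LL l r) ph"
 define ps where "ps x = ph x - m * et x" for x
 have tp: "test_fun {l<..<r} ps" unfolding ps_def by (rule test_fun_linear_combination[OF t te lr])
 hence sp: "smooth_fun ps" by (simp add: test_fun_def)
 have ip: "intg (LL l r) ps" by (rule acd_integrable(1)[OF acd_test_fun(5)[OF tp lr]])
 have ct: "continuous_on UNIV ph" "continuous_on UNIV ps"
 using t tp smooth_cont unfolding test_fun_def by blast+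
 have iph: "intg (LL l r) ph" by (rule acd_integrable(1)[OF acd_test_fun(5)[OF t lr]])
 have iet: "intg (LL l r) et" by (rule acd_integrable(1)[OF acd_test_fun(5)[OF te lr]])
 have z: "integral\<^sup>L (LL l r) ps = 0"
 unfolding ps_def using iph iet ie by (simp add: m_def)
 obtain Ph where tF: "test_fun {l<..<r} Ph" and D: "!!x. (Ph has_vector_derivative ps x) (at x)"
 using test_fun_antiderivative[OF tp z lr] by metis
 have dF: "D1 Ph x = ps x" for x
 using frechet_derivative_at[OF D[unfolded has_vector_derivative_def, of x], symmetric] by simp
 show "AE t in N. (LINT x|LL l r. ph x *R (h t x - k t)) = 0"
 using W[OF tF] int
 proof eventually_elim
 case (elim t)
 have ht: "intg (LL l r) (h t)" using hi elim by blast
 have ag: "acd l r (prim l (g t)) (g t)" by (rule acdI[of _ _ _ _ 0]) (use elim in auto)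
 have pi: "intg (LL l r) (%x. prim l (g t) x)" by (rule acd_integrable(1)[OF ag])
 have "(LINT x|LL l r. ps x *R h t x) = (LINT x|LL l r. ps x *R f t x) - (LINT x|LL l r. ps x *R prim l (g t) x)"
 unfolding h_def scaleR_diff_right
 by (rule int_diff) (intro integrable_test_fun_scaleR[OF ct(2)] elim pi)+
 also have "(LINT x|LL l r. ps x *R f t x) = - (LINT x|LL l r. Ph x *R g t x)"
 using elim(1) unfolding dF .
 also have "(LINT x|LL l r. ps x *R prim l (g t) x) = - (LINT x|LL l r. Ph x *R g t x)"
 using integral_test_fun_acd[OF ag tF lr] unfolding dF .
 finally have z0: "(LINT x|LL l r. ps x *R h t x) = 0" by simp
 note ih = integrable_test_fun_scaleR[OF ct(1) ht] integrable_test_fun_scaleR[OF cte ht]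
 have "(LINT x|LL l r. ph x *R (h t x - k t)) = (LINT x|LL l r. ph x *R h t x) - m *R k t"
 unfolding scaleR_diff_right using ih iph
 by (subst int_diff) (auto simp: m_def)
 also have "m *R k t = (LINT x|LL l r. (m * et x) *R h t x)"
 unfolding k_def by (subst integral_scaleR_right[symmetric]) simp
 also have "(LINT x|LL l r. ph x *R h t x) - (LINT x|LL l r. (m * et x) *R h t x) = (LINT x|LL l r. ps x *R h t x)"
 unfolding ps_def scaleR_diff_left using ih
 by (subst int_diff) (auto simp: scaleR_scaleR[symmetric] simp del: scaleR_scaleR)
 finally show ?case using z0 by simp
 qed
 qed
 with int show ?thesis
 proof eventually_elim
 case (elim t)
 show ?case
 proof (rule acdI[where c="k t"])
 show "AE x in LL l r. f t x = k t + prim l (g t) x"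
 using elim(3) by eventually_elim (simp add: h_def algebra_simps)
 qed (use elim in auto)
 qed
qed

lemma integrable_imp_locally_integrable:
 fixes f :: "real => 'b::euclidean_space"
 assumes "intg (LL l r) f"
 shows "locally_integrable {l<..<r} f"
 unfolding locally_integrable_def
proof (intro allI impI)
 fix K assume K: "compact K & K \<subseteq> {l<..<r}"
 hence m: "K : sets lebesgue" by (simp add: compact_imp_closed borel_closed)
 have "set_integrable lebesgue K f"
 by (rule set_integrable_subset[OF assms[unfolded LL_integrable_iff] m]) (use K in auto)
 thus "intg (leb K) f"
 unfolding set_integrable_def using integrable_restrict_space[of K lebesgue f] m by auto
qed

lemma locally_integrable_LL:
 fixes f :: "real => 'b::euclidean_space"
 assumes "locally_integrable {l<..<r} f" "l < c" "d < r"
 shows "intg (LL c d) f"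
proof -
 have "{c..d} \<subseteq> {l<..<r}" using assms by auto
 hence "intg (leb {c..d}) f"
 using assms(1) unfolding locally_integrable_def by (metis compact_Icc)
 hence "set_integrable lebesgue {c..d} f"
 unfolding set_integrable_def using integrable_restrict_space[of "{c..d}" lebesgue f] by auto
 thus ?thesis unfolding LL_integrable_iff by (rule set_integrable_subset) auto
qed

lemma acd_imp_has_weak_deriv: "acd l r f g ==> l < r ==> has_weak_deriv {l<..<r} 1 f g"
 unfolding has_weak_deriv_def
 using integral_test_fun_acd acd_integrable(1,2) integrable_imp_locally_integrable by blast

lemma has_weak_deriv_imp_acd:
 fixes f :: "real => 'b::euclidean_space"
 assumes "has_weak_deriv {l<..<r} 1 f g" "intg (LL l r) f" "intg (LL l r) g" "l < r"
 shows "acd l r f g"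
proof -
 \<comment> \<open>A one-point parameter space, where almost everywhere means everywhere.\<close>
 have "AE t in count_space (UNIV::unit set). acd l r f g"
 by (rule weak_derivative_imp_acd) (use assms in "auto simp: has_weak_deriv_def")
 thus ?thesis by (simp add: AE_count_space)
qed

text \<open>A weak derivative is only locally integrable, so it need not be covered by
  \<open>acd\<close>. The compact support of the test function restores integrability on a smaller
  interval, and the fundamental lemma applies to \<open>g - g'\<close>.\<close>

lemma has_weak_deriv_unique:
 fixes f :: "real => 'b::euclidean_space"
 assumes "has_weak_deriv {l<..<r} 1 f g" "has_weak_deriv {l<..<r} 1 f g'" "l < r"
 shows "AE x in LL l r. g x = g' x"
proof -
 have L: "locally_integrable {l<..<r} g" "locally_integrable {l<..<r} g'"
 using assms by (auto simp: has_weak_deriv_def)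
 have "AE t in count_space (UNIV::unit set). AE x in LL l r. g x - g' x = 0"
 proof (rule fundamental_lemma_AE)
 show "AE t in count_space UNIV. ALL c d. l < c --> d < r --> intg (LL c d) (%x. g x - g' x)"
 using locally_integrable_LL[OF L(1)] locally_integrable_LL[OF L(2)] by auto
 fix ph :: "real => real" assume t: "test_fun {l<..<r} ph"
 obtain a b where ab: "l < a" "a < b" "b < r" "!!x. x \<notin> {a..b} ==> ph x = 0"
 using test_fun_real_support[OF t assms(3)] by metis
 have c: "continuous_on UNIV ph" using t smooth_cont by (auto simp: test_fun_def)
 have i: "intg (LL l r) (%x. ph x *R h x)" if "locally_integrable {l<..<r} h" for h :: "real => 'b"
 proof -
 define a' where "a' = (l + a)/2"
 define b' where "b' = (b + r)/2"
 have ab': "l < a'" "a' < a" "b < b'" "b' < r" using ab by (auto simp: a'_def b'_def)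
 have "intg (LL a' b') (%x. ph x *R h x)"
 by (rule integrable_test_fun_scaleR[OF c locally_integrable_LL[OF that]]) (use ab' in auto)
 thus ?thesis
 unfolding LL_integrable_iff set_integrable_def
 proof (rule Bochner_Integration.integrable_cong[THEN iffD1, rotated -1])
 show "indicat_real {a'<..<b'} x *R ph x *R h x = indicat_real {l<..<r} x *R ph x *R h x" for x
 using ab' ab(4)[of x] by (cases "x : {a..b}") (auto simp: indicator_def)
 qed simp
 qed
 have "(LINT x|LL l r. ph x *R g x) = (LINT x|LL l r. ph x *R g' x)"
 proof -
 have "- (LINT x|LL l r. ph x *R g x) = - (LINT x|LL l r. ph x *R g' x)"
 using assms(1,2)[unfolded has_weak_deriv_def] t by simp
 thus ?thesis by simp
 qed
 thus "AE t in count_space UNIV. (LINT x|LL l r. ph x *R (g x - g' x)) = 0"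
 using int_diff[OF i[OF L(1)] i[OF L(2)]] by (simp add: scaleR_diff_right)
 qed
 hence "AE x in LL l r. g x - g' x = 0" by (simp add: AE_count_space)
 thus ?thesis by eventually_elim simp
qed

lemma has_weak_deriv_weak_deriv: "has_weak_deriv S v f g ==> has_weak_deriv S v f (weak_deriv S v f)"
 unfolding weak_deriv_def using someI[of "has_weak_deriv S v f" g] by simp

text \<open>\<open>weak_deriv\<close> is an arbitrary choice; uniqueness almost everywhere
  identifies it with any derivative known in the sense of \<open>acd\<close>.\<close>

lemma acd_weak_deriv:
 fixes f :: "real => 'b::euclidean_space"
 assumes "acd l r f g" "l < r"
 shows "AE x in LL l r. weak_deriv {l<..<r} 1 f x = g x" "acd l r f (weak_deriv {l<..<r} 1 f)"
proof -
 have w: "has_weak_deriv {l<..<r} 1 f g" by (rule acd_imp_has_weak_deriv[OF assms])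
 show 1: "AE x in LL l r. weak_deriv {l<..<r} 1 f x = g x"
 by (rule has_weak_deriv_unique[OF has_weak_deriv_weak_deriv[OF w] w assms(2)])
 have m: "weak_deriv {l<..<r} 1 f : bm (LL l r)"
 by (rule AE_measurable_LL[OF 1]) (use acd_integrable(2)[OF assms(1)] in auto)
 show "acd l r f (weak_deriv {l<..<r} 1 f)"
 by (rule acd_AE_cong_deriv[OF assms(1) _ m]) (use 1 in "auto elim: eventually_mono")
qed

text \<open>\<open>cont_rep\<close> is an arbitrary choice too, but continuous functions that agree
  almost everywhere inside the interval agree up to its end points.\<close>

lemma cont_rep_acd:
 fixes f :: "real => 'b::euclidean_space"
 assumes "intg (LL l r) g" "AE x in LL l r. f x = c + prim l g x" "l < r" "x : {l..r}"
 shows "cont_rep l r f x = c + prim l g x"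
proof -
 define w where "w x = c + prim l g x" for x
 have w: "continuous_on {l..r} w" unfolding w_def by (intro continuous_intros continuous_on_prim assms)
 moreover have "AE x in leb {l<..<r}. w x = f x"
 using assms(2) by eventually_elim (simp add: w_def)
 ultimately have "continuous_on {l..r} (cont_rep l r f) & (AE x in leb {l<..<r}. cont_rep l r f x = f x)"
 unfolding cont_rep_def
 using someI[of "%w. continuous_on {l..r} w & (AE x in LL l r. w x = f x)" w] by blast
 hence "continuous_on {l..r} (cont_rep l r f)" "AE x in LL l r. cont_rep l r f x = w x"
 using assms(2) by (auto simp: w_def elim: eventually_elim2)
 from continuous_AE_eq[OF this(1) w this(2) assms(3,4)] show ?thesis by (simp add: w_def)
qed

section \<open>Sobolev norms\<close>

lemma L2_norm_eq:
 "sqi (leb S) f ==> L2_norm S f = ereal (sqrt (n2 (leb S) f))"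
 by (simp add: L2_norm_def sqi_def n2_def)

lemma L2_norm_less_top_iff: "L2_norm S f < \<infinity> \<longleftrightarrow> sqi (leb S) f"
 by (simp add: L2_norm_def sqi_def)

lemma sqi_intg: "sqi (LL l r) f ==> intg (LL l r) f"
 by (rule finite_measure.sqi_integrable[OF fin_LL])

lemma H_norm_1_eq:
 assumes "acd l r f g" "sqi (LL l r) f" "sqi (LL l r) g" "l < r"
 shows "H_norm 1 {l<..<r} f = ereal (sqrt (n2 (LL l r) f + n2 (LL l r) g))"
proof -
 define w where "w = weak_deriv {l<..<r} 1 f"
 have w: "AE x in LL l r. w x = g x" "acd l r f w"
 using acd_weak_deriv[OF assms(1,4)] by (auto simp: w_def)
 have sw: "sqi (LL l r) w"
 by (rule sqi_cong[OF _ assms(3)]) (use w acd_integrable(2)[OF w(2)] in "auto elim: eventually_mono")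
 have n: "n2 (LL l r) w = n2 (LL l r) g"
 by (rule n2_cong[OF w(1)]) (use sw assms in "auto simp: sqi_def")
 have "has_weak_deriv {l<..<r} 1 f w" by (rule acd_imp_has_weak_deriv[OF w(2) assms(4)])
 moreover have "(ALL j<=1. P j) \<longleftrightarrow> P 0 & P (1::nat)" for P using le_Suc_eq[of _ 0] by auto
 ultimately show ?thesis
 using assms(2) sw by (auto simp: H_norm_def Let_def w_def[symmetric] L2_norm_eq n atMost_Suc)
qed

lemma H_norm_1_finite:
 assumes "H_norm 1 {l<..<r} f < \<infinity>" "l < r"
 shows "EX g. acd l r f g & sqi (LL l r) f & sqi (LL l r) g"
proof -
 define w where "w = weak_deriv {l<..<r} 1 f"
 have w: "EX g. has_weak_deriv {l<..<r} 1 f g" "L2_norm {l<..<r} f < \<infinity>" "L2_norm {l<..<r} w < \<infinity>"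
 using assms(1) unfolding H_norm_def Let_def
 by (auto simp: w_def split: if_splits dest: spec[of _ 0] spec[of _ "1::nat"])
 note s = w(2,3)[unfolded L2_norm_less_top_iff]
 have "has_weak_deriv {l<..<r} 1 f w" using w(1) has_weak_deriv_weak_deriv unfolding w_def by blast
 hence "acd l r f w"
 by (rule has_weak_deriv_imp_acd[OF _ s[THEN sqi_intg] assms(2)])
 thus ?thesis using s by blast
qed

text \<open>The norm iterates \<open>weak_deriv\<close>, so its second-order part is the derivative
  of the chosen function \<open>w\<close> and not of \<open>g\<close>. As the two agree almost
  everywhere, \<open>k\<close> serves for both.\<close>

lemma H_norm_2_eq:
 assumes "acd l r f g" "acd l r g k" "sqi (LL l r) f" "sqi (LL l r) g" "sqi (LL l r) k" "l < r"
 shows "H_norm 2 {l<..<r} f = ereal (sqrt (n2 (LL l r) f + n2 (LL l r) g + n2 (LL l r) k))"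
proof -
 define w where "w = weak_deriv {l<..<r} 1 f"
 define w2 where "w2 = weak_deriv {l<..<r} 1 w"
 have w: "AE x in LL l r. w x = g x" "acd l r f w"
 using acd_weak_deriv[OF assms(1,6)] by (auto simp: w_def)
 have wk: "acd l r w k" by (rule acd_AE_cong[OF assms(2)]) (use w(1) in "auto elim: eventually_mono")
 have w2: "AE x in LL l r. w2 x = k x" "acd l r w w2"
 using acd_weak_deriv[OF wk assms(6)] by (auto simp: w2_def)
 have sw: "sqi (LL l r) w"
 by (rule sqi_cong[OF _ assms(4)]) (use w acd_integrable(2)[OF w(2)] in "auto elim: eventually_mono")
 have sw2: "sqi (LL l r) w2"
 by (rule sqi_cong[OF _ assms(5)]) (use w2 acd_integrable(2)[OF w2(2)] in "auto elim: eventually_mono")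
 have n: "n2 (LL l r) w = n2 (LL l r) g" "n2 (LL l r) w2 = n2 (LL l r) k"
 by (rule n2_cong[OF w(1) sqi_meas[OF sw] sqi_meas[OF assms(4)]],
 rule n2_cong[OF w2(1) sqi_meas[OF sw2] sqi_meas[OF assms(5)]])
 have hw: "has_weak_deriv {l<..<r} 1 f w" "has_weak_deriv {l<..<r} 1 w w2"
 using acd_imp_has_weak_deriv[OF w(2) assms(6)] acd_imp_has_weak_deriv[OF w2(2) assms(6)] .
 have D: "(weak_deriv {l<..<r} 1 ^^ 2) f = w2" "(weak_deriv {l<..<r} 1 ^^ 1) f = w" "(weak_deriv {l<..<r} 1 ^^ Suc 0) f = w"
 by (simp_all add: numeral_2_eq_2 w_def w2_def)
 have 2: "(ALL j<=2. P j) \<longleftrightarrow> P 0 & P (1::nat) & P 2" "(ALL j<2. P j) \<longleftrightarrow> P 0 & P (1::nat)" for P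
 by (auto simp: le_Suc_eq less_Suc_eq numeral_2_eq_2)
 have s: "(\<Sum>j\<le>2. F j) = F 0 + F (1::nat) + F 2" for F :: "nat => real"
 by (simp add: numeral_2_eq_2 atMost_Suc algebra_simps)
 show ?thesis
 unfolding H_norm_def Let_def 2 s D using assms(3) sw sw2 hw by (auto simp: L2_norm_eq n)
qed

lemma H_norm_2_finite:
 assumes "H_norm 2 {l<..<r} f < \<infinity>" "l < r"
 shows "EX g k. acd l r f g & acd l r g k & sqi (LL l r) f & sqi (LL l r) g & sqi (LL l r) k"
proof -
 define w where "w = weak_deriv {l<..<r} 1 f"
 define w2 where "w2 = weak_deriv {l<..<r} 1 w"
 have D: "(weak_deriv {l<..<r} 1 ^^ 2) f = w2" "(weak_deriv {l<..<r} 1 ^^ 1) f = w" "(weak_deriv {l<..<r} 1 ^^ Suc 0) f = w"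
 by (simp_all add: numeral_2_eq_2 w_def w2_def)
 have 2: "(ALL j<=2. P j) \<longleftrightarrow> P 0 & P (1::nat) & P 2" "(ALL j<2. P j) \<longleftrightarrow> P 0 & P (1::nat)" for P
 by (auto simp: le_Suc_eq less_Suc_eq numeral_2_eq_2)
 have w: "EX g. has_weak_deriv {l<..<r} 1 f g" "EX g. has_weak_deriv {l<..<r} 1 w g"
 "sqi (LL l r) f" "sqi (LL l r) w" "sqi (LL l r) w2"
 using assms(1) unfolding H_norm_def Let_def 2 D L2_norm_less_top_iff by (auto split: if_splits)
 have "has_weak_deriv {l<..<r} 1 f w" using w(1) has_weak_deriv_weak_deriv unfolding w_def by blast
 hence "acd l r f w"
 by (rule has_weak_deriv_imp_acd[OF _ w(3,4)[THEN sqi_intg] assms(2)])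
 moreover have "has_weak_deriv {l<..<r} 1 w w2" using w(2) has_weak_deriv_weak_deriv unfolding w2_def by blast
 hence "acd l r w w2"
 by (rule has_weak_deriv_imp_acd[OF _ w(4,5)[THEN sqi_intg] assms(2)])
 ultimately show ?thesis using w by blast
qed

section \<open>The space of functions vanishing at the end points\<close>

lemma test_fun_add:
 assumes "test_fun S f" "test_fun S g"
 shows "test_fun S (%x. f x + g x)"
proof -
 obtain K where K: "compact K" "K \<subseteq> S" "!!x. x \<notin> K ==> f x = 0"
 using assms unfolding test_fun_def by blast
 obtain L where L: "compact L" "L \<subseteq> S" "!!x. x \<notin> L ==> g x = 0"
 using assms unfolding test_fun_def by blast
 have "smooth_fun (%x. f x + g x)" by (rule smooth_fun_add) (use assms in "auto simp: test_fun_def")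
 thus ?thesis
 unfolding test_fun_def using K L by (intro conjI exI[of _ "K \<union> L"]) (auto simp: compact_Un)
qed

lemma test_fun_bounded_linear:
 assumes "bounded_linear L" "test_fun S f"
 shows "test_fun S (%x. L (f x))"
 unfolding test_fun_def
 using assms smooth_fun_bounded_linear[OF assms(1)] linear_0[OF bounded_linear.linear[OF assms(1)]]
 unfolding test_fun_def by auto

lemma test_fun_zero: "test_fun S (%x. 0)"
 unfolding test_fun_def by (auto intro!: smooth_fun_const exI[of _ "{}"])

lemma sqi_test_fun:
 assumes "test_fun {l<..<r} ph"
 shows "sqi (LL l r) ph"
proof -
 have c: "continuous_on UNIV ph" using assms smooth_cont by (auto simp: test_fun_def)
 have "bounded (ph ` {l..r})"
 by (intro compact_imp_bounded compact_continuous_image continuous_on_subset[OF c]) auto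
 then obtain B where B: "!!x. x : {l..r} ==> norm (ph x) <= B" unfolding bounded_iff by fastforce
 show ?thesis
 proof (rule finite_measure.sqi_bounded[OF fin_LL])
 show "ph : bm (LL l r)"
 by (rule cont_imp_meas[OF continuous_on_subset[OF c]]) auto
 show "AE x in LL l r. norm (ph x) <= B" using AE_space by eventually_elim (use B in auto)
 qed
qed

lemma n2_add_scaleR:
 assumes "sqi M f" "sqi M g"
 shows "n2 M (%x. f x - s *R g x) = n2 M f - 2 * s * (LINT x|M. f x *I g x) + s^2 * n2 M g"
proof -
 have "(norm (f x - s *R g x))^2 = (norm (f x))^2 - 2 * s * (f x *I g x) + s^2 * (norm (g x))^2" for x
 unfolding power2_norm_eq_inner by (simp add: inner_simps inner_commute power2_eq_square algebra_simps)
 thus ?thesis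
 unfolding n2_def using assms sqi_inner[OF assms] by (simp add: sqi_def)
qed

lemma quadratic_minimum_at_0:
 fixes a b :: real
 assumes "!!s. c <= c - 2 * s * a + s^2 * b" "b >= 0"
 shows "a = 0"
proof (rule ccontr)
 assume "a ~= 0"
 \<comment> \<open>The denominator \<open>b + 1\<close> covers the case
   \<open>b = 0\<close>.\<close>
 define s where "s = a / (b + 1)"
 have b1: "b + 1 > 0" using assms(2) by simp
 hence a: "a = s * (b + 1)" "s ~= 0" using \<open>a ~= 0\<close> by (simp_all add: s_def)
 have "2 * s * a <= s^2 * b" using assms(1)[of s] by simp
 hence "s^2 * (2 * (b + 1)) <= s^2 * b" unfolding a(1) by (simp add: power2_eq_square algebra_simps)
 hence "2 * (b + 1) <= b" using a(2) by simp
 thus False using assms(2) by simp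
qed

text \<open>
 The element of minimal norm in the closure of \<open>g + test functions\<close> is orthogonal to all test
 functions, hence zero.
\<close>

lemma test_fun_dense:
 fixes g :: "real => 'b::euclidean_space"
 assumes g: "sqi (LL l r) g" and "e > 0"
 shows "EX s. test_fun {l<..<r} s & n2 (LL l r) (%x. g x - s x) < e"
proof -
 define M where "M = LL l r"
 define C where "C = {%x. g x - s x |s. test_fun {l<..<r} s}"
 have fin: "finite_measure M" unfolding M_def by (rule fin_LL)
 have sC: "sqi M f" if "f : C" for f
 using that g sqi_test_fun unfolding C_def M_def by (auto intro!: sqi_diff)
 have conv: "(%x. (1/2) *R f x + (1/2) *R h x) : C" if "f : C" "h : C" for f h
 proof -
 obtain s t where st: "f = (%x. g x - s x)" "h = (%x. g x - t x)" "test_fun {l<..<r} s" "test_fun {l<..<r} t"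
 using \<open>f : C\<close> \<open>h : C\<close> unfolding C_def by auto
 have eq: "(1/2) *R (g x - s x) + (1/2) *R (g x - t x) = g x - (1/2) *R (s x + t x)" for x
 by (simp add: algebra_simps flip: scaleR_add_left)
 have "test_fun {l<..<r} (%x. (1/2) *R (s x + t x))"
 by (rule test_fun_bounded_linear[OF bounded_linear_scaleR_right test_fun_add[OF st(3,4)]])
 thus ?thesis unfolding C_def st(1,2) eq by auto
 qed
 have move: "(%x. f x - s x) : C" if "f : C" "test_fun {l<..<r} s" for f s
 proof -
 obtain t where t: "f = (%x. g x - t x)" "test_fun {l<..<r} t" using \<open>f : C\<close> unfolding C_def by auto
 have "(%x. f x - s x) = (%x. g x - (t x + s x))" unfolding t by auto
 thus ?thesis
 using test_fun_add[OF t(2) that(2)] unfolding C_def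
 by (intro CollectI exI[of _ "%x. t x + s x"]) auto
 qed
 define mu where "mu = Inf (n2 M ` C)"
 have bdd: "bdd_below (n2 M ` C)" by (rule bdd_belowI[of _ 0]) auto
 have "(%x. g x - 0) : C"
 unfolding C_def using test_fun_zero by (intro CollectI exI[of _ "%x. 0"]) auto
 hence ne: "C ~= {}" by blast
 have low: "mu <= n2 M f" if "f : C" for f unfolding mu_def using that bdd by (intro cInf_lower) auto
 have ap: "EX f:C. n2 M f < mu + ep" if "ep > 0" for ep
 using cInf_lessD[of "n2 M ` C" "mu + ep"] ne that unfolding mu_def by auto
 have "EX f:C. n2 M f < mu + 1 / Suc n" for n by (rule ap) simp
 then obtain v where v: "!!n. v n : C" "!!n. n2 M (v n) < mu + 1 / Suc n" by metis
 have sv: "sqi M (v n)" for n using v(1) sC by blast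
 have "EX h. sqi M h & (%n. n2 M (%x. v n x - h x)) \<longlonglongrightarrow> 0"
 by (rule minimising_sequence_converges[OF fin sv tendsto_const[of mu]])
 (use low conv v in "auto intro: less_imp_le")
 then obtain h where h: "sqi M h" "(%n. n2 M (%x. v n x - h x)) \<longlonglongrightarrow> 0" by blast
 have "n2 M h <= mu"
 proof (rule LIMSEQ_le[OF tendsto_n2[OF sv h]])
 have "(%n. mu + 1 / real (Suc n)) \<longlonglongrightarrow> mu + 0"
 using LIMSEQ_inverse_real_of_nat by (intro tendsto_intros) (simp add: inverse_eq_divide)
 thus "(%n. mu + 1 / real (Suc n)) \<longlonglongrightarrow> mu" by simp
 show "EX N. ALL n>=N. n2 M (v n) <= mu + 1 / real (Suc n)" using v(2) less_imp_le by blast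
 qed
 \<comment> \<open>\<open>C\<close> is invariant under subtraction of test functions, so minimality
   passes from the sequence \<open>v\<close> to all translates of its limit
   \<open>h\<close>.\<close>
 have min: "n2 M h <= n2 M (%x. h x - s x)" if "test_fun {l<..<r} s" for s
 proof -
 have ss: "sqi M s" unfolding M_def by (rule sqi_test_fun[OF that])
 have "(%n. n2 M (%x. v n x - s x)) \<longlonglongrightarrow> n2 M (%x. h x - s x)"
 by (rule tendsto_n2) (use h(2) in "auto intro!: sqi_diff sv h(1) ss")
 hence "mu <= n2 M (%x. h x - s x)"
 by (rule LIMSEQ_le_const) (use low move v(1) that in blast)
 with \<open>n2 M h <= mu\<close> show ?thesis by simp
 qed
 have orth: "(LINT x|M. ph x *R h x) = 0" if t: "test_fun {l<..<r} ph" for ph :: "real => real"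
 proof (rule euclidean_eqI)
 fix b :: 'b assume "b : Basis"
 have tb: "test_fun {l<..<r} (%x. ph x *R b)"
 by (rule test_fun_bounded_linear[OF bounded_linear_scaleR_left t])
 have sb: "sqi M (%x. ph x *R b)" unfolding M_def by (rule sqi_test_fun[OF tb])
 have "(LINT x|M. h x *I (ph x *R b)) = 0"
 proof (rule quadratic_minimum_at_0)
 fix s
 have "test_fun {l<..<r} (%x. s *R (ph x *R b))"
 by (rule test_fun_bounded_linear[OF bounded_linear_scaleR_right tb])
 from min[OF this] show "n2 M h <= n2 M h - 2 * s * (LINT x|M. h x *I (ph x *R b)) + s^2 * n2 M (%x. ph x *R b)"
 unfolding n2_add_scaleR[OF h(1) sb] .
 qed simp
 moreover have "intg M (%x. ph x *R h x)"
 by (rule sqi_scal[OF _ h(1)]) (unfold M_def, rule sqi_test_fun[OF t])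
 ultimately show "(LINT x|M. ph x *R h x) *I b = 0 *I b"
 using int_blin[OF bounded_linear_inner_left[of b], of M "%x. ph x *R h x"]
 by (simp add: inner_commute)
 qed
 have "AE t in count_space (UNIV::unit set). AE x in LL l r. h x = 0"
 proof (rule fundamental_lemma_AE)
 show "AE t in count_space UNIV. ALL c d. l < c --> d < r --> intg (LL c d) h"
 using integrable_LL_subset_closed[OF sqi_intg[OF h(1)[unfolded M_def]]] by simp
 qed (use orth in "simp add: M_def")
 hence "AE x in M. h x = 0" unfolding M_def by (simp add: AE_count_space)
 hence "n2 M h = n2 M (%x. 0::'b)" by (rule n2_cong) (use h in "auto simp: sqi_def")
 hence "n2 M h = 0" by (simp add: n2_def)
 hence "(%n. n2 M (v n)) \<longlonglongrightarrow> 0" using tendsto_n2[OF sv h] by simp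
 then obtain n where "n2 M (v n) < e"
 using order_tendstoD(2)[OF _ assms(2)] eventually_sequentially by (metis order_refl)
 thus ?thesis using v(1)[of n] unfolding C_def M_def by auto
qed

text \<open>\<open>f\<close> belongs to \<open>H_0^1(0,1)\<close> and has derivative
  \<open>g\<close>. No approximation is involved: \<open>f\<close> vanishes at 0 because it is a
  primitive and at 1 because \<open>g\<close> has mean zero. \<open>h10_imp_H10_norm\<close> and
  \<open>H10_norm_imp_h10\<close> connect this with the closure of the test functions.\<close>

definition h10 :: "(real => 'b::euclidean_space) => (real => 'b) => bool" where
 "h10 f g \<longleftrightarrow> sqi LI g & integral\<^sup>L LI g = 0 & (AE x in LI. f x = prim 0 g x)"

lemma h10_sqi_deriv: "h10 f g ==> sqi LI g"
 by (simp add: h10_def)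

lemma h10_acd: "h10 f g ==> acd 0 1 f g"
 unfolding h10_def by (auto intro!: acdI[of _ _ _ _ 0] sqi_intg)

lemma norm_prim_le_n2:
 assumes "sqi LI g" "x : {0..1}"
 shows "norm (prim 0 g x) <= sqrt (n2 LI g)"
proof -
 have "norm (prim 0 g x) <= (LINT y|LI. norm (g y))"
 by (rule norm_prim_bound[OF sqi_intg[OF assms(1)]]) (use assms in auto)
 also have "... <= sqrt (measure LI (space LI)) * sqrt (n2 LI g)"
 by (rule finite_measure.integral_norm_le_n2[OF fin_LL assms(1)])
 finally show ?thesis using measure_LL[of 0 1] by simp
qed

text \<open>Poincare's inequality with constant 1: on the unit interval the primitive is bounded
  pointwise by the \<open>L^2\<close> norm of \<open>g\<close>.\<close>

lemma sqi_prim: "sqi LI g ==> sqi LI (prim 0 g)"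
 "sqi LI g ==> n2 LI (prim 0 g) <= n2 LI g"
proof -
 assume g: "sqi LI g"
 have m: "prim 0 g : bm LI"
 using prim_measurable[OF sqi_intg[OF g], of 0] by simp
 have b: "AE x in LI. norm (prim 0 g x) <= sqrt (n2 LI g) * norm (1::real)"
 using AE_space by eventually_elim (use norm_prim_le_n2[OF g] in auto)
 have one: "sqi LI (%x. 1::real)" by (rule finite_measure.sqi_const[OF fin_LL])
 show "sqi LI (prim 0 g)" by (rule sqi_bound(1)[OF one m b])
 have "n2 LI (%x. 1::real) = 1" using measure_LL[of 0 1] by (simp add: n2_def)
 thus "n2 LI (prim 0 g) <= n2 LI g" using sqi_bound(2)[OF one m b] by simp
qed

lemma h10_sqi: assumes "h10 f g" shows "sqi LI f"
proof -
 have "sqi LI (prim 0 g)" by (rule sqi_prim[OF h10_sqi_deriv[OF assms]])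
 moreover have "AE x in LI. prim 0 g x = f x" using assms unfolding h10_def by (auto elim: eventually_mono)
 ultimately show ?thesis using sqi_cong acd_integrable(3)[OF h10_acd[OF assms]] by blast
qed

lemma h10_AE_cong: "h10 f g ==> (AE x in LI. f x = f' x) ==> h10 f' g"
 unfolding h10_def by (auto elim: eventually_elim2)

lemma h10_AE_cong_deriv:
 assumes "h10 f g" "AE x in LI. g x = g' x" "g' : bm LI"
 shows "h10 f g'"
proof -
 have g: "sqi LI g" "integral\<^sup>L LI g = 0" "AE x in LI. f x = prim 0 g x"
 using assms(1) by (auto simp: h10_def)
 have g': "sqi LI g'" by (rule sqi_cong[OF assms(2) g(1) assms(3)])
 have "integral\<^sup>L LI g' = integral\<^sup>L LI g"
 by (rule int_cong_AE) (use assms g in "auto simp: sqi_def elim: eventually_mono")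
 moreover have pc: "prim 0 g x = prim 0 g' x" if "x <= 1" for x
 by (rule prim_cong_AE[OF assms(2) _ assms(3) that]) (use g in "simp add: sqi_def")
 have "AE x in LI. f x = prim 0 g' x"
 using g(3) AE_space by eventually_elim (use pc in auto)
 ultimately show ?thesis using g g' by (simp add: h10_def)
qed

lemma h10_diff:
 assumes "h10 f g" "h10 f' g'"
 shows "h10 (%x. f x - f' x) (%x. g x - g' x)"
proof -
 have g: "sqi LI g" "integral\<^sup>L LI g = 0" "AE x in LI. f x = prim 0 g x"
 and g': "sqi LI g'" "integral\<^sup>L LI g' = 0" "AE x in LI. f' x = prim 0 g' x"
 using assms by (auto simp: h10_def)
 note i = g(1)[THEN sqi_intg] g'(1)[THEN sqi_intg]
 have "AE x in LI. f x - f' x = prim 0 (%x. g x - g' x) x"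
 using g(3) g'(3) AE_space by eventually_elim (simp add: prim_subtract[OF i])
 thus ?thesis using g g' i by (simp add: h10_def sqi_diff)
qed

lemma h10_bounded_linear:
 assumes L: "bounded_linear L" and "h10 f g"
 shows "h10 (%x. L (f x)) (%x. L (g x))"
proof -
 have g: "sqi LI g" "integral\<^sup>L LI g = 0" "AE x in LI. f x = prim 0 g x"
 using assms by (auto simp: h10_def)
 note i = sqi_intg[OF g(1)]
 obtain K where K: "!!x. norm (L x) <= norm x * K" using bounded_linear.bounded[OF L] by blast
 have "(%x. L (g x)) : bm LI"
 using integrable_bounded_linear[OF L i] by auto
 hence "sqi LI (%x. L (g x))"
 by (rule sqi_bound(1)[OF g(1)]) (use K in "auto simp: mult.commute")
 moreover have "AE x in LI. L (f x) = prim 0 (%x. L (g x)) x"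
 using g(3) AE_space by eventually_elim (simp add: prim_bounded_linear[OF L i])
 ultimately show ?thesis
 using int_blin[OF L i] g(2) linear_0[OF bounded_linear.linear[OF L]] by (simp add: h10_def)
qed

lemma h10_test_fun:
 assumes "test_fun unit_iv ph"
 shows "h10 ph (%x. D1 ph x)"
proof -
 note t = acd_test_fun[OF assms, simplified]
 have c: "continuous_on UNIV (%x. D1 ph x)"
 using assms smooth_fun_deriv_continuous by (auto simp: test_fun_def)
 have "bounded ((%x. D1 ph x) ` {0..1})"
 by (intro compact_imp_bounded compact_continuous_image continuous_on_subset[OF c]) auto
 then obtain B where B: "!!x. x : {0..1} ==> norm (D1 ph x) <= B" unfolding bounded_iff by fastforce
 have "sqi LI (%x. D1 ph x)"
 by (rule finite_measure.sqi_bounded[OF fin_LL, of _ _ _ B])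
 (use t(1) B in "auto intro!: AE_I2")
 moreover have "AE x in LI. ph x = prim 0 (%x. D1 ph x) x"
 using AE_space by eventually_elim (use t(2) in auto)
 ultimately show ?thesis
 using t(2)[of 1] t(3) by (simp add: h10_def LL_prim)
qed

lemma h10_parts:
 fixes pr :: "'b::euclidean_space => 'c::euclidean_space => 'd::euclidean_space"
 assumes pr: "bounded_bilinear pr" and "h10 f g" "acd 0 1 A B"
 shows "(LINT x|LI. pr (g x) (A x)) = - (LINT x|LI. pr (f x) (B x))"
proof -
 have g: "sqi LI g" "integral\<^sup>L LI g = 0" "AE x in LI. f x = prim 0 g x"
 using assms(2) by (auto simp: h10_def)
 note i = sqi_intg[OF g(1)]
 have z: "prim 0 g 1 = 0" using g(2) by (simp add: LL_prim)
 have "(LINT x|LI. pr (g x) (A x)) = - (LINT x|LI. pr (prim 0 g x) (B x))"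
 by (rule acd_integral_product_zero(1)[OF pr i z assms(3)]) simp
 also have "(LINT x|LI. pr (prim 0 g x) (B x)) = (LINT x|LI. pr (f x) (B x))"
 proof (rule int_cong_AE)
 show "(%x. pr (prim 0 g x) (B x)) : bm LI" "(%x. pr (f x) (B x)) : bm LI"
 by (rule measurable_bilinear[OF pr sqi_meas[OF sqi_prim(1)[OF g(1)]] bm_intg[OF acd_integrable(2)[OF assms(3)]]],
 rule measurable_bilinear[OF pr sqi_meas[OF h10_sqi[OF assms(2)]] bm_intg[OF acd_integrable(2)[OF assms(3)]]])
 show "AE x in LI. pr (prim 0 g x) (B x) = pr (f x) (B x)" using g(3) by eventually_elim simp
 qed
 finally show ?thesis .
qed

text \<open>The derivative is approximated first: a test function \<open>s\<close> close to
  \<open>g\<close> is corrected by a multiple of a fixed bump \<open>et\<close> to mean zero, so its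
  antiderivative is again a test function. By Poincare's inequality this antiderivative is close to
  \<open>f\<close>.\<close>

lemma h10_imp_H10_norm:
 assumes h: "h10 f g"
 shows "H10_norm f < \<infinity>"
proof -
 have g: "sqi LI g" "integral\<^sup>L LI g = 0" using h by (auto simp: h10_def)
 obtain et :: "real => real" where et: "test_fun unit_iv et" "integral\<^sup>L LI et = 1"
 using exists_test_fun_integral_1[of 0 1] by auto
 have "EX ph. test_fun unit_iv ph & H_norm 1 unit_iv (%x. f x - ph x) < ereal e" if e: "e > 0" for e
 proof -
 \<comment> \<open>Correcting the mean costs at most the factor \<open>2 * (1 + n2 LI et)\<close>.
   With this \<open>D\<close> the derivatives differ by at most \<open>e^2 / 4\<close> in
   \<open>n2\<close>, hence functions and derivatives together by at most
   \<open>e^2 / 2\<close>.\<close>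
 define D where "D = e^2 / (8 * (1 + n2 LI et))"
 have n0: "1 + n2 LI et > 0" by (rule add_pos_nonneg) auto
 have D: "D > 0" unfolding D_def using e n0 by simp
 obtain s where s: "test_fun unit_iv s" "n2 LI (%x. g x - s x) < D"
 using test_fun_dense[OF g(1) D] by auto
 define m where "m = integral\<^sup>L LI s"
 have ss: "sqi LI s" by (rule sqi_test_fun[OF s(1)])
 have set: "sqi LI et" by (rule sqi_test_fun[OF et(1)])
 have sgs: "sqi LI (%x. g x - s x)" by (intro sqi_diff g ss)
 \<comment> \<open>Since \<open>g\<close> has mean zero, the mean of \<open>s\<close> is controlled
   by the error of the approximation.\<close>
 have "m = - (LINT x|LI. g x - s x)"
 using g(2) sqi_intg[OF g(1)] sqi_intg[OF ss] by (simp add: m_def)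
 also have "... = - prim 0 (%x. g x - s x) 1" by (simp only: LL_prim)
 finally have "norm m <= sqrt (n2 LI (%x. g x - s x))" using norm_prim_le_n2[OF sgs, of 1] by simp
 hence m2: "(norm m)^2 <= n2 LI (%x. g x - s x)"
 using power_mono[of "norm m" _ 2] by fastforce
 define ps where "ps x = s x + (- (et x *R m))" for x
 have tetm: "test_fun unit_iv (%x. - (et x *R m))"
 by (rule test_fun_bounded_linear[OF bounded_linear_minus[OF bounded_linear_scaleR_left] et(1)])
 have tp: "test_fun unit_iv ps" unfolding ps_def by (rule test_fun_add[OF s(1) tetm])
 have sp: "sqi LI ps" by (rule sqi_test_fun[OF tp])
 have z: "integral\<^sup>L LI ps = 0"
 unfolding ps_def using sqi_intg[OF ss] sqi_intg[OF set] et(2) by (simp add: m_def)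
 obtain Ph where Ph: "test_fun unit_iv Ph" "!!x. (Ph has_vector_derivative ps x) (at x)"
 "!!x. 0 <= x ==> prim 0 ps x = Ph x"
 using test_fun_antiderivative[OF tp z] by auto
 have hPh: "h10 Ph ps"
 unfolding h10_def using sp z Ph(3) AE_space by (auto elim!: eventually_mono)
 have d: "h10 (%x. f x - Ph x) (%x. g x - ps x)" by (rule h10_diff[OF h hPh])
 have sd: "sqi LI (%x. g x - ps x)" by (intro sqi_diff g sp)
 have eq: "g x - ps x = (g x - s x) + et x *R m" for x by (simp add: ps_def)
 have sm: "sqi LI (%x. et x *R m)" using sqi_test_fun[OF tetm] sqi_minus by fastforce
 have "n2 LI (%x. g x - ps x) <= 2 * n2 LI (%x. g x - s x) + 2 * n2 LI (%x. et x *R m)"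
 unfolding eq by (rule n2_add_le[OF sgs sm])
 also have "n2 LI (%x. et x *R m) = n2 LI et * (norm m)^2"
 by (simp add: n2_def power_mult_distrib)
 also have "... <= n2 LI et * n2 LI (%x. g x - s x)"
 by (rule mult_left_mono[OF m2]) simp
 also have "2 * n2 LI (%x. g x - s x) + 2 * (n2 LI et * n2 LI (%x. g x - s x)) =
 2 * (1 + n2 LI et) * n2 LI (%x. g x - s x)" by (simp add: algebra_simps)
 also have "... <= 2 * (1 + n2 LI et) * D"
 by (rule mult_left_mono) (use s(2) n0 in auto)
 also have "... = e^2 / 4" unfolding D_def using n0 by (simp add: field_simps)
 finally have le: "n2 LI (%x. g x - ps x) <= e^2 / 4" by simp
 have "n2 LI (%x. f x - Ph x) = n2 LI (prim 0 (%x. g x - ps x))"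
 by (rule n2_cong) (use d h10_sqi[OF d] sqi_prim(1)[OF sd] in "auto simp: h10_def sqi_meas")
 also have "... <= n2 LI (%x. g x - ps x)" by (rule sqi_prim(2)[OF sd])
 finally have "n2 LI (%x. f x - Ph x) + n2 LI (%x. g x - ps x) <= e^2 / 2" using le by simp
 also have "... < e^2" using e by simp
 finally have "sqrt (n2 LI (%x. f x - Ph x) + n2 LI (%x. g x - ps x)) < e"
 using e by (metis real_sqrt_less_iff real_sqrt_unique less_imp_le)
 moreover have "H_norm 1 unit_iv (%x. f x - Ph x) = ereal (sqrt (n2 LI (%x. f x - Ph x) + n2 LI (%x. g x - ps x)))"
 by (rule H_norm_1_eq[OF h10_acd[OF d] h10_sqi[OF d] sd]) simp
 ultimately show ?thesis using Ph(1) by auto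
 qed
 moreover have "H_norm 1 unit_iv f < \<infinity>"
 using H_norm_1_eq[OF h10_acd[OF h] h10_sqi[OF h] g(1)] by simp
 ultimately show ?thesis by (simp add: H10_norm_def)
qed

text \<open>For a test function the constant of integration and the mean of the derivative both
  vanish. Approximating \<open>f\<close> in \<open>H^1\<close> makes the two quantities of
  \<open>f\<close> smaller than any positive number.\<close>

lemma H10_norm_imp_h10:
 assumes "H10_norm f < \<infinity>"
 shows "EX g. h10 f g"
proof -
 have ap: "!!e. e > 0 ==> EX ph. test_fun unit_iv ph & H_norm 1 unit_iv (%x. f x - ph x) < ereal e"
 and fin: "H_norm 1 unit_iv f < \<infinity>"
 using assms unfolding H10_norm_def by (auto split: if_splits)
 obtain g where g: "acd 0 1 f g" "sqi LI f" "sqi LI g"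
 using H_norm_1_finite[OF fin] by auto
 obtain c where c: "AE x in LI. f x = c + prim 0 g x" using g(1) unfolding acd_def by blast
 have key: "norm (integral\<^sup>L LI g) <= e & norm c <= 2 * e" if e: "e > 0" for e
 proof -
 obtain ph where ph: "test_fun unit_iv ph" "H_norm 1 unit_iv (%x. f x - ph x) < ereal e" using ap[OF e] by blast
 define ph' where "ph' x = D1 ph x" for x
 have h: "h10 ph ph'" unfolding ph'_def by (rule h10_test_fun[OF ph(1)])
 have p: "sqi LI ph'" "integral\<^sup>L LI ph' = 0" "AE x in LI. ph x = prim 0 ph' x"
 using h by (auto simp: h10_def)
 have s: "sqi LI (%x. f x - ph x)" "sqi LI (%x. g x - ph' x)"
 by (intro sqi_diff g p h10_sqi[OF h])+
 have H: "H_norm 1 unit_iv (%x. f x - ph x) = ereal (sqrt (n2 LI (%x. f x - ph x) + n2 LI (%x. g x - ph' x)))"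
 by (rule H_norm_1_eq[OF acd_diff[OF g(1) h10_acd[OF h]] s]) simp
 have lt: "sqrt (n2 LI (%x. f x - ph x) + n2 LI (%x. g x - ph' x)) < e"
 using ph(2) unfolding H by simp
 have b: "sqrt (n2 LI (%x. f x - ph x)) < e" "sqrt (n2 LI (%x. g x - ph' x)) < e"
 by (rule le_less_trans[OF _ lt], simp)+
 have ig: "integral\<^sup>L LI g = prim 0 (%x. g x - ph' x) 1"
 using p(2) sqi_intg[OF g(3)] sqi_intg[OF p(1)]
 by (simp add: LL_prim[symmetric])
 have 1: "norm (integral\<^sup>L LI g) <= e"
 unfolding ig using norm_prim_le_n2[OF s(2), of 1] b(2) by simp
 have "AE x in LI. norm c <= norm (f x - ph x) + e"
 using c p(3) AE_space
 proof eventually_elim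
 case (elim x)
 have "prim 0 (%x. g x - ph' x) x = prim 0 g x - prim 0 ph' x"
 by (rule prim_subtract[OF sqi_intg[OF g(3)] sqi_intg[OF p(1)]]) (use elim in auto)
 hence "c = (f x - ph x) - prim 0 (%x. g x - ph' x) x" using elim by simp
 hence "norm c <= norm (f x - ph x) + norm (prim 0 (%x. g x - ph' x) x)" by (metis norm_triangle_ineq4)
 moreover have "norm (prim 0 (%x. g x - ph' x) x) <= e" using norm_prim_le_n2[OF s(2), of x] b(2) elim by simp
 ultimately show ?case by simp
 qed
 moreover have "intg LI (%x. norm (f x - ph x) + e)"
 by (intro intg_add integrable_norm sqi_intg[OF s(1)]
 fm_intg_const[OF fin_LL])
 moreover have "intg LI (%x. norm c)" by (rule fm_intg_const[OF fin_LL])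
 ultimately have "(LINT x|LI. norm c) <= (LINT x|LI. norm (f x - ph x) + e)"
 by (intro int_mono_AE) auto
 also have "... = (LINT x|LI. norm (f x - ph x)) + e"
 using measure_LL[of 0 1]
 by (subst int_add)
 (auto intro!: integrable_norm sqi_intg[OF s(1)] fm_intg_const[OF fin_LL])
 also have "(LINT x|LI. norm (f x - ph x)) <= e"
 using finite_measure.integral_norm_le_n2[OF fin_LL s(1)] measure_LL[of 0 1] b(1) by simp
 finally have "norm c <= 2 * e" using measure_LL[of 0 1] by simp
 with 1 show ?thesis by simp
 qed
 have "norm (integral\<^sup>L LI g) <= 0" by (rule field_le_epsilon) (use key in auto)
 moreover have "norm c <= 0"
 proof (rule field_le_epsilon)
 fix e :: real assume "e > 0"
 thus "norm c <= 0 + e" using key[of "e/2"] by simp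
 qed
 ultimately have "h10 f g" unfolding h10_def using g c by simp
 thus ?thesis by blast
qed

lemma h10_if_trace_zero:
 assumes "acd 0 1 f g" "sqi LI g" "cont_rep 0 1 f 0 = 0" "cont_rep 0 1 f 1 = 0"
 shows "h10 f g"
proof -
 obtain c where c: "AE x in LI. f x = c + prim 0 g x" using assms(1) unfolding acd_def by blast
 note r = cont_rep_acd[OF sqi_intg[OF assms(2)] c]
 have "c = 0" using r[of 0] assms(3) by simp
 moreover have "prim 0 g 1 = 0" using r[of 1] assms(4) \<open>c = 0\<close> by simp
 ultimately show ?thesis using c assms(2) by (simp add: h10_def LL_prim)
qed

section \<open>Estimates for primitives in time\<close>

lemma LL_shift:
 fixes f :: "real => 'b::euclidean_space"
 shows "intg (LL l r) (%t. f (t + h)) \<longleftrightarrow> intg (LL (l + h) (r + h)) f"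
 and "(LINT t|LL l r. f (t + h)) = (LINT t|LL (l + h) (r + h). f t)"
proof -
 have eq: "indicat_real {l + h<..<r + h} (h + 1 * t) *R f (h + 1 * t) = indicat_real {l<..<r} t *R f (t + h)" for t
 by (auto simp: indicator_def add.commute)
 show "intg (LL l r) (%t. f (t + h)) \<longleftrightarrow> intg (LL (l + h) (r + h)) f"
 unfolding LL_integrable_iff set_integrable_def
 using lebesgue_integrable_real_affine_iff[of 1 "%t. indicat_real {l + h<..<r + h} t *R f t" h] unfolding eq by simp
 show "(LINT t|LL l r. f (t + h)) = (LINT t|LL (l + h) (r + h). f t)"
 unfolding LL_integral_eq set_int_def
 using lebesgue_integral_real_affine[of 1 "%t. indicat_real {l + h<..<r + h} t *R f t" h] unfolding eq by simp
qed

lemma AE_LL_subset: "(AE x in LL l r. P x) ==> l <= l' ==> r' <= r ==> AE x in LL l' r'. P x"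
 unfolding AE_LL_iff by (auto elim!: eventually_mono)

lemma AE_LL_shift:
 assumes "AE t in LL (l + h) (r + h). P t"
 shows "AE t in LL l r. P (t + h)"
proof -
 obtain N where N: "{t. \<not> (t : {l + h<..<r + h} --> P t)} \<subseteq> N" "N : null_sets lebesgue"
 using assms unfolding AE_LL_iff by (auto elim!: AE_E simp: null_sets_def)
 have "negligible N" using N(2) negligible_iff_null_sets by blast
 hence "negligible ((+) (- h) ` N)" by (rule negligible_translation)
 hence "(+) (- h) ` N : null_sets lebesgue" using negligible_iff_null_sets by blast
 moreover have "{t : space lebesgue. \<not> (t : {l<..<r} --> P (t + h))} \<subseteq> (+) (- h) ` N"
 proof
 fix t assume "t : {t : space lebesgue. \<not> (t : {l<..<r} --> P (t + h))}"
 hence "t + h : N" using N(1) by auto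
 thus "t : (+) (- h) ` N" by (intro image_eqI[of _ _ "t + h"]) auto
 qed
 ultimately show ?thesis unfolding AE_LL_iff by (rule AE_I')
qed

lemma sqi_LL_subset: "sqi (LL l r) f ==> l <= l' ==> r' <= r ==> sqi (LL l' r') f"
proof -
 assume f: "sqi (LL l r) f" and lr: "l <= l'" "r' <= r"
 have "intg (LL l' r') f" by (rule intg_subset[OF sqi_intg[OF f] lr])
 moreover have "intg (LL l' r') (%x. (norm (f x))^2)"
 by (rule intg_subset[OF sqi_norm2[OF f] lr])
 ultimately show ?thesis by (auto simp: sqi_def)
qed

lemma n2_LL_mono: "sqi (LL l r) f ==> l <= l' ==> l' <= r' ==> r' <= r ==> n2 (LL l' r') f <= n2 (LL l r) f"
proof -
 assume f: "sqi (LL l r) f" and lr: "l <= l'" "l' <= r'" "r' <= r"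
 note i = sqi_norm2[OF f]
 have "n2 (LL l' r') f = prim l (%x. (norm (f x))^2) r' - prim l (%x. (norm (f x))^2) l'"
 unfolding n2_def LL_prim by (rule prim_diff[OF i lr, symmetric])
 moreover have "prim l (%x. (norm (f x))^2) l' >= 0" by (rule prim_nonneg) simp
 moreover have "prim l (%x. (norm (f x))^2) r' <= prim l (%x. (norm (f x))^2) r"
 by (rule prim_mono[OF i]) (use lr in auto)
 ultimately show ?thesis unfolding n2_def LL_prim by linarith
qed

lemma sqi_shift:
 assumes "sqi (LL (l + h) (r + h)) f"
 shows "sqi (LL l r) (%t. f (t + h))" "n2 (LL l r) (%t. f (t + h)) = n2 (LL (l + h) (r + h)) f"
proof -
 have "intg (LL l r) (%t. f (t + h))" using LL_shift(1) sqi_intg[OF assms] by blast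
 moreover have "intg (LL l r) (%t. (norm (f (t + h)))^2)"
 using LL_shift(1)[of l r "%t. (norm (f t))^2" h] sqi_norm2[OF assms] by blast
 ultimately show "sqi (LL l r) (%t. f (t + h))" by (auto simp: sqi_def)
 show "n2 (LL l r) (%t. f (t + h)) = n2 (LL (l + h) (r + h)) f"
 unfolding n2_def by (rule LL_shift(2)[of l r "%t. (norm (f t))^2" h])
qed

lemma norm_prim_squared_le:
 assumes "sqi (LL l r) g" "l <= r"
 shows "(norm (prim l g r))^2 <= (r - l) * n2 (LL l r) g" "(prim l (%x. norm (g x)) r)^2 <= (r - l) * n2 (LL l r) g"
proof -
 have "prim l (%x. norm (g x)) r <= sqrt (r - l) * sqrt (n2 (LL l r) g)"
 using finite_measure.integral_norm_le_n2[OF fin_LL assms(1)] measure_LL[OF assms(2)]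
 by (simp add: LL_prim)
 moreover have "0 <= prim l (%x. norm (g x)) r" by (rule prim_nonneg) simp
 ultimately have "(prim l (%x. norm (g x)) r)^2 <= (sqrt (r - l) * sqrt (n2 (LL l r) g))^2"
 by (rule power_mono)
 also have "... = (r - l) * n2 (LL l r) g" using assms(2) by (simp add: power_mult_distrib)
 finally show 1: "(prim l (%x. norm (g x)) r)^2 <= (r - l) * n2 (LL l r) g" .
 have "(norm (prim l g r))^2 <= (prim l (%x. norm (g x)) r)^2"
 by (rule power_mono[OF norm_prim_le]) simp
 with 1 show "(norm (prim l g r))^2 <= (r - l) * n2 (LL l r) g" by simp
qed

lemma sqi_continuous:
 assumes "continuous_on {l..r} f"
 shows "sqi (LL l r) f"
proof -
 have "bounded (f ` {l..r})" by (intro compact_imp_bounded compact_continuous_image assms compact_Icc)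
 then obtain B where B: "!!x. x : {l..r} ==> norm (f x) <= B" unfolding bounded_iff by fastforce
 show ?thesis
 proof (rule finite_measure.sqi_bounded[OF fin_LL])
 show "f : bm (LL l r)"
 by (rule cont_imp_meas[OF continuous_on_subset[OF assms]]) auto
 show "AE x in LL l r. norm (f x) <= B" using AE_space by eventually_elim (use B in auto)
 qed
qed

lemma continuous_on_prim_shift:
 assumes "intg (LL 0 T) g" "0 <= h"
 shows "continuous_on {0..T - h} (%t. prim 0 g (t + h))"
 by (rule continuous_on_compose2[OF continuous_on_prim[OF assms(1)]])
 (use assms(2) in "auto intro!: continuous_intros")

text \<open>The Cauchy-Schwarz inequality on \<open>(t, t + h)\<close> gives
  \<open>h * (V (t + h) - V t)\<close>, where \<open>V\<close> is the primitive of the squared norm.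
  The integral over \<open>t\<close> telescopes: what is left is at most the integral of
  \<open>V\<close> over the last interval of length \<open>h\<close>.\<close>

lemma n2_prim_difference:
 assumes g: "sqi (LL 0 T) g" and h: "0 <= h" "h <= T"
 shows "sqi (LL 0 (T - h)) (%t. prim 0 g (t + h) - prim 0 g t)"
 and "n2 (LL 0 (T - h)) (%t. prim 0 g (t + h) - prim 0 g t) <= h^2 * n2 (LL 0 T) g"
proof -
 note ig = sqi_intg[OF g]
 have c: "continuous_on {0..T - h} (%t. prim 0 g (t + h) - prim 0 g t)"
 by (intro continuous_on_diff continuous_on_prim_shift[OF ig h(1)] continuous_on_subset[OF continuous_on_prim[OF ig]])
 (use h in auto)
 show s: "sqi (LL 0 (T - h)) (%t. prim 0 g (t + h) - prim 0 g t)" by (rule sqi_continuous[OF c])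
 define V where "V = prim 0 (%s. (norm (g s))^2)"
 note iV = sqi_norm2[OF g]
 have cV: "continuous_on {0..T} V" unfolding V_def by (rule continuous_on_prim[OF iV])
 have sV: "intg (LL 0 T) V" by (rule sqi_intg[OF sqi_continuous[OF cV]])
 have Vnn: "0 <= V t" for t unfolding V_def by (rule prim_nonneg) simp
 have pw: "(norm (prim 0 g (t + h) - prim 0 g t))^2 <= h * (V (t + h) - V t)" if "t : {0<..<T - h}" for t
 proof -
 have "prim 0 g (t + h) - prim 0 g t = prim t g (t + h)"
 by (rule prim_diff[OF ig]) (use that h in auto)
 moreover have "V (t + h) - V t = n2 (LL t (t + h)) g"
 unfolding n2_def LL_prim V_def by (rule prim_diff[OF iV]) (use that h in auto)
 moreover have "sqi (LL t (t + h)) g" by (rule sqi_LL_subset[OF g]) (use that h in auto)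
 ultimately show ?thesis using norm_prim_squared_le(1)[of t "t + h" g] h by simp
 qed
 have i1: "intg (LL 0 (T - h)) (%t. V (t + h))"
 by (rule sqi_intg[OF sqi_continuous]) (unfold V_def, rule continuous_on_prim_shift[OF iV h(1)])
 have i2: "intg (LL 0 (T - h)) V" by (rule intg_subset[OF sV]) (use h in auto)
 have "n2 (LL 0 (T - h)) (%t. prim 0 g (t + h) - prim 0 g t) <= (LINT t|LL 0 (T - h). h * (V (t + h) - V t))"
 unfolding n2_def
 by (rule int_mono_AE[OF sqi_norm2[OF s]]) (use i1 i2 pw in "auto intro!: AE_I2")
 also have "... = h * ((LINT t|LL 0 (T - h). V (t + h)) - (LINT t|LL 0 (T - h). V t))"
 using i1 i2 by simp
 also have "(LINT t|LL 0 (T - h). V (t + h)) = prim h V T"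
 using LL_shift(2)[of 0 "T - h" V h] by (simp add: LL_prim)
 also have "prim h V T = prim 0 V T - prim 0 V h" by (rule prim_diff[symmetric, OF sV]) (use h in auto)
 also have "(LINT t|LL 0 (T - h). V t) = prim 0 V (T - h)" by (rule LL_prim)
 also have "prim 0 V T - prim 0 V h - prim 0 V (T - h) <= prim 0 V T - prim 0 V (T - h)"
 using prim_nonneg[of V 0 h] Vnn by simp
 also have "prim 0 V T - prim 0 V (T - h) = prim (T - h) V T" by (rule prim_diff[OF sV]) (use h in auto)
 also have "prim (T - h) V T <= prim (T - h) (%t. V T) T"
 unfolding LL_prim[symmetric]
 proof (rule int_mono_AE)
 show "intg (LL (T - h) T) V" by (rule intg_subset[OF sV]) (use h in auto)
 show "AE x in LL (T - h) T. V x <= V T"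
 using AE_space by eventually_elim (unfold V_def, rule prim_mono[OF iV], use h in auto)
 qed (rule fm_intg_const[OF fin_LL])
 also have "... = h * V T" using h by (simp add: prim_const)
 also have "V T = n2 (LL 0 T) g" by (simp add: V_def n2_def LL_prim)
 finally show "n2 (LL 0 (T - h)) (%t. prim 0 g (t + h) - prim 0 g t) <= h^2 * n2 (LL 0 T) g"
 using h by (simp add: mult_left_mono power2_eq_square mult.assoc)
qed

lemma n2_prim_le:
 assumes g: "sqi (LL 0 T) g" and h: "0 <= h" "h <= T"
 shows "sqi (LL 0 h) (prim 0 g)" "n2 (LL 0 h) (prim 0 g) <= h^2 * n2 (LL 0 T) g"
proof -
 note ig = sqi_intg[OF g]
 show s: "sqi (LL 0 h) (prim 0 g)"
 by (rule sqi_continuous[OF continuous_on_subset[OF continuous_on_prim[OF ig]]]) (use h in auto)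
 have "n2 (LL 0 h) (prim 0 g) <= (LINT t|LL 0 h. h * n2 (LL 0 T) g)"
 unfolding n2_def[of "LL 0 h"]
 proof (rule int_mono_AE[OF sqi_norm2[OF s] fm_intg_const[OF fin_LL]])
 show "AE t in LL 0 h. (norm (prim 0 g t))^2 <= h * n2 (LL 0 T) g"
 using AE_space
 proof eventually_elim
 case (elim t)
 hence t: "0 <= t" "t <= h" by auto
 have "(norm (prim 0 g t))^2 <= (t - 0) * n2 (LL 0 t) g"
 by (rule norm_prim_squared_le(1)[OF sqi_LL_subset[OF g]]) (use t h in auto)
 also have "... <= h * n2 (LL 0 T) g"
 by (rule mult_mono) (use t h n2_LL_mono[OF g] in auto)
 finally show ?case .
 qed
 qed
 also have "... = h^2 * n2 (LL 0 T) g"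
 using measure_LL[of 0 h] h by (simp add: power2_eq_square mult.assoc)
 finally show "n2 (LL 0 h) (prim 0 g) <= h^2 * n2 (LL 0 T) g" .
qed

text \<open>\<open>w\<close> is a coefficient \<open>a(\<sqdot>, x)\<close> for fixed \<open>x\<close>; \<open>w0\<close> is its Lipschitz representative.\<close>

locale lip_coef =
 fixes T al A L c0 :: real and w dw :: "real => real"
 assumes T: "0 < T" and al: "0 < al" and L: "0 <= L"
 and dw: "intg (LL 0 T) dw" "AE t in LL 0 T. \<bar>dw t\<bar> <= L"
 and w: "AE t in LL 0 T. w t = c0 + prim 0 dw t" "AE t in LL 0 T. al <= w t & w t <= A"
begin

definition w0 :: "real => real" where "w0 t = c0 + prim 0 dw t"

lemma w0_continuous: "continuous_on {0..T} w0"
 unfolding w0_def by (intro continuous_intros continuous_on_prim dw)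

text \<open>Clipping \<open>w0\<close> to \<open>[al, A]\<close> gives a continuous function that
  equals \<open>w0\<close> almost everywhere, hence everywhere on the closed interval. Values at the
  end points are needed for the boundary terms.\<close>

lemma w0_bounds: "t : {0..T} ==> al <= w0 t" "t : {0..T} ==> w0 t <= A"
proof -
 assume t: "t : {0..T}"
 have ae: "AE t in LL 0 T. max al (min A (w0 t)) = w0 t"
 using w unfolding w0_def[symmetric] by eventually_elim auto
 have "max al (min A (w0 t)) = w0 t"
 by (rule continuous_AE_eq[OF _ w0_continuous ae T t]) (intro continuous_intros w0_continuous)
 moreover have "al <= A"
 proof (rule AE_LL_contradiction[OF T])
 show "AE t in LL 0 T. al <= A" using w(2) by eventually_elim auto
 qed
 ultimately show "al <= w0 t" "w0 t <= A" by (auto simp: max_def min_def split: if_splits)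
qed

lemma w0_lipschitz: assumes "0 <= s" "s <= t" "t <= T" shows "\<bar>w0 t - w0 s\<bar> <= L * (t - s)"
proof -
 have "\<bar>w0 t - w0 s\<bar> = norm (prim s dw t)"
 using prim_diff[OF dw(1) assms] by (simp add: w0_def)
 also have "... <= prim s (%x. norm (dw x)) t" by (rule norm_prim_le)
 also have "... <= prim s (%x. L) t"
 unfolding LL_prim[symmetric]
 proof (rule int_mono_AE)
 show "intg (LL s t) (%x. norm (dw x))"
 by (intro integrable_norm intg_subset[OF dw(1)]) (use assms in auto)
 show "AE x in LL s t. norm (dw x) <= L"
 using AE_LL_subset[OF dw(2) assms(1,3)] by eventually_elim simp
 qed (rule fm_intg_const[OF fin_LL])
 also have "... = L * (t - s)" using assms by (simp add: prim_const)
 finally show ?thesis .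
qed

lemma w_measurable: "w : bm (LL 0 T)"
 by (rule AE_measurable_LL[OF w(1) prim_measurable[OF dw(1)]])

lemma sqi_w_scaleR:
 assumes "sqi (LL 0 T) p"
 shows "sqi (LL 0 T) (%t. w t *R p t)"
proof (rule sqi_bound(1)[OF assms])
 show "(%t. w t *R p t) : bm (LL 0 T)"
 using w_measurable sqi_meas[OF assms] by simp
 show "AE t in LL 0 T. norm (w t *R p t) <= A * norm (p t)"
 using w(2) by eventually_elim (use al in "auto intro!: mult_r_mono")
qed

text \<open>The coefficient is frozen at the left end point; on \<open>(s, t)\<close> it changes by
  at most \<open>L * (t - s)\<close>.\<close>

lemma prim_commutator:
 assumes p: "intg (LL 0 T) p" "intg (LL 0 T) (%s. w s *R p s)" and st: "0 <= s" "s <= t" "t <= T"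
 shows "norm (prim s (%s. w s *R p s) t - w0 s *R prim s p t) <= L * (t - s) * prim s (%s. norm (p s)) t"
proof -
 have i: "intg (LL s t) p" "intg (LL s t) (%s. w s *R p s)"
 by (rule intg_subset; use p st in auto)+
 have "prim s (%r. w r *R p r) t - w0 s *R prim s p t = prim s (%r. w r *R p r - w0 s *R p r) t"
 using i by (simp add: LL_prim[symmetric])
 also have "norm ... <= prim s (%r. norm (w r *R p r - w0 s *R p r)) t" by (rule norm_prim_le)
 also have "... <= prim s (%r. L * (t - s) * norm (p r)) t"
 unfolding LL_prim[symmetric]
 proof (rule int_mono_AE)
 show "AE r in LL s t. norm (w r *R p r - w0 s *R p r) <= L * (t - s) * norm (p r)"
 using AE_LL_subset[OF w(1) st(1,3)] AE_space
 proof eventually_elim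
 case (elim r)
 hence "\<bar>w r - w0 s\<bar> <= L * (r - s)" using w0_lipschitz[of s r] st by (auto simp: w0_def)
 also have "... <= L * (t - s)" using elim L by (intro mult_left_mono) auto
 finally show ?case
 by (simp add: scaleR_diff_left[symmetric] mult_r_mono)
 qed
 qed (use i in auto)
 also have "... = L * (t - s) * prim s (%r. norm (p r)) t"
 using prim_scaleR[of s "L * (t - s)" "%r. norm (p r)"] by simp
 finally show ?thesis .
qed

text \<open>Write \<open>P t\<close> for the integral of \<open>p\<close> over
  \<open>(t, t + h)\<close> and \<open>D t\<close> for the increment of \<open>p\<close>, which is
  the derivative of \<open>P\<close>. Up to the commutator the integrand is
  \<open>w0 * (P *I D)\<close>, half the derivative of \<open>w0 * (norm P)^2\<close> without the
  derivative of \<open>w0\<close>. The boundary term at \<open>T - h\<close> is nonnegative, the one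
  at 0 appears on the left-hand side, and everything else is of order \<open>h^2\<close>.\<close>

lemma difference_quotient_bound:
 fixes p :: "real => 'b::euclidean_space"
 assumes p: "sqi (LL 0 T) p" and h: "0 < h" "h <= T"
 shows "intg (LL 0 (T - h)) (%t. (prim 0 (%s. w s *R p s) (t + h) - prim 0 (%s. w s *R p s) t) *I (p (t + h) - p t))"
 and "- (A / 2 * (norm (prim 0 p h))^2) - 3 * L * h^2 * n2 (LL 0 T) p <=
 (LINT t|LL 0 (T - h). (prim 0 (%s. w s *R p s) (t + h) - prim 0 (%s. w s *R p s) t) *I (p (t + h) - p t))"
proof -
 define \<tau> where "\<tau> = T - h"
 define M where "M = LL 0 \<tau>"
 have \<tau>: "0 <= \<tau>" "\<tau> <= T" using h by (auto simp: \<tau>_def)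
 define Q where "Q t = prim 0 (%s. w s *R p s) (t + h) - prim 0 (%s. w s *R p s) t" for t
 define P where "P t = prim 0 p (t + h) - prim 0 p t" for t
 define D where "D t = p (t + h) - p t" for t
 define R where "R t = prim 0 (%s. norm (p s)) (t + h) - prim 0 (%s. norm (p s)) t" for t
 note wp = sqi_w_scaleR[OF p]
 note ip = sqi_intg[OF p] and iwp = sqi_intg[OF wp]
 have sQ: "sqi M Q" unfolding Q_def[abs_def] M_def \<tau>_def by (rule n2_prim_difference(1)[OF wp]) (use h in auto)
 have sP: "sqi M P" and nP: "n2 M P <= h^2 * n2 (LL 0 T) p"
 unfolding P_def[abs_def] M_def \<tau>_def using n2_prim_difference[OF p, of h] h by auto
 have sR: "sqi M R" and nR: "n2 M R <= h^2 * n2 (LL 0 T) p"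
 unfolding R_def[abs_def] M_def \<tau>_def using n2_prim_difference[OF sqi_norm[OF p], of h] h by (auto simp: n2_def)
 have "sqi (LL (0 + h) (\<tau> + h)) p" by (rule sqi_LL_subset[OF p]) (use h in \<open>auto simp: \<tau>_def\<close>)
 note sh = sqi_shift[OF this]
 have "n2 (LL (0 + h) (\<tau> + h)) p <= n2 (LL 0 T) p" by (rule n2_LL_mono[OF p]) (use h \<tau> in \<open>auto simp: \<tau>_def\<close>)
 hence nsh: "n2 M (%t. p (t + h)) <= n2 (LL 0 T) p" using sh(2) by (simp add: M_def)
 have ps: "sqi M p" unfolding M_def by (rule sqi_LL_subset[OF p]) (use \<tau> in auto)
 have np: "n2 M p <= n2 (LL 0 T) p" unfolding M_def by (rule n2_LL_mono[OF p]) (use \<tau> in auto)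
 have sD: "sqi M D" unfolding D_def[abs_def] using sh(1) ps by (intro sqi_diff) (auto simp: M_def)
 have nD: "n2 M D <= 4 * n2 (LL 0 T) p"
 using n2_diff_le[of M "%t. p (t + h)" p] sh(1) ps nsh np by (simp add: D_def[abs_def] M_def)
 have iD: "intg (LL 0 \<tau>) D" using sqi_intg sD unfolding M_def by blast
 \<comment> \<open>The window integral has initial value \<open>prim 0 p h\<close> and derivative
   \<open>D\<close>.\<close>
 have Peq: "P t = prim 0 p h + prim 0 D t" if "t : {0..\<tau>}" for t
 proof -
 have "prim 0 D t = (LINT s|LL 0 t. p (s + h)) - (LINT s|LL 0 t. p s)"
 unfolding D_def LL_prim[symmetric]
 proof (rule int_diff)
 show "intg (LL 0 t) (%s. p (s + h))"
 by (rule intg_subset[OF sqi_intg[OF sh(1)]]) (use that in auto)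
 show "intg (LL 0 t) p"
 by (rule intg_subset[OF ip]) (use that h in \<open>auto simp: \<tau>_def\<close>)
 qed
 also have "(LINT s|LL 0 t. p (s + h)) = prim h p (t + h)" using LL_shift(2)[of 0 t p h] by (simp add: LL_prim)
 also have "prim h p (t + h) = prim 0 p (t + h) - prim 0 p h"
 by (rule prim_diff[OF ip, symmetric]) (use that h in \<open>auto simp: \<tau>_def\<close>)
 finally show ?thesis by (simp add: P_def LL_prim)
 qed
 define b where "b t = D t *I (prim 0 p h + prim 0 D t) + (prim 0 p h + prim 0 D t) *I D t" for t
 have ib: "intg (LL 0 \<tau>) b" unfolding b_def
 by (rule prim_product(1)[OF bb_inner iD iD \<tau>(1) order_refl])
 have beq: "(norm (P t))^2 = (norm (prim 0 p h))^2 + prim 0 b t" if "t : {0..\<tau>}" for t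
 proof -
 have "prim 0 b t = (prim 0 p h + prim 0 D t) *I (prim 0 p h + prim 0 D t) - prim 0 p h *I prim 0 p h"
 unfolding b_def by (rule prim_product(2)[OF bb_inner iD iD]) (use that in auto)
 thus ?thesis by (simp add: Peq[OF that] power2_norm_eq_inner)
 qed
 have idw: "intg (LL 0 \<tau>) dw" by (rule intg_subset[OF dw(1)]) (use \<tau> in auto)
 \<comment> \<open>The product rule for \<open>w0 t * (norm (P t))^2\<close>, integrated over
   \<open>(0, \<tau>)\<close>.\<close>
 have "prim 0 (%t. dw t * ((norm (prim 0 p h))^2 + prim 0 b t) + (c0 + prim 0 dw t) * b t) \<tau> =
 (c0 + prim 0 dw \<tau>) * ((norm (prim 0 p h))^2 + prim 0 b \<tau>) - c0 * (norm (prim 0 p h))^2"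
 by (rule prim_product(2)[OF bounded_bilinear_mult idw ib \<tau>(1) order_refl])
 also have "prim 0 (%t. dw t * ((norm (prim 0 p h))^2 + prim 0 b t) + (c0 + prim 0 dw t) * b t) \<tau> =
 (LINT t|M. dw t * (norm (P t))^2 + 2 * (w0 t * (P t *I D t)))"
 unfolding LL_prim[symmetric, where l=0 and r=\<tau>] M_def
 by (rule int_cong[OF refl])
 (use beq in "auto simp: b_def Peq w0_def inner_commute")
 also have "(c0 + prim 0 dw \<tau>) * ((norm (prim 0 p h))^2 + prim 0 b \<tau>) = w0 \<tau> * (norm (P \<tau>))^2"
 using beq[of \<tau>] \<tau> by (simp add: w0_def)
 finally have I: "(LINT t|M. dw t * (norm (P t))^2 + 2 * (w0 t * (P t *I D t))) = w0 \<tau> * (norm (P \<tau>))^2 - c0 * (norm (prim 0 p h))^2" .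
 have c0: "c0 <= A" using w0_bounds(2)[of 0] T by (simp add: w0_def)
 have mw0: "w0 : bm M" unfolding w0_def[abs_def] M_def by (rule prim_measurable[OF idw])
 have dwM: "AE t in M. \<bar>dw t\<bar> <= L" unfolding M_def by (rule AE_LL_subset[OF dw(2)]) (use \<tau> in auto)
 have i1: "intg M (%t. dw t * (norm (P t))^2)"
 proof (rule intg_bound[OF intg_mult[OF sqi_norm2[OF sP], of L]])
 show "(%t. dw t * (norm (P t))^2) : bm M"
 using idw sqi_meas[OF sP] by (auto simp: M_def)
 show "AE t in M. norm (dw t * (norm (P t))^2) <= norm (L * (norm (P t))^2)"
 using dwM by eventually_elim (use L in "auto simp: abs_mult intro!: mult_r_mono")
 qed
 have iPD: "intg M (%t. P t *I D t)" by (rule sqi_inner[OF sP sD])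
 have i2: "intg M (%t. w0 t * (P t *I D t))"
 proof (rule intg_bound[OF intg_mult[OF iPD, of A]])
 show "(%t. w0 t * (P t *I D t)) : bm M" using mw0 iPD by auto
 show "AE t in M. norm (w0 t * (P t *I D t)) <= norm (A * (P t *I D t))"
 using AE_space
 proof eventually_elim
 case (elim t)
 hence "al <= w0 t" "w0 t <= A" using w0_bounds[of t] \<tau> by (auto simp: M_def)
 thus ?case using al by (auto simp: abs_mult intro!: mult_r_mono)
 qed
 qed
 show iQD: "intg (LL 0 (T - h)) (%t. (prim 0 (%s. w s *R p s) (t + h) - prim 0 (%s. w s *R p s) t) *I (p (t + h) - p t))"
 using sqi_inner[OF sQ sD] unfolding Q_def D_def M_def \<tau>_def .
 have nn: "(LINT t|M. dw t * (norm (P t))^2) <= (LINT t|M. L * (norm (P t))^2)"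
 proof (rule int_mono_AE[OF i1 intg_mult[OF sqi_norm2[OF sP]]])
 show "AE t in M. dw t * (norm (P t))^2 <= L * (norm (P t))^2"
 using dwM by eventually_elim (auto intro!: mult_r_mono)
 qed
 have low1: "(LINT t|M. w0 t * (P t *I D t)) >= - (A / 2 * (norm (prim 0 p h))^2) - L / 2 * n2 M P"
 proof -
 have "2 * (LINT t|M. w0 t * (P t *I D t)) = w0 \<tau> * (norm (P \<tau>))^2 - c0 * (norm (prim 0 p h))^2 - (LINT t|M. dw t * (norm (P t))^2)"
 using I i1 i2 by simp
 moreover have "0 <= w0 \<tau> * (norm (P \<tau>))^2" using w0_bounds(1)[of \<tau>] \<tau> al by simp
 moreover have "c0 * (norm (prim 0 p h))^2 <= A * (norm (prim 0 p h))^2" using c0 by (simp add: mult_r_mono)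
 moreover have "(LINT t|M. dw t * (norm (P t))^2) <= L * n2 M P" using nn by (simp add: n2_def)
 ultimately show ?thesis by argo
 qed
 have iR: "intg M (%t. L / 2 * (norm (R t))^2 + L * h^2 / 2 * (norm (D t))^2)"
 using sqi_norm2[OF sR] sqi_norm2[OF sD] by auto
 have "(LINT t|M. w0 t * (P t *I D t) - (L / 2 * (norm (R t))^2 + L * h^2 / 2 * (norm (D t))^2)) <= (LINT t|M. Q t *I D t)"
 proof (rule int_mono_AE[OF _ sqi_inner[OF sQ sD]])
 show "intg M (%t. w0 t * (P t *I D t) - (L / 2 * (norm (R t))^2 + L * h^2 / 2 * (norm (D t))^2))"
 by (rule intg_diff[OF i2 iR])
 show "AE t in M. w0 t * (P t *I D t) - (L / 2 * (norm (R t))^2 + L * h^2 / 2 * (norm (D t))^2) <= Q t *I D t"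
 using AE_space
 proof eventually_elim
 case (elim t)
 hence t: "0 <= t" "t <= \<tau>" by (auto simp: M_def)
 have th: "t <= t + h" "t + h <= T" using t h by (auto simp: \<tau>_def)
 have "Q t = prim t (%s. w s *R p s) (t + h)" "P t = prim t p (t + h)" "R t = prim t (%s. norm (p s)) (t + h)"
 unfolding Q_def P_def R_def by (rule prim_diff; use ip iwp t th in auto)+
 with prim_commutator[OF ip iwp t(1) th]
 have c: "norm (Q t - w0 t *R P t) <= L * h * R t" by simp
 have "\<bar>(Q t - w0 t *R P t) *I D t\<bar> <= norm (Q t - w0 t *R P t) * norm (D t)" by (rule Cauchy_Schwarz_ineq2)
 also have "... <= L * h * R t * norm (D t)" by (rule mult_r_mono[OF c]) simp
 \<comment> \<open>The factor \<open>h\<close> is put on \<open>D\<close>, because \<open>R\<close>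
   is already of order \<open>h\<close> in \<open>L^2\<close>.\<close>
 also have "... = L / 2 * (2 * R t * (h * norm (D t)))" by simp
 also have "... <= L / 2 * ((R t)^2 + (h * norm (D t))^2)"
 by (rule mult_left_mono[OF sum_squares_bound]) (use L in simp)
 also have "... = L / 2 * (norm (R t))^2 + L * h^2 / 2 * (norm (D t))^2" by (simp add: power_mult_distrib algebra_simps)
 finally show ?case by (simp add: inner_diff_left abs_le_iff)
 qed
 qed
 also have "(LINT t|M. w0 t * (P t *I D t) - (L / 2 * (norm (R t))^2 + L * h^2 / 2 * (norm (D t))^2)) =
 (LINT t|M. w0 t * (P t *I D t)) - (L / 2 * n2 M R + L * h^2 / 2 * n2 M D)"
 using i2 iR sqi_norm2[OF sR] sqi_norm2[OF sD] by (simp add: n2_def)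
 finally have fin: "(LINT t|M. w0 t * (P t *I D t)) - (L / 2 * n2 M R + L * h^2 / 2 * n2 M D) <= (LINT t|M. Q t *I D t)" .
 \<comment> \<open>The contributions are \<open>L / 2\<close> from \<open>P\<close>,
   \<open>L / 2\<close> from \<open>R\<close> and \<open>2 * L\<close> from \<open>D\<close>; this
   is the origin of \<open>3 * L\<close>.\<close>
 have "L / 2 * n2 M P <= L / 2 * (h^2 * n2 (LL 0 T) p)" "L / 2 * n2 M R <= L / 2 * (h^2 * n2 (LL 0 T) p)"
 "L * h^2 / 2 * n2 M D <= L * h^2 / 2 * (4 * n2 (LL 0 T) p)"
 by (rule mult_left_mono[OF nP], use L in simp) (rule mult_left_mono[OF nR], use L in simp,
 rule mult_left_mono[OF nD], use L in simp)
 hence "- (A / 2 * (norm (prim 0 p h))^2) - 3 * L * h^2 * n2 (LL 0 T) p <= (LINT t|M. Q t *I D t)"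
 using fin low1 by (simp add: algebra_simps)
 thus "- (A / 2 * (norm (prim 0 p h))^2) - 3 * L * h^2 * n2 (LL 0 T) p <=
 (LINT t|LL 0 (T - h). (prim 0 (%s. w s *R p s) (t + h) - prim 0 (%s. w s *R p s) t) *I (p (t + h) - p t))"
 unfolding Q_def D_def M_def \<tau>_def .
qed

text \<open>
 With the weight \<open>2 - t / h\<close> the boundary term controls the primitive at \<open>h\<close> and the derivative
 of the weight absorbs the mixed term with \<open>p0\<close>.
\<close>

lemma initial_layer_bound:
 fixes p :: "real => 'b::euclidean_space"
 assumes p: "sqi (LL 0 T) p" and h: "0 < h" "h <= T"
 shows "intg (LL 0 h) (%t. (2 - t / h) * (prim 0 (%s. w s *R p s) t *I (p t - p0)))"
 and "al / 2 * (norm (prim 0 p h))^2 - h^2 * (2 * A * (norm p0)^2 + 3 * L * n2 (LL 0 T) p + L * h * (norm p0)^2) <=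
 (LINT t|LL 0 h. (2 - t / h) * (prim 0 (%s. w s *R p s) t *I (p t - p0)))"
proof -
 define M where "M = LL 0 h"
 have fin: "finite_measure M" unfolding M_def by (rule fin_LL)
 have mM: "measure M (space M) = h" using measure_LL[of 0 h] h by (simp add: M_def)
 define P where "P = prim 0 p"
 define Q where "Q = prim 0 (%s. w s *R p s)"
 define k where "k = w0 0"
 define N where "N = prim 0 (%s. norm (p s)) h"
 have k: "al <= k" "k <= A" "0 < k" using w0_bounds[of 0] T al by (auto simp: k_def)
 note wp = sqi_w_scaleR[OF p]
 note ip = sqi_intg[OF p] and iwp = sqi_intg[OF wp]
 have sP: "sqi M P" and sQ: "sqi M Q" unfolding P_def Q_def M_def
 by (rule n2_prim_le(1); use p wp h in auto)+
 have sp: "sqi M p" unfolding M_def by (rule sqi_LL_subset[OF p]) (use h in auto)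
 have ipM: "intg (LL 0 h) p" using sqi_intg sp unfolding M_def by blast
 have sc: "sqi M (%t. c)" for c :: 'b by (rule finite_measure.sqi_const[OF fin])
 have wt: "(%t. 2 - t / h) : bm M"
 unfolding M_def by (rule cont_imp_meas) (auto intro!: continuous_intros simp: h less_imp_neq)
 have wt2: "1 <= 2 - t / h" "2 - t / h <= 2" if "t : {0<..<h}" for t using that h by auto
 have iw: "intg M (%t. (2 - t / h) * f t)" if "intg M f" for f :: "real => real"
 proof (rule intg_bound[OF intg_mult[OF that, of 2]])
 show "(%t. (2 - t / h) * f t) : bm M" using wt that by auto
 show "AE t in M. norm ((2 - t / h) * f t) <= norm (2 * f t)"
 using AE_space
 proof eventually_elim
 case (elim t)
 hence "t : {0<..<h}" by (simp add: M_def)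
 hence "\<bar>2 - t / h\<bar> <= 2" using wt2[of t] by linarith
 thus ?case by (simp only: real_norm_def abs_mult) (auto intro!: mult_r_mono)
 qed
 qed
 show "intg (LL 0 h) (%t. (2 - t / h) * (prim 0 (%s. w s *R p s) t *I (p t - p0)))"
 using iw[OF sqi_inner[OF sQ sqi_diff[OF sp sc]]] unfolding Q_def M_def .
 have one: "intg (LL 0 h) (%t. - (1 / h))" by (rule fm_intg_const[OF fin_LL])
 define b where "b t = p t *I (0 + P t) + (0 + P t) *I p t" for t
 have ib: "intg (LL 0 h) b" unfolding b_def P_def
 by (rule prim_product(1)[OF bb_inner ipM ipM, where x=h]) (use h in auto)
 have beq: "prim 0 b t = (norm (P t))^2" if "t : {0..h}" for t
 proof -
 have "prim 0 b t = (0 + P t) *I (0 + P t) - (0::'b) *I 0"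
 unfolding b_def P_def by (rule prim_product(2)[OF bb_inner ipM ipM]) (use that in auto)
 thus ?thesis by (simp add: power2_norm_eq_inner)
 qed
 \<comment> \<open>The product rule for \<open>(2 - t / h) * (norm (P t))^2\<close>. The weight
   equals 1 at \<open>t = h\<close>, and its derivative \<open>- 1 / h\<close> produces the useful
   term \<open>n2 M P / h\<close>.\<close>
 have "prim 0 (%t. - (1 / h) * (0 + prim 0 b t) + (2 + prim 0 (%t. - (1 / h)) t) * b t) h =
 (2 + prim 0 (%t. - (1 / h)) h) * (0 + prim 0 b h) - 2 * 0"
 by (rule prim_product(2)[OF bounded_bilinear_mult one ib]) (use h in auto)
 also have "prim 0 (%t. - (1 / h) * (0 + prim 0 b t) + (2 + prim 0 (%t. - (1 / h)) t) * b t) h =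
 (LINT t|M. 2 * ((2 - t / h) * (P t *I p t)) - (1 / h) * (norm (P t))^2)"
 unfolding LL_prim[symmetric, where l=0 and r=h] M_def
 by (rule int_cong[OF refl])
 (auto simp: beq prim_const b_def inner_commute algebra_simps)
 also have "(2 + prim 0 (%t. - (1 / h)) h) * (0 + prim 0 b h) - 2 * 0 = (norm (P h))^2"
 using h beq[of h] by (simp add: prim_const)
 finally have I: "(LINT t|M. 2 * ((2 - t / h) * (P t *I p t)) - (1 / h) * (norm (P t))^2) = (norm (P h))^2" .
 have iPp: "intg M (%t. (2 - t / h) * (P t *I p t))" by (rule iw[OF sqi_inner[OF sP sp]])
 have iP2: "intg M (%t. (norm (P t))^2)" by (rule sqi_norm2[OF sP])
 have I2: "(LINT t|M. (2 - t / h) * (P t *I p t)) = (norm (P h))^2 / 2 + n2 M P / (2 * h)"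
 proof -
 define X where "X = (LINT t|M. (2 - t / h) * (P t *I p t))"
 have "(LINT t|M. 2 * ((2 - t / h) * (P t *I p t)) - (1 / h) * (norm (P t))^2) =
 (LINT t|M. 2 * ((2 - t / h) * (P t *I p t))) - (LINT t|M. (1 / h) * (norm (P t))^2)"
 by (rule int_diff[OF intg_mult[OF iPp] intg_mult[OF iP2]])
 also have "... = 2 * X - (1 / h) * n2 M P"
 unfolding X_def n2_def by (simp only: integral_mult_right_zero)
 finally have "2 * X - (1 / h) * n2 M P = (norm (P h))^2" using I by simp
 thus ?thesis unfolding X_def[symmetric] using h by (simp add: field_simps)
 qed
 have inp: "intg M (%t. norm (p t))" using ipM by (simp add: M_def)
 have ic: "intg M (%t. c)" for c :: real by (rule fm_intg_const[OF fin])
 \<comment> \<open>A lower bound of the integrand: the main term with frozen coefficient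
   \<open>k\<close>, then the two terms from Young's inequality for \<open>P t *I p0\<close>, then
   the commutator against \<open>p t\<close> and \<open>p0\<close> with the weight bounded by
   2.\<close>
 define F where "F t = k * ((2 - t / h) * (P t *I p t)) - k / (2 * h) * (norm (P t))^2 - 2 * h * k * (norm p0)^2
 - 2 * L * h * N * norm (p t) - 2 * L * h * N * norm p0" for t
 have "(LINT t|M. F t) <= (LINT t|M. (2 - t / h) * (Q t *I (p t - p0)))"
 proof (rule int_mono_AE)
 show "intg M F" unfolding F_def
 by (intro intg_diff intg_mult iPp iP2 inp ic)
 show "intg M (%t. (2 - t / h) * (Q t *I (p t - p0)))"
 by (rule iw[OF sqi_inner[OF sQ sqi_diff[OF sp sc]]])
 show "AE t in M. F t <= (2 - t / h) * (Q t *I (p t - p0))"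
 using AE_space
 proof eventually_elim
 case (elim t)
 hence t: "0 < t" "t < h" by (auto simp: M_def)
 define m where "m = 2 - t / h"
 have "t : {0<..<h}" using t by simp
 hence m: "0 <= m" "m <= 2" unfolding m_def using wt2[of t] by linarith+
 define x where "x = norm (P t)"
 define y where "y = norm p0"
 have "norm (Q t - k *R P t) <= L * (t - 0) * prim 0 (%s. norm (p s)) t"
 unfolding Q_def P_def k_def by (rule prim_commutator[OF ip iwp]) (use t h in auto)
 also have "... <= L * h * N"
 unfolding N_def
 proof (rule mult_mono)
 show "prim 0 (%s. norm (p s)) t <= prim 0 (%s. norm (p s)) h"
 by (rule prim_mono[OF integrable_norm[OF ip]]) (use t h in auto)
 show "0 <= prim 0 (%s. norm (p s)) t" by (rule prim_nonneg) simp
 qed (use t h L in "auto intro!: mult_left_mono")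
 finally have E: "norm (Q t - k *R P t) <= L * h * N" .
 have LN: "0 <= L * h * N" using E norm_ge_zero order_trans by blast
 have "\<bar>(Q t - k *R P t) *I (p t - p0)\<bar> <= norm (Q t - k *R P t) * norm (p t - p0)" by (rule Cauchy_Schwarz_ineq2)
 also have "... <= L * h * N * (norm (p t) + y)"
 by (rule mult_mono[OF E]) (use LN norm_triangle_ineq4[of "p t" p0] in "auto simp: y_def")
 finally have e1: "\<bar>(Q t - k *R P t) *I (p t - p0)\<bar> <= L * h * N * (norm (p t) + y)" .
 have "m * \<bar>(Q t - k *R P t) *I (p t - p0)\<bar> <= 2 * (L * h * N * (norm (p t) + y))"
 by (rule mult_mono[OF m(2) e1]) auto
 hence e2: "m * ((Q t - k *R P t) *I (p t - p0)) >= - (2 * (L * h * N * (norm (p t) + y)))"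
 using m(1) by (metis abs_le_iff abs_mult abs_of_nonneg minus_le_iff)
 have "m * (P t *I p0) <= 2 * (x * y)"
 proof -
 have "P t *I p0 <= x * y" unfolding x_def y_def by (rule norm_cauchy_schwarz)
 hence "m * (P t *I p0) <= m * (x * y)" using m by (intro mult_left_mono)
 also have "... <= 2 * (x * y)" by (rule mult_r_mono[OF m(2)]) (simp add: x_def y_def)
 finally show ?thesis .
 qed
 also have "2 * (x * y) <= x^2 / (2 * h) + 2 * h * y^2"
 proof -
 have "0 <= (x - 2 * h * y)^2 / (2 * h)" using h by simp
 also have "... = x^2 / (2 * h) + 2 * h * y^2 - 2 * (x * y)"
 using h by (simp add: power2_eq_square field_simps)
 finally show ?thesis by simp
 qed
 finally have "k * (m * (P t *I p0)) <= k * (x^2 / (2 * h) + 2 * h * y^2)"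
 using k(3) by (intro mult_left_mono) auto
 hence e3: "k * (m * (P t *I p0)) <= k / (2 * h) * x^2 + 2 * h * k * y^2" by (simp add: algebra_simps)
 have "m * (Q t *I (p t - p0)) = m * ((Q t - k *R P t) *I (p t - p0)) + k * (m * (P t *I p t)) - k * (m * (P t *I p0))"
 by (simp add: inner_diff_left inner_diff_right algebra_simps)
 thus ?case
 using e2 e3 by (simp add: F_def m_def[symmetric] x_def[symmetric] y_def[symmetric] algebra_simps)
 qed
 qed
 \<comment> \<open>The multiple of \<open>n2 M P\<close> produced by the weight cancels the one
   spent in Young's inequality.\<close>
 moreover have "(LINT t|M. F t) = k * ((norm (P h))^2 / 2 + n2 M P / (2 * h)) - k / (2 * h) * n2 M P - 2 * h * k * (norm p0)^2 * h
 - 2 * L * h * N * N - 2 * L * h * N * norm p0 * h"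
 proof -
 have NM: "(LINT t|M. norm (p t)) = N" by (simp add: N_def M_def LL_prim)
 have "(LINT t|M. F t) = (LINT t|M. k * ((2 - t / h) * (P t *I p t))) - (LINT t|M. k / (2 * h) * (norm (P t))^2)
 - (LINT t|M. 2 * h * k * (norm p0)^2) - (LINT t|M. 2 * L * h * N * norm (p t)) - (LINT t|M. 2 * L * h * N * norm p0)"
 unfolding F_def
 by (subst int_diff,
 (intro intg_diff intg_mult iPp iP2 inp ic)+)+ simp
 also have "... = k * (LINT t|M. (2 - t / h) * (P t *I p t)) - k / (2 * h) * n2 M P
 - 2 * h * k * (norm p0)^2 * h - 2 * L * h * N * N - 2 * L * h * N * norm p0 * h"
 using NM mM by (simp add: n2_def)
 finally show ?thesis unfolding I2 .
 qed
 ultimately have main: "k * (norm (P h))^2 / 2 - 2 * h^2 * k * (norm p0)^2 - 2 * L * h * (N * N + N * (h * norm p0)) <=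
 (LINT t|M. (2 - t / h) * (Q t *I (p t - p0)))"
 by (simp add: algebra_simps power2_eq_square)
 have "N^2 <= (h - 0) * n2 (LL 0 h) p" unfolding N_def
 by (rule norm_prim_squared_le(2)) (use sp h in "auto simp: M_def")
 also have "... <= h * n2 (LL 0 T) p" using n2_LL_mono[OF p, of 0 h] h by simp
 finally have N2: "N * N <= h * n2 (LL 0 T) p" by (simp add: power2_eq_square)
 have "N * (h * norm p0) <= N * N / 2 + h * h * (norm p0)^2 / 2"
 using sum_squares_bound[of N "h * norm p0"] by (simp add: power2_eq_square algebra_simps)
 hence "N * N + N * (h * norm p0) <= 3 / 2 * (h * n2 (LL 0 T) p) + h * h * (norm p0)^2 / 2" using N2 by simp
 hence "2 * L * h * (N * N + N * (h * norm p0)) <= 2 * L * h * (3 / 2 * (h * n2 (LL 0 T) p) + h * h * (norm p0)^2 / 2)"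
 using L h by (intro mult_left_mono) auto
 hence e1: "2 * L * h * (N * N + N * (h * norm p0)) <= h^2 * (3 * L * n2 (LL 0 T) p + L * h * (norm p0)^2)"
 by (simp add: algebra_simps power2_eq_square)
 have "h^2 * k * (norm p0)^2 <= h^2 * A * (norm p0)^2" using k by (intro mult_r_mono mult_left_mono) auto
 moreover have "al * (norm (P h))^2 <= k * (norm (P h))^2" using k by (intro mult_r_mono) auto
 ultimately show "al / 2 * (norm (prim 0 p h))^2 - h^2 * (2 * A * (norm p0)^2 + 3 * L * n2 (LL 0 T) p + L * h * (norm p0)^2) <=
 (LINT t|LL 0 h. (2 - t / h) * (prim 0 (%s. w s *R p s) t *I (p t - p0)))"
 using main e1 unfolding P_def[symmetric] Q_def[symmetric] M_def[symmetric] by (simp add: algebra_simps)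
qed

end

section \<open>The space-time cylinder as a product\<close>

text \<open>A product measure, so that Fubini's theorem applies directly. In general it is not
  complete, whereas the norms refer to Lebesgue measure on the cylinder; the two have to be
  compared.\<close>

abbreviation QM :: "real => (real \<times> real) measure" where
 "QM T == LL 0 T \<Otimes>\<^sub>M LI"

abbreviation (input) sqQ where "sqQ T f == sqi (QM T) (case_prod f)"
abbreviation (input) nQ where "nQ T f == n2 (QM T) (case_prod f)"
abbreviation (input) bmQ where "bmQ T == borel_measurable (QM T)"

lemma psf_LL: "pair_sigma_finite (LL l r) (LL l' r')"
 by (intro pair_sigma_finite.intro finite_measure.axioms(1) fin_LL)

lemma finite_measure_QM: "finite_measure (QM T)"
proof -
 interpret A: finite_measure "LL 0 T" by (rule fin_LL)
 interpret B: finite_measure "LI" by (rule fin_LL)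
 show ?thesis by (rule finite_measure_pair_measure) unfold_locales
qed

lemma space_QM: "space (QM T) = QT T"
 by (simp add: space_pair_measure QT_def)

lemma measurable_id_LL: "(%x. x) : bm (LL l r)"
 using id_borel_measurable_lebesgue_on[unfolded id_def] .

lemma measurable_id_QM: "(%p. p) : bmQ T"
proof -
 have "(%p. (fst p, snd p)) : QM T \<rightarrow>\<^sub>M borel \<Otimes>\<^sub>M borel"
 by (intro measurable_Pair m_comp[OF measurable_fst measurable_id_LL]
 m_comp[OF measurable_snd measurable_id_LL])
 thus ?thesis by (simp add: borel_prod)
qed

lemma borel_bmQ: "f : bm borel ==> f : bmQ T"
proof -
 assume f: "f : bm borel"
 from m_comp[OF measurable_id_QM f] show ?thesis by simp
qed

lemma QT_borel[measurable]: "QT T : sets borel"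
 unfolding QT_def by (intro borel_open open_Times) auto

section \<open>Comparison with Lebesgue measure on the cylinder\<close>

lemma emeasure_QM:
 assumes B: "B : sets borel" "B \<subseteq> QT T"
 shows "emeasure (QM T) B = emeasure lborel B"
proof -
 interpret F: finite_measure "LI" by (rule fin_LL)
 have BQ: "B : sets (QM T)"
 proof -
 have "(%p. p) -` B \<inter> space (QM T) : sets (QM T)" by (rule measurable_sets[OF measurable_id_QM B(1)])
 moreover have "(%p. p) -` B \<inter> space (QM T) = B" using B(2) by (auto simp: space_QM)
 ultimately show ?thesis by simp
 qed
 have Bl: "B : sets (lborel \<Otimes>\<^sub>M lborel)" using B(1) by (simp only: lborel_prod sets_lborel)
 have sl: "Pair t -` B : sets borel" for t using sets_Pair1[OF Bl, of t] by simp
 have sub: "Pair t -` B \<subseteq> {0<..<1}" "t \<notin> {0<..<T} ==> Pair t -` B = {}" for t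
 using B(2) by (auto simp: QT_def)
 have eq: "emeasure LI (Pair t -` B) = emeasure lborel (Pair t -` B)" for t
 using sl[of t] sub(1)[of t] by (subst emeasure_restrict_space) (auto simp: emeasure_completion)
 have m: "(%t. emeasure lborel (Pair t -` B)) : bm lborel"
 using lborel.measurable_emeasure_Pair[OF Bl] .
 have "emeasure (QM T) B = (\<integral>\<^sup>+t. emeasure lborel (Pair t -` B) \<partial>LL 0 T)"
 by (subst F.emeasure_pair_measure_alt[OF BQ]) (simp add: eq)
 also have "... = (\<integral>\<^sup>+t. emeasure lborel (Pair t -` B) * indicator {0<..<T} t \<partial>lebesgue)"
 by (rule nn_integral_restrict_space) auto
 also have "... = (\<integral>\<^sup>+t. emeasure lborel (Pair t -` B) \<partial>lebesgue)"
 by (rule nn_integral_cong) (use sub(2) in "auto simp: indicator_def")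
 also have "... = (\<integral>\<^sup>+t. emeasure lborel (Pair t -` B) \<partial>lborel)"
 by (rule nn_integral_completion)
 also have "... = emeasure (lborel \<Otimes>\<^sub>M lborel) B"
 by (rule lborel.emeasure_pair_measure_alt[OF Bl, symmetric])
 finally show ?thesis by (simp add: lborel_prod)
qed

lemma distr_QM: "distr (leb (QT T)) borel (%p. p) = distr (QM T) borel (%p. p)"
proof (rule measure_eqI)
 have m: "(%p. p) : bm (leb (QT T))"
 using id_borel_measurable_lebesgue_on[unfolded id_def] .
 fix B assume "B : sets (distr (leb (QT T)) borel (%p. p))"
 hence B: "B : sets borel" by simp
 have BQ: "B \<inter> QT T : sets borel" using B by simp
 have "emeasure (distr (leb (QT T)) borel (%p. p)) B = emeasure (leb (QT T)) (B \<inter> QT T)"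
 by (subst emeasure_distr[OF m B]) simp
 also have "... = emeasure lborel (B \<inter> QT T)"
 using BQ by (subst emeasure_restrict_space) (auto simp: emeasure_completion)
 also have "... = emeasure (QM T) (B \<inter> QT T)" by (rule emeasure_QM[symmetric, OF BQ]) auto
 also have "... = emeasure (distr (QM T) borel (%p. p)) B"
 by (subst emeasure_distr[OF measurable_id_QM B]) (simp add: space_QM)
 finally show "emeasure (distr (leb (QT T)) borel (%p. p)) B = emeasure (distr (QM T) borel (%p. p)) B" .
qed simp

text \<open>A Lebesgue null set is contained in a Borel null set, and the two measures agree on
  Borel subsets of the cylinder.\<close>

lemma AE_lebesgue_on_QT:
 assumes "AE p in leb (QT T). P p"
 shows "AE p in QM T. P p"
proof -
 have "AE p in lebesgue. p : QT T --> P p"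
 using assms by (subst (asm) AE_restrict_space_iff) auto
 hence "AE p in lborel. p : QT T --> P p" by (simp add: AE_completion_iff)
 then obtain N where N: "{p : space lborel. \<not> (p : QT T --> P p)} \<subseteq> N" "emeasure lborel N = 0" "N : sets lborel"
 by (rule AE_E)
 have N': "N \<inter> QT T : sets borel" using N(3) by simp
 have "emeasure lborel (N \<inter> QT T) <= emeasure lborel N" by (rule emeasure_mono) (use N(3) in auto)
 hence "emeasure (QM T) (N \<inter> QT T) = 0" using emeasure_QM[OF N'] N(2) by simp
 moreover have "N \<inter> QT T : sets (QM T)"
 using measurable_sets[OF measurable_id_QM N', of T] by (simp add: space_QM inf_assoc)
 ultimately have "N \<inter> QT T : null_sets (QM T)" by auto
 thus ?thesis by (rule AE_I') (use N(1) in "auto simp: space_QM")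
qed

lemma AE_QM_fst: "AE p in QM T. P p ==> AE t in LL 0 T. AE x in LI. P (t, x)"
 by (rule pair_sigma_finite.AE_pair[OF psf_LL])

lemma AE_QM_snd:
 assumes "AE p in QM T. P p"
 shows "AE x in LI. AE t in LL 0 T. P (t, x)"
proof -
 interpret P: pair_sigma_finite "LI" "LL 0 T" by (rule psf_LL)
 interpret P': pair_sigma_finite "LL 0 T" "LI" by (rule psf_LL)
 have "AE p in distr (LI \<Otimes>\<^sub>M LL 0 T) (QM T) (%(x, y). (y, x)). P p"
 using assms by (simp only: P'.distr_pair_swap[symmetric])
 hence "AE p in LI \<Otimes>\<^sub>M LL 0 T. P (case p of (x, y) => (y, x))"
 by (rule AE_distrD[rotated]) (rule measurable_pair_swap')
 from P.AE_pair[OF this] show ?thesis by simp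
qed

lemma integral_QM_borel:
 fixes f :: "real \<times> real => 'b::euclidean_space"
 assumes f: "f : bm borel"
 shows "intg (QM T) f \<longleftrightarrow> intg (leb (QT T)) f" "integral\<^sup>L (QM T) f = integral\<^sup>L (leb (QT T)) f"
proof -
 have m: "(%p. p) : bm (leb (QT T))"
 using id_borel_measurable_lebesgue_on[unfolded id_def] .
 show "intg (QM T) f \<longleftrightarrow> intg (leb (QT T)) f"
 using integrable_distr_eq[OF measurable_id_QM f, of T] integrable_distr_eq[OF m f] by (simp add: distr_QM)
 show "integral\<^sup>L (QM T) f = integral\<^sup>L (leb (QT T)) f"
 using integral_distr[OF measurable_id_QM f, of T] integral_distr[OF m f] by (simp add: distr_QM)
qed

text \<open>Passing to a Borel function makes slices and Fubini's theorem available for functions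
  that are only Lebesgue measurable on the plane.\<close>

lemma lebesgue_borel_representative:
 fixes f :: "'a::euclidean_space => 'b::euclidean_space"
 assumes f: "f : bm (leb S)" and S: "S : sets lebesgue"
 shows "EX g:bm borel. AE x in leb S. f x = g x"
proof -
 have F: "(%x. if x : S then f x else 0) : bm lebesgue" by (rule borel_measurable_if_I[OF f S])
 have "EX g:bm lborel. AE x in lborel. (if x : S then f x else 0) *I i = (g x :: real)" for i
 proof (rule completion_ex_borel_measurable_real)
 show "(%x. (if x : S then f x else 0) *I i) : bm lebesgue" using F by measurable
 qed
 then obtain g where g: "!!i. g i : bm lborel"
 "!!i. AE x in lborel. (if x : S then f x else 0) *I i = (g i x :: real)" by metis
 define h where "h x = (\<Sum>i\<in>Basis. g i x *R i :: 'b)" for x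
 have "h : bm borel" unfolding h_def using g(1) by measurable
 moreover have "AE x in lborel. ALL i:Basis. (if x : S then f x else 0) *I (i::'b) = g i x"
 using g(2) by (intro AE_finite_allI) auto
 hence "AE x in lborel. x : S --> f x = h x"
 proof eventually_elim
 case (elim x)
 show ?case
 proof
 assume "x : S"
 hence "h x = (\<Sum>i\<in>Basis. (f x *I i) *R i)" unfolding h_def using elim by (intro sum.cong) auto
 thus "f x = h x" by (simp add: euclidean_representation)
 qed
 qed
 hence "AE x in leb S. f x = h x"
 using S by (subst AE_restrict_space_iff) (auto simp: AE_completion_iff)
 ultimately show ?thesis by blast
qed

text \<open>For completed sigma-algebras Borel measurability is not sufficient: null sets must also
  pull back to null sets. The preimage of a null set under a projection is a strip, which is
  null.\<close>

lemma measurable_proj_lebesgue: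
 "fst : (lebesgue :: (real \<times> real) measure) \<rightarrow>\<^sub>M (lebesgue :: real measure)"
 "snd : (lebesgue :: (real \<times> real) measure) \<rightarrow>\<^sub>M (lebesgue :: real measure)"
proof -
 have null: "N \<times> UNIV : null_sets (lborel :: (real \<times> real) measure)" "UNIV \<times> N : null_sets (lborel :: (real \<times> real) measure)"
 if "N : null_sets lborel" for N :: "real set"
 proof -
 have N: "N : sets lborel" "emeasure lborel N = 0" using that by auto
 have "emeasure (lborel \<Otimes>\<^sub>M lborel) (N \<times> UNIV) = 0" "emeasure (lborel \<Otimes>\<^sub>M lborel) ((UNIV::real set) \<times> N) = 0"
 using N by (simp_all add: lborel.emeasure_pair_measure_Times)
 moreover have "N \<times> UNIV : sets (lborel \<Otimes>\<^sub>M lborel)" "(UNIV::real set) \<times> N : sets (lborel \<Otimes>\<^sub>M lborel)"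
 using N by auto
 ultimately have "N \<times> UNIV : null_sets (lborel \<Otimes>\<^sub>M lborel)" "(UNIV::real set) \<times> N : null_sets (lborel \<Otimes>\<^sub>M lborel)"
 by (auto intro!: null_setsI)
 thus "N \<times> UNIV : null_sets (lborel :: (real \<times> real) measure)" "UNIV \<times> N : null_sets (lborel :: (real \<times> real) measure)"
 unfolding lborel_prod by auto
 qed
 have *: "h -` A : sets (lebesgue :: (real \<times> real) measure)"
 if h: "h : bm borel" "!!N. N : null_sets lborel ==> h -` N : null_sets (lborel :: (real \<times> real) measure)"
 and A: "A : sets lebesgue" for h :: "real \<times> real => real" and A
 proof -
 obtain S N N' where S: "A = S \<union> N" "N \<subseteq> N'" "N' : null_sets lborel" "S : sets lborel"
 using sets_completionE[OF A] by metis
 show ?thesis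
 proof (rule sets_completionI[of _ "h -` S" "h -` N" "h -` N'"])
 show "h -` S : sets lborel" using measurable_sets[OF h(1), of S] S(4) by simp
 qed (use S h(2) in auto)
 qed
 have b: "(fst :: real \<times> real => real) : bm borel" "(snd :: real \<times> real => real) : bm borel"
 by (intro bm_cont continuous_intros)+
 have 1: "fst -` N = N \<times> UNIV" "snd -` N = UNIV \<times> N" for N :: "real set" by auto
 show "fst : (lebesgue :: (real \<times> real) measure) \<rightarrow>\<^sub>M (lebesgue :: real measure)"
 by (rule measurableI) (use *[OF b(1)] null in "auto simp: 1")
 show "snd : (lebesgue :: (real \<times> real) measure) \<rightarrow>\<^sub>M (lebesgue :: real measure)"
 by (rule measurableI) (use *[OF b(2)] null in "auto simp: 1")
qed

lemma measurable_QM_imp_lebesgue: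
 "f : bmQ T ==> f : bm (leb (QT T))"
proof -
 assume f: "f : bmQ T"
 have "(%p. (fst p, snd p)) : leb (QT T) \<rightarrow>\<^sub>M QM T"
 by (rule measurable_Pair; rule measurable_restrict_space3[OF measurable_proj_lebesgue(1)] measurable_restrict_space3[OF measurable_proj_lebesgue(2)])
 (auto simp: QT_def)
 from m_comp[OF this f] show ?thesis by simp
qed

lemma sqi_QM_of_L2_norm:
 fixes f :: "real => real => 'b::euclidean_space"
 assumes "L2_norm (QT T) (cp f) < \<infinity>"
 shows "EX g. sqQ T g & (AE p in leb (QT T). cp f p = cp g p) &
 L2_norm (QT T) (cp f) = ereal (sqrt (nQ T g))"
proof -
 have f: "sqi (leb (QT T)) (cp f)" using assms L2_norm_less_top_iff by blast
 obtain g where g: "g : bm borel" "AE p in leb (QT T). cp f p = g p"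
 using lebesgue_borel_representative[OF sqi_meas[OF f]] QT_borel[of T] by auto
 have mg: "g : bm (leb (QT T))"
 by (rule measurable_QM_imp_lebesgue[OF borel_bmQ[OF g(1)]])
 have sg: "sqi (leb (QT T)) g" by (rule sqi_cong[OF g(2) f mg])
 have gn: "(%p. (norm (g p))^2) : bm borel" using g(1) by measurable
 have "sqi (QM T) g"
 using sg integral_QM_borel(1)[OF gn] borel_bmQ[OF g(1)] by (simp add: sqi_def)
 moreover have "n2 (QM T) g = n2 (leb (QT T)) (cp f)"
 using integral_QM_borel(2)[OF gn, of T] n2_cong[OF g(2) sqi_meas[OF f] mg] by (simp add: n2_def)
 moreover have "cp (curry g) = g" by auto
 ultimately show ?thesis
 using g(2) L2_norm_eq[OF f] by (intro exI[of _ "curry g"]) auto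
qed

section \<open>Slices of square-integrable functions\<close>

lemma QM_integral:
 fixes f :: "real => real => 'b::euclidean_space"
 assumes "intg (QM T) (cp f)"
 shows "AE t in LL 0 T. intg LI (f t)" "AE x in LI. intg (LL 0 T) (%t. f t x)"
 "intg (LL 0 T) (%t. LINT x|LI. f t x)" "intg LI (%x. LINT t|LL 0 T. f t x)"
 "integral\<^sup>L (QM T) (cp f) = (LINT t|LL 0 T. LINT x|LI. f t x)"
 "integral\<^sup>L (QM T) (cp f) = (LINT x|LI. LINT t|LL 0 T. f t x)"
proof -
 interpret P: pair_sigma_finite "LL 0 T" "LI" by (rule psf_LL)
 show "AE t in LL 0 T. intg LI (f t)" "AE x in LI. intg (LL 0 T) (%t. f t x)"
 "intg (LL 0 T) (%t. LINT x|LI. f t x)" "intg LI (%x. LINT t|LL 0 T. f t x)"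
 "integral\<^sup>L (QM T) (cp f) = (LINT t|LL 0 T. LINT x|LI. f t x)"
 "integral\<^sup>L (QM T) (cp f) = (LINT x|LI. LINT t|LL 0 T. f t x)"
 using P.AE_integrable_fst[OF assms] P.AE_integrable_snd[OF assms] P.integrable_fst[OF assms] P.integrable_snd[OF assms]
 P.integral_fst[OF assms] P.integral_snd[OF assms] by simp_all
qed

lemma QM_slice_measurable:
 assumes "cp f : bmQ T"
 shows "t : {0<..<T} ==> f t : bm LI" "x : {0<..<1} ==> (%t. f t x) : bm (LL 0 T)"
proof -
 show "f t : bm LI" if "t : {0<..<T}"
 using m_comp[OF measurable_Pair1'[of t "LL 0 T" "LI"] assms] that by simp
 show "(%t. f t x) : bm (LL 0 T)" if "x : {0<..<1}"
 using m_comp[OF measurable_Pair2'[of x "LI" "LL 0 T"] assms] that by simp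
qed

lemma slices:
 fixes f :: "real => real => 'b::euclidean_space"
 assumes f: "sqQ T f"
 shows "AE t in LL 0 T. sqi LI (f t)" "AE x in LI. sqi (LL 0 T) (%t. f t x)"
 "intg (LL 0 T) (%t. n2 LI (f t))" "intg LI (%x. n2 (LL 0 T) (%t. f t x))"
 "nQ T f = (LINT t|LL 0 T. n2 LI (f t))"
 "nQ T f = (LINT x|LI. n2 (LL 0 T) (%t. f t x))"
proof -
 have i: "intg (QM T) (cp (%t x. (norm (f t x))^2))"
 using sqi_norm2[OF f] by (simp add: split_def)
 note Q = QM_integral[OF i] and m = QM_slice_measurable[OF sqi_meas[OF f]]
 show "AE t in LL 0 T. sqi LI (f t)"
 using Q(1) AE_space by eventually_elim (use m in "simp add: sqi_def")
 show "AE x in LI. sqi (LL 0 T) (%t. f t x)"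
 using Q(2) AE_space by eventually_elim (use m in "simp add: sqi_def")
 show "intg (LL 0 T) (%t. n2 LI (f t))" "intg LI (%x. n2 (LL 0 T) (%t. f t x))"
 using Q(3,4) by (simp_all add: n2_def)
 show "nQ T f = (LINT t|LL 0 T. n2 LI (f t))"
 "nQ T f = (LINT x|LI. n2 (LL 0 T) (%t. f t x))"
 using Q(5,6) by (simp_all add: n2_def split_def)
qed

text \<open>Tonelli's theorem. Through this lemma one-dimensional estimates in time, proved for
  almost every \<open>x\<close>, become estimates on the cylinder.\<close>

lemma sqi_QM_if_slices:
 fixes f :: "real => real => 'b::euclidean_space"
 assumes m: "cp f : bmQ T"
 and B: "intg LI B" "AE x in LI. sqi (LL 0 T) (%t. f t x) & n2 (LL 0 T) (%t. f t x) <= B x"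
 shows "sqQ T f" "nQ T f <= integral\<^sup>L LI B"
proof -
 interpret P: pair_sigma_finite "LI" "LL 0 T" by (rule psf_LL)
 have m2: "(%(x, t). (norm (f t x))^2) : bm (LI \<Otimes>\<^sub>M LL 0 T)"
 using m_comp[OF measurable_pair_swap' m] by (simp add: split_def)
 have n2m: "(%x. n2 (LL 0 T) (%t. f t x)) : bm LI"
 unfolding n2_def by (rule P.M2.borel_measurable_lebesgue_integral[OF m2])
 have "intg (LI \<Otimes>\<^sub>M LL 0 T) (%(x, t). (norm (f t x))^2)"
 proof (rule P.Fubini_integrable[OF m2])
 have "intg LI (%x. n2 (LL 0 T) (%t. f t x))"
 proof (rule intg_bound[OF B(1) n2m])
 show "AE x in LI. norm (n2 (LL 0 T) (%t. f t x)) <= norm (B x)"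
 using B(2) by eventually_elim auto
 qed
 thus "intg LI (%x. LINT y|LL 0 T. norm (case (x, y) of (x, t) => (norm (f t x))^2))"
 by (simp add: n2_def)
 show "AE x in LI. intg (LL 0 T) (%y. case (x, y) of (x, t) => (norm (f t x))^2)"
 using B(2) by eventually_elim (simp add: sqi_def)
 qed
 hence "intg (QM T) (%(t, x). (norm (f t x))^2)"
 using P.integrable_product_swap[of "%(x, t). (norm (f t x))^2"] by simp
 thus s: "sqQ T f" using m by (simp add: sqi_def split_def)
 show "nQ T f <= integral\<^sup>L LI B"
 unfolding slices(6)[OF s]
 by (rule int_mono_AE[OF slices(4)[OF s] B(1)]) (use B(2) in "eventually_elim, auto")
qed

text \<open>The variable upper limit is encoded by the indicator of \<open>s < t\<close>, which
  turns the primitive into an ordinary parameter integral.\<close>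

lemma measurable_prim_QM:
 fixes f :: "real => real => 'b::euclidean_space"
 assumes f: "cp f : bmQ T"
 shows "(%(t, x). prim 0 (%s. f s x) t) : bmQ T"
proof -
 interpret finite_measure "LL 0 T" by (rule fin_LL)
 have 1: "(%z. (snd z, snd (fst z))) : QM T \<Otimes>\<^sub>M LL 0 T \<rightarrow>\<^sub>M QM T" by measurable
 have 2: "(%z. f (snd z) (snd (fst z))) : bm (QM T \<Otimes>\<^sub>M LL 0 T)"
 using m_comp[OF 1 f] by (simp add: split_def)
 have 3: "(%z. fst (fst z)) : bm (QM T \<Otimes>\<^sub>M LL 0 T)" "(%z. snd z) : bm (QM T \<Otimes>\<^sub>M LL 0 T)"
 by (rule m_comp[OF _ measurable_id_LL]; measurable)+
 have 4: "{z : space (QM T \<Otimes>\<^sub>M LL 0 T). snd z < fst (fst z)} : sets (QM T \<Otimes>\<^sub>M LL 0 T)"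
 by (rule borel_measurable_less[OF 3(2,1)])
 have "(%z. indicator {z : space (QM T \<Otimes>\<^sub>M LL 0 T). snd z < fst (fst z)} z *R f (snd z) (snd (fst z))) : bm (QM T \<Otimes>\<^sub>M LL 0 T)"
 by (intro bm_scal borel_measurable_indicator 4 2)
 hence "(%p. LINT s|LL 0 T. indicator {z : space (QM T \<Otimes>\<^sub>M LL 0 T). snd z < fst (fst z)} (p, s) *R f s (snd p)) : bmQ T"
 by (intro borel_measurable_lebesgue_integral) (simp add: split_def)
 thus ?thesis
 proof (rule measurable_cong[THEN iffD1, rotated])
 fix p assume p: "p : space (QM T)"
 hence "(LINT s|LL 0 T. indicator {z : space (QM T \<Otimes>\<^sub>M LL 0 T). snd z < fst (fst z)} (p, s) *R f s (snd p)) =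
 (LINT s|LL 0 T. indicator {..<fst p} s *R f s (snd p))"
 by (intro int_cong refl) (auto simp: space_pair_measure indicator_def)
 also have "... = prim 0 (%s. f s (snd p)) (fst p)"
 by (rule prim_indicator[symmetric]) (use p in "auto simp: space_pair_measure")
 finally show "(LINT s|LL 0 T. indicator {z : space (QM T \<Otimes>\<^sub>M LL 0 T). snd z < fst (fst z)} (p, s) *R f s (snd p)) =
 (case p of (t, x) => prim 0 (%s. f s x) t)" by (simp add: split_def)
 qed
qed

lemma sqi_prim_QM:
 fixes f :: "real => real => 'b::euclidean_space"
 assumes f: "sqQ T f" and "0 <= T"
 shows "sqi (QM T) (%(t, x). prim 0 (%s. f s x) t)"
proof (rule sqi_QM_if_slices(1)[OF measurable_prim_QM[OF sqi_meas[OF f]]])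
 show "intg LI (%x. T^2 * n2 (LL 0 T) (%t. f t x))" using slices(4)[OF f] by simp
 show "AE x in LI. sqi (LL 0 T) (%t. prim 0 (%s. f s x) t) & n2 (LL 0 T) (%t. prim 0 (%s. f s x) t) <= T^2 * n2 (LL 0 T) (%t. f t x)"
 using slices(2)[OF f]
 by eventually_elim (use n2_prim_le[of T _ T] assms(2) in auto)
qed

lemma measurable_shift: "0 <= h ==> (%t. t + h) : LL 0 (T - h) \<rightarrow>\<^sub>M LL 0 T"
 and measurable_inclusion: "h <= T ==> (%t. t) : LL 0 h \<rightarrow>\<^sub>M LL 0 T"
proof -
 have "(%t::real. h + (\<Sum>j\<in>Basis. (1 * (t *I j)) *R j)) : lebesgue \<rightarrow>\<^sub>M lebesgue"
 by (rule lebesgue_affine_measurable) simp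
 hence *: "(%t::real. t + h) : lebesgue \<rightarrow>\<^sub>M lebesgue" by (simp add: add.commute)
 show "0 <= h ==> (%t. t + h) : LL 0 (T - h) \<rightarrow>\<^sub>M LL 0 T"
 by (rule measurable_restrict_space3[OF *]) auto
 show "h <= T ==> (%t. t) : LL 0 h \<rightarrow>\<^sub>M LL 0 T"
 by (rule measurable_restrict_space3) auto
qed

lemma measurable_QM_shift:
 assumes f: "cp f : bmQ T"
 shows "0 <= h ==> (%(t, x). f (t + h) x) : bm (QM (T - h))"
 "h <= T ==> cp f : bm (QM h)"
proof -
 show "(%(t, x). f (t + h) x) : bm (QM (T - h))" if "0 <= h"
 proof -
 have "(%p. (fst p + h, snd p)) : QM (T - h) \<rightarrow>\<^sub>M QM T"
 by (intro measurable_Pair m_comp[OF measurable_fst measurable_shift[OF that]] measurable_snd)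
 from m_comp[OF this f] show ?thesis by (simp add: split_def)
 qed
 show "cp f : bm (QM h)" if "h <= T"
 proof -
 have "(%p. (fst p, snd p)) : QM h \<rightarrow>\<^sub>M QM T"
 by (intro measurable_Pair m_comp[OF measurable_fst measurable_inclusion[OF that]] measurable_snd)
 from m_comp[OF this f] show ?thesis by (simp add: split_def)
 qed
qed

lemma sqi_QM_subset:
 fixes f :: "real => real => 'b::euclidean_space"
 assumes f: "sqQ T f" and h: "0 <= h" "h <= T"
 shows "sqQ h f" "nQ h f <= nQ T f"
 "sqi (QM (T - h)) (%(t, x). f (t + h) x)" "n2 (QM (T - h)) (%(t, x). f (t + h) x) <= nQ T f"
proof -
 have B: "AE x in LI. sqi (LL 0 h) (%t. f t x) & n2 (LL 0 h) (%t. f t x) <= n2 (LL 0 T) (%t. f t x)"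
 using slices(2)[OF f]
 by eventually_elim (use h in "auto intro!: sqi_LL_subset[of 0 T] n2_LL_mono")
 show "sqQ h f"
 by (rule sqi_QM_if_slices(1)[OF measurable_QM_shift(2)[OF sqi_meas[OF f] h(2)] slices(4)[OF f] B])
 show "nQ h f <= nQ T f"
 using sqi_QM_if_slices(2)[OF measurable_QM_shift(2)[OF sqi_meas[OF f] h(2)] slices(4)[OF f] B]
 unfolding slices(6)[OF f] .
 have C: "AE x in LI. sqi (LL 0 (T - h)) (%t. f (t + h) x) & n2 (LL 0 (T - h)) (%t. f (t + h) x) <= n2 (LL 0 T) (%t. f t x)"
 using slices(2)[OF f]
 proof eventually_elim
 case (elim x)
 have "sqi (LL (0 + h) (T - h + h)) (%t. f t x)" by (rule sqi_LL_subset[OF elim]) (use h in auto)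
 from sqi_shift[OF this] show ?case using n2_LL_mono[OF elim, of h T] h by simp
 qed
 show "sqi (QM (T - h)) (%(t, x). f (t + h) x)"
 by (rule sqi_QM_if_slices(1)[OF measurable_QM_shift(1)[OF sqi_meas[OF f] h(1)] slices(4)[OF f] C])
 show "n2 (QM (T - h)) (%(t, x). f (t + h) x) <= nQ T f"
 using sqi_QM_if_slices(2)[OF measurable_QM_shift(1)[OF sqi_meas[OF f] h(1)] slices(4)[OF f] C]
 unfolding slices(6)[OF f] .
qed

lemma QM_integral_bilinear:
 fixes pr :: "'b::euclidean_space => 'c::euclidean_space => 'd::euclidean_space"
 assumes "bounded_bilinear pr" "sqQ T f" "sqQ T g"
 shows "intg (QM T) (cp (%t x. pr (f t x) (g t x)))"
 using sqi_bilin[OF assms(2,3,1)] by (simp add: split_def)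

lemma sqi_QM_time: "sqi (LL 0 T) f ==> sqQ T (%t x. f t)"
 and sqi_QM_space: "sqi LI g ==> sqQ T (%t x. g x)"
proof -
 show "sqQ T (%t x. f t)" if f: "sqi (LL 0 T) f"
 proof (rule sqi_QM_if_slices(1)[where B="%x. n2 (LL 0 T) f"])
 show "(%(t, x). f t) : bmQ T"
 using m_comp[OF measurable_fst sqi_meas[OF f]] by (simp add: split_def)
 qed (use f in "auto intro: fm_intg_const[OF fin_LL]")
 show "sqQ T (%t x. g x)" if g: "sqi LI g"
 proof (rule sqi_QM_if_slices(1)[where B="%x. measure (LL 0 T) (space (LL 0 T)) * (norm (g x))^2"])
 show "(%(t, x). g x) : bmQ T"
 using m_comp[OF measurable_snd sqi_meas[OF g]] by (simp add: split_def)
 show "AE x in LI. sqi (LL 0 T) (%t. g x) & n2 (LL 0 T) (%t. g x) <= measure (LL 0 T) (space (LL 0 T)) * (norm (g x))^2"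
 by (rule AE_I2) (simp add: n2_def finite_measure.sqi_const[OF fin_LL])
 qed (use sqi_norm2[OF g] in simp)
qed

text \<open>Fubini's theorem. It connects the time-integrated equation with the pairings at single
  times, which are recovered by differentiating in \<open>t\<close>.\<close>

lemma inner_swap:
 fixes f :: "real => real => 'b::euclidean_space" and pr :: "'b => 'c::euclidean_space => 'd::euclidean_space"
 assumes pr: "bounded_bilinear pr" and f: "sqQ T f" and ps: "sqi LI ps" and t: "0 <= t" "t <= T"
 shows "(LINT x|LI. pr (prim 0 (%s. f s x) t) (ps x)) = prim 0 (%s. LINT x|LI. pr (f s x) (ps x)) t"
 and "intg (LL 0 T) (%s. LINT x|LI. pr (f s x) (ps x))"
proof -
 have i: "intg (QM r) (cp (%s x. pr (f s x) (ps x)))" if "0 <= r" "r <= T" for r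
 by (rule QM_integral_bilinear[OF pr sqi_QM_subset(1)[OF f that] sqi_QM_space[OF ps]])
 show "intg (LL 0 T) (%s. LINT x|LI. pr (f s x) (ps x))"
 using QM_integral(3)[OF i[of T]] t by simp
 have "(LINT x|LI. pr (prim 0 (%s. f s x) t) (ps x)) = (LINT x|LI. LINT s|LL 0 t. pr (f s x) (ps x))"
 proof (rule int_cong_AE)
 have AE: "AE x in LI. pr (prim 0 (%s. f s x) t) (ps x) = (LINT s|LL 0 t. pr (f s x) (ps x))"
 using slices(2)[OF sqi_QM_subset(1)[OF f t]]
 by eventually_elim
 (simp add: LL_prim[symmetric] int_blin[OF bounded_bilinear.bounded_linear_left[OF pr] sqi_intg])
 show m: "(%x. LINT s|LL 0 t. pr (f s x) (ps x)) : bm LI"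
 using QM_integral(4)[OF i[OF t]] by auto
 show "(%x. pr (prim 0 (%s. f s x) t) (ps x)) : bm LI"
 by (rule AE_measurable_LL[OF AE m])
 show "AE x in LI. pr (prim 0 (%s. f s x) t) (ps x) = (LINT s|LL 0 t. pr (f s x) (ps x))" by (rule AE)
 qed
 also have "... = (LINT s|LL 0 t. LINT x|LI. pr (f s x) (ps x))"
 using QM_integral(5,6)[OF i[OF t]] by simp
 finally show "(LINT x|LI. pr (prim 0 (%s. f s x) t) (ps x)) = prim 0 (%s. LINT x|LI. pr (f s x) (ps x)) t"
 by (simp add: LL_prim)
qed

section \<open>Maximal regularity\<close>

lemma inner_young_n2:
 assumes "sqi M f" "sqi M g"
 shows "2 * (LINT x|M. f x *I g x) <= n2 M f + n2 M g"
proof -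
 have "(LINT x|M. f x *I g x) <= (LINT x|M. norm (f x) * norm (g x))"
 by (intro integral_mono sqi_inner sqi_integrable_norm_mult assms norm_cauchy_schwarz)
 with n2_young[OF assms] show ?thesis by simp
qed

lemma n2_eq_inner: "n2 M f = (LINT x|M. f x *I f x)"
 by (simp add: n2_def power2_norm_eq_inner)

text \<open>A weak solution \<open>w\<close> with zero boundary values, spatial derivative
  \<open>p\<close> and source \<open>G\<close>. The equation is integrated over
  \<open>(0, t)\<close>, so that neither a time derivative of \<open>w\<close> nor a dual space
  occurs. The exceptional set of times is the same for all test functions, so functions depending on
  \<open>t\<close> may be inserted.\<close>

locale weak_parabolic =
 fixes T al A L :: real and a da :: "real => real => real"
 and w p G :: "real => real => 'b::euclidean_space" and w0 p0 :: "real => 'b"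
 assumes T: "0 < T" and al: "0 < al" and L: "0 <= L"
 and coef: "AE x in LI. EX c0. lip_coef T al A L c0 (%t. a t x) (%t. da t x)"
 and a_meas: "cp a : bmQ T"
 and w: "sqQ T w" and p: "sqQ T p" and G: "sqQ T G"
 and init: "h10 w0 p0" and h10: "AE t in LL 0 T. h10 (w t) (p t)"
 and eq: "AE t in LL 0 T. ALL ph ph'. h10 ph ph' -->
 (LINT x|LI. (w t x - w0 x) *I ph x) =
 - (LINT x|LI. prim 0 (%s. a s x *R p s x) t *I ph' x) + (LINT x|LI. prim 0 (%s. G s x) t *I ph x)"
begin

lemma A_pos: "0 < A"
proof -
 have "AE x in LI. 0 < A"
 using coef
 proof eventually_elim
 case (elim x)
 then obtain c0 where "lip_coef T al A L c0 (%t. a t x) (%t. da t x)" by blast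
 then interpret lip_coef T al A L c0 "%t. a t x" "%t. da t x" .
 show ?case using w0_bounds[of 0] T al by auto
 qed
 thus ?thesis by (rule AE_LL_contradiction[rotated]) simp
qed

definition AP :: "real => real => 'b" where "AP t x = prim 0 (%s. a s x *R p s x) t"
definition GG :: "real => real => 'b" where "GG t x = prim 0 (%s. G s x) t"

lemma sqi_ap: "sqQ T (%t x. a t x *R p t x)"
proof (rule sqi_QM_if_slices(1))
 show "(%(t, x). a t x *R p t x) : bmQ T"
 using bm_scal[OF a_meas sqi_meas[OF p]] by (simp add: split_def)
 show "intg LI (%x. A^2 * n2 (LL 0 T) (%t. p t x))" using slices(4)[OF p] by simp
 show "AE x in LI. sqi (LL 0 T) (%t. a t x *R p t x) & n2 (LL 0 T) (%t. a t x *R p t x) <= A^2 * n2 (LL 0 T) (%t. p t x)"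
 using coef slices(2)[OF p]
 proof eventually_elim
 case (elim x)
 then obtain c0 where "lip_coef T al A L c0 (%t. a t x) (%t. da t x)" by blast
 then interpret l: lip_coef T al A L c0 "%t. a t x" "%t. da t x" .
 have "AE t in LL 0 T. norm (a t x *R p t x) <= A * norm (p t x)"
 using l.w(2) by eventually_elim (use al in "auto intro!: mult_r_mono")
 thus ?case
 using l.sqi_w_scaleR[OF elim(2)] sqi_bound(2)[OF elim(2) sqi_meas[OF l.sqi_w_scaleR[OF elim(2)]]] by blast
 qed
qed

lemma sqi_AP: "sqQ T AP" and sqi_GG: "sqQ T GG"
 using sqi_prim_QM[OF sqi_ap] sqi_prim_QM[OF G] T by (simp_all add: AP_def[abs_def] GG_def[abs_def])

lemma sqi_w0: "sqi LI w0" and sqi_p0: "sqi LI p0"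
 using h10_sqi[OF init] h10_sqi_deriv[OF init] .

text \<open>Test with \<open>w(t) - w0\<close> and the weight \<open>2 - t / h\<close> on \<open>(0, h)\<close>.\<close>

lemma initial_layer:
 assumes h: "0 < h" "h <= T" "h <= 1"
 defines "K == (2 * A + L) * n2 LI p0 + 3 * L * nQ T p + nQ T G"
 shows "intg LI (%x. (norm (prim 0 (%t. p t x) h))^2)"
 and "al / 2 * (LINT x|LI. (norm (prim 0 (%t. p t x) h))^2) + (LINT t|LL 0 h. n2 LI (%x. w t x - w0 x)) / 2 <= h^2 * K"
proof -
 have h': "0 <= h" "h <= T" using h by auto
 define m where "m t = 2 - t / h" for t
 have mb: "1 <= m t" "m t <= 2" if "t : {0<..<h}" for t using that h by (auto simp: m_def field_simps)
 define P where "P x = prim 0 (%t. p t x) h" for x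
 have ph: "sqQ h p" and wh: "sqQ h w" and APh: "sqQ h AP" and GGh: "sqQ h GG"
 by (rule sqi_QM_subset(1)[OF _ h']; rule p w sqi_AP sqi_GG)+
 have dp: "sqQ h (%t x. p t x - p0 x)" and dw: "sqQ h (%t x. w t x - w0 x)"
 using sqi_diff[OF ph sqi_QM_space[OF sqi_p0]] sqi_diff[OF wh sqi_QM_space[OF sqi_w0]] by (simp_all add: split_def)
 have mAP: "sqQ h (%t x. m t *R AP t x)"
 proof (rule sqi_bound(1)[OF APh])
 have mm: "(%t. m t) : bm (LL 0 h)"
 unfolding m_def by (rule cont_imp_meas) (use h in "auto intro!: continuous_intros")
 show "(%(t, x). m t *R AP t x) : bm (QM h)"
 using bm_scal[OF m_comp[OF measurable_fst mm] sqi_meas[OF APh]] by (simp add: split_def)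
 show "AE z in QM h. norm (case z of (t, x) => m t *R AP t x) <= 2 * norm (case z of (t, x) => AP t x)"
 using AE_space
 proof eventually_elim
 case (elim z)
 hence "1 <= m (fst z)" "m (fst z) <= 2" using mb[of "fst z"] by (auto simp: space_pair_measure)
 hence "\<bar>m (fst z)\<bar> <= 2" by linarith
 thus ?case by (simp add: split_def mult_r_mono)
 qed
 qed
 have F: "intg (QM h) (cp (%t x. (m t *R AP t x) *I (p t x - p0 x)))"
 by (rule QM_integral_bilinear[OF bb_inner mAP dp])
 note QF = QM_integral[OF F]
 have P_meas: "P : bm LI"
 using QM_integral(4)[OF finite_measure.sqi_integrable[OF finite_measure_QM ph]] unfolding P_def LL_prim by auto
 have P_le: "AE x in LI. (norm (P x))^2 <= h * n2 (LL 0 T) (%t. p t x)"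
 using slices(2)[OF p]
 proof eventually_elim
 case (elim x)
 have "(norm (P x))^2 <= (h - 0) * n2 (LL 0 h) (%t. p t x)"
 unfolding P_def by (rule norm_prim_squared_le(1)[OF sqi_LL_subset[OF elim]]) (use h in auto)
 also have "... <= h * n2 (LL 0 T) (%t. p t x)" using n2_LL_mono[OF elim, of 0 h] h by simp
 finally show ?case .
 qed
 have iP: "intg LI (%x. (norm (P x))^2)"
 by (rule intg_bound[OF intg_mult[OF slices(4)[OF p], of h]])
 (use P_meas P_le in "auto elim!: eventually_mono")
 thus "intg LI (%x. (norm (prim 0 (%t. p t x) h))^2)" by (simp add: P_def)
 define E where "E t = n2 LI (%x. w t x - w0 x)" for t
 have iE: "intg (LL 0 h) E" using slices(3)[OF dw] by (simp add: E_def[abs_def])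
 have E_le: "AE t in LL 0 h. E t / 2 <= - (LINT x|LI. (m t *R AP t x) *I (p t x - p0 x)) + n2 LI (GG t)"
 using AE_LL_subset[OF eq order_refl h(2)] AE_LL_subset[OF h10 order_refl h(2)] slices(1)[OF GGh] slices(1)[OF dw] AE_space
 proof eventually_elim
 case (elim t)
 have mt: "1 <= m t" "m t <= 2" using mb[of t] elim by auto
 \<comment> \<open>Admissible because \<open>w0\<close> itself vanishes at the end points; this is
   the place where compatibility of the data enters.\<close>
 have "h10 (%x. w t x - w0 x) (%x. p t x - p0 x)" by (rule h10_diff[OF elim(2) init])
 with elim(1) have "(LINT x|LI. (w t x - w0 x) *I (w t x - w0 x)) = - (LINT x|LI. AP t x *I (p t x - p0 x)) + (LINT x|LI. GG t x *I (w t x - w0 x))"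
 unfolding AP_def GG_def by blast
 hence E: "E t = - (LINT x|LI. AP t x *I (p t x - p0 x)) + (LINT x|LI. GG t x *I (w t x - w0 x))"
 unfolding E_def n2_eq_inner .
 have "2 * (LINT x|LI. GG t x *I (w t x - w0 x)) <= n2 LI (GG t) + E t"
 unfolding E_def by (rule inner_young_n2[OF elim(3,4)])
 with E have "E t <= - 2 * (LINT x|LI. AP t x *I (p t x - p0 x)) + n2 LI (GG t)" by simp
 hence "m t * E t <= m t * (- 2 * (LINT x|LI. AP t x *I (p t x - p0 x)) + n2 LI (GG t))"
 using mt by (intro mult_left_mono) auto
 moreover have "E t <= m t * E t" using mt mult_r_mono[of 1 "m t" "E t"] by (simp add: E_def)
 moreover have "m t * n2 LI (GG t) <= 2 * n2 LI (GG t)" using mt by (intro mult_r_mono) auto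
 moreover have "(LINT x|LI. (m t *R AP t x) *I (p t x - p0 x)) = m t * (LINT x|LI. AP t x *I (p t x - p0 x))"
 by simp
 ultimately show ?case by (simp add: algebra_simps)
 qed
 have "(LINT t|LL 0 h. E t / 2) <= (LINT t|LL 0 h. - (LINT x|LI. (m t *R AP t x) *I (p t x - p0 x)) + n2 LI (GG t))"
 by (rule int_mono_AE[OF _ _ E_le]) (use iE QF(3) slices(3)[OF GGh] in auto)
 also have "... = - (LINT t|LL 0 h. LINT x|LI. (m t *R AP t x) *I (p t x - p0 x)) + (LINT t|LL 0 h. n2 LI (GG t))"
 by (subst int_add) (use QF(3) slices(3)[OF GGh] in auto)
 also have "(LINT t|LL 0 h. LINT x|LI. (m t *R AP t x) *I (p t x - p0 x)) = (LINT x|LI. LINT t|LL 0 h. (m t *R AP t x) *I (p t x - p0 x))"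
 using QF(5,6) by simp
 also have "(LINT t|LL 0 h. n2 LI (GG t)) = nQ h GG" using slices(5)[OF GGh] by simp
 finally have 1: "(LINT t|LL 0 h. E t) / 2 <= - (LINT x|LI. LINT t|LL 0 h. (m t *R AP t x) *I (p t x - p0 x)) + nQ h GG"
 by simp
 have 2: "nQ h GG <= h^2 * nQ T G"
 proof -
 have "nQ h GG = (LINT x|LI. n2 (LL 0 h) (%t. GG t x))" by (rule slices(6)[OF GGh])
 also have "... <= (LINT x|LI. h^2 * n2 (LL 0 T) (%t. G t x))"
 proof (rule int_mono_AE[OF slices(4)[OF GGh] intg_mult[OF slices(4)[OF G]]])
 show "AE x in LI. n2 (LL 0 h) (%t. GG t x) <= h^2 * n2 (LL 0 T) (%t. G t x)"
 using slices(2)[OF G] by eventually_elim (unfold GG_def, rule n2_prim_le(2)[OF _ h'])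
 qed
 also have "... = h^2 * nQ T G" using slices(6)[OF G] by simp
 finally show ?thesis .
 qed
 define R where "R x = al / 2 * (norm (P x))^2 - (h^2 * (2 * A + L) * (norm (p0 x))^2 + h^2 * 3 * L * n2 (LL 0 T) (%t. p t x))" for x
 have 3: "(LINT x|LI. R x) <= (LINT x|LI. LINT t|LL 0 h. (m t *R AP t x) *I (p t x - p0 x))"
 proof (rule int_mono_AE[OF _ QF(4)])
 show "intg LI R"
 unfolding R_def using iP sqi_norm2[OF sqi_p0] slices(4)[OF p] by auto
 show "AE x in LI. R x <= (LINT t|LL 0 h. (m t *R AP t x) *I (p t x - p0 x))"
 using coef slices(2)[OF p]
 proof eventually_elim
 case (elim x)
 then obtain c0 where "lip_coef T al A L c0 (%t. a t x) (%t. da t x)" by blast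
 then interpret l: lip_coef T al A L c0 "%t. a t x" "%t. da t x" .
 have "al / 2 * (norm (P x))^2 - h^2 * (2 * A * (norm (p0 x))^2 + 3 * L * n2 (LL 0 T) (%t. p t x) + L * h * (norm (p0 x))^2) <=
 (LINT t|LL 0 h. m t * (AP t x *I (p t x - p0 x)))"
 unfolding P_def AP_def m_def by (rule l.initial_layer_bound(2)[OF elim(2) h(1,2)])
 moreover have "L * h * (norm (p0 x))^2 <= L * (norm (p0 x))^2"
 using h L by (intro mult_r_mono) (auto simp: mult_left_le)
 hence "h^2 * (L * h * (norm (p0 x))^2) <= h^2 * (L * (norm (p0 x))^2)" by (intro mult_left_mono) auto
 ultimately show ?case by (simp add: R_def algebra_simps)
 qed
 qed
 have 4: "(LINT x|LI. R x) = al / 2 * (LINT x|LI. (norm (P x))^2) - (h^2 * (2 * A + L) * n2 LI p0 + h^2 * 3 * L * nQ T p)"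
 unfolding R_def slices(6)[OF p] n2_def[of "LI" p0]
 using iP sqi_norm2[OF sqi_p0] slices(4)[OF p] by simp
 have "al / 2 * (LINT x|LI. (norm (P x))^2) + (LINT t|LL 0 h. E t) / 2 <=
 (h^2 * (2 * A + L) * n2 LI p0 + h^2 * 3 * L * nQ T p) + h^2 * nQ T G"
 using 1 2 3 4 by argo
 also have "... = h^2 * K" by (simp add: K_def algebra_simps)
 finally show "al / 2 * (LINT x|LI. (norm (prim 0 (%t. p t x) h))^2) + (LINT t|LL 0 h. n2 LI (%x. w t x - w0 x)) / 2 <= h^2 * K"
 by (simp add: P_def E_def)
qed

text \<open>Test with \<open>w(t + h) - w(t)\<close>.\<close>

lemma difference_quotients:
 assumes h: "0 < h" "h < T" "h <= 1"
 shows "n2 (QM (T - h)) (%(t, x). w (t + h) x - w t x) <=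
 A * (LINT x|LI. (norm (prim 0 (%t. p t x) h))^2) + 6 * L * h^2 * nQ T p + h^2 * nQ T G"
 and "sqQ (T - h) (%t x. w (t + h) x - w t x)"
proof -
 define r where "r = T - h"
 have h': "0 <= h" "h <= T" "0 <= r" "r <= T" using h by (auto simp: r_def)
 have sh: "sqQ r (%t x. f (t + h) x - f t x)" if "sqQ T f" for f :: "real => real => 'b"
 using sqi_diff[OF sqi_QM_subset(3)[OF that h'(1,2), folded r_def] sqi_QM_subset(1)[OF that h'(3,4)]] by (simp add: split_def)
 note sD = sh[OF w] and sP = sh[OF p] and sA = sh[OF sqi_AP] and sG = sh[OF sqi_GG]
 show "sqQ (T - h) (%t x. w (t + h) x - w t x)" using sD unfolding r_def .
 have F: "intg (QM r) (cp (%t x. (AP (t + h) x - AP t x) *I (p (t + h) x - p t x)))"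
 by (rule QM_integral_bilinear[OF bb_inner sA sP])
 note QF = QM_integral[OF F]
 define E where "E t = n2 LI (%x. w (t + h) x - w t x)" for t
 define N where "N t = n2 LI (%x. GG (t + h) x - GG t x)" for t
 have good: "AE t in LL 0 T. h10 (w t) (p t) & sqi LI (AP t) & sqi LI (GG t) & (ALL ph ph'. h10 ph ph' -->
 (LINT x|LI. (w t x - w0 x) *I ph x) = - (LINT x|LI. AP t x *I ph' x) + (LINT x|LI. GG t x *I ph x))"
 using h10 slices(1)[OF sqi_AP] slices(1)[OF sqi_GG] eq unfolding AP_def GG_def by eventually_elim blast
 have good1: "AE t in LL 0 r. h10 (w t) (p t) & sqi LI (AP t) & sqi LI (GG t) & (ALL ph ph'. h10 ph ph' -->
 (LINT x|LI. (w t x - w0 x) *I ph x) = - (LINT x|LI. AP t x *I ph' x) + (LINT x|LI. GG t x *I ph x))"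
 by (rule AE_LL_subset[OF good]) (use h' in auto)
 have good2: "AE t in LL 0 r. h10 (w (t + h)) (p (t + h)) & sqi LI (AP (t + h)) & sqi LI (GG (t + h)) & (ALL ph ph'. h10 ph ph' -->
 (LINT x|LI. (w (t + h) x - w0 x) *I ph x) = - (LINT x|LI. AP (t + h) x *I ph' x) + (LINT x|LI. GG (t + h) x *I ph x))"
 by (rule AE_LL_shift, rule AE_LL_subset[OF good]) (use h' in "auto simp: r_def")
 have E_le: "AE t in LL 0 r. E t <= - 2 * (LINT x|LI. (AP (t + h) x - AP t x) *I (p (t + h) x - p t x)) + N t"
 using good1 good2
 proof eventually_elim
 case (elim t)
 define ph where "ph x = w (t + h) x - w t x" for x
 define ph' where "ph' x = p (t + h) x - p t x" for x
 have ph: "h10 ph ph'" unfolding ph_def ph'_def by (rule h10_diff) (use elim in auto)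
 have s: "sqi LI ph" "sqi LI ph'" using h10_sqi[OF ph] h10_sqi_deriv[OF ph] by auto
 have sw: "sqi LI (%x. w (t + h) x - w0 x)" "sqi LI (%x. w t x - w0 x)"
 by (intro sqi_diff sqi_w0; use elim h10_sqi in blast)+
 have e1: "(LINT x|LI. (w t x - w0 x) *I ph x) = - (LINT x|LI. AP t x *I ph' x) + (LINT x|LI. GG t x *I ph x)"
 "(LINT x|LI. (w (t + h) x - w0 x) *I ph x) = - (LINT x|LI. AP (t + h) x *I ph' x) + (LINT x|LI. GG (t + h) x *I ph x)"
 using elim ph by blast+
 have d: "(LINT x|LI. (f x - g x) *I k x) = (LINT x|LI. f x *I k x) - (LINT x|LI. g x *I k x)"
 if "sqi LI f" "sqi LI g" "sqi LI k" for f g k :: "real => 'b"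
 unfolding inner_diff_left using that by (intro int_diff sqi_inner)
 have "ph = (%x. (w (t + h) x - w0 x) - (w t x - w0 x))" by (auto simp: ph_def)
 hence "E t = (LINT x|LI. ((w (t + h) x - w0 x) - (w t x - w0 x)) *I ph x)"
 unfolding E_def n2_eq_inner by (simp add: ph_def)
 also have "... = (LINT x|LI. (w (t + h) x - w0 x) *I ph x) - (LINT x|LI. (w t x - w0 x) *I ph x)"
 by (rule d[OF sw s(1)])
 also have "... = - (LINT x|LI. (AP (t + h) x - AP t x) *I ph' x) + (LINT x|LI. (GG (t + h) x - GG t x) *I ph x)"
 using elim s by (simp add: e1 d)
 finally have E: "E t = - (LINT x|LI. (AP (t + h) x - AP t x) *I ph' x) + (LINT x|LI. (GG (t + h) x - GG t x) *I ph x)" .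
 \<comment> \<open>The term \<open>n2 LI ph\<close> on the right equals \<open>E t\<close> and is
   absorbed into twice the identity for \<open>E t\<close>.\<close>
 have "2 * (LINT x|LI. (GG (t + h) x - GG t x) *I ph x) <= N t + n2 LI ph"
 unfolding N_def by (rule inner_young_n2) (use elim s in "auto intro!: sqi_diff")
 moreover have "n2 LI ph = E t" by (simp add: E_def ph_def[abs_def])
 ultimately show ?case using E unfolding ph'_def by argo
 qed
 have iE: "intg (LL 0 r) E" "nQ r (%t x. w (t + h) x - w t x) = (LINT t|LL 0 r. E t)"
 using slices(3,5)[OF sD] by (simp_all add: E_def[abs_def])
 have iN: "intg (LL 0 r) N" "nQ r (%t x. GG (t + h) x - GG t x) = (LINT t|LL 0 r. N t)"
 using slices(3,5)[OF sG] by (simp_all add: N_def[abs_def])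
 have "(LINT t|LL 0 r. E t) <= (LINT t|LL 0 r. - 2 * (LINT x|LI. (AP (t + h) x - AP t x) *I (p (t + h) x - p t x)) + N t)"
 by (rule int_mono_AE[OF iE(1) _ E_le]) (use QF(3) iN in auto)
 also have "... = - 2 * (LINT t|LL 0 r. LINT x|LI. (AP (t + h) x - AP t x) *I (p (t + h) x - p t x)) + (LINT t|LL 0 r. N t)"
 by (subst int_add) (use QF(3) iN in auto)
 also have "(LINT t|LL 0 r. LINT x|LI. (AP (t + h) x - AP t x) *I (p (t + h) x - p t x)) =
 (LINT x|LI. LINT t|LL 0 r. (AP (t + h) x - AP t x) *I (p (t + h) x - p t x))" using QF(5,6) by simp
 finally have 1: "(LINT t|LL 0 r. E t) <= - 2 * (LINT x|LI. LINT t|LL 0 r. (AP (t + h) x - AP t x) *I (p (t + h) x - p t x)) + (LINT t|LL 0 r. N t)" .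
 have iP: "intg LI (%x. (norm (prim 0 (%t. p t x) h))^2)" by (rule initial_layer(1)) (use h in auto)
 have 2: "(LINT t|LL 0 r. N t) <= h^2 * nQ T G"
 proof -
 have "(LINT t|LL 0 r. N t) = (LINT x|LI. n2 (LL 0 r) (%t. GG (t + h) x - GG t x))" using slices(6)[OF sG] iN(2) by simp
 also have "... <= (LINT x|LI. h^2 * n2 (LL 0 T) (%t. G t x))"
 proof (rule int_mono_AE[OF slices(4)[OF sG] intg_mult[OF slices(4)[OF G]]])
 show "AE x in LI. n2 (LL 0 r) (%t. GG (t + h) x - GG t x) <= h^2 * n2 (LL 0 T) (%t. G t x)"
 using slices(2)[OF G] by eventually_elim (unfold GG_def r_def, rule n2_prim_difference(2)[OF _ h'(1,2)])
 qed
 also have "... = h^2 * nQ T G" using slices(6)[OF G] by simp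
 finally show ?thesis .
 qed
 define R where "R x = - (A / 2 * (norm (prim 0 (%t. p t x) h))^2) - 3 * L * h^2 * n2 (LL 0 T) (%t. p t x)" for x
 have 3: "(LINT x|LI. R x) <= (LINT x|LI. LINT t|LL 0 r. (AP (t + h) x - AP t x) *I (p (t + h) x - p t x))"
 proof (rule int_mono_AE[OF _ QF(4)])
 show "intg LI R" unfolding R_def using iP slices(4)[OF p] by auto
 show "AE x in LI. R x <= (LINT t|LL 0 r. (AP (t + h) x - AP t x) *I (p (t + h) x - p t x))"
 using coef slices(2)[OF p]
 proof eventually_elim
 case (elim x)
 then obtain c0 where "lip_coef T al A L c0 (%t. a t x) (%t. da t x)" by blast
 then interpret l: lip_coef T al A L c0 "%t. a t x" "%t. da t x" .
 show ?case unfolding R_def AP_def r_def by (rule l.difference_quotient_bound(2)[OF elim(2) h(1) h'(2)])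
 qed
 qed
 have 4: "(LINT x|LI. R x) = - (A / 2 * (LINT x|LI. (norm (prim 0 (%t. p t x) h))^2)) - 3 * L * h^2 * nQ T p"
 unfolding R_def slices(6)[OF p] using iP slices(4)[OF p] by simp
 show "n2 (QM (T - h)) (%(t, x). w (t + h) x - w t x) <=
 A * (LINT x|LI. (norm (prim 0 (%t. p t x) h))^2) + 6 * L * h^2 * nQ T p + h^2 * nQ T G"
 using 1 2 3 4 iE(2) unfolding r_def by argo
qed

end

section \<open>Passage to the limit in the difference quotients\<close>

lemma LL_integral_if:
 fixes f :: "real => 'b::euclidean_space"
 assumes "r <= T"
 shows "intg (LL l T) (%t. if t < r then f t else 0) \<longleftrightarrow> intg (LL l r) f"
 and "(LINT t|LL l T. (if t < r then f t else 0)) = (LINT t|LL l r. f t)"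
proof -
 have eq: "indicat_real {l<..<T} t *R (if t < r then f t else 0) = indicat_real {l<..<r} t *R f t" for t
 using assms by (auto simp: indicator_def)
 show "intg (LL l T) (%t. if t < r then f t else 0) \<longleftrightarrow> intg (LL l r) f"
 unfolding LL_integrable_iff set_integrable_def eq ..
 show "(LINT t|LL l T. (if t < r then f t else 0)) = (LINT t|LL l r. f t)"
 unfolding LL_integral_eq set_int_def eq ..
qed

lemma truncated_shift_measurable:
 fixes f :: "real => real => 'b::euclidean_space"
 assumes f: "cp f : bmQ T" and h: "0 <= h" "0 < T"
 shows "(%(t, x). if t < T - h then f (t + h) x else 0) : bmQ T"
proof -
 \<comment> \<open>Late times are sent to the interior point \<open>T / 2\<close>, so that
   \<open>s\<close> maps \<open>(0, T)\<close> into itself; the value there is discarded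
   afterwards.\<close>
 define s where "s t = (if t < T - h then t + h else T / 2)" for t
 have "(%t::real. h + (\<Sum>j\<in>Basis. (1 * (t *I j)) *R j)) : lebesgue \<rightarrow>\<^sub>M lebesgue"
 by (rule lebesgue_affine_measurable) simp
 hence *: "(%t::real. t + h) : lebesgue \<rightarrow>\<^sub>M lebesgue" by (simp add: add.commute)
 have "s : lebesgue \<rightarrow>\<^sub>M lebesgue"
 unfolding s_def[abs_def] by (rule measurable_If[OF *]) auto
 hence s: "s : LL 0 T \<rightarrow>\<^sub>M LL 0 T"
 by (rule measurable_restrict_space3) (use h in "auto simp: s_def")
 have "(%p. (s (fst p), snd p)) : QM T \<rightarrow>\<^sub>M QM T"
 by (intro measurable_Pair m_comp[OF measurable_fst s] measurable_snd)
 from m_comp[OF this f] have 1: "(%p. f (s (fst p)) (snd p)) : bmQ T"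
 by (simp add: split_def)
 have fm: "(%p. fst p) : bmQ T" by (rule m_comp[OF measurable_fst measurable_id_LL])
 have "{p : space (QM T). fst p < T - h} : sets (QM T)"
 by (rule borel_measurable_less[OF fm borel_measurable_const])
 hence "(%p. if fst p < T - h then f (s (fst p)) (snd p) else 0) : bmQ T"
 by (intro measurable_If 1) auto
 moreover have "(%p. if fst p < T - h then f (s (fst p)) (snd p) else 0) = (%(t, x). if t < T - h then f (t + h) x else 0)"
 by (auto simp: s_def split_def)
 ultimately show ?thesis by simp
qed

text \<open>The margin \<open>c\<close> allows shifts by less than \<open>c\<close> without leaving
  \<open>(0, T)\<close>, and the Lipschitz constant \<open>B\<close> is the dominating bound for the
  difference quotients of \<open>th\<close>.\<close>

lemma test_fun_difference_quotient:
 fixes th :: "real => real"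
 assumes t: "test_fun {0<..<T} th" and T: "0 < T"
 obtains c B where "0 < c" "c < T" "!!t. t \<notin> {c..T - c} ==> th t = 0" "!!s t. \<bar>th s - th t\<bar> <= B * \<bar>s - t\<bar>" "0 <= B"
proof -
 obtain a b where ab: "0 < a" "a < b" "b < T" "!!x. x \<notin> {a..b} ==> th x = 0"
 using test_fun_real_support[OF t T] by metis
 have s: "smooth_fun th" using t by (simp add: test_fun_def)
 define D where "D x = D1 th x" for x
 have D: "(th has_real_derivative D x) (at x)" for x
 using smooth_fun_real_derivative[OF s] unfolding D_def real_deriv_iff .
 have "bounded (D ` {a..b})" unfolding D_def
 by (intro compact_imp_bounded compact_continuous_image smooth_fun_deriv_continuous[OF s] compact_Icc)
 then obtain B0 where B0: "!!x. x : {a..b} ==> \<bar>D x\<bar> <= B0" unfolding bounded_iff by fastforce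
 have D0: "D x = 0" if "x \<notin> {a..b}" for x
 proof -
 have "\<forall>\<^sub>F y in nhds x. th y = 0"
 proof (rule eventually_mono)
 show "\<forall>\<^sub>F y in nhds x. y : - {a..b}"
 by (rule eventually_nhds_in_open) (use that in "auto intro: open_Compl")
 qed (use ab(4) in auto)
 hence "((%x. 0) has_real_derivative D x) (at x)"
 using D[of x] DERIV_cong_ev[of x x th "%x. 0" "D x" "D x"] by auto
 thus ?thesis using DERIV_unique[of "%x. 0" "D x" x 0] by simp
 qed
 define B where "B = max 0 B0"
 have B: "\<bar>D x\<bar> <= B" for x
 using B0[of x] D0[of x] by (cases "x : {a..b}") (auto simp: B_def)
 have lip: "\<bar>th s - th t\<bar> <= B * \<bar>s - t\<bar>" for s t
 proof -
 have "norm (th s - th t) <= B * norm (s - t)"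
 by (rule field_differentiable_bound[of UNIV th D]) (use D B in auto)
 thus ?thesis by simp
 qed
 show ?thesis
 proof (rule that[of "min a (T - b) / 2" B])
 have m: "min a (T - b) / 2 <= a" "b <= T - min a (T - b) / 2" using ab(1-3) by argo+
 show "th t = 0" if "t \<notin> {min a (T - b) / 2..T - min a (T - b) / 2}" for t
 proof (rule ab(4), rule notI)
 assume "t : {a..b}"
 thus False using that m by auto
 qed
 qed (use ab(1-3) lip in "auto simp: B_def min_def")
qed

lemma n2_const_LL: "n2 (LL 0 T) (%t. c) = max 0 T * (norm c)^2"
 using measure_LL[of 0 T] by (cases "0 <= T") (auto simp: n2_def)

context weak_parabolic
begin

definition K where "K = (2 * A + L) * n2 LI p0 + 3 * L * nQ T p + nQ T G"

text \<open>What remains of the bound of the increments after division by \<open>h^2\<close>, once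
  the initial layer has bounded the primitive of \<open>p\<close> at \<open>h\<close> by
  \<open>2 * h^2 * K / al\<close>.\<close>

definition K2 where "K2 = 2 * A * K / al + 6 * L * nQ T p + nQ T G"

text \<open>Extended by 0 to the whole time interval, so that the quotients for all \<open>h\<close>
  lie in one space and weak compactness applies.\<close>

definition dq where "dq h t x = (if t < T - h then (1 / h) *R (w (t + h) x - w t x) else 0)"

lemma difference_quotient_n2:
 assumes h: "0 < h" "h < T" "h <= 1"
 shows "sqQ T (dq h)" "nQ T (dq h) <= K2"
proof -
 define r where "r = T - h"
 have r: "r <= T" using h by (simp add: r_def)
 define D where "D t x = w (t + h) x - w t x" for t x
 have sD: "sqQ r D"
 using difference_quotients(2)[OF h] unfolding D_def[abs_def] r_def .
 have D: "nQ r D <=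
 A * (LINT x|LI. (norm (prim 0 (%t. p t x) h))^2) + 6 * L * h^2 * nQ T p + h^2 * nQ T G"
 using difference_quotients(1)[OF h] unfolding D_def[abs_def] r_def .
 have "al / 2 * (LINT x|LI. (norm (prim 0 (%t. p t x) h))^2) + (LINT t|LL 0 h. n2 LI (%x. w t x - w0 x)) / 2 <= h^2 * K"
 unfolding K_def by (rule initial_layer(2)) (use h in auto)
 moreover have "0 <= (LINT t|LL 0 h. n2 LI (%x. w t x - w0 x))" by simp
 ultimately have "al / 2 * (LINT x|LI. (norm (prim 0 (%t. p t x) h))^2) <= h^2 * K" by linarith
 hence "(LINT x|LI. (norm (prim 0 (%t. p t x) h))^2) <= 2 * h^2 * K / al" using al by (simp add: field_simps)
 hence "A * (LINT x|LI. (norm (prim 0 (%t. p t x) h))^2) <= A * (2 * h^2 * K / al)"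
 using A_pos by (intro mult_left_mono) auto
 with D have D2: "nQ r D <= h^2 * K2" by (simp add: K2_def algebra_simps)
 have eq: "dq h t x = (if t < r then (1 / h) *R D t x else 0)" for t x by (simp add: dq_def D_def r_def)
 have m: "cp (dq h) : bmQ T"
 proof -
 have "(%p. (1 / h) *R ((case p of (t, x) => if t < T - h then w (t + h) x else 0) - (case p of (t, x) => if t < T - h then w t x else 0))) : bmQ T"
 proof (intro bm_scal bm_diff borel_measurable_const)
 show "(%(t, x). if t < T - h then w (t + h) x else 0) : bmQ T"
 by (rule truncated_shift_measurable[OF sqi_meas[OF w]]) (use h T in auto)
 have fm: "(%p. fst p) : bmQ T" by (rule m_comp[OF measurable_fst measurable_id_LL])
 have "{p : space (QM T). fst p < T - h} : sets (QM T)"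
 by (rule borel_measurable_less[OF fm borel_measurable_const])
 hence "(%p. if fst p < T - h then (case p of (t, x) => w t x) else 0) : bmQ T"
 by (intro measurable_If sqi_meas[OF w]) auto
 thus "(%(t, x). if t < T - h then w t x else 0) : bmQ T" by (simp add: split_def cong: if_cong)
 qed
 moreover have "(%p. (1 / h) *R ((case p of (t, x) => if t < T - h then w (t + h) x else 0) - (case p of (t, x) => if t < T - h then w t x else 0))) = cp (dq h)"
 by (auto simp: dq_def split_def)
 ultimately show ?thesis by simp
 qed
 have sl: "AE x in LI. sqi (LL 0 T) (%t. dq h t x) & n2 (LL 0 T) (%t. dq h t x) <= (1 / h)^2 * n2 (LL 0 r) (%t. D t x)"
 using slices(2)[OF sD] AE_space
 proof eventually_elim
 case (elim x)
 have n: "(norm (dq h t x))^2 = (if t < r then (norm ((1 / h) *R D t x))^2 else 0)" for t by (simp add: eq)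
 have s: "sqi (LL 0 r) (%t. (1 / h) *R D t x)" by (rule sqi_scaleR[OF elim(1)])
 have "intg (LL 0 T) (%t. (norm (dq h t x))^2)"
 unfolding n LL_integral_if(1)[OF r] by (rule sqi_norm2[OF s])
 moreover have "(%t. dq h t x) : bm (LL 0 T)" by (rule QM_slice_measurable(2)[OF m]) (use elim in auto)
 moreover have "n2 (LL 0 T) (%t. dq h t x) = (1 / h)^2 * n2 (LL 0 r) (%t. D t x)"
 unfolding n2_def[of "LL 0 T"] n LL_integral_if(2)[OF r] n2_scaleR[symmetric] by (simp add: n2_def)
 ultimately show ?case by (simp add: sqi_def)
 qed
 have i: "intg LI (%x. (1 / h)^2 * n2 (LL 0 r) (%t. D t x))" using slices(4)[OF sD] by simp
 show "sqQ T (dq h)" by (rule sqi_QM_if_slices(1)[OF m i sl])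
 have "nQ T (dq h) <= (LINT x|LI. (1 / h)^2 * n2 (LL 0 r) (%t. D t x))" by (rule sqi_QM_if_slices(2)[OF m i sl])
 also have "... = (1 / h)^2 * nQ r D" using slices(6)[OF sD] by simp
 also have "... <= (1 / h)^2 * (h^2 * K2)" by (rule mult_left_mono[OF D2]) simp
 also have "... = K2" using h by (simp add: power2_eq_square)
 finally show "nQ T (dq h) <= K2" .
qed

text \<open>Discrete integration by parts: the shift moves from \<open>w\<close> to
  \<open>th\<close>. Since \<open>h < c\<close>, the pieces near 0 and \<open>T\<close> where the
  domains differ do not meet the support.\<close>

lemma integral_dq:
 assumes t: "!!t. t \<notin> {c..T - c} ==> th t = (0::real)" and ct: "continuous_on UNIV th" and h: "0 < h" "h < c" "c < T"
 and wx: "intg (LL 0 T) (%t. w t x)"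
 shows "(LINT t|LL 0 T. th t *R dq h t x) = (LINT t|LL 0 T. ((th (t - h) - th t) / h) *R w t x)"
proof -
 define r where "r = T - h"
 have r: "r <= T" "0 <= r" using h by (auto simp: r_def)
 have cs: "continuous_on UNIV (%t. th (t - h))" by (rule continuous_on_compose2[OF ct]) (auto intro!: continuous_intros)
 have i1: "intg (LL 0 T) (%t. th t *R w t x)" by (rule integrable_test_fun_scaleR[OF ct wx])
 have i2: "intg (LL 0 T) (%t. th (t - h) *R w t x)" by (rule integrable_test_fun_scaleR[OF cs wx])
 have i3: "intg (LL 0 r) (%t. th t *R w (t + h) x)"
 proof -
 have "intg (LL (0 + h) (r + h)) (%t. th (t - h) *R w t x)"
 by (rule intg_subset[OF i2]) (use h in "auto simp: r_def")
 thus ?thesis using LL_shift(1)[of 0 r "%t. th (t - h) *R w t x" h] by simp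
 qed
 have i4: "intg (LL 0 r) (%t. th t *R w t x)" by (rule intg_subset[OF i1]) (use r in auto)
 have a: "(LINT t|LL 0 r. th t *R w (t + h) x) = (LINT t|LL 0 T. th (t - h) *R w t x)"
 proof -
 have "(LINT t|LL 0 r. th t *R w (t + h) x) = (LINT t|LL h T. th (t - h) *R w t x)"
 using LL_shift(2)[of 0 r "%t. th (t - h) *R w t x" h] by (simp add: r_def)
 also have "... = (LINT t|LL 0 T. th (t - h) *R w t x)"
 unfolding LL_integral_eq set_int_def
 proof (rule int_cong[OF refl])
 show "indicat_real {h<..<T} s *R th (s - h) *R w s x = indicat_real {0<..<T} s *R th (s - h) *R w s x" for s
 using t[of "s - h"] h by (cases "s - h : {c..T - c}") (auto simp: indicator_def)
 qed
 finally show ?thesis .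
 qed
 have b: "(LINT t|LL 0 r. th t *R w t x) = (LINT t|LL 0 T. th t *R w t x)"
 unfolding LL_integral_eq set_int_def
 proof (rule int_cong[OF refl])
 show "indicat_real {0<..<r} s *R th s *R w s x = indicat_real {0<..<T} s *R th s *R w s x" for s
 using t[of s] h by (cases "s : {c..T - c}") (auto simp: indicator_def r_def)
 qed
 have "(LINT t|LL 0 T. th t *R dq h t x) = (LINT t|LL 0 T. (if t < r then (1 / h) *R (th t *R w (t + h) x - th t *R w t x) else 0))"
 by (rule int_cong) (auto simp: dq_def r_def scaleR_diff_right)
 also have "... = (1 / h) *R ((LINT t|LL 0 T. th (t - h) *R w t x) - (LINT t|LL 0 T. th t *R w t x))"
 unfolding LL_integral_if(2)[OF r(1)] using i3 i4 a b by simp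
 also have "... = (1 / h) *R (LINT t|LL 0 T. th (t - h) *R w t x - th t *R w t x)" using i1 i2 by simp
 also have "... = (LINT t|LL 0 T. (1 / h) *R (th (t - h) *R w t x - th t *R w t x))" by simp
 also have "... = (LINT t|LL 0 T. ((th (t - h) - th t) / h) *R w t x)"
 by (rule int_cong[OF refl]) (simp add: scaleR_diff_left[symmetric])
 finally show ?thesis .
qed

text \<open>The weak limit of the difference quotients is tested with tensor products. Discrete
  integration by parts shows that the required integrals converge, and their limits state that
  \<open>v\<close> is the weak time derivative on almost every line of constant
  \<open>x\<close>.\<close>

lemma exists_time_derivative:
 "EX v. sqQ T v & nQ T v <= K2 & (AE x in LI. acd 0 T (%t. w t x) (%t. v t x))"
proof -
 \<comment> \<open>Step sizes that tend to 0 and satisfy the constraints \<open>h n < T\<close> and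
   \<open>h n <= 1\<close> for every \<open>n\<close>.\<close>
 define h where "h n = min 1 (T / 2) / real (Suc n)" for n
 have h: "0 < h n" "h n < T" "h n <= 1" for n
 proof -
 have m: "0 < min 1 (T / 2)" using T by simp
 show "0 < h n" unfolding h_def using m by simp
 have "h n <= min 1 (T / 2) / 1" unfolding h_def by (rule divide_left_mono) (use m in auto)
 moreover have "min 1 (T / 2) < T" "min 1 (T / 2) <= 1" using T by auto
 ultimately show "h n < T" "h n <= 1" by linarith+
 qed
 have h0: "h \<longlonglongrightarrow> 0"
 proof -
 have "(%n. min 1 (T / 2) * inverse (real (Suc n))) \<longlonglongrightarrow> 0"
 by (rule tendsto_mult_right_zero[OF LIMSEQ_inverse_real_of_nat])
 moreover have "h = (%n. min 1 (T / 2) * inverse (real (Suc n)))" by (rule ext) (simp only: h_def divide_inverse)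
 ultimately show ?thesis by simp
 qed
 have "EX V. sqi (QM T) V & n2 (QM T) V <= K2 & (ALL ph::real \<times> real => real. ALL l. sqi (QM T) ph -->
 (%n. LINT z|QM T. ph z *R cp (dq (h n)) z) \<longlonglongrightarrow> l --> (LINT z|QM T. ph z *R V z) = l)"
 by (rule L2_weakly_compact[OF finite_measure_QM]) (rule difference_quotient_n2(1)[OF h], rule difference_quotient_n2(2)[OF h])
 then obtain V where V: "sqi (QM T) V" "n2 (QM T) V <= K2"
 "!!Ph::real \<times> real => real. !!l. sqi (QM T) Ph ==> (%n. LINT z|QM T. Ph z *R cp (dq (h n)) z) \<longlonglongrightarrow> l ==> (LINT z|QM T. Ph z *R V z) = l"
 by blast
 define v where "v = curry V"
 have v: "sqQ T v" "nQ T v <= K2" using V by (simp_all add: v_def)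
 have iw: "AE x in LI. intg (LL 0 T) (%t. w t x)" using slices(2)[OF w] by eventually_elim (rule sqi_intg)
 have iv: "AE x in LI. intg (LL 0 T) (%t. v t x)" using slices(2)[OF v(1)] by eventually_elim (rule sqi_intg)
 have "AE x in LI. acd 0 T (%t. w t x) (%t. v t x)"
 proof (rule weak_derivative_imp_acd[OF T iw iv])
 fix th :: "real => real" assume th: "test_fun {0<..<T} th"
 define th' where "th' t = D1 th t" for t
 have sth: "smooth_fun th" using th by (simp add: test_fun_def)
 have ct: "continuous_on UNIV th" "continuous_on UNIV th'"
 unfolding th'_def by (rule smooth_cont[OF sth], rule smooth_fun_deriv_continuous[OF sth])
 obtain c B where c: "0 < c" "c < T" "!!t. t \<notin> {c..T - c} ==> th t = 0" and B: "!!s t. \<bar>th s - th t\<bar> <= B * \<bar>s - t\<bar>" "0 <= B"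
 using test_fun_difference_quotient[OF th T] by metis
 have sq: "sqi (LL 0 T) th" "sqi (LL 0 T) th'" by (rule sqi_continuous, rule continuous_on_subset, rule ct, simp)+
 have qn: "(%n. (th (t - h n) - th t) / h n) \<longlonglongrightarrow> - th' t" for t
 proof -
 have "(th has_real_derivative th' t) (at t)"
 using smooth_fun_real_derivative[OF sth] unfolding th'_def real_deriv_iff .
 hence D: "((%k. (th (t + k) - th t) / k) \<longlongrightarrow> th' t) (at 0)" by (simp add: DERIV_def)
 have "filterlim (%n. - h n) (at 0) sequentially"
 using tendsto_minus[OF h0] h(1) by (auto simp: filterlim_at intro!: always_eventually) (metis less_irrefl)
 from filterlim_compose[OF D this] have "(%n. (th (t - h n) - th t) / - h n) \<longlonglongrightarrow> th' t" by simp
 from tendsto_minus[OF this] show ?thesis by simp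
 qed
 have key: "(LINT x|LI. ph x *R ((LINT t|LL 0 T. th t *R v t x) + (LINT t|LL 0 T. th' t *R w t x))) = 0"
 if ph: "test_fun {0<..<1} ph" for ph :: "real => real"
 proof -
 have sph: "sqi LI ph" by (rule sqi_test_fun[OF ph])
 have cph: "continuous_on UNIV ph" using ph smooth_cont by (auto simp: test_fun_def)
 have tens: "sqQ T (%t x. f t * ph x)" if f: "continuous_on UNIV f" for f :: "real => real"
 proof -
 have "bounded (f ` {0..T})" by (intro compact_imp_bounded compact_continuous_image continuous_on_subset[OF f]) auto
 then obtain M where M: "!!t. t : {0..T} ==> \<bar>f t\<bar> <= M" unfolding bounded_iff by fastforce
 have fm: "f : bm (LL 0 T)"
 by (rule cont_imp_meas[OF continuous_on_subset[OF f]]) auto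
 show ?thesis
 proof (rule sqi_bound(1)[OF sqi_QM_space[OF sph]])
 show "(%(t, x). f t * ph x) : bmQ T"
 using borel_measurable_times[OF m_comp[OF measurable_fst fm] m_comp[OF measurable_snd sqi_meas[OF sph]]]
 by (simp add: split_def)
 show "AE z in QM T. norm (case z of (t, x) => f t * ph x) <= M * norm (case z of (t, x) => ph x)"
 using AE_space by eventually_elim (use M in "auto simp: space_pair_measure abs_mult intro!: mult_r_mono")
 qed
 qed
 have I: "intg (QM T) (cp (%t x. (f t * ph x) *R g t x))" if "continuous_on UNIV f" "sqQ T g" for f :: "real => real" and g :: "real => real => 'b"
 by (rule QM_integral_bilinear[OF bounded_bilinear_scaleR tens[OF that(1)] that(2)])
 have II: "(LINT z|QM T. cp (%t x. (f t * ph x) *R g t x) z) = (LINT x|LI. ph x *R (LINT t|LL 0 T. f t *R g t x))"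
 "intg LI (%x. ph x *R (LINT t|LL 0 T. f t *R g t x))"
 if "continuous_on UNIV f" "sqQ T g" for f :: "real => real" and g :: "real => real => 'b"
 proof -
 have e: "(LINT t|LL 0 T. (f t * ph x) *R g t x) = ph x *R (LINT t|LL 0 T. f t *R g t x)" for x
 by (subst integral_scaleR_right[symmetric]) (simp add: mult.commute)
 show "(LINT z|QM T. cp (%t x. (f t * ph x) *R g t x) z) = (LINT x|LI. ph x *R (LINT t|LL 0 T. f t *R g t x))"
 "intg LI (%x. ph x *R (LINT t|LL 0 T. f t *R g t x))"
 using QM_integral(4,6)[OF I[OF that]] unfolding e by auto
 qed
 have cq: "continuous_on UNIV (%t. (th (t - h n) - th t) / h n)" for n
 proof -
 have "continuous_on UNIV (%t. th (t - h n))" by (rule continuous_on_compose2[OF ct(1)]) (auto intro!: continuous_intros)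
 thus ?thesis using h(1)[of n] by (intro continuous_intros ct) auto
 qed
 have ev: "\<forall>\<^sub>F n in sequentially. (LINT z|QM T. cp (%t x. (th t * ph x) *R dq (h n) t x) z) =
 (LINT z|QM T. cp (%t x. (((th (t - h n) - th t) / h n) * ph x) *R w t x) z)"
 using order_tendstoD(2)[OF h0 c(1)]
 proof eventually_elim
 case hn: (elim n)
 have "AE x in LI. ph x *R (LINT t|LL 0 T. th t *R dq (h n) t x) = ph x *R (LINT t|LL 0 T. ((th (t - h n) - th t) / h n) *R w t x)"
 using iw
 proof eventually_elim
 case wx: (elim x)
 have "(LINT t|LL 0 T. th t *R dq (h n) t x) = (LINT t|LL 0 T. ((th (t - h n) - th t) / h n) *R w t x)"
 by (rule integral_dq[where c=c]) (use c ct(1) h(1)[of n] hn wx in auto)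
 thus ?case by simp
 qed
 hence "(LINT x|LI. ph x *R (LINT t|LL 0 T. th t *R dq (h n) t x)) = (LINT x|LI. ph x *R (LINT t|LL 0 T. ((th (t - h n) - th t) / h n) *R w t x))"
 using II(2)[OF ct(1) difference_quotient_n2(1)[OF h]] II(2)[OF cq w] by (intro int_cong_AE) auto
 thus ?case using II(1)[OF ct(1) difference_quotient_n2(1)[OF h]] II(1)[OF cq w] by simp
 qed
 \<comment> \<open>Dominated convergence, with the Lipschitz constant \<open>B\<close> of
   \<open>th\<close> in the dominating function.\<close>
 have lim: "(%n. LINT z|QM T. cp (%t x. (((th (t - h n) - th t) / h n) * ph x) *R w t x) z) \<longlonglongrightarrow>
 (LINT z|QM T. cp (%t x. (- th' t * ph x) *R w t x) z)"
 proof (rule integral_dominated_convergence[where w="%z. norm (cp (%t x. (B * ph x) *R w t x) z)"])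
 show "cp (%t x. (- th' t * ph x) *R w t x) : bmQ T"
 by (rule bm_intg[OF I[OF continuous_on_minus[OF ct(2)] w]])
 show "cp (%t x. (((th (t - h n) - th t) / h n) * ph x) *R w t x) : bmQ T" for n
 by (rule bm_intg[OF I[OF cq w]])
 show "intg (QM T) (%z. norm (cp (%t x. (B * ph x) *R w t x) z))"
 by (rule integrable_norm[OF I[OF _ w, of "%t. B"]]) simp
 show "AE z in QM T. (%n. cp (%t x. (((th (t - h n) - th t) / h n) * ph x) *R w t x) z) \<longlonglongrightarrow> cp (%t x. (- th' t * ph x) *R w t x) z"
 proof (rule AE_I2)
 fix z :: "real \<times> real"
 have "(%n. (((th (t - h n) - th t) / h n) * ph x) *R w t x) \<longlonglongrightarrow> (- th' t * ph x) *R w t x" for t x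
 by (intro tendsto_scaleR tendsto_mult qn tendsto_const)
 thus "(%n. cp (%t x. (((th (t - h n) - th t) / h n) * ph x) *R w t x) z) \<longlonglongrightarrow> cp (%t x. (- th' t * ph x) *R w t x) z"
 by (cases z) (simp only: prod.case)
 qed
 show "AE z in QM T. norm (cp (%t x. (((th (t - h n) - th t) / h n) * ph x) *R w t x) z) <= norm (cp (%t x. (B * ph x) *R w t x) z)" for n
 proof (rule AE_I2)
 fix z :: "real \<times> real"
 have "\<bar>(th (t - h n) - th t) / h n\<bar> <= B" for t
 using B(1)[of "t - h n" t] h(1)[of n] by (simp add: abs_divide divide_le_eq)
 hence "norm ((((th (t - h n) - th t) / h n) * ph x) *R w t x) <= norm ((B * ph x) *R w t x)" for t x
 unfolding norm_scaleR abs_mult using B(2) by (intro mult_r_mono) auto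
 thus "norm (cp (%t x. (((th (t - h n) - th t) / h n) * ph x) *R w t x) z) <= norm (cp (%t x. (B * ph x) *R w t x) z)"
 by (cases z) (simp only: prod.case)
 qed
 qed
 have "(%n. LINT z|QM T. cp (%t x. (th t * ph x) *R dq (h n) t x) z) \<longlonglongrightarrow> (LINT z|QM T. cp (%t x. (- th' t * ph x) *R w t x) z)"
 by (rule Lim_transform_eventually[OF lim]) (use ev in "auto elim: eventually_mono")
 hence "(LINT z|QM T. (cp (%t x. th t * ph x) z) *R V z) = (LINT z|QM T. cp (%t x. (- th' t * ph x) *R w t x) z)"
 by (intro V(3) tens ct) (simp add: split_def)
 also have "(LINT z|QM T. (cp (%t x. th t * ph x) z) *R V z) = (LINT z|QM T. cp (%t x. (th t * ph x) *R v t x) z)"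
 by (simp add: v_def split_def)
 finally have e1: "(LINT x|LI. ph x *R (LINT t|LL 0 T. th t *R v t x)) = (LINT x|LI. ph x *R (LINT t|LL 0 T. (- th' t) *R w t x))"
 using II(1)[OF ct(1) v(1)] II(1)[OF continuous_on_minus[OF ct(2)] w] by simp
 have e2: "(LINT x|LI. ph x *R (LINT t|LL 0 T. (- th' t) *R w t x)) = - (LINT x|LI. ph x *R (LINT t|LL 0 T. th' t *R w t x))"
 by simp
 show ?thesis
 unfolding scaleR_add_right
 by (subst int_add[OF II(2)[OF ct(1) v(1)] II(2)[OF ct(2) w]]) (simp add: e1 e2)
 qed
 have int: "intg LI (%x. (LINT t|LL 0 T. th t *R v t x) + (LINT t|LL 0 T. th' t *R w t x))"
 using QM_integral(4)[OF QM_integral_bilinear[OF bounded_bilinear_scaleR sqi_QM_time[OF sq(1)] v(1)]]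
 QM_integral(4)[OF QM_integral_bilinear[OF bounded_bilinear_scaleR sqi_QM_time[OF sq(2)] w]] by auto
 have "AE u in count_space (UNIV::unit set). AE x in LI. (LINT t|LL 0 T. th t *R v t x) + (LINT t|LL 0 T. th' t *R w t x) = 0"
 proof (rule fundamental_lemma_AE)
 show "AE u in count_space (UNIV::unit set). ALL c d. 0 < c --> d < 1 --> intg (LL c d) (%x. (LINT t|LL 0 T. th t *R v t x) + (LINT t|LL 0 T. th' t *R w t x))"
 using integrable_LL_subset_closed[OF int] by simp
 qed (use key in simp)
 hence "AE x in LI. (LINT t|LL 0 T. th t *R v t x) + (LINT t|LL 0 T. th' t *R w t x) = 0" by (simp add: AE_count_space)
 thus "AE x in LI. (LINT t|LL 0 T. D1 th t *R w t x) = - (LINT t|LL 0 T. th t *R v t x)"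
 unfolding th'_def by eventually_elim (simp add: add_eq_0_iff add.commute)
 qed
 thus ?thesis using v by blast
qed

text \<open>On almost every line \<open>w\<close> is a constant \<open>c x\<close> plus the
  primitive of \<open>v\<close>. On \<open>(0, h)\<close> the initial layer bounds the square
  integral of \<open>w - w0\<close> by \<open>2 * h^2 * K\<close>, and that of the primitive is also
  of order \<open>h^2\<close>. Hence \<open>h * n2 LI (c - w0)\<close> is of order
  \<open>h^2\<close>, and \<open>h\<close> tends to 0.\<close>

lemma time_derivative_initial_value:
 assumes v: "sqQ T v" and ac: "AE x in LI. acd 0 T (%t. w t x) (%t. v t x)"
 shows "AE x in LI. AE t in LL 0 T. w t x = w0 x + prim 0 (%s. v s x) t"
proof -
 define V where "V t x = prim 0 (%s. v s x) t" for t x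
 have sV: "sqQ T V" using sqi_prim_QM[OF v] T by (simp add: V_def[abs_def])
 have swV: "sqQ T (%t x. w t x - V t x)" using sqi_diff[OF w sV] by (simp add: split_def)
 \<comment> \<open>Defined as a mean over time, so that it is measurable in
   \<open>x\<close>.\<close>
 define c where "c x = (1 / T) *R (LINT t|LL 0 T. w t x - V t x)" for x
 have cm: "c : bm LI"
 unfolding c_def using QM_integral(4)[OF finite_measure.sqi_integrable[OF finite_measure_QM swV]] by auto
 have cw: "AE x in LI. AE t in LL 0 T. w t x = c x + V t x"
 using ac AE_space
 proof eventually_elim
 case (elim x)
 then obtain c1 where c1: "AE t in LL 0 T. w t x = c1 + V t x" unfolding acd_def V_def by blast
 have "(LINT t|LL 0 T. w t x - V t x) = (LINT t|LL 0 T. c1)"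
 proof (rule int_cong_AE)
 show "(%t. w t x - V t x) : bm (LL 0 T)"
 by (rule QM_slice_measurable(2)[OF sqi_meas[OF swV]]) (use elim in auto)
 show "AE t in LL 0 T. w t x - V t x = c1" using c1 by eventually_elim simp
 qed simp
 also have "... = T *R c1" using measure_LL[of 0 T] T by simp
 finally have "c x = c1" using T by (simp add: c_def)
 thus ?case using c1 by simp
 qed
 have sc: "sqi LI (%x. c x - w0 x)" and bound: "!!h. 0 < h ==> h <= T ==> h <= 1 ==> n2 LI (%x. c x - w0 x) <= h * (4 * K + 2 * nQ T v)"
 proof -
 have *: "sqi LI (%x. c x - w0 x) & n2 LI (%x. c x - w0 x) <= h * (4 * K + 2 * nQ T v)"
 if h: "0 < h" "h <= T" "h <= 1" for h
 proof -
 have h': "0 <= h" using h by simp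
 have dw: "sqQ h (%t x. w t x - w0 x)"
 using sqi_diff[OF sqi_QM_subset(1)[OF w h' h(2)] sqi_QM_space[OF sqi_w0]] by (simp add: split_def)
 have sVh: "sqQ h V" by (rule sqi_QM_subset(1)[OF sV h' h(2)])
 have d: "sqQ h (%t x. (w t x - w0 x) - V t x)" using sqi_diff[OF dw sVh] by (simp add: split_def)
 have eqx: "AE x in LI. h * (norm (c x - w0 x))^2 = n2 (LL 0 h) (%t. (w t x - w0 x) - V t x)"
 using cw slices(2)[OF d]
 proof eventually_elim
 case (elim x)
 have "n2 (LL 0 h) (%t. (w t x - w0 x) - V t x) = n2 (LL 0 h) (%t. c x - w0 x)"
 proof (rule n2_cong)
 show "AE t in LL 0 h. (w t x - w0 x) - V t x = c x - w0 x"
 using AE_LL_subset[OF elim(1) order_refl h(2)] by eventually_elim simp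
 qed (use elim(2) in "auto simp: sqi_def")
 thus ?case using h by (simp add: n2_const_LL)
 qed
 have i: "intg LI (%x. h * (norm (c x - w0 x))^2)"
 proof (rule intg_bound[OF slices(4)[OF d]])
 show "(%x. h * (norm (c x - w0 x))^2) : bm LI" using cm sqi_meas[OF sqi_w0] by simp
 show "AE x in LI. norm (h * (norm (c x - w0 x))^2) <= norm (n2 (LL 0 h) (%t. w t x - w0 x - V t x))"
 using eqx by eventually_elim (metis order_refl)
 qed
 hence "intg LI (%x. (norm (c x - w0 x))^2)" using h by simp
 hence s: "sqi LI (%x. c x - w0 x)" using cm sqi_meas[OF sqi_w0] by (simp add: sqi_def)
 have "h * n2 LI (%x. c x - w0 x) = (LINT x|LI. h * (norm (c x - w0 x))^2)" by (simp add: n2_def)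
 also have "... = (LINT x|LI. n2 (LL 0 h) (%t. (w t x - w0 x) - V t x))"
 by (rule int_cong_AE) (use i slices(4)[OF d] eqx in auto)
 also have "... = nQ h (%t x. (w t x - w0 x) - V t x)" by (rule slices(6)[OF d, symmetric])
 also have "... <= 2 * nQ h (%t x. w t x - w0 x) + 2 * nQ h V"
 using n2_diff_le[OF dw sVh] by (simp add: split_def)
 also have "nQ h V <= h^2 * nQ T v"
 proof -
 have "nQ h V = (LINT x|LI. n2 (LL 0 h) (%t. V t x))" by (rule slices(6)[OF sVh])
 also have "... <= (LINT x|LI. h^2 * n2 (LL 0 T) (%t. v t x))"
 proof (rule int_mono_AE[OF slices(4)[OF sVh] intg_mult[OF slices(4)[OF v]]])
 show "AE x in LI. n2 (LL 0 h) (%t. V t x) <= h^2 * n2 (LL 0 T) (%t. v t x)"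
 using slices(2)[OF v] by eventually_elim (unfold V_def, rule n2_prim_le(2)[OF _ h' h(2)])
 qed
 also have "... = h^2 * nQ T v" using slices(6)[OF v] by simp
 finally show ?thesis .
 qed
 also have "nQ h (%t x. w t x - w0 x) <= 2 * h^2 * K"
 proof -
 have "al / 2 * (LINT x|LI. (norm (prim 0 (%t. p t x) h))^2) + (LINT t|LL 0 h. n2 LI (%x. w t x - w0 x)) / 2 <= h^2 * K"
 unfolding K_def by (rule initial_layer(2)[OF h])
 moreover have "0 <= al / 2 * (LINT x|LI. (norm (prim 0 (%t. p t x) h))^2)" using al by simp
 ultimately show ?thesis using slices(5)[OF dw] by simp
 qed
 finally have "h * n2 LI (%x. c x - w0 x) <= h * (h * (4 * K + 2 * nQ T v))"
 by (simp add: algebra_simps power2_eq_square)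
 thus ?thesis using s h by simp
 qed
 show "sqi LI (%x. c x - w0 x)" using *[of "min 1 T"] T by auto
 show "!!h. 0 < h ==> h <= T ==> h <= 1 ==> n2 LI (%x. c x - w0 x) <= h * (4 * K + 2 * nQ T v)" using * by blast
 qed
 define M where "M = 4 * K + 2 * nQ T v"
 have "n2 LI (%x. c x - w0 x) <= 0"
 proof (rule tendsto_lowerbound)
 have "((%h. h * M) \<longlongrightarrow> 0 * M) (at_right 0)" by (intro tendsto_intros)
 thus "((%h. h * M) \<longlongrightarrow> 0) (at_right 0)" by simp
 show "\<forall>\<^sub>F h in at_right 0. n2 LI (%x. c x - w0 x) <= h * M"
 unfolding eventually_at_right_field M_def using bound T by (intro exI[of _ "min 1 T"]) auto
 qed simp
 hence "n2 LI (%x. c x - w0 x) = 0" using n2_nonneg order_antisym by blast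
 hence "AE x in LI. (norm (c x - w0 x))^2 = 0"
 using integral_nonneg_eq_0_iff_AE[OF sqi_norm2[OF sc]] by (simp add: n2_def)
 with cw show ?thesis by eventually_elim (simp add: V_def)
qed

text \<open>For a fixed test function and coordinate \<open>b\<close>, the time-integrated equation
  says that a primitive in time vanishes almost everywhere, hence everywhere by continuity, so its
  integrand vanishes for almost every \<open>t\<close>. That the null set depends on the test
  function is permitted by \<open>weak_derivative_imp_acd\<close>.\<close>

lemma flux_derivative:
 assumes v: "sqQ T v" and vw: "AE x in LI. AE t in LL 0 T. w t x = w0 x + prim 0 (%s. v s x) t"
 shows "AE t in LL 0 T. acd 0 1 (%x. a t x *R p t x) (%x. v t x - G t x)"
proof -
 have vG: "sqQ T (%t x. v t x - G t x)" using sqi_diff[OF v G] by (simp add: split_def)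
 have i1: "AE t in LL 0 T. intg LI (%x. a t x *R p t x)"
 using slices(1)[OF sqi_ap] by eventually_elim (rule sqi_intg)
 have i2: "AE t in LL 0 T. intg LI (%x. v t x - G t x)"
 using slices(1)[OF vG] by eventually_elim (rule sqi_intg)
 have vm: "(%(t, x). prim 0 (%s. v s x) t) : bmQ T" by (rule measurable_prim_QM[OF sqi_meas[OF v]])
 have w0m: "(%(t, x). w0 x) : bmQ T" using sqi_meas[OF sqi_QM_space[OF sqi_w0]] .
 have vw': "AE t in LL 0 T. AE x in LI. w t x = w0 x + prim 0 (%s. v s x) t"
 proof -
 interpret P: pair_sigma_finite "LL 0 T" "LI" by (rule psf_LL)
 have "(%z. cp w z - ((case z of (t, x) => w0 x) + (case z of (t, x) => prim 0 (%s. v s x) t))) -` {0} \<inter> space (QM T) : sets (QM T)"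
 by (rule measurable_sets[OF bm_diff[OF sqi_meas[OF w] borel_measurable_add[OF w0m vm]]]) simp
 moreover have "(%z. cp w z - ((case z of (t, x) => w0 x) + (case z of (t, x) => prim 0 (%s. v s x) t))) -` {0} \<inter> space (QM T) =
 {z : space (QM T). w (fst z) (snd z) = w0 (snd z) + prim 0 (%s. v s (snd z)) (fst z)}"
 by (auto simp: split_def)
 ultimately have "{z : space (QM T). w (fst z) (snd z) = w0 (snd z) + prim 0 (%s. v s (snd z)) (fst z)} : sets (QM T)"
 by simp
 from P.AE_commute[OF this] vw show ?thesis by simp
 qed
 show ?thesis
 proof (rule weak_derivative_imp_acd[OF _ i1 i2])
 fix ph :: "real => real" assume ph: "test_fun {0<..<1} ph"
 define ph' where "ph' x = D1 ph x" for x
 have h: "h10 ph ph'" unfolding ph'_def by (rule h10_test_fun[OF ph])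
 have s: "sqi LI ph" "sqi LI ph'" using h10_sqi[OF h] h10_sqi_deriv[OF h] by auto
 have "AE t in LL 0 T. ((LINT x|LI. ph' x *R (a t x *R p t x)) + (LINT x|LI. ph x *R (v t x - G t x))) *I b = 0"
 if b: "b : Basis" for b
 proof -
 have hb: "h10 (%x. ph x *R b) (%x. ph' x *R b)" by (rule h10_bounded_linear[OF bounded_linear_scaleR_left h])
 have sb: "sqi LI (%x. ph x *R b)" "sqi LI (%x. ph' x *R b)" using h10_sqi[OF hb] h10_sqi_deriv[OF hb] by auto
 define f1 where "f1 s = (LINT x|LI. v s x *I (ph x *R b))" for s
 define f2 where "f2 s = (LINT x|LI. (a s x *R p s x) *I (ph' x *R b))" for s
 define f3 where "f3 s = (LINT x|LI. G s x *I (ph x *R b))" for s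
 have sw: "(LINT x|LI. prim 0 (%s. v s x) t *I (ph x *R b)) = prim 0 f1 t"
 "(LINT x|LI. prim 0 (%s. a s x *R p s x) t *I (ph' x *R b)) = prim 0 f2 t"
 "(LINT x|LI. prim 0 (%s. G s x) t *I (ph x *R b)) = prim 0 f3 t" if "t : {0<..<T}" for t
 proof -
 have t: "0 <= t" "t <= T" using that by auto
 show "(LINT x|LI. prim 0 (%s. v s x) t *I (ph x *R b)) = prim 0 f1 t"
 unfolding f1_def by (rule inner_swap(1)[OF bb_inner v sb(1) t])
 show "(LINT x|LI. prim 0 (%s. a s x *R p s x) t *I (ph' x *R b)) = prim 0 f2 t"
 unfolding f2_def by (rule inner_swap(1)[OF bb_inner sqi_ap sb(2) t])
 show "(LINT x|LI. prim 0 (%s. G s x) t *I (ph x *R b)) = prim 0 f3 t"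
 unfolding f3_def by (rule inner_swap(1)[OF bb_inner G sb(1) t])
 qed
 have T0: "0 <= T" using T by simp
 have fi: "intg (LL 0 T) f1" "intg (LL 0 T) f2" "intg (LL 0 T) f3"
 unfolding f1_def f2_def f3_def
 by (rule inner_swap(2)[OF bb_inner v sb(1) T0 order_refl],
 rule inner_swap(2)[OF bb_inner sqi_ap sb(2) T0 order_refl],
 rule inner_swap(2)[OF bb_inner G sb(1) T0 order_refl])
 have fi': "intg (LL 0 T) (%s. f1 s + f2 s - f3 s)" using fi by auto
 have "AE t in LL 0 T. prim 0 (%s. f1 s + f2 s - f3 s) t = 0"
 using eq vw' AE_space
 proof eventually_elim
 case (elim t)
 hence t: "t : {0<..<T}" by simp
 have wv: "(LINT x|LI. (w t x - w0 x) *I (ph x *R b)) = (LINT x|LI. prim 0 (%s. v s x) t *I (ph x *R b))"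
 proof (rule int_cong_AE)
 show "AE x in LI. (w t x - w0 x) *I (ph x *R b) = prim 0 (%s. v s x) t *I (ph x *R b)"
 using elim(2) by eventually_elim simp
 show "(%x. (w t x - w0 x) *I (ph x *R b)) : bm LI"
 by (rule bm_inner[OF bm_diff[OF QM_slice_measurable(1)[OF sqi_meas[OF w] t] sqi_meas[OF sqi_w0]] sqi_meas[OF sb(1)]])
 show "(%x. prim 0 (%s. v s x) t *I (ph x *R b)) : bm LI"
 by (rule bm_inner[OF QM_slice_measurable(1)[OF vm t] sqi_meas[OF sb(1)]])
 qed
 have "(LINT x|LI. (w t x - w0 x) *I (ph x *R b)) = - prim 0 f2 t + prim 0 f3 t"
 using elim(1)[rule_format, OF hb] unfolding sw(2,3)[OF t] .
 hence "prim 0 f1 t = - prim 0 f2 t + prim 0 f3 t" unfolding wv sw(1)[OF t] .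
 thus ?case
 using prim_subtract[OF intg_add[OF fi(1,2)] fi(3), of t] prim_add[OF fi(1,2), of t] t by simp
 qed
 hence z: "prim 0 (%s. f1 s + f2 s - f3 s) t = 0" if "t : {0..T}" for t
 by (rule continuous_AE_eq[OF continuous_on_prim[OF fi'] continuous_on_const _ T that])
 have "AE s in LL 0 T. f1 s + f2 s - f3 s = 0"
 by (rule AE_zero_if_prim_zero[OF fi' _ z]) (use T in auto)
 thus ?thesis
 using slices(1)[OF v] slices(1)[OF sqi_ap] slices(1)[OF G]
 proof eventually_elim
 case (elim t)
 have "(LINT x|LI. ph' x *R (a t x *R p t x)) *I b = f2 t"
 using int_blin[OF bounded_linear_inner_left[of b] sqi_scal[OF s(2) elim(3)]] by (simp add: f2_def mult.assoc)
 moreover have "(LINT x|LI. ph x *R (v t x - G t x)) *I b = f1 t - f3 t"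
 proof -
 have "(LINT x|LI. ph x *R (v t x - G t x)) *I b = (LINT x|LI. (ph x *R (v t x - G t x)) *I b)"
 by (rule int_blin[OF bounded_linear_inner_left sqi_scal[OF s(1) sqi_diff[OF elim(2,4)]], symmetric])
 also have "... = (LINT x|LI. v t x *I (ph x *R b) - G t x *I (ph x *R b))"
 by (rule int_cong[OF refl]) (simp add: inner_diff_left right_diff_distrib)
 also have "... = f1 t - f3 t"
 unfolding f1_def f3_def
 by (rule int_diff[OF sqi_inner[OF elim(2) sb(1)] sqi_inner[OF elim(4) sb(1)]])
 finally show ?thesis .
 qed
 ultimately show ?case using elim(1) unfolding inner_add_left by linarith
 qed
 qed
 note B = this
 have "AE t in LL 0 T. ALL b:Basis. ((LINT x|LI. ph' x *R (a t x *R p t x)) + (LINT x|LI. ph x *R (v t x - G t x))) *I b = 0"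
 by (rule AE_finite_allI[OF finite_Basis B])
 thus "AE t in LL 0 T. (LINT x|LI. D1 ph x *R (a t x *R p t x)) = - (LINT x|LI. ph x *R (v t x - G t x))"
 proof (rule AE_mp[OF _ AE_I2], intro impI)
 fix t
 define I where "I = (LINT x|LI. ph' x *R (a t x *R p t x))"
 define J where "J = (LINT x|LI. ph x *R (v t x - G t x))"
 assume h: "ALL b:Basis. ((LINT x|LI. ph' x *R (a t x *R p t x)) + (LINT x|LI. ph x *R (v t x - G t x))) *I b = 0"
 have "I + J = 0"
 by (rule euclidean_eqI) (use h in "simp only: inner_zero_left I_def J_def")
 hence "I = - J" by (simp add: eq_neg_iff_add_eq_0)
 thus "(LINT x|LI. D1 ph x *R (a t x *R p t x)) = - (LINT x|LI. ph x *R (v t x - G t x))"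
 unfolding I_def J_def ph'_def .
 qed
 qed simp
qed

theorem maximal_regularity:
 "EX v. sqQ T v & nQ T v <= K2 &
 (AE x in LI. AE t in LL 0 T. w t x = w0 x + prim 0 (%s. v s x) t) &
 (AE t in LL 0 T. acd 0 1 (%x. a t x *R p t x) (%x. v t x - G t x))"
proof -
 obtain v where v: "sqQ T v" "nQ T v <= K2" "AE x in LI. acd 0 T (%t. w t x) (%t. v t x)"
 using exists_time_derivative by blast
 note i = time_derivative_initial_value[OF v(1,3)]
 show ?thesis using v(1,2) i flux_derivative[OF v(1) i] by blast
qed

end

section \<open>Energy estimate\<close>

text \<open>The inequality holds only almost everywhere, so the integrating factor
  \<open>exp (- C * t)\<close> is applied to the primitive of \<open>y\<close>: the product has
  derivative at most \<open>D\<close>.\<close>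

lemma gronwall:
 fixes y :: "real => real"
 assumes y: "intg (LL 0 T) y" "!!t. 0 <= y t" and T: "0 <= T" and D: "0 <= D" and C: "0 <= C"
 and le: "AE t in LL 0 T. y t <= D + C * prim 0 y t"
 shows "prim 0 y T <= D * T * exp (C * T)"
proof -
 \<comment> \<open>The derivative of the integrating factor, so that \<open>1 + prim 0 f t\<close>
   equals \<open>exp (- C * t)\<close>.\<close>
 define f where "f t = - C * exp (- C * t)" for t
 have f: "prim 0 f t = exp (- C * t) - exp (- C * 0)" "intg (LL 0 t) f" if "0 <= t" for t
 proof -
 have d: "((%t. exp (- C * t)) has_vector_derivative f t) (at t)" for t
 unfolding f_def real_deriv_iff[symmetric]
 by (auto intro!: derivative_eq_intros)
 have c: "continuous_on UNIV f" unfolding f_def[abs_def] by (intro continuous_intros)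
 show "prim 0 f t = exp (- C * t) - exp (- C * 0)" "intg (LL 0 t) f" using prim_FTC[OF d c that] by auto
 qed
 note P = prim_product[OF bounded_bilinear_mult f(2)[OF T] y(1) T order_refl, of 0 1]
 have "prim 0 (%x. f x * (0 + prim 0 y x) + (1 + prim 0 f x) * y x) T <= (LINT t|LL 0 T. D)"
 unfolding LL_prim[symmetric, where l = 0 and r = T]
 proof (rule int_mono_AE)
 show "intg (LL 0 T) (%x. f x * (0 + prim 0 y x) + (1 + prim 0 f x) * y x)" by (rule P(1))
 show "intg (LL 0 T) (%t. D)" using fm_intg_const[OF fin_LL] .
 show "AE x in LL 0 T. f x * (0 + prim 0 y x) + (1 + prim 0 f x) * y x <= D"
 using le AE_space
 proof eventually_elim
 case (elim t)
 hence t: "0 <= t" by simp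
 have "f t * (0 + prim 0 y t) + (1 + prim 0 f t) * y t = exp (- C * t) * (y t - C * prim 0 y t)"
 unfolding f(1)[OF t] f_def by (simp add: algebra_simps)
 also have "... <= exp (- C * t) * D" using elim by (intro mult_left_mono) auto
 also have "... <= 1 * D" using D C t by (intro mult_r_mono) auto
 finally show ?case by simp
 qed
 qed
 moreover have "(LINT t|LL 0 T. D) = D * T"
 unfolding lebesgue_integral_const measure_LL[OF T] by (simp add: mult.commute)
 moreover have "prim 0 (%x. f x * (0 + prim 0 y x) + (1 + prim 0 f x) * y x) T = exp (- C * T) * prim 0 y T"
 unfolding P(2) f(1)[OF T] by (simp only: mult_zero_right exp_zero) argo
 ultimately have "exp (- C * T) * prim 0 y T <= D * T" by argo
 hence "exp (C * T) * (exp (- C * T) * prim 0 y T) <= exp (C * T) * (D * T)" by (rule mult_left_mono) simp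
 moreover have "exp (C * T) * (exp (- C * T) * prim 0 y T) = prim 0 y T"
 proof -
 have "exp (C * T) * exp (- C * T) = 1" unfolding exp_add[symmetric] by simp
 thus ?thesis by (metis mult.assoc mult_1)
 qed
 ultimately show ?thesis by (metis mult.commute)
qed

text \<open>The quotient \<open>q\<close> of \<open>w p\<close> by \<open>w\<close> is constructed as a primitive; the error \<open>w q - w p\<close> solves a
 homogeneous linear equation, so it vanishes.\<close>

lemma (in lip_coef) acd_factor:
 fixes p F :: "real => 'b::euclidean_space"
 assumes F: "acd 0 T (%x. w x *R p x) F"
 shows "acd 0 T p (%x. (1 / w x) *R (F x - dw x *R p x))"
proof -
 obtain c where c: "AE x in LL 0 T. w x *R p x = c + prim 0 F x" and iF: "intg (LL 0 T) F"
 using F by (auto simp: acd_def)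
 define Fh where "Fh x = c + prim 0 F x" for x
 define u where "u x = inverse (w0 x)" for x
 have pos: "0 < w0 x" if "x : {0..T}" for x using w0_bounds(1)[OF that] al by linarith
 have ct: "continuous_on {0..T} u" unfolding u_def[abs_def] using w0_continuous
 by (rule continuous_on_inverse) (use pos in force)
 have cF: "continuous_on {0..T} Fh" unfolding Fh_def[abs_def] by (intro continuous_on_add continuous_on_const continuous_on_prim iF)
 have ib: "intg (LL 0 T) (%x. k x *R g x)" if "continuous_on {0..T} k" "intg (LL 0 T) g" for k and g :: "real => 'b"
 proof -
 have "bounded (k ` {0..T})" by (rule compact_imp_bounded[OF compact_continuous_image[OF that(1) compact_Icc]])
 then obtain B where B: "!!x. x : {0..T} ==> \<bar>k x\<bar> <= B" unfolding bounded_iff by (metis imageI real_norm_def)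
 show ?thesis
 proof (rule intg_bound)
 show "intg (LL 0 T) (%x. B *R g x)" using that(2) by simp
 show "(%x. k x *R g x) : bm (LL 0 T)"
 by (intro bm_scal bm_intg[OF that(2)] sqi_meas[OF sqi_continuous[OF that(1)]])
 show "AE x in LL 0 T. norm (k x *R g x) <= norm (B *R g x)"
 using AE_space
 proof eventually_elim
 case (elim x)
 have "\<bar>k x\<bar> * norm (g x) <= \<bar>B\<bar> * norm (g x)"
 using B[of x] elim by (intro mult_r_mono) auto
 thus ?case by (simp only: norm_scaleR real_norm_def)
 qed
 qed
 qed
 \<comment> \<open>The quotient rule for \<open>Fh / w0\<close>, with \<open>u\<close> the
   reciprocal of \<open>w0\<close>.\<close>
 define r where "r x = u x *R (F x - dw x *R (u x *R Fh x))" for x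
 have i1: "intg (LL 0 T) (%x. dw x *R (u x *R Fh x))"
 proof -
 have cc: "continuous_on {0..T} (%x. u x *R Fh x)" by (intro continuous_on_scaleR ct cF)
 have "bounded ((%x. u x *R Fh x) ` {0..T})" by (rule compact_imp_bounded[OF compact_continuous_image[OF cc compact_Icc]])
 then obtain B where B: "!!x. x : {0..T} ==> norm (u x *R Fh x) <= B" unfolding bounded_iff by (metis (no_types, lifting) imageI)
 show ?thesis
 proof (rule intg_bound)
 show "intg (LL 0 T) (%x. B * dw x)" using dw(1) by simp
 show "(%x. dw x *R (u x *R Fh x)) : bm (LL 0 T)"
 by (intro bm_scal bm_intg[OF dw(1)] sqi_meas[OF sqi_continuous[OF ct]] sqi_meas[OF sqi_continuous[OF cF]])
 show "AE x in LL 0 T. norm (dw x *R (u x *R Fh x)) <= norm (B * dw x)"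
 using AE_space
 proof eventually_elim
 case (elim x)
 have "\<bar>dw x\<bar> * norm (u x *R Fh x) <= \<bar>dw x\<bar> * \<bar>B\<bar>"
 using B[of x] elim by (intro mult_left_mono) auto
 thus ?case by (simp only: norm_scaleR real_norm_def abs_mult mult.commute)
 qed
 qed
 qed
 have ir: "intg (LL 0 T) r" unfolding r_def[abs_def] by (intro ib ct intg_diff iF i1)
 define q where "q x = u 0 *R c + prim 0 r x" for x
 have cq: "continuous_on {0..T} q" unfolding q_def[abs_def] by (intro continuous_on_add continuous_on_const continuous_on_prim ir)
 define E where "E x = w0 x *R q x - Fh x" for x
 have cE: "continuous_on {0..T} E" unfolding E_def[abs_def] by (intro continuous_on_diff continuous_on_scaleR w0_continuous cq cF)
 have iE: "intg (LL 0 T) E" by (rule sqi_intg[OF sqi_continuous[OF cE]])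
 \<comment> \<open>\<open>E\<close> vanishes at 0 and has derivative
   \<open>dw x * u x * E x\<close>, where \<open>dw * u\<close> is bounded by
   \<open>L / al\<close>.\<close>
 have Eb: "norm (E x) <= (L / al) * prim 0 (%x. norm (E x)) x" if x: "x : {0..T}" for x
 proof -
 have x0: "0 <= x" "x <= T" using x by auto
 note PP = prim_product[OF bounded_bilinear_scaleR dw(1) ir x0, where c = c0 and d = "u 0 *R c"]
 have "prim 0 (%x. dw x *R q x + w0 x *R r x) x = w0 x *R q x - c"
 using PP(2) T pos[of 0] by (simp add: q_def w0_def u_def)
 moreover have "intg (LL 0 T) (%x. dw x *R q x + w0 x *R r x)"
 using PP(1) by (simp add: q_def[abs_def] w0_def[abs_def])
 moreover note ii = calculation(2)
 ultimately have "E x = prim 0 (%x. (dw x *R q x + w0 x *R r x) - F x) x"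
 by (subst prim_subtract[OF _ iF x0(2)]) (auto simp: E_def Fh_def)
 also have "... = (LINT s|LL 0 x. (dw s *R q s + w0 s *R r s) - F s)" by (simp only: LL_prim)
 finally have Ex: "E x = (LINT s|LL 0 x. (dw s *R q s + w0 s *R r s) - F s)" .
 have "norm (E x) <= (LINT s|LL 0 x. norm ((dw s *R q s + w0 s *R r s) - F s))"
 unfolding Ex by (rule integral_norm_bound)
 also have "... <= (LINT s|LL 0 x. (L / al) * norm (E s))"
 proof (rule int_mono_AE)
 show "intg (LL 0 x) (%s. norm ((dw s *R q s + w0 s *R r s) - F s))"
 by (rule integrable_norm[OF intg_subset[OF intg_diff[OF ii iF] order_refl x0(2)]])
 show "intg (LL 0 x) (%s. (L / al) * norm (E s))"
 by (rule intg_mult[OF integrable_norm[OF intg_subset[OF iE order_refl x0(2)]]])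
 show "AE s in LL 0 x. norm ((dw s *R q s + w0 s *R r s) - F s) <= (L / al) * norm (E s)"
 using AE_LL_subset[OF dw(2) order_refl x0(2)] AE_space
 proof eventually_elim
 case (elim s)
 hence s: "s : {0..T}" using x0 by auto
 have p: "w0 s ~= 0" using pos[OF s] by simp
 have "w0 s *R r s = F s - dw s *R (u s *R Fh s)" using p by (simp add: r_def u_def)
 moreover have "u s *R E s = q s - u s *R Fh s" using p by (simp add: E_def u_def scaleR_diff_right)
 ultimately have "(dw s *R q s + w0 s *R r s) - F s = dw s *R (u s *R E s)"
 by (simp only: scaleR_diff_right) simp
 hence "norm ((dw s *R q s + w0 s *R r s) - F s) = (\<bar>dw s\<bar> * u s) * norm (E s)"
 proof -
 have "0 < u s" using pos[OF s] by (simp add: u_def)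
 moreover assume h: "(dw s *R q s + w0 s *R r s) - F s = dw s *R (u s *R E s)"
 ultimately show ?thesis unfolding h norm_scaleR by (simp only: abs_of_pos mult.assoc)
 qed
 also have "... <= (L * (1 / al)) * norm (E s)"
 using elim(1) w0_bounds(1)[OF s] al L pos[OF s]
 by (intro mult_r_mono mult_mono) (auto simp: u_def inverse_eq_divide intro!: divide_left_mono)
 finally show ?case by simp
 qed
 qed
 also have "... = (L / al) * prim 0 (%x. norm (E x)) x" by (simp add: LL_prim)
 finally show ?thesis .
 qed
 have "prim 0 (%x. norm (E x)) T <= 0 * T * exp ((L / al) * T)"
 proof (rule gronwall)
 show "AE t in LL 0 T. norm (E t) <= 0 + (L / al) * prim 0 (%x. norm (E x)) t"
 using AE_space by eventually_elim (use Eb in auto)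
 qed (use iE T L al in auto)
 hence "(LINT x|LL 0 T. norm (E x)) <= 0" by (simp add: LL_prim)
 hence "(LINT x|LL 0 T. norm (E x)) = 0" by (intro antisym integral_nonneg_AE) auto
 hence E0: "AE x in LL 0 T. norm (E x) = 0"
 by (subst integral_nonneg_eq_0_iff_AE[OF integrable_norm[OF iE], symmetric]) auto
 have pq: "AE x in LL 0 T. q x = p x & r x = (1 / w x) *R (F x - dw x *R p x)"
 using E0 c w(1) AE_space
 proof eventually_elim
 case (elim x)
 have p: "w0 x ~= 0" using pos[of x] elim(4) by simp
 have wx: "w x = w0 x" using elim(3) by (simp add: w0_def)
 have 1: "Fh x = w0 x *R p x" using elim(2) wx by (simp add: Fh_def)
 have 2: "w0 x *R q x = w0 x *R p x" using elim(1) 1 by (simp add: E_def)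
 show ?case using 2 p by (simp add: r_def u_def 1 wx inverse_eq_divide)
 qed
 have "acd 0 T q r" by (rule acdI[OF ir, where c = "u 0 *R c"]) (simp add: q_def)
 hence "acd 0 T p r" by (rule acd_AE_cong) (use pq in eventually_elim, simp)
 thus ?thesis
 proof (rule acd_AE_cong_deriv)
 show *: "AE x in LL 0 T. r x = (1 / w x) *R (F x - dw x *R p x)" using pq by eventually_elim simp
 show "(%x. (1 / w x) *R (F x - dw x *R p x)) : bm (LL 0 T)"
 by (rule AE_measurable_LL[OF _ bm_intg[OF ir]]) (use * in eventually_elim, simp)
 qed
qed

section \<open>Almost everywhere statements and bounds on the cylinder\<close>

lemma AE_QM_if_slices:
 assumes "Measurable.pred (QM T) P" "AE t in LL 0 T. AE x in LI. P (t, x)"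
 shows "AE p in QM T. P p"
proof -
 interpret P: pair_sigma_finite "LL 0 T" "LI" by (rule psf_LL)
 show ?thesis by (rule P.AE_pair_measure) (use assms in "auto simp: pred_def")
qed

text \<open>Fubini's theorem for the exceptional set. For its sake representatives are kept jointly
  measurable.\<close>

lemma AE_QM_swap:
 assumes "Measurable.pred (QM T) P"
 shows "(AE t in LL 0 T. AE x in LI. P (t, x)) \<longleftrightarrow> (AE x in LI. AE t in LL 0 T. P (t, x))"
proof -
 interpret P: pair_sigma_finite "LL 0 T" "LI" by (rule psf_LL)
 show ?thesis using P.AE_commute[of "%t x. P (t, x)"] assms by (auto simp: pred_def)
qed

text \<open>Each summand costs one factor 2, from the square of a sum being at most twice the sum of
  the squares. The list form lets long pointwise bounds be squared and integrated at once.\<close>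

lemma n2_linear_combination:
 fixes fs :: "(real \<times> ('a => 'b::euclidean_space)) list"
 assumes f: "!!c f. (c, f) : set fs ==> sqi M f" and g: "g : bm M"
 and le: "AE x in M. norm (g x) <= (\<Sum>(c, f)\<leftarrow>fs. c * norm (f x))"
 shows "sqi M g" "n2 M g <= 2 ^ length fs * (\<Sum>(c, f)\<leftarrow>fs. c^2 * n2 M f)"
proof -
 have *: "sqi M (%x. \<Sum>(c, f)\<leftarrow>fs. c * norm (f x)) & n2 M (%x. \<Sum>(c, f)\<leftarrow>fs. c * norm (f x)) <= 2 ^ length fs * (\<Sum>(c, f)\<leftarrow>fs. c^2 * n2 M f)"
 using f
 proof (induction fs)
 case (Cons cf fs)
 obtain c f where cf: "cf = (c, f)" by force
 have IH: "sqi M (%x. \<Sum>(c, f)\<leftarrow>fs. c * norm (f x))" "n2 M (%x. \<Sum>(c, f)\<leftarrow>fs. c * norm (f x)) <= 2 ^ length fs * (\<Sum>(c, f)\<leftarrow>fs. c^2 * n2 M f)"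
 using Cons by auto
 have s: "sqi M (%x. c * norm (f x))" using sqi_scaleR[OF sqi_norm[of M f], of c] Cons.prems[of c f] by (simp add: cf)
 have n: "n2 M (%x. c * norm (f x)) = c^2 * n2 M f"
 by (simp add: n2_def power_mult_distrib)
 have "n2 M (%x. c * norm (f x) + (\<Sum>(c, f)\<leftarrow>fs. c * norm (f x))) <= 2 * (c^2 * n2 M f) + 2 * (2 ^ length fs * (\<Sum>(c, f)\<leftarrow>fs. c^2 * n2 M f))"
 using n2_add_le[OF s IH(1)] IH(2) n by linarith
 also have "... <= 2 * (2 ^ length fs * (c^2 * n2 M f)) + 2 * (2 ^ length fs * (\<Sum>(c, f)\<leftarrow>fs. c^2 * n2 M f))"
 using mult_r_mono[OF one_le_power[of "2::real" "length fs"], of "c^2 * n2 M f"] by simp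
 finally show ?case using sqi_add[OF s IH(1)] by (simp add: cf algebra_simps)
 qed (simp add: n2_def)
 have le': "AE x in M. norm (g x) <= 1 * norm (\<Sum>(c, f)\<leftarrow>fs. c * norm (f x))"
 using le by eventually_elim (rule order_trans, assumption, simp only: mult_1 real_norm_def abs_ge_self)
 show "sqi M g" by (rule sqi_bound(1)[OF conjunct1[OF *] g le'])
 show "n2 M g <= 2 ^ length fs * (\<Sum>(c, f)\<leftarrow>fs. c^2 * n2 M f)"
 using sqi_bound(2)[OF conjunct1[OF *] g le'] * by simp
qed

lemma AE_QM_bound:
 fixes g :: "real => real => 'b::euclidean_space" and fs :: "(real \<times> (real => real => 'b)) list"
 assumes f: "!!c f. (c, f) : set fs ==> sqQ T f" and g: "cp g : bmQ T"
 and le: "AE t in LL 0 T. AE x in LI. norm (g t x) <= (\<Sum>(c, f)\<leftarrow>fs. c * norm (f t x))"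
 shows "sqQ T g" "nQ T g <= 2 ^ length fs * (\<Sum>(c, f)\<leftarrow>fs. c^2 * nQ T f)"
proof -
 define gs where "gs = map (%(c, f). (c, cp f)) fs"
 have gs: "sqi (QM T) f" if "(c, f) : set gs" for c f using that assms(1) by (auto simp: gs_def)
 have S: "(\<Sum>(c, f)\<leftarrow>gs. c * norm (f (t, x))) = (\<Sum>(c, f)\<leftarrow>fs. c * norm (f t x))" for t x
 unfolding gs_def by (induction fs) auto
 have N: "(\<Sum>(c, f)\<leftarrow>gs. c^2 * n2 (QM T) f) = (\<Sum>(c, f)\<leftarrow>fs. c^2 * nQ T f)"
 unfolding gs_def by (induction fs) auto
 have m: "(%p. \<Sum>(c, f)\<leftarrow>gs. c * norm (f p)) : bmQ T"
 using gs
 proof (induction gs)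
 case (Cons cf gs)
 obtain c f where cf: "cf = (c, f)" by force
 have "f : bmQ T" using Cons.prems[of c f] by (auto simp: cf sqi_def)
 moreover have "(%p. \<Sum>(c, f)\<leftarrow>gs. c * norm (f p)) : bmQ T" using Cons by auto
 ultimately show ?case by (simp add: cf)
 qed simp
 have "AE p in QM T. norm (cp g p) <= (\<Sum>(c, f)\<leftarrow>gs. c * norm (f p))"
 proof (rule AE_QM_if_slices)
 show "Measurable.pred (QM T) (%p. norm (cp g p) <= (\<Sum>(c, f)\<leftarrow>gs. c * norm (f p)))"
 unfolding pred_def by (rule borel_measurable_le[OF m_comp[OF g borel_measurable_norm] m])
 qed (use le in "simp add: S")
 note c = n2_linear_combination[OF _ g this]
 show "sqQ T g" by (rule c(1)) (rule gs)
 have "nQ T g <= 2 ^ length gs * (\<Sum>(c, f)\<leftarrow>gs. c^2 * n2 (QM T) f)" by (rule c(2)) (rule gs)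
 thus "nQ T g <= 2 ^ length fs * (\<Sum>(c, f)\<leftarrow>fs. c^2 * nQ T f)"
 unfolding N by (simp only: gs_def length_map)
qed

section \<open>Estimates by the data\<close>

lemma integral_prim_swap:
 fixes f :: "real => real => 'b::euclidean_space"
 assumes f: "intg (QM T) (cp f)" and t: "0 <= t" "t <= T"
 shows "(LINT x|LI. prim 0 (%s. f s x) t) = prim 0 (%s. LINT x|LI. f s x) t"
 and "intg LI (%x. prim 0 (%s. f s x) t)"
proof -
 define g where "g s x = (if s < t then f s x else 0)" for s x
 have g: "intg (QM T) (cp g)"
 proof (rule intg_bound[OF f])
 have m: "fst : bmQ T"
 by (intro borel_bmQ bm_cont continuous_on_fst continuous_on_id)
 have "(%p. if fst p < t then cp f p else 0) : bmQ T"
 using m bm_intg[OF f] by measurable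
 thus "cp g : bmQ T" by (simp add: g_def[abs_def] split_def cong: if_cong)
 show "AE x in QM T. norm (cp g x) <= norm (cp f x)" by (simp add: g_def split_def)
 qed
 have p: "(LINT s|LL 0 T. g s x) = prim 0 (%s. f s x) t" for x
 unfolding g_def LL_integral_if(2)[OF t(2)] by (rule LL_prim)
 have q: "(LINT x|LI. g s x) = (if s < t then \<integral>x. f s x \<partial>LI else 0)" for s by (simp add: g_def)
 show "intg LI (%x. prim 0 (%s. f s x) t)" using QM_integral(4)[OF g] by (simp only: p)
 have "(LINT x|LI. prim 0 (%s. f s x) t) = (LINT s|LL 0 T. LINT x|LI. g s x)"
 using QM_integral(5,6)[OF g] by (simp only: p)
 thus "(LINT x|LI. prim 0 (%s. f s x) t) = prim 0 (%s. LINT x|LI. f s x) t"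
 unfolding q LL_integral_if(2)[OF t(2)] LL_prim[where l = 0 and r = t] .
qed

text \<open>The constants bound squared norms relative to \<open>n2 LI p0 + nQ T R\<close>:
  \<open>c1\<close> is the Gronwall rate, \<open>k1\<close> belongs to \<open>z\<close>,
  \<open>k2\<close> to \<open>p\<close>, \<open>k3\<close> to the source \<open>G\<close>,
  \<open>k4\<close> to the initial layer constant \<open>K\<close>, \<open>k5\<close> to
  \<open>K2\<close> and hence to the time derivative, \<open>k6\<close> to the second spatial
  derivative. Each factor 8 comes from a pointwise bound with three summands.\<close>

definition parabolic_const :: "real => real => real => real => real => real" where
 "parabolic_const T al A L B =
 (let c1 = 1 + B^2 / al + 2 * B; k1 = T * exp (c1 * T); k2 = (1 + c1 * k1) / al;
 k3 = 8 * (1 + B^2 * k2 + B^2 * k1); k4 = 2 * A + L + 3 * L * k2 + k3;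
 k5 = 2 * A * k4 / al + 6 * L * k2 + k3; k6 = 8 * ((1 / al)^2 * k5 + (1 / al)^2 * k3 + (L / al)^2 * k2)
 in k1 + k2 + k5 + k6)"

text \<open>The source \<open>G\<close> contains the lower-order terms of \<open>z\<close>, while
  \<open>R\<close> is the actual data. Maximal regularity, with its bound in terms of
  \<open>p\<close> and \<open>G\<close>, thus becomes an estimate by the data only through the
  energy estimate.\<close>

locale parabolic_estimate = weak_parabolic T al A L a da z p G z0 p0
 for T al A L :: real and a da :: "real => real => real"
 and z p G :: "real => real => 'b::euclidean_space" and z0 p0 :: "real => 'b" +
 fixes ax b :: "real => real => real" and q :: "real => real" and R :: "real => real => 'b" and B :: real
 assumes ax_meas: "cp ax : bmQ T"
 and ax: "AE t in LL 0 T. EX c0. lip_coef 1 al A L c0 (a t) (ax t)"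
 and R: "sqQ T R" and B: "0 <= B"
 and G_eq: "AE t in LL 0 T. AE x in LI. \<bar>b t x\<bar> <= B & \<bar>q x\<bar> <= B & G t x = R t x - b t x *R p t x - q x *R z t x"
begin

text \<open>The three summands come from \<open>R\<close>, from the convection term balanced against
  the dissipation, and from the zeroth-order term.\<close>

definition c1 where "c1 = 1 + B^2 / al + 2 * B"

text \<open>Pair the equation with \<open>2 z\<close> and integrate the flux by parts. Half of the
  dissipation \<open>2 * al * n2 LI (p t)\<close> is spent on the convection term.\<close>

lemma dissipation:
 assumes v: "sqQ T v" and flux: "AE t in LL 0 T. acd 0 1 (%x. a t x *R p t x) (%x. v t x - G t x)"
 shows "AE t in LL 0 T. (LINT x|LI. 2 * (v t x *I z t x)) <=
 - al * n2 LI (p t) + n2 LI (R t) + c1 * n2 LI (z t)"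
 using flux h10 G_eq ax slices(1)[OF v] slices(1)[OF G] slices(1)[OF R] slices(1)[OF p] slices(1)[OF w] slices(1)[OF sqi_ap]
proof eventually_elim
 case (elim t)
 obtain c0 where "lip_coef 1 al A L c0 (a t) (ax t)" using elim(4) by blast
 then interpret l: lip_coef 1 al A L c0 "a t" "ax t" .
 note i1 = sqi_inner[OF elim(8,10)] and i2 = sqi_inner[OF elim(9) sqi_diff[OF elim(5,6)]]
 and i3 = sqi_inner[OF elim(6,9)] and i4 = sqi_inner[OF elim(5,9)]
 note sq = sqi_norm2[OF elim(8)] sqi_norm2[OF elim(7)] sqi_norm2[OF elim(9)]
 have "(LINT x|LI. v t x *I z t x) = (LINT x|LI. z t x *I (v t x - G t x) + G t x *I z t x)"
 by (rule int_cong[OF refl]) (simp add: inner_diff_right inner_commute)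
 also have "... = (LINT x|LI. z t x *I (v t x - G t x)) + (LINT x|LI. G t x *I z t x)"
 by (rule int_add[OF i2 i3])
 also have "... = - (LINT x|LI. p t x *I (a t x *R p t x)) + (LINT x|LI. G t x *I z t x)"
 using h10_parts[OF bb_inner elim(2,1)] by linarith
 finally have "(LINT x|LI. 2 * (v t x *I z t x)) = - 2 * (LINT x|LI. p t x *I (a t x *R p t x)) + 2 * (LINT x|LI. G t x *I z t x)"
 by simp
 also have "... = (LINT x|LI. - 2 * (p t x *I (a t x *R p t x)) + 2 * (G t x *I z t x))"
 by (subst int_add[OF intg_mult[OF i1] intg_mult[OF i3]]) simp
 also have "... <= (LINT x|LI. - al * (norm (p t x))^2 + (norm (R t x))^2 + c1 * (norm (z t x))^2)"
 proof (rule int_mono_AE)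
 show "intg LI (%x. - 2 * (p t x *I (a t x *R p t x)) + 2 * (G t x *I z t x))"
 by (rule intg_add[OF intg_mult[OF i1] intg_mult[OF i3]])
 show "intg LI (%x. - al * (norm (p t x))^2 + (norm (R t x))^2 + c1 * (norm (z t x))^2)"
 by (rule intg_add[OF intg_add[OF intg_mult[OF sq(1)] sq(2)] intg_mult[OF sq(3)]])
 show "AE x in LI. - 2 * (p t x *I (a t x *R p t x)) + 2 * (G t x *I z t x) <= - al * (norm (p t x))^2 + (norm (R t x))^2 + c1 * (norm (z t x))^2"
 using elim(3) l.w(2)
 proof eventually_elim
 case (elim x)
 define P Z Rn where "P = norm (p t x)" and "Z = norm (z t x)" and "Rn = norm (R t x)"
 have nn: "0 <= P" "0 <= Z" "0 <= Rn" by (simp_all add: P_def Z_def Rn_def)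
 have "norm (G t x) <= Rn + B * P + B * Z"
 proof -
 have "norm (G t x) <= norm (R t x) + norm (b t x *R p t x) + norm (q x *R z t x)"
 using elim(1) norm_triangle_ineq4[of "R t x - b t x *R p t x" "q x *R z t x"] norm_triangle_ineq4[of "R t x" "b t x *R p t x"] by simp
 also have "... <= Rn + B * P + B * Z"
 unfolding norm_scaleR P_def Z_def Rn_def using elim(1) by (intro add_mono mult_r_mono order_refl) auto
 finally show ?thesis .
 qed
 hence "G t x *I z t x <= (Rn + B * P + B * Z) * Z"
 using norm_cauchy_schwarz[of "G t x" "z t x"] mult_r_mono[of "norm (G t x)" _ Z] nn unfolding Z_def by (meson order_trans)
 moreover have "al * P^2 <= p t x *I (a t x *R p t x)"
 using elim(2) by (auto simp: P_def power2_norm_eq_inner intro: mult_r_mono)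
 moreover have "2 * (B * P * Z) <= al * P^2 + B^2 / al * Z^2"
 proof -
 have "0 <= (al * P - B * Z)^2 / al" using al by simp
 also have "... = al * P^2 + B^2 / al * Z^2 - 2 * (B * P * Z)"
 using al by (simp add: power2_eq_square field_simps)
 finally show ?thesis by simp
 qed
 moreover have "2 * (Rn * Z) <= Rn^2 + Z^2" using sum_squares_bound[of Rn Z] by simp
 ultimately have "- 2 * (p t x *I (a t x *R p t x)) + 2 * (G t x *I z t x) <= - al * P^2 + Rn^2 + c1 * Z^2"
 unfolding c1_def by (simp add: algebra_simps power2_eq_square)
 thus ?case unfolding P_def Z_def Rn_def .
 qed
 qed
 also have "... = - al * n2 LI (p t) + n2 LI (R t) + c1 * n2 LI (z t)"
 unfolding n2_def
 by (subst int_add[OF intg_add[OF intg_mult[OF sq(1)] sq(2)] intg_mult[OF sq(3)]],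
 subst int_add[OF intg_mult[OF sq(1)] sq(2)]) simp
 finally show ?case .
qed

text \<open>For almost every fixed \<open>x\<close> the map from \<open>t\<close> to
  \<open>z t x\<close> is absolutely continuous, so the product rule gives the identity pointwise in
  \<open>x\<close>; it is then integrated over space. No chain rule in dual spaces is
  involved.\<close>

lemma energy_identity:
 assumes v: "sqQ T v" and vz: "AE x in LI. AE t in LL 0 T. z t x = z0 x + prim 0 (%s. v s x) t"
 shows "AE t in LL 0 T. n2 LI (z t) = n2 LI z0 + prim 0 (%s. LINT x|LI. 2 * (v s x *I z s x)) t"
proof -
 have i: "intg (QM T) (cp (%s x. 2 * (v s x *I z s x)))"
 using intg_mult[OF QM_integral_bilinear[OF bb_inner v w], of 2] by (simp add: split_def)
 have im: "cp (%s x. 2 * (v s x *I z s x)) : bmQ T" using i by (rule bm_intg)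
 have "AE x in LI. AE t in LL 0 T. z t x *I z t x = z0 x *I z0 x + prim 0 (%s. 2 * (v s x *I z s x)) t"
 using vz slices(2)[OF v] QM_integral(2)[OF i]
 proof eventually_elim
 case (elim x)
 have iv: "intg (LL 0 T) (%s. v s x)" using elim(2) by (rule sqi_intg)
 define zh where "zh t = z0 x + prim 0 (%s. v s x) t" for t
 have zz: "AE t in LL 0 T. z t x = zh t" using elim(1) by (simp add: zh_def)
 show ?case using zz AE_space
 proof eventually_elim
 case (elim t)
 hence t: "0 <= t" "t <= T" by auto
 note PP = prim_product[OF bb_inner iv iv t, where c = "z0 x" and d = "z0 x"]
 have "prim 0 (%s. 2 * (v s x *I z s x)) t = prim 0 (%s. v s x *I zh s + zh s *I v s x) t"
 proof (rule prim_cong_AE[OF _ _ _ t(2)])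
 show "AE s in LL 0 T. 2 * (v s x *I z s x) = v s x *I zh s + zh s *I v s x"
 using zz by eventually_elim (simp add: inner_commute)
 show "(%s. 2 * (v s x *I z s x)) : bm (LL 0 T)" using \<open>intg (LL 0 T) (%s. 2 * (v s x *I z s x))\<close> by (rule bm_intg)
 show "(%s. v s x *I zh s + zh s *I v s x) : bm (LL 0 T)"
 unfolding zh_def using prim_product(1)[OF bb_inner iv iv, where c = "z0 x" and d = "z0 x" and x = T] T by auto
 qed
 also have "... = zh t *I zh t - z0 x *I z0 x" using PP(2) unfolding zh_def .
 finally show ?case using elim(1) by simp
 qed
 qed
 moreover have "Measurable.pred (QM T) (%p. cp (%t x. z t x *I z t x) p = cp (%t x. z0 x *I z0 x + prim 0 (%s. 2 * (v s x *I z s x)) t) p)"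
 unfolding pred_def
 proof (rule borel_measurable_eq)
 show "cp (%t x. z t x *I z t x) : bmQ T"
 using bm_inner[OF sqi_meas[OF w] sqi_meas[OF w]] by (simp add: split_def)
 show "cp (%t x. z0 x *I z0 x + prim 0 (%s. 2 * (v s x *I z s x)) t) : bmQ T"
 using borel_measurable_add[OF bm_inner[OF sqi_meas[OF sqi_QM_space[OF sqi_w0]] sqi_meas[OF sqi_QM_space[OF sqi_w0]]] measurable_prim_QM[OF im]]
 by (simp add: split_def)
 qed
 ultimately have "AE t in LL 0 T. AE x in LI. z t x *I z t x = z0 x *I z0 x + prim 0 (%s. 2 * (v s x *I z s x)) t"
 using AE_QM_swap[where T = T and P = "%p. cp (%t x. z t x *I z t x) p = cp (%t x. z0 x *I z0 x + prim 0 (%s. 2 * (v s x *I z s x)) t) p"]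
 unfolding prod.case by blast
 thus ?thesis using AE_space
 proof eventually_elim
 case (elim t)
 hence t: "0 <= t" "t <= T" "t : {0<..<T}" by auto
 note sw = integral_prim_swap[OF i t(1,2)]
 have iz0: "intg LI (%x. z0 x *I z0 x)" by (rule sqi_inner[OF sqi_w0 sqi_w0])
 have "n2 LI (z t) = (LINT x|LI. z0 x *I z0 x + prim 0 (%s. 2 * (v s x *I z s x)) t)"
 unfolding n2_eq_inner
 proof (rule int_cong_AE)
 show "(%x. z t x *I z t x) : bm LI"
 by (rule bm_inner[OF QM_slice_measurable(1)[OF sqi_meas[OF w] t(3)] QM_slice_measurable(1)[OF sqi_meas[OF w] t(3)]])
 show "(%x. z0 x *I z0 x + prim 0 (%s. 2 * (v s x *I z s x)) t) : bm LI"
 by (rule borel_measurable_add[OF bm_intg[OF iz0] bm_intg[OF sw(2)]])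
 qed (rule elim(1))
 also have "... = n2 LI z0 + prim 0 (%s. LINT x|LI. 2 * (v s x *I z s x)) t"
 unfolding int_add[OF iz0 sw(2)] sw(1) n2_eq_inner ..
 finally show ?case .
 qed
qed


lemma energy_estimate:
 assumes v: "sqQ T v" and vz: "AE x in LI. AE t in LL 0 T. z t x = z0 x + prim 0 (%s. v s x) t"
 and flux: "AE t in LL 0 T. acd 0 1 (%x. a t x *R p t x) (%x. v t x - G t x)"
 defines "D == n2 LI p0 + nQ T R"
 shows "nQ T z <= (T * exp (c1 * T)) * D"
 and "nQ T p <= ((1 + c1 * (T * exp (c1 * T))) / al) * D"
proof -
 define y where "y t = n2 LI (z t)" for t
 define e where "e t = n2 LI (p t)" for t
 define rh where "rh t = n2 LI (R t)" for t
 have iy: "intg (LL 0 T) y" and ie: "intg (LL 0 T) e" and ir: "intg (LL 0 T) rh"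
 using slices(3)[OF w] slices(3)[OF p] slices(3)[OF R] by (simp_all add: y_def[abs_def] e_def[abs_def] rh_def[abs_def])
 have nn: "0 <= y t" "0 <= e t" "0 <= rh t" for t by (simp_all add: y_def e_def rh_def)
 have c1: "0 <= c1" using B al by (simp add: c1_def)
 have D: "0 <= D" by (simp add: D_def)
 have n: "nQ T z = prim 0 y T" "nQ T p = prim 0 e T" "nQ T R = prim 0 rh T"
 using slices(5)[OF w] slices(5)[OF p] slices(5)[OF R] by (simp_all add: y_def[abs_def] e_def[abs_def] rh_def[abs_def] LL_prim)
 define g where "g s = (LINT x|LI. 2 * (v s x *I z s x))" for s
 have "intg (QM T) (cp (%s x. 2 * (v s x *I z s x)))"
 using intg_mult[OF QM_integral_bilinear[OF bb_inner v w], of 2] by (simp add: split_def)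
 from QM_integral(3)[OF this] have ig: "intg (LL 0 T) g" unfolding g_def[abs_def] .
 have main: "AE t in LL 0 T. y t + al * prim 0 e t <= D + c1 * prim 0 y t"
 using energy_identity[OF v vz] AE_space
 proof eventually_elim
 case (elim t)
 hence t: "0 <= t" "t <= T" by auto
 note I = intg_subset[OF ie order_refl t(2)] intg_subset[OF ir order_refl t(2)] intg_subset[OF iy order_refl t(2)]
 have "prim 0 g t <= (LINT s|LL 0 t. - al * e s + rh s + c1 * y s)"
 unfolding LL_prim[symmetric]
 proof (rule int_mono_AE)
 show "intg (LL 0 t) g" by (rule intg_subset[OF ig order_refl t(2)])
 show "intg (LL 0 t) (%s. - al * e s + rh s + c1 * y s)"
 by (rule intg_add[OF intg_add[OF intg_mult[OF I(1)] I(2)] intg_mult[OF I(3)]])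
 show "AE s in LL 0 t. g s <= - al * e s + rh s + c1 * y s"
 unfolding g_def e_def rh_def y_def by (rule AE_LL_subset[OF dissipation[OF v flux] order_refl t(2)])
 qed
 also have "... = - al * prim 0 e t + prim 0 rh t + c1 * prim 0 y t"
 unfolding LL_prim[symmetric]
 by (subst int_add[OF intg_add[OF intg_mult[OF I(1)] I(2)] intg_mult[OF I(3)]],
 subst int_add[OF intg_mult[OF I(1)] I(2)]) simp
 finally have 1: "prim 0 g t <= - al * prim 0 e t + prim 0 rh t + c1 * prim 0 y t" .
 have 2: "prim 0 rh t <= prim 0 rh T" by (rule prim_mono[OF ir nn(3) t order_refl])
 have 3: "n2 LI z0 <= n2 LI p0"
 proof -
 have "n2 LI z0 = n2 LI (prim 0 p0)"
 using init by (intro n2_cong sqi_meas[OF sqi_w0] sqi_meas[OF sqi_prim(1)[OF sqi_p0]]) (simp add: h10_def)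
 thus ?thesis using sqi_prim(2)[OF sqi_p0] by simp
 qed
 have "y t = n2 LI z0 + prim 0 g t" using elim(1) by (simp only: y_def g_def[abs_def])
 thus ?case using 1 2 3 unfolding D_def n by linarith
 qed
 have pe: "0 <= prim 0 e t" "0 <= prim 0 y t" for t by (rule prim_nonneg[OF nn(2)], rule prim_nonneg[OF nn(1)])
 have "prim 0 y T <= D * T * exp (c1 * T)"
 proof (rule gronwall[OF iy nn(1) _ D c1])
 show "AE t in LL 0 T. y t <= D + c1 * prim 0 y t"
 using main by eventually_elim (use pe(1) al in "smt (verit) mult_nonneg_nonneg")
 qed (use T in simp)
 thus Y: "nQ T z <= (T * exp (c1 * T)) * D" by (simp only: n mult_ac)
 define M where "M = D + c1 * prim 0 y T"
 \<comment> \<open>The inequality is phrased as an equation between continuous functions, so that it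
   extends from almost every \<open>t\<close> to \<open>t = T\<close>.\<close>
 have Mle: "AE t in LL 0 T. min (al * prim 0 e t) M = al * prim 0 e t"
 using main AE_space
 proof eventually_elim
 case (elim t)
 hence t: "0 <= t" "t <= T" by auto
 have "c1 * prim 0 y t <= c1 * prim 0 y T" by (rule mult_left_mono[OF prim_mono[OF iy nn(1) t order_refl] c1])
 thus ?case using elim(1) nn(1)[of t] unfolding M_def by simp
 qed
 have "min (al * prim 0 e T) M = al * prim 0 e T"
 proof (rule continuous_AE_eq[OF _ _ Mle T])
 show "continuous_on {0..T} (%t. min (al * prim 0 e t) M)" "continuous_on {0..T} (%t. al * prim 0 e t)"
 by (intro continuous_intros continuous_on_min continuous_on_prim[OF ie])+
 qed (use T in simp)
 hence "al * prim 0 e T <= D + c1 * prim 0 y T" unfolding M_def by linarith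
 also have "... <= D + c1 * ((T * exp (c1 * T)) * D)" using mult_left_mono[OF Y c1] by (simp only: n)
 finally have "al * prim 0 e T <= (1 + c1 * (T * exp (c1 * T))) * D" by (simp add: algebra_simps)
 thus "nQ T p <= ((1 + c1 * (T * exp (c1 * T))) / al) * D"
 unfolding n using al by (simp add: pos_le_divide_eq mult.commute)
qed

text \<open>The bounds depend on each other: the energy estimate controls \<open>z\<close> and
  \<open>p\<close>, these control \<open>G\<close>, then \<open>K\<close> and \<open>K2\<close> and
  with them \<open>v\<close>. The spatial derivative \<open>r\<close> of \<open>p\<close> is read
  off from that of the flux by \<open>acd_factor\<close>, dividing by a coefficient that is at least
  \<open>al\<close>.\<close>

theorem regularity_estimate:
 "EX v r. sqQ T v & sqQ T r &
 (AE x in LI. AE t in LL 0 T. z t x = z0 x + prim 0 (%s. v s x) t) &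
 (AE t in LL 0 T. acd 0 1 (p t) (r t)) &
 nQ T z + nQ T p + nQ T v + nQ T r
 <= parabolic_const T al A L B * (n2 LI p0 + nQ T R)"
proof -
 define D where "D = n2 LI p0 + nQ T R"
 define k1 where "k1 = T * exp (c1 * T)"
 define k2 where "k2 = (1 + c1 * k1) / al"
 define k3 where "k3 = 8 * (1 + B^2 * k2 + B^2 * k1)"
 define k4 where "k4 = 2 * A + L + 3 * L * k2 + k3"
 define k5 where "k5 = 2 * A * k4 / al + 6 * L * k2 + k3"
 define k6 where "k6 = 8 * ((1 / al)^2 * k5 + (1 / al)^2 * k3 + (L / al)^2 * k2)"
 have k: "parabolic_const T al A L B = k1 + k2 + k5 + k6"
 by (simp only: parabolic_const_def Let_def k1_def k2_def k3_def k4_def k5_def k6_def c1_def)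
 obtain v where v: "sqQ T v" "nQ T v <= K2"
 and vz: "AE x in LI. AE t in LL 0 T. z t x = z0 x + prim 0 (%s. v s x) t"
 and flux: "AE t in LL 0 T. acd 0 1 (%x. a t x *R p t x) (%x. v t x - G t x)"
 using maximal_regularity by blast
 note E = energy_estimate[OF v(1) vz flux, folded D_def k1_def, folded k2_def]
 have D: "0 <= n2 LI p0" "n2 LI p0 <= D" "nQ T R <= D" by (simp_all add: D_def)
 have "nQ T G <= 2 ^ length [(1, R), (B, p), (B, z)] * (\<Sum>(c, f)\<leftarrow>[(1, R), (B, p), (B, z)]. c^2 * nQ T f)"
 proof (rule AE_QM_bound(2)[OF _ sqi_meas[OF G]])
 show "AE t in LL 0 T. AE x in LI. norm (G t x) <= (\<Sum>(c, f)\<leftarrow>[(1, R), (B, p), (B, z)]. c * norm (f t x))"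
 using G_eq
 proof (eventually_elim)
 case (elim t)
 thus ?case
 proof eventually_elim
 case (elim x)
 have "norm (G t x) <= norm (R t x) + norm (b t x *R p t x) + norm (q x *R z t x)"
 using elim norm_triangle_ineq4[of "R t x - b t x *R p t x" "q x *R z t x"] norm_triangle_ineq4[of "R t x" "b t x *R p t x"] by simp
 also have "... <= norm (R t x) + B * norm (p t x) + B * norm (z t x)"
 unfolding norm_scaleR using elim by (intro add_mono mult_r_mono order_refl) auto
 finally show ?case by simp
 qed
 qed
 qed (use R p w in auto)
 also have "... = 8 * (nQ T R + B^2 * nQ T p + B^2 * nQ T z)" by simp
 also have "... <= 8 * (D + B^2 * (k2 * D) + B^2 * (k1 * D))"
 by (intro mult_left_mono add_mono D E) auto
 also have "... = k3 * D" by (simp add: k3_def algebra_simps)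
 finally have G3: "nQ T G <= k3 * D" .
 have "K <= (2 * A + L) * D + 3 * L * (k2 * D) + k3 * D"
 unfolding K_def using A_pos L by (intro add_mono mult_left_mono D E G3) auto
 also have "... = k4 * D" by (simp add: k4_def algebra_simps)
 finally have K4: "K <= k4 * D" .
 have "K2 <= 2 * A * (k4 * D) / al + 6 * L * (k2 * D) + k3 * D"
 unfolding K2_def using A_pos L al by (intro add_mono mult_left_mono divide_right_mono E G3 K4) auto
 also have "... = k5 * D" by (simp add: k5_def algebra_simps)
 finally have V5: "nQ T v <= k5 * D" using v(2) by linarith
 define r where "r t x = (1 / a t x) *R ((v t x - G t x) - ax t x *R p t x)" for t x
 have rm: "cp r : bmQ T"
 unfolding r_def[abs_def] split_def
 by (intro bm_scal bm_diff borel_measurable_divide borel_measurable_const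
 a_meas[unfolded split_def] ax_meas[unfolded split_def] sqi_meas[OF v(1), unfolded split_def]
 sqi_meas[OF G, unfolded split_def] sqi_meas[OF p, unfolded split_def])
 have r: "AE t in LL 0 T. acd 0 1 (p t) (r t)"
 using ax flux
 proof eventually_elim
 case (elim t)
 then obtain c0 where "lip_coef 1 al A L c0 (a t) (ax t)" by blast
 then interpret l: lip_coef 1 al A L c0 "a t" "ax t" .
 show ?case using l.acd_factor[OF elim(2)] unfolding r_def[abs_def] .
 qed
 have le: "AE t in LL 0 T. AE x in LI. norm (r t x) <= (\<Sum>(c, f)\<leftarrow>[(1 / al, v), (1 / al, G), (L / al, p)]. c * norm (f t x))"
 using ax
 proof eventually_elim
 case (elim t)
 then obtain c0 where "lip_coef 1 al A L c0 (a t) (ax t)" by blast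
 then interpret l: lip_coef 1 al A L c0 "a t" "ax t" .
 show ?case using l.w(2) l.dw(2)
 proof eventually_elim
 case (elim x)
 have "norm ((v t x - G t x) - ax t x *R p t x) <= norm (v t x) + norm (G t x) + \<bar>ax t x\<bar> * norm (p t x)"
 using norm_triangle_ineq4[of "v t x - G t x" "ax t x *R p t x"] norm_triangle_ineq4[of "v t x" "G t x"] by simp
 also have "... <= norm (v t x) + norm (G t x) + L * norm (p t x)" using elim(2) by (intro add_mono mult_r_mono order_refl) auto
 finally have 1: "norm ((v t x - G t x) - ax t x *R p t x) <= norm (v t x) + norm (G t x) + L * norm (p t x)" .
 have "norm (r t x) = (1 / a t x) * norm ((v t x - G t x) - ax t x *R p t x)"
 using elim al unfolding r_def by simp
 also have "... <= (1 / al) * (norm (v t x) + norm (G t x) + L * norm (p t x))"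
 by (rule mult_mono[OF _ 1]) (use elim al in "auto intro!: divide_left_mono")
 also have "... = (\<Sum>(c, f)\<leftarrow>[(1 / al, v), (1 / al, G), (L / al, p)]. c * norm (f t x))" by (simp add: algebra_simps)
 finally show ?case .
 qed
 qed
 have sf: "sqQ T f" if "(c, f) : set [(1 / al, v), (1 / al, G), (L / al, p)]" for c f
 using that v(1) G p by auto
 note rb = AE_QM_bound[OF sf rm le]
 have "nQ T r <= 8 * ((1 / al)^2 * nQ T v + (1 / al)^2 * nQ T G + (L / al)^2 * nQ T p)"
 using rb(2) by (simp add: add.assoc)
 also have "... <= 8 * ((1 / al)^2 * (k5 * D) + (1 / al)^2 * (k3 * D) + (L / al)^2 * (k2 * D))"
 by (intro mult_left_mono add_mono E V5 G3) auto
 also have "... = k6 * D" by (simp add: k6_def algebra_simps)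
 finally have R6: "nQ T r <= k6 * D" .
 have "nQ T z + nQ T p + nQ T v + nQ T r <= parabolic_const T al A L B * D"
 unfolding k using E V5 R6 by (simp add: distrib_right)
 hence "sqQ T v & sqQ T r &
 (AE x in LI. AE t in LL 0 T. z t x = z0 x + prim 0 (%s. v s x) t) &
 (AE t in LL 0 T. acd 0 1 (p t) (r t)) &
 nQ T z + nQ T p + nQ T v + nQ T r
 <= parabolic_const T al A L B * (n2 LI p0 + nQ T R)"
 unfolding D_def by (intro conjI v(1) rb(1) vz r)
 thus ?thesis by (intro exI)
qed

end

section \<open>Representatives of functions of time and space\<close>

lemma QM_representative:
 fixes u :: "real => real => 'b::euclidean_space"
 assumes "cp u : bm (leb (QT T))"
 shows "EX U. cp U : bm borel & (AE p in leb (QT T). cp u p = cp U p)"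
proof -
 obtain g where g: "g : bm borel" "AE p in leb (QT T). cp u p = g p"
 using lebesgue_borel_representative[OF assms] QT_borel[of T] by auto
 have "cp (curry g) = g" by auto
 thus ?thesis using g by (intro exI[of _ "curry g"]) auto
qed

lemma AE_QT_slices:
 assumes "AE p in leb (QT T). cp u p = cp U p"
 shows "AE t in LL 0 T. AE x in LI. u t x = U t x" "AE x in LI. AE t in LL 0 T. u t x = U t x"
 using AE_QM_fst[OF AE_lebesgue_on_QT[OF assms]] AE_QM_snd[OF AE_lebesgue_on_QT[OF assms]] by simp_all

lemma L2_time_norm_eq:
 assumes N: "AE t in LL 0 T. N t = ereal (sqrt (m t))" and m: "intg (LL 0 T) m" "!!t. 0 <= m t"
 shows "L2_time_norm T N = ereal (sqrt (LINT t|LL 0 T. m t))"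
proof -
 have s: "sqi (LL 0 T) (%t. sqrt (m t))" using m by (auto simp: sqi_def)
 have AE: "AE t in LL 0 T. sqrt (m t) = real_of_ereal (N t)" using N by eventually_elim simp
 have ms: "(%t. real_of_ereal (N t)) : bm (LL 0 T)"
 by (rule AE_measurable_LL[OF _ sqi_meas[OF s]]) (use AE in eventually_elim, simp)
 have sN: "sqi (LL 0 T) (%t. real_of_ereal (N t))" by (rule sqi_cong[OF AE s ms])
 have "n2 (LL 0 T) (%t. real_of_ereal (N t)) = n2 (LL 0 T) (%t. sqrt (m t))"
 by (rule n2_cong[OF _ ms sqi_meas[OF s]]) (use AE in eventually_elim, simp)
 also have "... = (LINT t|LL 0 T. m t)" using m by (simp add: n2_def)
 finally have n: "n2 (LL 0 T) (%t. real_of_ereal (N t)) = (LINT t|LL 0 T. m t)" .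
 have "AE t in LL 0 T. N t < \<infinity>" using N by eventually_elim simp
 thus ?thesis unfolding L2_time_norm_def by (simp only: if_True L2_norm_eq[OF sN] n)
qed

lemma L2_time_norm_finite:
 assumes "L2_time_norm T N < \<infinity>"
 shows "AE t in LL 0 T. N t < \<infinity>" "sqi (LL 0 T) (%t. real_of_ereal (N t))"
proof -
 show *: "AE t in LL 0 T. N t < \<infinity>" by (rule ccontr) (use assms in "simp add: L2_time_norm_def")
 thus "sqi (LL 0 T) (%t. real_of_ereal (N t))"
 using assms L2_norm_less_top_iff[of "{0<..<T}" "%t. real_of_ereal (N t)"] by (simp add: L2_time_norm_def)
qed

lemma bochner_fin:
 assumes "L2_bochner_norm T N u < \<infinity>"
 shows "cp u : bm (leb (QT T))" "L2_time_norm T (%t. N (u t)) < \<infinity>"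
 using assms by (simp_all add: L2_bochner_norm_def split: if_splits)

lemma sqi_QM_if_time_slices:
 fixes f :: "real => real => 'b::euclidean_space"
 assumes m: "cp f : bmQ T"
 and B: "intg (LL 0 T) B" "AE t in LL 0 T. sqi LI (f t) & n2 LI (f t) <= B t"
 shows "sqQ T f"
proof -
 interpret P: pair_sigma_finite "LL 0 T" "LI" by (rule psf_LL)
 have m2: "(%(t, x). (norm (f t x))^2) : bmQ T" using m by (simp add: split_def)
 have n2m: "(%t. n2 LI (f t)) : bm (LL 0 T)"
 unfolding n2_def by (rule P.M2.borel_measurable_lebesgue_integral[OF m2])
 have "intg (QM T) (%(t, x). (norm (f t x))^2)"
 proof (rule P.Fubini_integrable[OF m2])
 have "intg (LL 0 T) (%t. n2 LI (f t))"
 proof (rule intg_bound[OF B(1) n2m])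
 show "AE t in LL 0 T. norm (n2 LI (f t)) <= norm (B t)"
 using B(2) by eventually_elim auto
 qed
 thus "intg (LL 0 T) (%t. LINT y|LI. norm (case (t, y) of (t, x) => (norm (f t x))^2))"
 by (simp add: n2_def)
 show "AE t in LL 0 T. intg LI (%y. case (t, y) of (t, x) => (norm (f t x))^2)"
 using B(2) by eventually_elim (simp add: sqi_def)
 qed
 thus ?thesis using m by (simp add: sqi_def split_def)
qed

lemma sqi_QM_tensor:
 fixes th :: "real => real" and ph :: "real => 'b::euclidean_space"
 assumes t: "sqi (LL 0 T) th" and f: "sqi LI ph"
 shows "sqQ T (%t x. th t *R ph x)"
proof (rule sqi_QM_if_time_slices[where B = "%t. (th t)^2 * n2 LI ph"])
 show "cp (%t x. th t *R ph x) : bmQ T"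
 using bm_scal[OF sqi_meas[OF sqi_QM_time[OF t]] sqi_meas[OF sqi_QM_space[OF f]]] by (simp add: split_def)
 show "intg (LL 0 T) (%t. (th t)^2 * n2 LI ph)" using sqi_norm2[OF t] by simp
 show "AE t in LL 0 T. sqi LI (%x. th t *R ph x) & n2 LI (%x. th t *R ph x) <= (th t)^2 * n2 LI ph"
 by (rule AE_I2) (simp add: sqi_scaleR[OF f] n2_scaleR)
qed

section \<open>Jointly measurable spatial derivatives\<close>

lemma LL_differentiation:
 fixes g :: "real => 'b::euclidean_space"
 assumes g: "intg LI g" and h: "!!n. 0 < h n" "h \<longlonglongrightarrow> 0"
 shows "AE x in LI. (%n. (prim 0 g (x + h n) - prim 0 g x) /\<^sub>R h n) \<longlonglongrightarrow> g x"
proof -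
 define f where "f y = indicat_real {0<..<1} y *R g y" for y
 have f: "intg lebesgue f"
 using g unfolding LL_integrable_iff set_integrable_def f_def[abs_def] .
 have sf: "set_integrable lebesgue S f" if "S : sets lebesgue" for S
 unfolding set_integrable_def by (rule integrable_mult_indicator[OF that f])
 have "f integrable_on cbox a b" for a b by (rule set_lebesgue_integral_eq_integral(1)[OF sf]) simp
 then obtain N where N: "negligible N"
 "!!x e. x \<notin> N ==> 0 < e ==> EX d>0. ALL h. 0 < h & h < d --> norm (integral (cbox x (x + h *R One)) f /\<^sub>R h ^ DIM(real) - f x) < e"
 by (rule integrable_ccontinuous_explicit) (blast intro: that)
 have "AE x in lebesgue. x \<notin> N" using N(1) by (auto simp: negligible_iff_null_sets intro: AE_not_in)
 hence "AE x in LI. x \<notin> N" unfolding AE_LL_iff by eventually_elim simp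
 thus ?thesis using AE_space
 proof eventually_elim
 case (elim x)
 hence x: "0 < x" "x < 1" by auto
 have eq: "integral (cbox x (x + k *R One)) f = prim 0 g (x + k) - prim 0 g x" if "0 < k" "k < 1 - x" for k
 proof -
 have "integral (cbox x (x + k *R One)) f = integral (box x (x + k)) f" using integral_open_interval[of x "x + k" f] by (simp add: box_real)
 also have "... = (LINT y:box x (x + k)|lebesgue. f y)" by (rule set_lebesgue_integral_eq_integral(2)[OF sf, symmetric]) simp
 also have "... = prim x f (x + k)" by (simp add: prim_def box_real)
 also have "... = prim x g (x + k)"
 unfolding prim_def set_int_def f_def
 by (rule int_cong[OF refl]) (use x that in "auto simp: indicator_def")
 also have "... = prim 0 g (x + k) - prim 0 g x" using prim_diff[OF g, of x "x + k"] x that by simp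
 finally show ?thesis .
 qed
 show ?case
 proof (rule LIMSEQ_I)
 fix e :: real assume "0 < e"
 from N(2)[OF elim(1) this] obtain d where d: "0 < d"
 "!!k. 0 < k ==> k < d ==> norm (integral (cbox x (x + k *R One)) f /\<^sub>R k ^ DIM(real) - f x) < e" by blast
 have "0 < min d (1 - x)" using d x by simp
 from LIMSEQ_D[OF h(2) this] obtain M where M: "!!n. n >= M ==> h n < min d (1 - x)" by fastforce
 have "norm ((prim 0 g (x + h n) - prim 0 g x) /\<^sub>R h n - g x) < e" if "n >= M" for n
 using d(2)[OF h(1)[of n]] M[OF that] eq[OF h(1)[of n]] x by (simp add: f_def)
 thus "EX no. ALL n>=no. norm ((prim 0 g (x + h n) - prim 0 g x) /\<^sub>R h n - g x) < e" by blast
 qed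
 qed
qed

text \<open>The derivatives \<open>g t\<close> are chosen separately for each \<open>t\<close> and
  need not depend measurably on \<open>t\<close>. The limit of difference quotients of the Borel
  function \<open>U\<close> is jointly Borel, and by Lebesgue's differentiation theorem it agrees
  with \<open>g t\<close> on almost every slice.\<close>

lemma joint_derivative:
 fixes U g :: "real => real => 'b::euclidean_space"
 assumes U: "cp U : bm borel" and ac: "AE t in LL 0 T. acd 0 1 (U t) (g t)"
 shows "EX P. cp P : bm borel & (AE t in LL 0 T. AE x in LI. P t x = g t x)"
proof -
 define h where "h n = inverse (real (Suc n))" for n
 have h: "0 < h n" "h \<longlonglongrightarrow> 0" for n
 using LIMSEQ_inverse_real_of_nat by (auto simp: h_def[abs_def])
 define P where "P t x = lim (%n. (U t (x + h n) - U t x) /\<^sub>R h n)" for t x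
 have sh: "(%p. U (fst p) (snd p + k)) : bm borel" for k
 proof -
 have "(%p::real \<times> real. (fst p, snd p + k)) : bm borel"
 by (intro bm_cont continuous_intros)
 from m_comp[OF this U] show ?thesis by simp
 qed
 have "cp P : bm borel"
 unfolding P_def[abs_def] split_def
 using sh[of 0] by (intro borel_measurable_lim_metric bm_scal bm_diff sh borel_measurable_const) simp
 moreover have "AE t in LL 0 T. AE x in LI. P t x = g t x"
 using ac
 proof eventually_elim
 case (elim t)
 then obtain c where g: "intg LI (g t)" and c: "AE x in LI. U t x = c + prim 0 (g t) x"
 unfolding acd_def by blast
 have "AE x in LI. x + h n < 1 --> U t (x + h n) = c + prim 0 (g t) (x + h n)" for n
 proof -
 have "AE x in LL (0 + h n) (1 - h n + h n). U t x = c + prim 0 (g t) x"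
 by (rule AE_LL_subset[OF c]) (use h(1)[of n] in auto)
 from AE_LL_shift[OF this] show ?thesis unfolding AE_LL_iff by eventually_elim auto
 qed
 hence "AE x in LI. ALL n. x + h n < 1 --> U t (x + h n) = c + prim 0 (g t) (x + h n)"
 by (simp add: AE_all_countable)
 thus ?case using c LL_differentiation[where h = h, OF g h] AE_space
 proof eventually_elim
 case (elim x)
 have "0 < 1 - x" using elim(4) by simp
 from LIMSEQ_D[OF h(2) this] obtain M where M: "!!n. n >= M ==> h n < 1 - x" by fastforce
 have "(%n. (U t (x + h n) - U t x) /\<^sub>R h n) \<longlonglongrightarrow> g t x"
 proof (rule Lim_transform_eventually[OF elim(3)])
 have "(prim 0 (g t) (x + h n) - prim 0 (g t) x) /\<^sub>R h n = (U t (x + h n) - U t x) /\<^sub>R h n" if "n >= M" for n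
 using elim(1)[rule_format, of n] elim(2) M[OF that] by simp
 thus "\<forall>\<^sub>F n in sequentially. (prim 0 (g t) (x + h n) - prim 0 (g t) x) /\<^sub>R h n = (U t (x + h n) - U t x) /\<^sub>R h n"
 by (auto simp: eventually_sequentially)
 qed
 thus ?case unfolding P_def by (rule limI)
 qed
 qed
 ultimately show ?thesis by blast
qed

section \<open>Coefficients\<close>

lemma tensor_integrals:
 fixes th ph :: "real => real" and f :: "real => real => real"
 assumes f: "sqQ T f" and t: "sqi (LL 0 T) th" and p: "sqi LI ph"
 shows "intg LI (%x. ph x * (LINT t|LL 0 T. th t * f t x))" "intg (LL 0 T) (%t. th t * (LINT x|LI. ph x * f t x))"
 "(LINT x|LI. ph x * (LINT t|LL 0 T. th t * f t x)) = integral\<^sup>L (QM T) (cp (%t x. (th t * ph x) * f t x))"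
 "(LINT t|LL 0 T. th t * (LINT x|LI. ph x * f t x)) = integral\<^sup>L (QM T) (cp (%t x. (th t * ph x) * f t x))"
proof -
 have i: "intg (QM T) (cp (%t x. (th t * ph x) * f t x))"
 using QM_integral_bilinear[OF bounded_bilinear_mult sqi_QM_tensor[OF t p] f] by simp
 have 1: "(LINT t|LL 0 T. (th t * ph x) * f t x) = ph x * (LINT t|LL 0 T. th t * f t x)" for x
 by (subst integral_mult_right_zero[symmetric]) (simp only: mult_ac)
 have 2: "(LINT x|LI. (th t * ph x) * f t x) = th t * (LINT x|LI. ph x * f t x)" for t
 by (subst integral_mult_right_zero[symmetric]) (simp only: mult_ac)
 note Q = QM_integral[OF i, unfolded 1 2]
 show "intg LI (%x. ph x * (LINT t|LL 0 T. th t * f t x))" "intg (LL 0 T) (%t. th t * (LINT x|LI. ph x * f t x))"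
 "(LINT x|LI. ph x * (LINT t|LL 0 T. th t * f t x)) = integral\<^sup>L (QM T) (cp (%t x. (th t * ph x) * f t x))"
 "(LINT t|LL 0 T. th t * (LINT x|LI. ph x * f t x)) = integral\<^sup>L (QM T) (cp (%t x. (th t * ph x) * f t x))"
 using Q(3-6) by simp_all
qed

lemma fundamental_lemma:
 fixes h :: "real => real"
 assumes h: "intg (LL l r) h" and z: "!!ph::real=>real. test_fun {l<..<r} ph ==> (LINT x|LL l r. ph x * h x) = 0"
 shows "AE x in LL l r. h x = 0"
proof -
 have "AE t in count_space (UNIV :: unit set). AE x in LL l r. h x = 0"
 by (rule fundamental_lemma_AE)
 (use integrable_LL_subset_closed[OF h] z in "auto simp: AE_count_space")
 thus ?thesis by (simp add: AE_count_space)
qed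

lemma sqi_test_deriv:
 assumes "test_fun {l<..<r} ph"
 shows "sqi (LL l r) (%x::real. D1 ph x)"
 using assms smooth_fun_deriv_continuous by (intro sqi_continuous) (auto simp: test_fun_def)

text \<open>For a fixed \<open>th\<close>, varying \<open>ph\<close> shows that the weak derivative
  identity in \<open>t\<close> holds for almost every \<open>x\<close>. The null set may depend on
  \<open>th\<close>, as \<open>weak_derivative_imp_acd\<close> permits.\<close>

lemma acd_time_if_tensor:
 fixes f g :: "real => real => real"
 assumes f: "sqQ T f" and g: "sqQ T g" and T: "0 < T"
 and W: "!!th ph. test_fun {0<..<T} th ==> test_fun unit_iv ph ==>
 integral\<^sup>L (QM T) (cp (%t x. (D1 th t * ph x) * f t x)) = - integral\<^sup>L (QM T) (cp (%t x. (th t * ph x) * g t x))"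
 shows "AE x in LI. acd 0 T (%t. f t x) (%t. g t x)"
proof (rule weak_derivative_imp_acd[OF T])
 show "AE x in LI. intg (LL 0 T) (%t. f t x)" using slices(2)[OF f] by eventually_elim (rule sqi_intg)
 show "AE x in LI. intg (LL 0 T) (%t. g t x)" using slices(2)[OF g] by eventually_elim (rule sqi_intg)
 fix th :: "real => real" assume th: "test_fun {0<..<T} th"
 have one: "sqi LI (%x. 1 :: real)" by (rule finite_measure.sqi_const[OF fin_LL])
 note s = sqi_test_deriv[OF th] sqi_test_fun[OF th]
 have "AE x in LI. (LINT t|LL 0 T. D1 th t * f t x) + (LINT t|LL 0 T. th t * g t x) = 0"
 proof (rule fundamental_lemma)
 show "intg LI (%x. (LINT t|LL 0 T. D1 th t * f t x) + (LINT t|LL 0 T. th t * g t x))"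
 using tensor_integrals(1)[OF f s(1) one] tensor_integrals(1)[OF g s(2) one] unfolding mult_1 by (rule intg_add)
 fix ph :: "real => real" assume ph: "test_fun {0<..<1} ph"
 note p = sqi_test_fun[OF ph]
 show "(LINT x|LI. ph x * ((LINT t|LL 0 T. D1 th t * f t x) + (LINT t|LL 0 T. th t * g t x))) = 0"
 unfolding distrib_left int_add[OF tensor_integrals(1)[OF f s(1) p] tensor_integrals(1)[OF g s(2) p]]
 tensor_integrals(3)[OF f s(1) p] tensor_integrals(3)[OF g s(2) p] W[OF th ph] by (rule left_minus)
 qed
 thus "AE x in LI. (LINT t|LL 0 T. D1 th t *R f t x) = - (LINT t|LL 0 T. th t *R g t x)"
 unfolding real_scaleR_def by eventually_elim (rule eq_neg_iff_add_eq_0[THEN iffD2])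
qed

lemma acd_space_if_tensor:
 fixes f g :: "real => real => real"
 assumes f: "sqQ T f" and g: "sqQ T g"
 and W: "!!th ph. test_fun {0<..<T} th ==> test_fun unit_iv ph ==>
 integral\<^sup>L (QM T) (cp (%t x. (th t * D1 ph x) * f t x)) = - integral\<^sup>L (QM T) (cp (%t x. (th t * ph x) * g t x))"
 shows "AE t in LL 0 T. acd 0 1 (f t) (g t)"
proof (rule weak_derivative_imp_acd[OF zero_less_one])
 show "AE t in LL 0 T. intg LI (f t)" using slices(1)[OF f] by eventually_elim (rule sqi_intg)
 show "AE t in LL 0 T. intg LI (g t)" using slices(1)[OF g] by eventually_elim (rule sqi_intg)
 fix ph :: "real => real" assume ph: "test_fun {0<..<1} ph"
 have one: "sqi (LL 0 T) (%x. 1 :: real)" by (rule finite_measure.sqi_const[OF fin_LL])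
 note s = sqi_test_deriv[OF ph] sqi_test_fun[OF ph]
 have "AE t in LL 0 T. (LINT x|LI. D1 ph x * f t x) + (LINT x|LI. ph x * g t x) = 0"
 proof (rule fundamental_lemma)
 show "intg (LL 0 T) (%t. (LINT x|LI. D1 ph x * f t x) + (LINT x|LI. ph x * g t x))"
 using tensor_integrals(2)[OF f one s(1)] tensor_integrals(2)[OF g one s(2)] unfolding mult_1 by (rule intg_add)
 fix th :: "real => real" assume th: "test_fun {0<..<T} th"
 note p = sqi_test_fun[OF th]
 show "(LINT t|LL 0 T. th t * ((LINT x|LI. D1 ph x * f t x) + (LINT x|LI. ph x * g t x))) = 0"
 unfolding distrib_left int_add[OF tensor_integrals(2)[OF f p s(1)] tensor_integrals(2)[OF g p s(2)]]
 tensor_integrals(4)[OF f p s(1)] tensor_integrals(4)[OF g p s(2)] W[OF th ph] by (rule left_minus)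
 qed
 thus "AE t in LL 0 T. (LINT x|LI. D1 ph x *R f t x) = - (LINT x|LI. ph x *R g t x)"
 unfolding real_scaleR_def by eventually_elim (rule eq_neg_iff_add_eq_0[THEN iffD2])
qed

text \<open>The essential supremum over a null set is minus infinity; the hypothesis says that
  \<open>S\<close> is not one.\<close>

lemma Linf_norm_nonneg:
 assumes "\<not> (AE x in leb S. False)"
 shows "0 <= Linf_norm S f"
proof (cases "f : bm (leb S)")
 case True
 have "\<not> esssup (leb S) (%x. ereal (norm (f x))) < 0"
 proof
 assume *: "esssup (leb S) (%x. ereal (norm (f x))) < 0"
 have "AE x in leb S. False"
 using esssup_AE[of "%x. ereal (norm (f x))" "leb S"]
 proof eventually_elim
 case (elim x)
 hence "ereal (norm (f x)) < 0" using * by (rule le_less_trans)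
 thus ?case by simp
 qed
 thus False using assms by simp
 qed
 thus ?thesis using True by (simp add: Linf_norm_def not_less)
qed (simp add: Linf_norm_def)

lemma Linf_norm_le_W1inf_norm:
 assumes "\<not> (AE x in leb S. False)"
 shows "Linf_norm S f <= W1inf_norm S f"
 unfolding W1inf_norm_def by (auto intro!: add_increasing2 sum_nonneg Linf_norm_nonneg assms)

lemma Linf_norm_bound:
 assumes "Linf_norm S f <= ereal N"
 shows "f : bm (leb S)" "AE x in leb S. norm (f x) <= N"
proof -
 show m: "f : bm (leb S)" by (rule ccontr) (use assms in "simp add: Linf_norm_def")
 show "AE x in leb S. norm (f x) <= N"
 using esssup_AE[of "%x. ereal (norm (f x))" "leb S"]
 proof eventually_elim
 case (elim x)
 also have "esssup (leb S) (%x. ereal (norm (f x))) <= ereal N" using assms m by (simp add: Linf_norm_def)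
 finally show ?case by simp
 qed
qed

lemma not_AE_False_LL: "l < r ==> \<not> (AE x in LL l r. False)"
 using AE_LL_contradiction by blast

lemma not_AE_False_QT: assumes "0 < T" shows "\<not> (AE p in leb (QT T). False)"
proof
 assume "AE p in leb (QT T). False"
 have "AE t in LL 0 T. False"
 by (rule AE_mp[OF AE_QM_fst[OF AE_lebesgue_on_QT[OF \<open>AE p in leb (QT T). False\<close>]] AE_I2]) (use not_AE_False_LL[of 0 1] in simp)
 thus False by (rule AE_LL_contradiction[OF assms])
qed

text \<open>Clipping makes the bound valid at every point instead of almost every point. Equality
  with \<open>g\<close> is asserted only where \<open>g\<close> obeys the bound.\<close>

lemma clipped_representative:
 fixes g :: "real => real => real"
 assumes g: "cp g : bm (leb (QT T))" and N: "0 <= N"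
 shows "EX G. cp G : bm borel & (ALL t x. \<bar>G t x\<bar> <= N) &
 (AE p in leb (QT T). \<bar>cp g p\<bar> <= N --> cp g p = cp G p)"
proof -
 obtain H where H: "cp H : bm borel" "AE p in leb (QT T). cp g p = cp H p"
 using QM_representative[OF g] by blast
 define G where "G t x = max (- N) (min N (H t x))" for t x
 have "cp G : bm borel" using H(1) unfolding G_def[abs_def] split_def by measurable
 moreover have "\<bar>G t x\<bar> <= N" for t x using N by (auto simp: G_def)
 moreover have "AE p in leb (QT T). \<bar>cp g p\<bar> <= N --> cp g p = cp G p"
 using H(2) by eventually_elim (auto simp: G_def split: prod.splits)
 ultimately show ?thesis by blast
qed

lemma QM_weak_derivative:
 fixes f g :: "real \<times> real => real"
 assumes wd: "has_weak_deriv (QT T) v f g" and F: "F : bm borel" "AE p in leb (QT T). f p = F p"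
 and G: "G : bm borel" "AE p in leb (QT T). g p = G p"
 and m: "f : bm (leb (QT T))" "g : bm (leb (QT T))"
 and tf: "test_fun (QT T) Ph"
 shows "(LINT p|QM T. fd Ph (at p) v * F p) = - (LINT p|QM T. Ph p * G p)"
proof -
 have s: "smooth_fun Ph" using tf by (simp add: test_fun_def)
 have b: "Ph : bm borel" "(%p. fd Ph (at p) v) : bm borel"
 by (intro bm_cont smooth_cont[OF s] smooth_cont[OF smooth_fun_frechet[OF s]])+
 note l = measurable_QM_imp_lebesgue[OF borel_bmQ]
 have *: "(LINT p|QM T. Ps p * H p) = (LINT p|leb (QT T). Ps p *R h p)"
 if "Ps : bm borel" "H : bm borel" "AE p in leb (QT T). h p = H p"
 "h : bm (leb (QT T))" for Ps H h :: "real \<times> real => real"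
 proof -
 have "(%p. Ps p * H p) : bm borel" using that(1,2) by (rule borel_measurable_times)
 hence "(LINT p|QM T. Ps p * H p) = (LINT p|leb (QT T). Ps p * H p)" by (rule integral_QM_borel(2))
 also have "... = (LINT p|leb (QT T). Ps p *R h p)"
 proof (rule int_cong_AE)
 show "AE p in leb (QT T). Ps p * H p = Ps p *R h p" using that(3) by eventually_elim simp
 show "(%p. Ps p * H p) : bm (leb (QT T))" by (rule borel_measurable_times[OF l[OF that(1)] l[OF that(2)]])
 show "(%p. Ps p *R h p) : bm (leb (QT T))" by (rule bm_scal[OF l[OF that(1)] that(4)])
 qed
 finally show ?thesis .
 qed
 show ?thesis
 unfolding *[OF b(2) F m(1)] *[OF b(1) G m(2)] using wd tf by (simp only: has_weak_deriv_def)
qed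

text \<open>The characterisation of Sobolev functions by absolute continuity on lines, in both
  directions and with one Borel representative \<open>A\<close>. All three functions share the bound
  \<open>N\<close>, since the norm is the sum of the three essential suprema.\<close>

lemma W1inf_representatives:
 assumes W: "W1inf_norm (QT T) (cp a) < \<infinity>" and T: "0 < T"
 defines "N == real_of_ereal (W1inf_norm (QT T) (cp a))"
 shows "EX A At Ax. cp A : bm borel & cp At : bm borel & cp Ax : bm borel &
 (ALL t x. \<bar>A t x\<bar> <= N & \<bar>At t x\<bar> <= N & \<bar>Ax t x\<bar> <= N) &
 (AE p in leb (QT T). cp a p = cp A p) &
 (AE x in LI. acd 0 T (%t. A t x) (%t. At t x)) & (AE t in LL 0 T. acd 0 1 (A t) (Ax t))"
proof -
 note nn = Linf_norm_nonneg[OF not_AE_False_QT[OF T]]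
 have ex: "EX g. has_weak_deriv (QT T) v (cp a) g" if "v : {(1, 0), (0, 1)}" for v
 using W that by (auto simp: W1inf_norm_def Basis_prod_def split: if_splits)
 define wt wx where "wt = weak_deriv (QT T) (1, 0) (cp a)" and "wx = weak_deriv (QT T) (0, 1) (cp a)"
 have wd: "has_weak_deriv (QT T) (1, 0) (cp a) wt" "has_weak_deriv (QT T) (0, 1) (cp a) wx"
 using ex has_weak_deriv_weak_deriv unfolding wt_def wx_def by blast+
 have B: "(Basis :: (real \<times> real) set) = {(1, 0), (0, 1)}" by (auto simp: Basis_prod_def)
 have "W1inf_norm (QT T) (cp a) = Linf_norm (QT T) (cp a) + (Linf_norm (QT T) wt + Linf_norm (QT T) wx)"
 using wd unfolding W1inf_norm_def B by (auto simp: wt_def wx_def)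
 moreover have "0 <= W1inf_norm (QT T) (cp a)"
 by (rule order_trans[OF nn Linf_norm_le_W1inf_norm[OF not_AE_False_QT[OF T]]])
 hence eN: "W1inf_norm (QT T) (cp a) = ereal N" and N: "0 <= N"
 using W unfolding N_def by (cases "W1inf_norm (QT T) (cp a)"; simp)+
 ultimately have s: "ereal N = Linf_norm (QT T) (cp a) + (Linf_norm (QT T) wt + Linf_norm (QT T) wx)" by simp
 have le: "Linf_norm (QT T) (cp a) <= ereal N" "Linf_norm (QT T) (cp (curry wt)) <= ereal N" "Linf_norm (QT T) (cp (curry wx)) <= ereal N"
 unfolding s case_prod_curry
 by (rule add_increasing2[OF add_nonneg_nonneg[OF nn nn] order_refl], rule add_increasing[OF nn add_increasing2[OF nn order_refl]],
 rule add_increasing[OF nn add_increasing[OF nn order_refl]])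
 have rep: "EX G. cp G : bm borel & (ALL t x. \<bar>G t x\<bar> <= N) & (AE p in leb (QT T). cp g p = cp G p)"
 if gN: "Linf_norm (QT T) (cp g) <= ereal N" for g :: "real => real => real"
 proof -
 obtain G where G: "cp G : bm borel" "ALL t x. \<bar>G t x\<bar> <= N"
 "AE p in leb (QT T). \<bar>cp g p\<bar> <= N --> cp g p = cp G p"
 using clipped_representative[OF Linf_norm_bound(1)[OF gN] N] by blast
 have "AE p in leb (QT T). cp g p = cp G p"
 using G(3) Linf_norm_bound(2)[OF gN] by eventually_elim simp
 with G show ?thesis by blast
 qed
 obtain A where A: "cp A : bm borel" "ALL t x. \<bar>A t x\<bar> <= N" "AE p in leb (QT T). cp a p = cp A p"
 using rep[OF le(1)] by blast
 obtain At where At: "cp At : bm borel" "ALL t x. \<bar>At t x\<bar> <= N" "AE p in leb (QT T). wt p = cp At p"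
 using rep[OF le(2)] by auto
 obtain Ax where Ax: "cp Ax : bm borel" "ALL t x. \<bar>Ax t x\<bar> <= N" "AE p in leb (QT T). wx p = cp Ax p"
 using rep[OF le(3)] by auto
 have m: "cp a : bm (leb (QT T))" "wt : bm (leb (QT T))" "wx : bm (leb (QT T))"
 using Linf_norm_bound(1)[OF le(1)] Linf_norm_bound(1)[OF le(2)] Linf_norm_bound(1)[OF le(3)] by simp_all
 have sq: "sqQ T F" if "cp F : bm borel" "ALL t x. \<bar>F t x\<bar> <= N" for F :: "real => real => real"
 by (rule finite_measure.sqi_bounded[OF finite_measure_QM borel_bmQ[OF that(1)], of N]) (use that(2) in auto)
 have "AE x in LI. acd 0 T (%t. A t x) (%t. At t x)"
 proof (rule acd_time_if_tensor[OF sq[OF A(1,2)] sq[OF At(1,2)] T])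
 fix th ph :: "real => real" assume t: "test_fun {0<..<T} th" "test_fun unit_iv ph"
 have "(%p. fd (%p. th (fst p) * ph (snd p)) (at p) (1, 0) * cp A p) = cp (%t x. (D1 th t * ph x) * A t x)"
 by (auto simp: fun_eq_iff test_fun_tensor(2)[OF t])
 moreover have "(%p. (th (fst p) * ph (snd p)) * cp At p) = cp (%t x. (th t * ph x) * At t x)" by (auto simp: fun_eq_iff)
 ultimately show "integral\<^sup>L (QM T) (cp (%t x. (D1 th t * ph x) * A t x)) = - integral\<^sup>L (QM T) (cp (%t x. (th t * ph x) * At t x))"
 using QM_weak_derivative[OF wd(1) A(1,3) At(1,3) m(1,2) test_fun_tensor(1)[OF t, folded QT_def]] by (simp only:)
 qed
 moreover have "AE t in LL 0 T. acd 0 1 (A t) (Ax t)"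
 proof (rule acd_space_if_tensor[OF sq[OF A(1,2)] sq[OF Ax(1,2)]])
 fix th ph :: "real => real" assume t: "test_fun {0<..<T} th" "test_fun unit_iv ph"
 have "(%p. fd (%p. th (fst p) * ph (snd p)) (at p) (0, 1) * cp A p) = cp (%t x. (th t * D1 ph x) * A t x)"
 by (auto simp: fun_eq_iff test_fun_tensor(2)[OF t])
 moreover have "(%p. (th (fst p) * ph (snd p)) * cp Ax p) = cp (%t x. (th t * ph x) * Ax t x)" by (auto simp: fun_eq_iff)
 ultimately show "integral\<^sup>L (QM T) (cp (%t x. (th t * D1 ph x) * A t x)) = - integral\<^sup>L (QM T) (cp (%t x. (th t * ph x) * Ax t x))"
 using QM_weak_derivative[OF wd(2) A(1,3) Ax(1,3) m(1,3) test_fun_tensor(1)[OF t, folded QT_def]] by (simp only:)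
 qed
 moreover have "ALL t x. \<bar>A t x\<bar> <= N & \<bar>At t x\<bar> <= N & \<bar>Ax t x\<bar> <= N" using A(2) At(2) Ax(2) by simp
 ultimately show ?thesis
 by (rule_tac exI[of _ A], rule_tac exI[of _ At], rule_tac exI[of _ Ax]) (intro conjI A(1,3) At(1) Ax(1))
qed

lemma Linf_bochner_bound:
 assumes b: "Linf_bochner_norm T (W1inf_norm unit_iv) b < \<infinity>" and T: "0 < T"
 defines "N == real_of_ereal (Linf_bochner_norm T (W1inf_norm unit_iv) b)"
 shows "cp b : bm (leb (QT T))" "0 <= N"
 "AE t in LL 0 T. AE x in LI. norm (b t x) <= N"
proof -
 show m: "cp b : bm (leb (QT T))" using b by (simp add: Linf_bochner_norm_def split: if_splits)
 define E where "E = Linf_bochner_norm T (W1inf_norm unit_iv) b"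
 have E: "E = esssup (LL 0 T) (%t. W1inf_norm unit_iv (b t))" using m by (simp add: E_def Linf_bochner_norm_def)
 have le: "AE t in LL 0 T. Linf_norm unit_iv (b t) <= E"
 unfolding E using esssup_AE[of "%t. W1inf_norm unit_iv (b t)" "LL 0 T"]
 by eventually_elim (rule order_trans[OF Linf_norm_le_W1inf_norm[OF not_AE_False_LL[OF zero_less_one]]])
 hence "AE t in LL 0 T. 0 <= E"
 by eventually_elim (rule order_trans[OF Linf_norm_nonneg[OF not_AE_False_LL[OF zero_less_one]]])
 hence "0 <= E" by (rule AE_LL_contradiction[OF T])
 hence eN: "E = ereal N" and N: "0 <= N" using b unfolding N_def E_def[symmetric] by (cases E; simp)+
 show "0 <= N" by (rule N)
 show "AE t in LL 0 T. AE x in LI. norm (b t x) <= N"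
 using le unfolding eN by eventually_elim (rule Linf_norm_bound(2))
qed

lemma Linf_bochner_representative:
 fixes b :: "real => real => real"
 assumes b: "Linf_bochner_norm T (W1inf_norm unit_iv) b < \<infinity>" and T: "0 < T"
 shows "EX bt N. cp bt : bm borel & (ALL t x. \<bar>bt t x\<bar> <= N) & (AE t in LL 0 T. AE x in LI. b t x = bt t x)"
proof -
 note B = Linf_bochner_bound[OF b T]
 define N where "N = real_of_ereal (Linf_bochner_norm T (W1inf_norm unit_iv) b)"
 obtain bt where bt: "cp bt : bm borel" "ALL t x. \<bar>bt t x\<bar> <= N"
 "AE p in leb (QT T). \<bar>cp b p\<bar> <= N --> cp b p = cp bt p"
 using clipped_representative[OF B(1,2), folded N_def] by blast
 have "AE t in LL 0 T. AE x in LI. b t x = bt t x"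
 using AE_QM_fst[OF AE_lebesgue_on_QT[OF bt(3)]] B(3)[folded N_def]
 proof eventually_elim
 case (elim t)
 show ?case using elim(1,2) by eventually_elim auto
 qed
 with bt show ?thesis by blast
qed

section \<open>Bochner norms\<close>

lemma pred_eq_if_measurable:
 fixes f g :: "'a => 'b::euclidean_space"
 assumes "f : bm M" "g : bm M"
 shows "Measurable.pred M (%p. f p = g p)"
proof -
 have "(%p. f p - g p) -` {0} \<inter> space M : sets M"
 by (rule measurable_sets[OF bm_diff[OF assms]]) simp
 moreover have "(%p. f p - g p) -` {0} \<inter> space M = {p : space M. f p = g p}" by auto
 ultimately show ?thesis unfolding pred_def by simp
qed

lemma deriv_eq_frechet_derivative:
 fixes th :: "real => real"
 assumes "test_fun S th"
 shows "deriv th t = D1 th t"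
 using smooth_fun_real_derivative[of th t] assms
 by (auto simp: test_fun_def real_deriv_iff[symmetric] intro: DERIV_imp_deriv)

lemma sqi_QM_representative:
 fixes U :: "real => real => 'b::euclidean_space"
 assumes U: "cp U : bm borel" and eq: "AE t in LL 0 T. AE x in LI. u t x = U t x"
 and m: "intg (LL 0 T) m" "AE t in LL 0 T. sqi LI (u t) & n2 LI (u t) <= m t"
 shows "sqQ T U"
proof (rule sqi_QM_if_time_slices[OF borel_bmQ[OF U] m(1)])
 show "AE t in LL 0 T. sqi LI (U t) & n2 LI (U t) <= m t"
 using eq m(2) AE_space
 proof eventually_elim
 case (elim t)
 have mt: "U t : bm LI"
 by (rule QM_slice_measurable(1)[OF borel_bmQ[OF U], of t T]) (use elim(3) in simp)
 have n: "n2 LI (u t) = n2 LI (U t)" by (rule n2_cong[OF elim(1) sqi_meas mt]) (use elim(2) in simp)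
 show ?case using sqi_cong[OF elim(1) _ mt] elim(2) n by simp
 qed
qed

lemma joint_derivative_sqi:
 fixes U :: "real => real => 'b::euclidean_space"
 assumes U: "cp U : bm borel" and m: "intg (LL 0 T) m"
 and ex: "AE t in LL 0 T. EX g. acd 0 1 (U t) g & sqi LI g & n2 LI g <= m t"
 shows "EX P. cp P : bm borel & sqQ T P & (AE t in LL 0 T. acd 0 1 (U t) (P t))"
proof -
 define g where "g t = (SOME g. acd 0 1 (U t) g & sqi LI g & n2 LI g <= m t)" for t
 have g: "AE t in LL 0 T. acd 0 1 (U t) (g t) & sqi LI (g t) & n2 LI (g t) <= m t"
 using ex
 proof eventually_elim
 case (elim t)
 from someI_ex[OF this] show ?case unfolding g_def .
 qed
 have "AE t in LL 0 T. acd 0 1 (U t) (g t)" using g by eventually_elim (rule conjunct1)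
 from joint_derivative[OF U this] obtain P where P: "cp P : bm borel" "AE t in LL 0 T. AE x in LI. P t x = g t x" by blast
 have gP: "AE t in LL 0 T. AE x in LI. g t x = P t x" using P(2) by eventually_elim (simp only: eq_commute)
 have "sqQ T P" by (rule sqi_QM_representative[OF P(1) gP m]) (use g in "eventually_elim, blast")
 moreover have "AE t in LL 0 T. acd 0 1 (U t) (P t)"
 using g gP AE_space
 proof eventually_elim
 case (elim t)
 show ?case
 by (rule acd_AE_cong_deriv[OF _ elim(2) QM_slice_measurable(1)[OF borel_bmQ[OF P(1)], of t T]])
 (use elim(1,3) in auto)
 qed
 ultimately show ?thesis using P(1) by blast
qed

lemma L2L2_representative:
 assumes u: "L2_bochner_norm T (L2_norm unit_iv) u < \<infinity>"
 shows "EX U. cp U : bm borel & sqQ T U & (AE p in leb (QT T). cp u p = cp U p)"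
proof -
 note L = bochner_fin[OF u] and F = L2_time_norm_finite[OF bochner_fin(2)[OF u]]
 obtain U where U: "cp U : bm borel" "AE p in leb (QT T). cp u p = cp U p"
 using QM_representative[OF L(1)] by blast
 have "sqQ T U"
 proof (rule sqi_QM_representative[OF U(1) AE_QT_slices(1)[OF U(2)] sqi_norm2[OF F(2)]])
 show "AE t in LL 0 T. sqi LI (u t) & n2 LI (u t) <= (norm (real_of_ereal (L2_norm unit_iv (u t))))^2"
 using F(1)
 proof eventually_elim
 case (elim t)
 hence "sqi LI (u t)" using L2_norm_less_top_iff by blast
 thus ?case using L2_norm_eq[of unit_iv "u t"] by simp
 qed
 qed
 thus ?thesis using U by blast
qed

lemma L2H1_representative:
 assumes u: "L2_bochner_norm T (H_norm 1 unit_iv) u < \<infinity>"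
 shows "EX U P. sqQ T U & sqQ T P &
 (AE p in leb (QT T). cp u p = cp U p) & (AE t in LL 0 T. acd 0 1 (U t) (P t))"
proof -
 note L = bochner_fin[OF u] and F = L2_time_norm_finite[OF bochner_fin(2)[OF u]]
 obtain U where U: "cp U : bm borel" "AE p in leb (QT T). cp u p = cp U p"
 using QM_representative[OF L(1)] by blast
 define m where "m t = (norm (real_of_ereal (H_norm 1 unit_iv (u t))))^2" for t
 have m: "intg (LL 0 T) m" unfolding m_def[abs_def] by (rule sqi_norm2[OF F(2)])
 have g: "AE t in LL 0 T. sqi LI (u t) & n2 LI (u t) <= m t & (EX g. acd 0 1 (u t) g & sqi LI g & n2 LI g <= m t)"
 using F(1)
 proof eventually_elim
 case (elim t)
 from H_norm_1_finite[OF this zero_less_one] obtain g where g: "acd 0 1 (u t) g" "sqi LI (u t)" "sqi LI g" by blast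
 have "m t = n2 LI (u t) + n2 LI g"
 unfolding m_def H_norm_1_eq[OF g(1,2,3) zero_less_one] by simp
 thus ?case using g by (auto intro!: exI[of _ g])
 qed
 have "sqQ T U"
 by (rule sqi_QM_representative[OF U(1) AE_QT_slices(1)[OF U(2)] m]) (use g in "eventually_elim, blast")
 moreover have "AE t in LL 0 T. EX g. acd 0 1 (U t) g & sqi LI g & n2 LI g <= m t"
 using g AE_QT_slices(1)[OF U(2)] by eventually_elim (blast intro: acd_AE_cong)
 from joint_derivative_sqi[OF U(1) m this] obtain P where "sqQ T P" "AE t in LL 0 T. acd 0 1 (U t) (P t)" by blast
 ultimately show ?thesis using U(2) by blast
qed

lemma L2H2_representative:
 assumes u: "L2_bochner_norm T (H_norm 2 unit_iv) u < \<infinity>"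
 shows "EX U P R. sqQ T U & sqQ T P & sqQ T R &
 (AE p in leb (QT T). cp u p = cp U p) & (AE t in LL 0 T. acd 0 1 (U t) (P t)) & (AE t in LL 0 T. acd 0 1 (P t) (R t))"
proof -
 note L = bochner_fin[OF u] and F = L2_time_norm_finite[OF bochner_fin(2)[OF u]]
 obtain U where U: "cp U : bm borel" "AE p in leb (QT T). cp u p = cp U p"
 using QM_representative[OF L(1)] by blast
 define m where "m t = (norm (real_of_ereal (H_norm 2 unit_iv (u t))))^2" for t
 have m: "intg (LL 0 T) m" unfolding m_def[abs_def] by (rule sqi_norm2[OF F(2)])
 have g: "AE t in LL 0 T. sqi LI (u t) & n2 LI (u t) <= m t & (EX g k. acd 0 1 (u t) g & sqi LI g & n2 LI g <= m t &
 acd 0 1 g k & sqi LI k & n2 LI k <= m t)"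
 using F(1)
 proof eventually_elim
 case (elim t)
 from H_norm_2_finite[OF this zero_less_one] obtain g k where g: "acd 0 1 (u t) g" "acd 0 1 g k" "sqi LI (u t)" "sqi LI g" "sqi LI k" by blast
 have "m t = n2 LI (u t) + n2 LI g + n2 LI k"
 unfolding m_def H_norm_2_eq[OF g zero_less_one] by simp
 hence "acd 0 1 (u t) g & sqi LI g & n2 LI g <= m t & acd 0 1 g k & sqi LI k & n2 LI k <= m t" "n2 LI (u t) <= m t" using g by simp_all
 thus ?case using g(3) by blast
 qed
 have "sqQ T U"
 by (rule sqi_QM_representative[OF U(1) AE_QT_slices(1)[OF U(2)] m]) (use g in "eventually_elim, blast")
 moreover have "AE t in LL 0 T. EX g. acd 0 1 (U t) g & sqi LI g & n2 LI g <= m t"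
 using g AE_QT_slices(1)[OF U(2)] by eventually_elim (blast intro: acd_AE_cong)
 from joint_derivative_sqi[OF U(1) m this] obtain P where P: "cp P : bm borel" "sqQ T P" "AE t in LL 0 T. acd 0 1 (U t) (P t)" by blast
 have "AE t in LL 0 T. EX k. acd 0 1 (P t) k & sqi LI k & n2 LI k <= m t"
 using g AE_QT_slices(1)[OF U(2)] P(3)
 proof eventually_elim
 case (elim t)
 then obtain g k where gk: "acd 0 1 (u t) g" "acd 0 1 g k" "sqi LI k" "n2 LI k <= m t" by blast
 have "AE x in LI. g x = P t x" by (rule acd_unique[OF acd_AE_cong[OF gk(1) elim(2)] elim(3) zero_less_one])
 from acd_AE_cong[OF gk(2) this] gk show ?case by blast
 qed
 from joint_derivative_sqi[OF P(1) m this] obtain R where "sqQ T R" "AE t in LL 0 T. acd 0 1 (P t) (R t)" by blast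
 ultimately show ?thesis using U(2) P by blast
qed

lemma L2L2_norm_eq:
 fixes f g :: "real => real => 'b::euclidean_space"
 assumes f: "sqQ T f" and g: "cp g : bm (leb (QT T))"
 and eq: "AE t in LL 0 T. AE x in LI. g t x = f t x"
 shows "L2_bochner_norm T (L2_norm unit_iv) g = ereal (sqrt (nQ T f))"
proof -
 have "L2_time_norm T (%t. L2_norm unit_iv (g t)) = ereal (sqrt (LINT t|LL 0 T. n2 LI (f t)))"
 proof (rule L2_time_norm_eq[OF _ slices(3)[OF f] n2_nonneg])
 show "AE t in LL 0 T. L2_norm unit_iv (g t) = ereal (sqrt (n2 LI (f t)))"
 using eq slices(1)[OF f]
 proof eventually_elim
 case (elim t)
 have mg: "g t : bm LI" by (rule AE_measurable_LL[OF elim(1) sqi_meas[OF elim(2)]])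
 have "AE x in LI. f t x = g t x" using elim(1) by eventually_elim simp
 from L2_norm_eq[OF sqi_cong[OF this elim(2) mg]] n2_cong[OF elim(1) mg sqi_meas[OF elim(2)]]
 show ?case by simp
 qed
 qed
 thus ?thesis using g slices(5)[OF f] by (simp add: L2_bochner_norm_def)
qed

lemma has_time_deriv_acd:
 fixes u v :: "real => real => 'b::euclidean_space"
 assumes uv: "has_time_deriv T u v" and T: "0 < T"
 obtains V where "sqQ T V" "AE p in leb (QT T). cp v p = cp V p"
 "AE x in LI. acd 0 T (%t. u t x) (%t. V t x)"
proof -
 have fin: "L2_bochner_norm T (L2_norm unit_iv) u < \<infinity>" "L2_bochner_norm T (L2_norm unit_iv) v < \<infinity>" using uv by (auto simp: has_time_deriv_def)
 obtain U where U: "sqQ T U" "AE p in leb (QT T). cp u p = cp U p" using L2L2_representative[OF fin(1)] by blast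
 obtain V where V: "sqQ T V" "AE p in leb (QT T). cp v p = cp V p" using L2L2_representative[OF fin(2)] by blast
 have iu: "AE x in LI. intg (LL 0 T) (%t. u t x)" if "sqQ T U" "AE p in leb (QT T). cp u p = cp U p" for u U :: "real => real => 'b"
 using AE_QT_slices(2)[OF that(2)] slices(2)[OF that(1)]
 proof eventually_elim
 case (elim x)
 have m: "(%t. u t x) : bm (LL 0 T)" by (rule AE_measurable_LL[OF elim(1) sqi_meas[OF elim(2)]])
 have "AE t in LL 0 T. U t x = u t x" using elim(1) by eventually_elim simp
 from sqi_cong[OF this elim(2) m] show ?case by (rule sqi_intg)
 qed
 have "AE x in LI. acd 0 T (%t. u t x) (%t. v t x)"
 proof (rule weak_derivative_imp_acd[OF T iu[OF U] iu[OF V]])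
 fix th :: "real => real" assume th: "test_fun {0<..<T} th"
 have "AE x in LI. (LINT t|LL 0 T. deriv th t *R u t x) = - (LINT t|LL 0 T. th t *R v t x)"
 using uv th unfolding has_time_deriv_def by blast
 thus "AE x in LI. (LINT t|LL 0 T. D1 th t *R u t x) = - (LINT t|LL 0 T. th t *R v t x)"
 unfolding deriv_eq_frechet_derivative[OF th] .
 qed
 hence "AE x in LI. acd 0 T (%t. u t x) (%t. V t x)"
 using AE_QT_slices(2)[OF V(2)] slices(2)[OF V(1)] by eventually_elim (rule acd_AE_cong_deriv[OF _ _ sqi_meas])
 thus ?thesis using V that by blast
qed

text \<open>The norm refers to chosen time and space derivatives. Uniqueness on lines replaces them
  by any jointly measurable derivatives \<open>v\<close>, \<open>p\<close> and \<open>r\<close>,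
  which makes the norm computable.\<close>

lemma H1L2_L2H2_norm_eq:
 fixes u D v p r :: "real => real => 'b::euclidean_space"
 assumes T: "0 < T" and D: "sqQ T D" and v: "sqQ T v" and p: "sqQ T p" and r: "sqQ T r"
 and Dv: "AE x in LI. acd 0 T (%t. D t x) (%t. v t x)"
 and Dp: "AE t in LL 0 T. acd 0 1 (D t) (p t)" and pr: "AE t in LL 0 T. acd 0 1 (p t) (r t)"
 and um: "cp u : bm (leb (QT T))" and uD: "AE t in LL 0 T. AE x in LI. u t x = D t x"
 shows "H1L2_L2H2_norm T u = ereal (sqrt (nQ T D + nQ T v) +
 sqrt (nQ T D + nQ T p + nQ T r))"
proof -
 \<comment> \<open>\<open>u\<close> is only Lebesgue measurable on the plane, so the order of the
   quantifiers over \<open>t\<close> and \<open>x\<close> is exchanged for a Borel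
   representative.\<close>
 obtain U where U: "cp U : bm borel" "AE p in leb (QT T). cp u p = cp U p"
 using QM_representative[OF um] by blast
 have "AE t in LL 0 T. AE x in LI. U t x = D t x"
 using uD AE_QT_slices(1)[OF U(2)]
 proof eventually_elim
 case (elim t) show ?case using elim(1,2) by eventually_elim simp
 qed
 moreover have "Measurable.pred (QM T) (%p. cp U p = cp D p)"
 by (rule pred_eq_if_measurable[OF borel_bmQ[OF U(1)] sqi_meas[OF D]])
 ultimately have "AE x in LI. AE t in LL 0 T. U t x = D t x"
 using AE_QM_swap[where T = T and P = "%p. cp U p = cp D p"] by simp
 hence uDx: "AE x in LI. AE t in LL 0 T. D t x = u t x"
 using AE_QT_slices(2)[OF U(2)]
 proof eventually_elim
 case (elim x) show ?case using elim(1,2) by eventually_elim simp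
 qed
 have uv: "AE x in LI. acd 0 T (%t. u t x) (%t. v t x)" using Dv uDx by eventually_elim (rule acd_AE_cong)
 have vm: "cp v : bm (leb (QT T))" by (rule measurable_QM_imp_lebesgue[OF sqi_meas[OF v]])
 have nu: "L2_bochner_norm T (L2_norm unit_iv) u = ereal (sqrt (nQ T D))" by (rule L2L2_norm_eq[OF D um uD])
 have "has_time_deriv T u v"
 unfolding has_time_deriv_def
 proof (intro conjI allI impI)
 show "L2_bochner_norm T (L2_norm unit_iv) u < \<infinity>" "L2_bochner_norm T (L2_norm unit_iv) v < \<infinity>"
 using nu L2L2_norm_eq[OF v vm] by simp_all
 fix th :: "real => real" assume th: "test_fun {0<..<T} th"
 show "AE x in LI. (LINT t|LL 0 T. deriv th t *R u t x) = - (LINT t|LL 0 T. th t *R v t x)"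
 unfolding deriv_eq_frechet_derivative[OF th] using uv by eventually_elim (rule integral_test_fun_acd[OF _ th T])
 qed
 define w where "w = (SOME v. has_time_deriv T u v)"
 have w: "has_time_deriv T u w" unfolding w_def by (rule someI[where P = "has_time_deriv T u"]) fact
 obtain W where W: "sqQ T W" "AE p in leb (QT T). cp w p = cp W p" "AE x in LI. acd 0 T (%t. u t x) (%t. W t x)"
 using has_time_deriv_acd[OF w T] by blast
 have vW: "AE x in LI. AE t in LL 0 T. W t x = v t x" using W(3) uv by eventually_elim (rule acd_unique[OF _ _ T])
 moreover have "Measurable.pred (QM T) (%p. cp W p = cp v p)"
 by (rule pred_eq_if_measurable[OF sqi_meas[OF W(1)] sqi_meas[OF v]])
 ultimately have "AE t in LL 0 T. AE x in LI. W t x = v t x"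
 using AE_QM_swap[where T = T and P = "%p. cp W p = cp v p"] by simp
 hence wv: "AE t in LL 0 T. AE x in LI. w t x = v t x"
 using AE_QT_slices(1)[OF W(2)]
 proof eventually_elim
 case (elim t) show ?case using elim(1,2) by eventually_elim simp
 qed
 have wm: "cp w : bm (leb (QT T))" using w by (auto simp: has_time_deriv_def L2_bochner_norm_def split: if_splits)
 have 1: "H1L2_norm T u = ereal (sqrt (nQ T D + nQ T v))"
 using \<open>has_time_deriv T u v\<close> L2L2_norm_eq[OF v wm wv] nu unfolding H1L2_norm_def w_def[symmetric] by auto
 define m where "m t = n2 LI (D t) + n2 LI (p t) + n2 LI (r t)" for t
 note I = slices(3)[OF D] slices(3)[OF p] slices(3)[OF r]
 have mi: "intg (LL 0 T) m" unfolding m_def[abs_def] by (rule intg_add[OF intg_add[OF I(1,2)] I(3)])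
 have mI: "(LINT t|LL 0 T. m t) = nQ T D + nQ T p + nQ T r"
 unfolding m_def int_add[OF intg_add[OF I(1,2)] I(3)] int_add[OF I(1,2)]
 slices(5)[OF D] slices(5)[OF p] slices(5)[OF r] ..
 have "L2_time_norm T (%t. H_norm 2 unit_iv (u t)) = ereal (sqrt (LINT t|LL 0 T. m t))"
 proof (rule L2_time_norm_eq[OF _ mi])
 show "0 <= m t" for t by (simp add: m_def)
 show "AE t in LL 0 T. H_norm 2 unit_iv (u t) = ereal (sqrt (m t))"
 using uD Dp pr slices(1)[OF D] slices(1)[OF p] slices(1)[OF r]
 proof eventually_elim
 case (elim t)
 have mu: "u t : bm LI" by (rule AE_measurable_LL[OF elim(1) sqi_meas[OF elim(4)]])
 have Du: "AE x in LI. D t x = u t x" using elim(1) by eventually_elim simp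
 show ?case
 using H_norm_2_eq[OF acd_AE_cong[OF elim(2) Du] elim(3) sqi_cong[OF Du elim(4) mu] elim(5,6) zero_less_one] n2_cong[OF elim(1) mu sqi_meas[OF elim(4)]]
 by (simp add: m_def)
 qed
 qed
 hence "L2_bochner_norm T (H_norm 2 unit_iv) u = ereal (sqrt (LINT t|LL 0 T. m t))" using um by (simp add: L2_bochner_norm_def)
 thus ?thesis unfolding H1L2_L2H2_norm_def 1 mI by simp
qed

section \<open>Traces and initial values\<close>

text \<open>The spatially affine lifting of the boundary values, as in the definition of a weak
  solution.\<close>

definition lin :: "complex => complex => real => complex" where
 "lin A B x = complex_of_real (1 - x) * A + complex_of_real x * B"

lemma lin_eq: "x : {0..} ==> lin A B x = A + prim 0 (%y. B - A) x"
 by (simp add: lin_def prim_const scaleR_conv_of_real algebra_simps)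

lemma acd_lin: "acd 0 1 (lin A B) (%x. B - A)"
 by (rule acdI[where c = A]) (use AE_space in "auto intro: fm_intg_const[OF fin_LL] elim!: eventually_mono simp: lin_eq")

lemma h10_if_traces:
 assumes ac: "acd 0 1 f g" and g: "sqi LI g" and tr: "cont_rep 0 1 f 0 = A" "cont_rep 0 1 f 1 = B"
 shows "h10 (%x. f x - lin A B x) (%x. g x - (B - A))"
proof (rule h10_if_trace_zero[OF acd_diff[OF ac acd_lin] sqi_diff[OF g finite_measure.sqi_const[OF fin_LL]]])
 obtain c where ig: "intg LI g" and c: "AE x in LI. f x = c + prim 0 g x" using ac by (auto simp: acd_def)
 have ic: "intg LI (%y. B - A)" by (rule fm_intg_const[OF fin_LL])
 have i: "intg LI (%x. g x - (B - A))" by (rule intg_diff[OF ig ic])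
 have e: "AE x in LI. f x - lin A B x = (c - A) + prim 0 (%x. g x - (B - A)) x"
 using c AE_space by eventually_elim (simp add: lin_eq prim_subtract[OF ig ic])
 have t: "A = c" "B = c + prim 0 g 1" using tr cont_rep_acd[OF ig c zero_less_one, of 0] cont_rep_acd[OF ig c zero_less_one, of 1] by auto
 have v1: "prim 0 (%x. g x - (B - A)) 1 = prim 0 g 1 - (B - A)" using prim_subtract[OF ig ic, of 1] prim_const[of 0 1 "B - A"] by simp
 have c0: "cont_rep 0 1 (%x. f x - lin A B x) 0 = (c - A) + prim 0 (%x. g x - (B - A)) 0"
 and c1: "cont_rep 0 1 (%x. f x - lin A B x) 1 = (c - A) + prim 0 (%x. g x - (B - A)) 1"
 by (rule cont_rep_acd[OF i e zero_less_one], simp)+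
 show "cont_rep 0 1 (%x. f x - lin A B x) 0 = 0" unfolding c0 using t by simp
 show "cont_rep 0 1 (%x. f x - lin A B x) 1 = 0" unfolding c1 v1 using t by simp
qed

text \<open>The pairing of the continuous representative \<open>Uh\<close> with \<open>ph\<close> is
  continuous in time and equals \<open>c + prim 0 ka t\<close> almost everywhere, hence for every
  \<open>t\<close>. At \<open>t = 0\<close> the constant turns out to be the pairing with
  \<open>u0\<close>.\<close>

lemma initial_value_pairing:
 fixes u U Uh :: "real => real => 'b::euclidean_space"
 assumes T: "0 < T" and U: "sqQ T U"
 and fin: "ALL t:{0..T}. L2_norm unit_iv (Uh t) < \<infinity>"
 and cont: "ALL s:{0..T}. ((%t. L2_norm unit_iv (%x. Uh t x - Uh s x)) \<longlongrightarrow> 0) (at s within {0..T})"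
 and eq: "AE t in LL 0 T. AE x in LI. Uh t x = U t x" and init: "AE x in LI. Uh 0 x = u0 x"
 and u0: "sqi LI u0" and ph: "sqi LI ph" and ac: "acd 0 T (%t. LINT x|LI. U t x *I ph x) ka" and t: "t : {0..T}"
 shows "(LINT x|LI. (Uh t x - u0 x) *I ph x) = prim 0 ka t"
proof -
 have s: "sqi LI (Uh t)" if "t : {0..T}" for t using fin that L2_norm_less_top_iff by blast
 define y where "y t = (LINT x|LI. Uh t x *I ph x)" for t
 have yd: "y t - y s = (LINT x|LI. (Uh t x - Uh s x) *I ph x)" if "t : {0..T}" "s : {0..T}" for t s
 unfolding y_def inner_diff_left
 by (rule int_diff[OF sqi_inner[OF s[OF that(1)] ph] sqi_inner[OF s[OF that(2)] ph], symmetric])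
 have cy: "continuous_on {0..T} y"
 unfolding continuous_on_def
 proof
 fix r assume r: "r : {0..T}"
 have "((%t. ereal (sqrt (n2 LI (%x. Uh t x - Uh r x)))) \<longlongrightarrow> ereal 0) (at r within {0..T})"
 proof (rule Lim_transform_eventually)
 show "((%t. L2_norm unit_iv (%x. Uh t x - Uh r x)) \<longlongrightarrow> ereal 0) (at r within {0..T})" using cont r by (simp add: zero_ereal_def)
 show "\<forall>\<^sub>F t in at r within {0..T}. L2_norm unit_iv (%x. Uh t x - Uh r x) = ereal (sqrt (n2 LI (%x. Uh t x - Uh r x)))"
 unfolding eventually_at_topological by (intro exI[of _ UNIV]) (use r in "auto intro!: L2_norm_eq sqi_diff s")
 qed
 hence "((%t. sqrt (n2 LI (%x. Uh t x - Uh r x))) \<longlongrightarrow> 0) (at r within {0..T})" by (simp only: lim_ereal)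
 from tendsto_mult_left_zero[OF this, of "sqrt (n2 LI ph)"]
 have "((%t. y t - y r) \<longlongrightarrow> 0) (at r within {0..T})"
 proof (rule Lim_null_comparison[rotated])
 show "\<forall>\<^sub>F t in at r within {0..T}. norm (y t - y r) <= sqrt (n2 LI (%x. Uh t x - Uh r x)) * sqrt (n2 LI ph)"
 unfolding eventually_at_topological
 by (intro exI[of _ UNIV]) (use r in "auto simp: yd intro!: norm_integral_inner_le sqi_diff s ph")
 qed
 thus "(y \<longlongrightarrow> y r) (at r within {0..T})" by (simp only: LIM_zero_iff)
 qed
 obtain c where i: "intg (LL 0 T) ka" and c: "AE t in LL 0 T. (LINT x|LI. U t x *I ph x) = c + prim 0 ka t" using ac by (auto simp: acd_def)
 have "AE t in LL 0 T. y t = c + prim 0 ka t"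
 using c eq slices(1)[OF U]
 proof eventually_elim
 case (elim t)
 have "y t = (LINT x|LI. U t x *I ph x)" unfolding y_def
 proof (rule int_cong_AE)
 show "(%x. Uh t x *I ph x) : bm LI"
 by (rule bm_inner[OF AE_measurable_LL[OF elim(2) sqi_meas[OF elim(3)]] sqi_meas[OF ph]])
 show "(%x. U t x *I ph x) : bm LI" by (rule bm_inner[OF sqi_meas[OF elim(3)] sqi_meas[OF ph]])
 show "AE x in LI. Uh t x *I ph x = U t x *I ph x" using elim(2) by eventually_elim simp
 qed
 thus ?case using elim(1) by simp
 qed
 note AE = this
 have y: "y t = c + prim 0 ka t" if "t : {0..T}" for t
 by (rule continuous_AE_eq[OF cy _ AE T that]) (intro continuous_on_add continuous_on_const continuous_on_prim i)
 have "y t - y 0 = prim 0 ka t" using y[OF t] y[of 0] T by simp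
 moreover have "y t - y 0 = (LINT x|LI. (Uh t x - u0 x) *I ph x)"
 proof (subst yd[OF t])
 show "0 : {0..T}" using T by simp
 next
 have z: "sqi LI (Uh 0)" using s[of 0] T by simp
 have m1: "(%x. (Uh t x - Uh 0 x) *I ph x) : bm LI"
 by (rule bm_inner[OF sqi_meas[OF sqi_diff[OF s[OF t] z]] sqi_meas[OF ph]])
 have m2: "(%x. (Uh t x - u0 x) *I ph x) : bm LI"
 by (rule bm_inner[OF sqi_meas[OF sqi_diff[OF s[OF t] u0]] sqi_meas[OF ph]])
 have "AE x in LI. (Uh t x - Uh 0 x) *I ph x = (Uh t x - u0 x) *I ph x" using init by eventually_elim simp
 from int_cong_AE[OF m1 m2 this] show "(LINT x|LI. (Uh t x - Uh 0 x) *I ph x) = (LINT x|LI. (Uh t x - u0 x) *I ph x)" .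
 qed
 ultimately show ?thesis by simp
qed

section \<open>Weak and strong solutions\<close>

lemma LL_cong_AE:
 fixes f g :: "real => 'b::euclidean_space"
 assumes "AE x in LL l r. f x = g x" "g : bm (LL l r)"
 shows "integral\<^sup>L (LL l r) f = integral\<^sup>L (LL l r) g"
 by (rule int_cong_AE[OF AE_measurable_LL[OF assms] assms(2,1)])

lemma pairing_weak:
 fixes f :: "real => real => 'b::euclidean_space"
 assumes f: "sqQ T f" and t: "sqi (LL 0 T) th" and p: "sqi LI ph"
 shows "(LINT t|LL 0 T. th t * (LINT x|LI. f t x *I ph x)) = (LINT x|LI. (LINT t|LL 0 T. th t *R f t x) *I ph x)"
proof -
 have i: "intg (QM T) (cp (%t x. (th t *R ph x) *I f t x))"
 by (rule QM_integral_bilinear[OF bb_inner sqi_QM_tensor[OF t p] f])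
 have 1: "(LINT x|LI. (th t *R ph x) *I f t x) = th t * (LINT x|LI. f t x *I ph x)" for t
 unfolding inner_scaleR_left integral_mult_right_zero by (simp only: inner_commute)
 have AE: "AE x in LI. (LINT t|LL 0 T. th t *R f t x) *I ph x = (LINT t|LL 0 T. (th t *R ph x) *I f t x)"
 using slices(2)[OF f]
 proof eventually_elim
 case (elim x)
 have "(LINT t|LL 0 T. (th t *R f t x) *I ph x) = (LINT t|LL 0 T. th t *R f t x) *I ph x"
 by (rule int_blin[OF bounded_linear_inner_left sqi_scal[OF t elim]])
 moreover have "(%t. (th t *R f t x) *I ph x) = (%t. (th t *R ph x) *I f t x)" by (auto simp: inner_commute)
 ultimately show ?case by (simp only:)
 qed
 show ?thesis
 using QM_integral(5,6)[OF i] LL_cong_AE[OF AE bm_intg[OF QM_integral(4)[OF i]]]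
 unfolding 1 by (simp only:)
qed

lemma weak_derivative_imp_acd_1:
 fixes f g :: "real => 'b::euclidean_space"
 assumes lr: "l < r" and int: "intg (LL l r) f" "intg (LL l r) g"
 and W: "!!ph::real=>real. test_fun {l<..<r} ph ==> (LINT x|LL l r. D1 ph x *R f x) = - (LINT x|LL l r. ph x *R g x)"
 shows "acd l r f g"
proof -
 have "AE t in count_space (UNIV :: unit set). acd l r f g"
 proof (rule weak_derivative_imp_acd[OF lr])
 fix ph :: "real => real" assume "test_fun {l<..<r} ph"
 from W[OF this] show "AE t in count_space (UNIV :: unit set). (LINT x|LL l r. D1 ph x *R f x) = - (LINT x|LL l r. ph x *R g x)"
 by (rule AE_I2)
 qed (rule AE_I2, rule int)+
 thus ?thesis by (simp add: AE_count_space)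
qed

text \<open>The initial value is defined in \<open>L^2(0,1)\<close>, while the time derivative is
  available on lines of constant \<open>x\<close>. Pairing with arbitrary square-integrable
  functions brings both together; choosing the difference of the two sides as test function gives
  equality almost everywhere.\<close>

lemma strong_initial_value:
 fixes U V :: "real => real => 'b::euclidean_space"
 assumes T: "0 < T" and U: "sqQ T U" and V: "sqQ T V"
 and uU: "AE t in LL 0 T. AE x in LI. u t x = U t x" and UV: "AE x in LI. acd 0 T (%t. U t x) (%t. V t x)"
 and u0: "sqi LI u0" and iv: "has_initial_value T u u0"
 shows "AE x in LI. AE t in LL 0 T. U t x = u0 x + prim 0 (%s. V s x) t"
proof -
 obtain Uh where Uh: "ALL t:{0..T}. L2_norm unit_iv (Uh t) < \<infinity>"
 "ALL s:{0..T}. ((%t. L2_norm unit_iv (%x. Uh t x - Uh s x)) \<longlongrightarrow> 0) (at s within {0..T})"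
 "AE t in LL 0 T. AE x in LI. Uh t x = u t x" "AE x in LI. Uh 0 x = u0 x"
 using iv unfolding has_initial_value_def by blast
 have eq: "AE t in LL 0 T. AE x in LI. Uh t x = U t x"
 using Uh(3) uU
 proof eventually_elim
 case (elim t) show ?case using elim by eventually_elim simp
 qed
 have W: "sqi (QM T) (%(t, x). prim 0 (%s. V s x) t)" using sqi_prim_QM[OF V] T by simp
 have pair: "(LINT x|LI. (Uh t x - u0 x) *I ph x) = (LINT x|LI. prim 0 (%s. V s x) t *I ph x)"
 if ph: "sqi LI ph" and t: "t : {0..T}" for ph t
 proof -
 have T0: "0 <= T" "T <= T" using T by auto
 note iU = inner_swap(2)[OF bb_inner U ph T0] and iV = inner_swap(2)[OF bb_inner V ph T0]
 have "acd 0 T (%t. LINT x|LI. U t x *I ph x) (%t. LINT x|LI. V t x *I ph x)"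
 proof (rule weak_derivative_imp_acd_1[OF T iU iV])
 fix th :: "real => real" assume th: "test_fun {0<..<T} th"
 note s = sqi_test_deriv[OF th] sqi_test_fun[OF th]
 have AE: "AE x in LI. (LINT t|LL 0 T. D1 th t *R U t x) *I ph x = - ((LINT t|LL 0 T. th t *R V t x) *I ph x)"
 using UV
 proof eventually_elim
 case (elim x)
 show ?case unfolding integral_test_fun_acd[OF elim th T] by (rule inner_minus_left)
 qed
 have m: "(%x. (LINT t|LL 0 T. th t *R V t x) *I ph x) : bm LI"
 proof -
 interpret P: pair_sigma_finite "LI" "LL 0 T" by (rule psf_LL)
 have 1: "(%(x, t). th t *R V t x) : bm (LI \<Otimes>\<^sub>M LL 0 T)"
 using m_comp[OF measurable_pair_swap' bm_scal[OF sqi_meas[OF sqi_QM_time[OF s(2)]] sqi_meas[OF V]]] by (simp add: split_def)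
 show ?thesis by (rule bm_inner[OF P.M2.borel_measurable_lebesgue_integral[OF 1] sqi_meas[OF ph]])
 qed
 show "(LINT t|LL 0 T. D1 th t *R (LINT x|LI. U t x *I ph x)) = - (LINT t|LL 0 T. th t *R (LINT x|LI. V t x *I ph x))"
 unfolding real_scaleR_def pairing_weak[OF U s(1) ph] pairing_weak[OF V s(2) ph] LL_cong_AE[OF AE borel_measurable_uminus[OF m]]
 by (rule Bochner_Integration.integral_minus)
 qed
 from initial_value_pairing[OF T U Uh(1,2) eq Uh(4) u0 ph this t]
 show ?thesis using inner_swap(1)[OF bb_inner V ph, of t] t by simp
 qed
 have "AE t in LL 0 T. AE x in LI. U t x = u0 x + prim 0 (%s. V s x) t"
 using eq slices(1)[of T "%t x. prim 0 (%s. V s x) t", OF W] AE_space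
 proof eventually_elim
 case (elim t)
 hence t: "t : {0..T}" by simp
 define d where "d x = (Uh t x - u0 x) - prim 0 (%s. V s x) t" for x
 have sU: "sqi LI (%x. Uh t x - u0 x)" using Uh(1) t L2_norm_less_top_iff by (intro sqi_diff u0) blast
 have sd: "sqi LI d" unfolding d_def[abs_def] by (rule sqi_diff[OF sU elim(2)])
 have "(LINT x|LI. d x *I d x) = (LINT x|LI. (Uh t x - u0 x) *I d x - prim 0 (%s. V s x) t *I d x)"
 by (rule int_cong[OF refl]) (simp add: d_def inner_diff_left)
 also have "... = (LINT x|LI. (Uh t x - u0 x) *I d x) - (LINT x|LI. prim 0 (%s. V s x) t *I d x)"
 by (rule int_diff[OF sqi_inner[OF sU sd] sqi_inner[OF elim(2) sd]])
 also have "... = 0" using pair[OF sd t] by simp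
 finally have "AE x in LI. d x *I d x = 0"
 by (subst integral_nonneg_eq_0_iff_AE[OF sqi_inner[OF sd sd], symmetric]) auto
 thus ?case using elim(1)
 proof eventually_elim
 case (elim x)
 hence "d x = 0" by (simp only: inner_eq_zero_iff)
 thus ?case using elim(2) by (simp add: d_def algebra_simps)
 qed
 qed
 moreover have "Measurable.pred (QM T) (%p. cp U p = cp (%t x. u0 x + prim 0 (%s. V s x) t) p)"
 proof (rule pred_eq_if_measurable[OF sqi_meas[OF U]])
 show "cp (%t x. u0 x + prim 0 (%s. V s x) t) : bmQ T"
 using borel_measurable_add[OF sqi_meas[OF sqi_QM_space[OF u0]] sqi_meas[OF W]] by (simp add: split_def)
 qed
 ultimately show ?thesis
 using AE_QM_swap[where T = T and P = "%p. cp U p = cp (%t x. u0 x + prim 0 (%s. V s x) t) p"] unfolding prod.case by blast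
qed

text \<open>The functions \<open>a\<close>, \<open>b\<close>, \<open>f\<close> are the given ones;
  \<open>A\<close> and \<open>bt\<close> are Borel representatives bounded everywhere by
  \<open>N\<close>, and \<open>F\<close> is a representative of \<open>f\<close> on the product
  measure.\<close>

locale coefficients =
 fixes T N :: real and a b A bt :: "real => real => real" and q :: "real => real" and f F :: "real => real => complex"
 assumes T: "0 < T" and N: "0 <= N"
 and A: "cp A : bm borel" "!!t x. \<bar>A t x\<bar> <= N" and aA: "AE t in LL 0 T. AE x in LI. a t x = A t x"
 and bt: "cp bt : bm borel" "!!t x. \<bar>bt t x\<bar> <= N" and bbt: "AE t in LL 0 T. AE x in LI. b t x = bt t x"
 and q: "q : bm LI" "AE x in LI. \<bar>q x\<bar> <= N"
 and F: "sqQ T F" and fF: "AE t in LL 0 T. AE x in LI. f t x = F t x"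
begin

lemma sqi_coefficients:
 fixes g :: "real => real => complex"
 assumes g: "sqQ T g"
 shows "sqQ T (%t x. A t x *R g t x)" "sqQ T (%t x. bt t x *R g t x)" "sqQ T (%t x. q x *R g t x)"
proof -
 have *: "sqQ T (%t x. k t x *R g t x)"
 if "cp k : bmQ T" "AE t in LL 0 T. AE x in LI. \<bar>k t x\<bar> <= N" for k
 proof (rule AE_QM_bound(1)[where fs = "[(N, g)]"])
 show "cp (%t x. k t x *R g t x) : bmQ T"
 using bm_scal[OF that(1) sqi_meas[OF g]] by (simp add: split_def)
 show "AE t in LL 0 T. AE x in LI. norm (k t x *R g t x) <= (\<Sum>(c, f)\<leftarrow>[(N, g)]. c * norm (f t x))"
 using that(2)
 proof eventually_elim
 case (elim t) thus ?case by eventually_elim (auto intro: mult_r_mono)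
 qed
 qed (use g in auto)
 have sq: "sqi LI q" by (rule finite_measure.sqi_bounded[OF fin_LL q(1), of N]) (use q(2) in simp)
 show "sqQ T (%t x. A t x *R g t x)" "sqQ T (%t x. bt t x *R g t x)" "sqQ T (%t x. q x *R g t x)"
 by (rule *[OF borel_bmQ[OF A(1)]], use A(2) in simp, rule *[OF borel_bmQ[OF bt(1)]], use bt(2) in simp,
 rule *[OF sqi_meas[OF sqi_QM_space[OF sq]]], use q(2) in simp)
qed

lemma sqi_slice_coefficients:
 fixes g :: "real => real => complex"
 assumes g: "sqQ T g"
 shows "AE t in LL 0 T. sqi LI (%x. A t x *R g t x) & sqi LI (%x. bt t x *R g t x) & sqi LI (%x. q x *R g t x)"
 using slices(1)[OF sqi_coefficients(1)[OF g]] slices(1)[OF sqi_coefficients(2)[OF g]] slices(1)[OF sqi_coefficients(3)[OF g]]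
 by eventually_elim simp

text \<open>The slicewise derivatives of the definition are replaced by jointly measurable
  \<open>V\<close>, \<open>P\<close>, \<open>R\<close>. The product rule for \<open>A\<close> and
  \<open>P\<close>, with uniqueness of weak derivatives, identifies the derivative of the flux and
  puts the equation into nondivergence form.\<close>

lemma strong_solution_facts:
 assumes S: "strong_solution T a b q f u0 g0 g1 u" and u0: "sqi LI u0" and ax: "AE t in LL 0 T. acd 0 1 (A t) (ax t)"
 shows "EX U V P R. sqQ T U & sqQ T V & sqQ T P & sqQ T R &
 (AE p in leb (QT T). cp u p = cp U p) &
 (AE x in LI. AE t in LL 0 T. U t x = u0 x + prim 0 (%s. V s x) t) &
 (AE t in LL 0 T. acd 0 1 (U t) (P t)) & (AE t in LL 0 T. acd 0 1 (P t) (R t)) &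
 (AE t in LL 0 T. h10 (%x. U t x - lin (g0 t) (g1 t) x) (%x. P t x - (g1 t - g0 t))) &
 (AE t in LL 0 T. AE x in LI. V t x = ax t x *R P t x + A t x *R R t x - bt t x *R P t x - q x *R U t x + F t x)"
proof -
 have fin: "L2_bochner_norm T (H_norm 2 unit_iv) u < \<infinity>"
 using S by (cases "L2_bochner_norm T (H_norm 2 unit_iv) u"; cases "H1L2_norm T u") (auto simp: strong_solution_def H1L2_L2H2_norm_def H1L2_norm_def split: if_splits)
 obtain v where v: "has_time_deriv T u v" "AE t in LL 0 T. EX z. has_weak_deriv unit_iv 1 (%x. complex_of_real (a t x) * wd (u t) x) z &
 (AE x in LI. v t x - z x + complex_of_real (b t x) * wd (u t) x + complex_of_real (q x) * u t x = f t x)"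
 and iv: "has_initial_value T u u0" and tr: "AE t in LL 0 T. cont_rep 0 1 (u t) 0 = g0 t" "AE t in LL 0 T. cont_rep 0 1 (u t) 1 = g1 t"
 using S unfolding strong_solution_def by blast
 obtain U P R where U: "sqQ T U" "sqQ T P" "sqQ T R"
 "AE p in leb (QT T). cp u p = cp U p" "AE t in LL 0 T. acd 0 1 (U t) (P t)" "AE t in LL 0 T. acd 0 1 (P t) (R t)"
 using L2H2_representative[OF fin] by blast
 obtain V where V: "sqQ T V" "AE p in leb (QT T). cp v p = cp V p" "AE x in LI. acd 0 T (%t. u t x) (%t. V t x)"
 using has_time_deriv_acd[OF v(1) T] by blast
 have UV: "AE x in LI. acd 0 T (%t. U t x) (%t. V t x)" using V(3) AE_QT_slices(2)[OF U(4)] by eventually_elim (rule acd_AE_cong)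
 have i: "AE x in LI. AE t in LL 0 T. U t x = u0 x + prim 0 (%s. V s x) t"
 by (rule strong_initial_value[OF T U(1) V(1) AE_QT_slices(1)[OF U(4)] UV u0 iv])
 have uP: "AE t in LL 0 T. acd 0 1 (u t) (P t)"
 using U(5) AE_QT_slices(1)[OF U(4)]
 proof eventually_elim
 case (elim t)
 have "AE x in LI. U t x = u t x" using elim(2) by eventually_elim simp
 thus ?case by (rule acd_AE_cong[OF elim(1)])
 qed
 have h: "AE t in LL 0 T. h10 (%x. U t x - lin (g0 t) (g1 t) x) (%x. P t x - (g1 t - g0 t))"
 using uP tr slices(1)[OF U(2)] AE_QT_slices(1)[OF U(4)]
 proof eventually_elim
 case (elim t)
 have "AE x in LI. u t x - lin (g0 t) (g1 t) x = U t x - lin (g0 t) (g1 t) x" using elim(5) by eventually_elim simp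
 thus ?case by (rule h10_AE_cong[OF h10_if_traces[OF elim(1,4,2,3)]])
 qed
 have e: "AE t in LL 0 T. AE x in LI. V t x = ax t x *R P t x + A t x *R R t x - bt t x *R P t x - q x *R U t x + F t x"
 using v(2) uP U(6) ax aA bbt fF AE_QT_slices(1)[OF U(4)] AE_QT_slices(1)[OF V(2)]
 proof eventually_elim
 case (elim t)
 obtain z where z: "has_weak_deriv unit_iv 1 (%x. complex_of_real (a t x) * wd (u t) x) z"
 "AE x in LI. v t x - z x + complex_of_real (b t x) * wd (u t) x + complex_of_real (q x) * u t x = f t x" using elim(1) by blast
 note wP = acd_weak_deriv(1)[OF elim(2) zero_less_one]
 have "AE x in LI. A t x *R P t x = complex_of_real (a t x) * wd (u t) x"
 using wP elim(5) by eventually_elim (simp add: scaleR_conv_of_real)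
 from acd_imp_has_weak_deriv[OF acd_AE_cong[OF acd_product[OF bounded_bilinear_scaleR elim(4,3)] this] zero_less_one]
 have "AE x in LI. z x = ax t x *R P t x + A t x *R R t x" using has_weak_deriv_unique[OF z(1) _ zero_less_one] by blast
 thus ?case using z(2) wP elim(6-9)
 by eventually_elim (simp add: scaleR_conv_of_real algebra_simps)
 qed
 show ?thesis
 by (rule exI[of _ U], rule exI[of _ V], rule exI[of _ P], rule exI[of _ R]) (intro conjI U V i h e)
qed

text \<open>For fixed \<open>ph\<close> the pairing with \<open>u\<close> is absolutely continuous,
  with derivative given by the equation, and its initial value is known through the continuous
  representative \<open>Uh\<close>. The integrated equation therefore holds for \<open>Uh\<close> at
  every time. Replacing \<open>Uh\<close> by \<open>U\<close> costs one null set of times, the same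
  for all \<open>ph\<close>.\<close>

lemma weak_solution_facts:
 assumes S: "weak_solution T a b q f u0 g0 g1 u" and u0: "sqi LI u0"
 shows "EX U P. sqQ T U & sqQ T P &
 (AE p in leb (QT T). cp u p = cp U p) & (AE t in LL 0 T. acd 0 1 (U t) (P t)) &
 (AE t in LL 0 T. h10 (%x. U t x - lin (g0 t) (g1 t) x) (%x. P t x - (g1 t - g0 t))) &
 (AE t in LL 0 T. ALL ph ph'. h10 ph ph' --> (LINT x|LI. (U t x - u0 x) *I ph x) =
 - (LINT x|LI. prim 0 (%s. A s x *R P s x) t *I ph' x) + (LINT x|LI. prim 0 (%s. F s x - bt s x *R P s x - q x *R U s x) t *I ph x))"
proof -
 have fin: "L2_bochner_norm T (H_norm 1 unit_iv) u < \<infinity>" and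
 fin0: "L2_bochner_norm T H10_norm (%t x. u t x - lin (g0 t) (g1 t) x) < \<infinity>" and iv: "has_initial_value T u u0"
 using S by (simp_all only: weak_solution_def lin_def)
 obtain xi where xi: "has_time_deriv_Hm1 T u xi" "!!ph. H10_norm ph < \<infinity> ==> AE t in LL 0 T.
 xi t ph + (LINT x|LI. complex_of_real (a t x) * wd (u t) x * cnj (wd ph x))
 + (LINT x|LI. complex_of_real (b t x) * wd (u t) x * cnj (ph x))
 + (LINT x|LI. complex_of_real (q x) * u t x * cnj (ph x)) = (LINT x|LI. f t x * cnj (ph x))"
 using S unfolding weak_solution_def by blast
 obtain U P where U: "sqQ T U" "sqQ T P"
 "AE p in leb (QT T). cp u p = cp U p" "AE t in LL 0 T. acd 0 1 (U t) (P t)"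
 using L2H1_representative[OF fin] by blast
 note uU = AE_QT_slices(1)[OF U(3)]
 have uP: "AE t in LL 0 T. acd 0 1 (u t) (P t)"
 using U(4) uU
 proof eventually_elim
 case (elim t)
 have "AE x in LI. U t x = u t x" using elim(2) by eventually_elim simp
 thus ?case by (rule acd_AE_cong[OF elim(1)])
 qed
 have h: "AE t in LL 0 T. h10 (%x. U t x - lin (g0 t) (g1 t) x) (%x. P t x - (g1 t - g0 t))"
 using uP slices(1)[OF U(2)] uU L2_time_norm_finite(1)[OF bochner_fin(2)[OF fin0]]
 proof eventually_elim
 case (elim t)
 obtain g where g: "h10 (%x. u t x - lin (g0 t) (g1 t) x) g" using H10_norm_imp_h10[OF elim(4)] by blast
 have "AE x in LI. g x = P t x - (g1 t - g0 t)" by (rule acd_unique[OF h10_acd[OF g] acd_diff[OF elim(1) acd_lin] zero_less_one])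
 from h10_AE_cong_deriv[OF g this sqi_meas[OF sqi_diff[OF elim(2) finite_measure.sqi_const[OF fin_LL]]]]
 have "h10 (%x. u t x - lin (g0 t) (g1 t) x) (%x. P t x - (g1 t - g0 t))" .
 moreover have "AE x in LI. u t x - lin (g0 t) (g1 t) x = U t x - lin (g0 t) (g1 t) x" using elim(3) by eventually_elim simp
 ultimately show ?case by (rule h10_AE_cong)
 qed
 define AP where "AP t x = A t x *R P t x" for t x
 define H where "H t x = F t x - bt t x *R P t x - q x *R U t x" for t x
 have sAP: "sqQ T AP" using sqi_coefficients(1)[OF U(2)] by (simp add: AP_def[abs_def])
 have sH: "sqQ T H"
 using sqi_diff[OF sqi_diff[OF F sqi_coefficients(2)[OF U(2)]] sqi_coefficients(3)[OF U(1)]] by (simp add: H_def[abs_def] split_def)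
 obtain Uh where Uh: "ALL t:{0..T}. L2_norm unit_iv (Uh t) < \<infinity>"
 "ALL s:{0..T}. ((%t. L2_norm unit_iv (%x. Uh t x - Uh s x)) \<longlongrightarrow> 0) (at s within {0..T})"
 "AE t in LL 0 T. AE x in LI. Uh t x = u t x" "AE x in LI. Uh 0 x = u0 x"
 using iv unfolding has_initial_value_def by blast
 have eq: "AE t in LL 0 T. AE x in LI. Uh t x = U t x"
 using Uh(3) uU
 proof eventually_elim
 case (elim t) show ?case using elim by eventually_elim simp
 qed
 have T0: "0 <= T" "T <= T" using T by auto
 \<comment> \<open>The sesquilinear pairing of the definition; its real part is the real inner
   product used in the estimates.\<close>
 define pr where "pr z w = z * cnj w" for z w :: complex
 have pr: "bounded_bilinear pr" unfolding pr_def[abs_def]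
 by (rule bounded_bilinear.comp[OF bounded_bilinear_mult bounded_linear_ident bounded_linear_cnj])
 have Re_pr: "Re (LINT x|LI. pr (g x) (ph x)) = (LINT x|LI. g x *I ph x)" if "sqi LI g" "sqi LI ph" for g ph
 unfolding integral_Re[OF sqi_bilin[OF that pr], symmetric] by (simp add: pr_def inner_complex_def)
 have main: "(LINT x|LI. (Uh t x - u0 x) *I ph x) = - (LINT x|LI. prim 0 (%s. AP s x) t *I ph' x) + (LINT x|LI. prim 0 (%s. H s x) t *I ph x)"
 if hp: "h10 ph ph'" and t: "t : {0..T}" for ph ph' :: "real => complex" and t
 proof -
 note s = h10_sqi[OF hp] h10_sqi_deriv[OF hp] and Hf = h10_imp_H10_norm[OF hp]
 define y ka where "y t = (LINT x|LI. pr (U t x) (ph x))" and "ka t = - (LINT x|LI. pr (AP t x) (ph' x)) + (LINT x|LI. pr (H t x) (ph x))" for t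
 have iy: "intg (LL 0 T) y" unfolding y_def[abs_def] by (rule inner_swap(2)[OF pr U(1) s(1) T0])
 have ik: "intg (LL 0 T) ka" unfolding ka_def[abs_def]
 by (rule intg_add[OF integrable_minus[OF inner_swap(2)[OF pr sAP s(2) T0]] inner_swap(2)[OF pr sH s(1) T0]])
 have yu: "AE t in LL 0 T. (LINT x|LI. u t x * cnj (ph x)) = y t"
 using uU slices(1)[OF U(1)]
 proof eventually_elim
 case (elim t)
 show ?case unfolding y_def
 by (rule LL_cong_AE[OF _ bm_intg[OF sqi_bilin[OF elim(2) s(1) pr]]])
 (use elim(1) in eventually_elim, simp add: pr_def)
 qed
 have xika: "AE t in LL 0 T. xi t ph = ka t"
 using xi(2)[OF Hf] uP uU aA bbt fF slices(1)[OF F] sqi_slice_coefficients[OF U(1)] sqi_slice_coefficients[OF U(2)]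
 proof eventually_elim
 case (elim t)
 note wP = acd_weak_deriv(1)[OF elim(2) zero_less_one] and wph = acd_weak_deriv(1)[OF h10_acd[OF hp] zero_less_one]
 note sA = elim(9)[THEN conjunct1] and sb = elim(9)[THEN conjunct2, THEN conjunct1] and sq = elim(8)[THEN conjunct2, THEN conjunct2]
 note i1 = sqi_bilin[OF sA s(2) pr] and i2 = sqi_bilin[OF sb s(1) pr]
 and i3 = sqi_bilin[OF sq s(1) pr] and i4 = sqi_bilin[OF elim(7) s(1) pr]
 have 1: "(LINT x|LI. complex_of_real (a t x) * wd (u t) x * cnj (wd ph x)) = (LINT x|LI. pr (A t x *R P t x) (ph' x))"
 by (rule LL_cong_AE[OF _ bm_intg[OF i1]]) (use wP wph elim(4) in "eventually_elim, simp add: pr_def scaleR_conv_of_real")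
 have 2: "(LINT x|LI. complex_of_real (b t x) * wd (u t) x * cnj (ph x)) = (LINT x|LI. pr (bt t x *R P t x) (ph x))"
 by (rule LL_cong_AE[OF _ bm_intg[OF i2]]) (use wP elim(5) in "eventually_elim, simp add: pr_def scaleR_conv_of_real")
 have 3: "(LINT x|LI. complex_of_real (q x) * u t x * cnj (ph x)) = (LINT x|LI. pr (q x *R U t x) (ph x))"
 by (rule LL_cong_AE[OF _ bm_intg[OF i3]]) (use elim(3) in "eventually_elim, simp add: pr_def scaleR_conv_of_real")
 have 4: "(LINT x|LI. f t x * cnj (ph x)) = (LINT x|LI. pr (F t x) (ph x))"
 by (rule LL_cong_AE[OF _ bm_intg[OF i4]]) (use elim(6) in "eventually_elim, simp add: pr_def")
 have "(LINT x|LI. pr (H t x) (ph x)) = (LINT x|LI. pr (F t x) (ph x) - pr (bt t x *R P t x) (ph x) - pr (q x *R U t x) (ph x))"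
 by (rule int_cong[OF refl]) (simp add: H_def bounded_bilinear.diff_left[OF pr])
 also have "... = (LINT x|LI. pr (F t x) (ph x)) - (LINT x|LI. pr (bt t x *R P t x) (ph x)) - (LINT x|LI. pr (q x *R U t x) (ph x))"
 unfolding int_diff[OF intg_diff[OF i4 i2] i3] int_diff[OF i4 i2] ..
 finally have 5: "(LINT x|LI. pr (H t x) (ph x)) = (LINT x|LI. pr (F t x) (ph x)) - (LINT x|LI. pr (bt t x *R P t x) (ph x)) - (LINT x|LI. pr (q x *R U t x) (ph x))" .
 have alg: "X = - I1 + (I4 - I2 - I3)" if "X + I1 + I2 + I3 = I4" for X I1 I2 I3 I4 :: complex
 unfolding that[symmetric] by simp
 show ?case unfolding ka_def 5 AP_def by (rule alg) (use elim(1) in "simp only: 1 2 3 4")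
 qed
 have "acd 0 T y ka"
 proof (rule weak_derivative_imp_acd_1[OF T iy ik])
 fix th :: "real => real" assume th: "test_fun {0<..<T} th"
 note st = sqi_test_deriv[OF th] sqi_test_fun[OF th]
 have "(LINT t|LL 0 T. deriv th t *R (LINT x|LI. u t x * cnj (ph x))) = - (LINT t|LL 0 T. th t *R xi t ph)"
 using xi(1) th Hf unfolding has_time_deriv_Hm1_def by blast
 moreover have "(LINT t|LL 0 T. deriv th t *R (LINT x|LI. u t x * cnj (ph x))) = (LINT t|LL 0 T. D1 th t *R y t)"
 unfolding deriv_eq_frechet_derivative[OF th]
 by (rule LL_cong_AE[OF _ bm_scal[OF sqi_meas[OF st(1)] bm_intg[OF iy]]]) (use yu in "eventually_elim, simp")
 moreover have "(LINT t|LL 0 T. th t *R xi t ph) = (LINT t|LL 0 T. th t *R ka t)"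
 by (rule LL_cong_AE[OF _ bm_scal[OF sqi_meas[OF st(2)] bm_intg[OF ik]]]) (use xika in "eventually_elim, simp")
 ultimately show "(LINT t|LL 0 T. D1 th t *R y t) = - (LINT t|LL 0 T. th t *R ka t)" by (simp only:)
 qed
 from acd_bounded_linear[OF bounded_linear_Re this] have "acd 0 T (%t. Re (y t)) (%t. Re (ka t))" .
 moreover have "AE t in LL 0 T. Re (y t) = (LINT x|LI. U t x *I ph x)"
 using slices(1)[OF U(1)] by eventually_elim (simp only: y_def Re_pr s)
 ultimately have a1: "acd 0 T (%t. LINT x|LI. U t x *I ph x) (%t. Re (ka t))" by (rule acd_AE_cong)
 define k1 k2 where "k1 t = (LINT x|LI. AP t x *I ph' x)" and "k2 t = (LINT x|LI. H t x *I ph x)" for t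
 note sw1 = inner_swap[OF bb_inner sAP s(2), folded k1_def] and sw2 = inner_swap[OF bb_inner sH s(1), folded k2_def]
 have "AE t in LL 0 T. Re (ka t) = k2 t - k1 t"
 using slices(1)[OF sAP] slices(1)[OF sH] by eventually_elim (simp only: ka_def plus_complex.sel uminus_complex.sel Re_pr s k1_def k2_def)
 from acd_AE_cong_deriv[OF a1 this] have a2: "acd 0 T (%t. LINT x|LI. U t x *I ph x) (%t. k2 t - k1 t)"
 using bm_diff[OF bm_intg[OF sw2(2)[OF T0]] bm_intg[OF sw1(2)[OF T0]]] by blast
 have tt: "0 <= t" "t <= T" using t by auto
 show ?thesis
 unfolding initial_value_pairing[OF T U(1) Uh(1,2) eq Uh(4) u0 s(1) a2 t] sw1(1)[OF tt] sw2(1)[OF tt]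
 prim_subtract[OF sw2(2)[OF T0] sw1(2)[OF T0] tt(2)] by simp
 qed
 have "AE t in LL 0 T. ALL ph ph'. h10 ph ph' --> (LINT x|LI. (U t x - u0 x) *I ph x) =
 - (LINT x|LI. prim 0 (%s. AP s x) t *I ph' x) + (LINT x|LI. prim 0 (%s. H s x) t *I ph x)"
 using eq slices(1)[OF U(1)] AE_space
 proof eventually_elim
 case (elim t)
 show ?case
 proof (intro allI impI)
 fix ph ph' :: "real => complex" assume hp: "h10 ph ph'"
 have "(LINT x|LI. (Uh t x - u0 x) *I ph x) = (LINT x|LI. (U t x - u0 x) *I ph x)"
 by (rule LL_cong_AE[OF _ bm_inner[OF sqi_meas[OF sqi_diff[OF elim(2) u0]] sqi_meas[OF h10_sqi[OF hp]]]])
 (use elim(1) in "eventually_elim, simp")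
 thus "(LINT x|LI. (U t x - u0 x) *I ph x) =
 - (LINT x|LI. prim 0 (%s. AP s x) t *I ph' x) + (LINT x|LI. prim 0 (%s. H s x) t *I ph x)"
 using main[OF hp, of t] elim(3) by simp
 qed
 qed
 note e = this[unfolded AP_def H_def]
 show ?thesis
 by (rule exI[of _ U], rule exI[of _ P]) (intro conjI U h e)
qed

end

section \<open>Perturbed problems\<close>

lemma n2_QM_time:
 assumes "sqi (LL 0 T) f"
 shows "nQ T (%t x. f t) = n2 (LL 0 T) f"
 unfolding slices(5)[OF sqi_QM_time[OF assms]] n2_const_LL by (simp add: n2_def)

lemma lin_bound: "x : {0<..<1} ==> norm (lin A B x) <= norm A + norm B"
proof -
 assume x: "x : {0<..<1}"
 have "norm (lin A B x) <= \<bar>1 - x\<bar> * norm A + \<bar>x\<bar> * norm B"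
 unfolding lin_def by (rule order_trans[OF norm_triangle_ineq]) (simp only: norm_mult norm_of_real order_refl)
 also have "... <= 1 * norm A + 1 * norm B" by (intro add_mono mult_r_mono) (use x in auto)
 finally show ?thesis by simp
qed

lemma lin_diff: "lin (A - A') (B - B') x = lin A B x - lin A' B' x"
 by (simp add: lin_def algebra_simps)

lemma sqi_lin:
 assumes "sqi (LL 0 T) f" "sqi (LL 0 T) g"
 shows "sqQ T (%t x. lin (f t) (g t) x)"
 and "nQ T (%t x. lin (f t) (g t) x) <= 4 * (n2 (LL 0 T) f + n2 (LL 0 T) g)"
proof -
 note m = sqi_meas[OF sqi_QM_time[OF assms(1)]] sqi_meas[OF sqi_QM_time[OF assms(2)]]
 have x: "(%p. complex_of_real (1 - snd p)) : bmQ T" "(%p. complex_of_real (snd p)) : bmQ T"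
 by (intro borel_bmQ bm_cont continuous_intros)+
 have b: "cp (%t x. lin (f t) (g t) x) : bmQ T"
 using borel_measurable_add[OF borel_measurable_times[OF x(1) m(1)] borel_measurable_times[OF x(2) m(2)]] by (simp add: lin_def split_def)
 have le: "AE t in LL 0 T. AE x in LI. norm (lin (f t) (g t) x) <= (\<Sum>(c, h)\<leftarrow>[(1, %t x. f t), (1, %t x. g t)]. c * norm (h t x))"
 proof (rule AE_I2)
 fix t show "AE x in LI. norm (lin (f t) (g t) x) <= (\<Sum>(c, h)\<leftarrow>[(1, %t x. f t), (1, %t x. g t)]. c * norm (h t x))"
 using AE_space by eventually_elim (use lin_bound in simp)
 qed
 have sq: "sqQ T h" if "(c, h) : set [(1, %t x. f t), (1, %t x. g t)]" for c :: real and h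
 using that sqi_QM_time[OF assms(1)] sqi_QM_time[OF assms(2)] by auto
 note B = AE_QM_bound[where fs = "[(1, %t x. f t), (1, %t x. g t)]", OF sq b le]
 show "sqQ T (%t x. lin (f t) (g t) x)" by (rule B(1))
 show "nQ T (%t x. lin (f t) (g t) x) <= 4 * (n2 (LL 0 T) f + n2 (LL 0 T) g)"
 using B(2) n2_QM_time[OF assms(1)] n2_QM_time[OF assms(2)] by simp
qed

lemma cont_rep_diff:
 assumes "acd l r f f'" "acd l r g g'" "l < r" "x : {l..r}"
 shows "cont_rep l r (%x. f x - g x) x = cont_rep l r f x - cont_rep l r g x"
proof -
 obtain c where f: "intg (LL l r) f'" "AE x in LL l r. f x = c + prim l f' x" using assms by (auto simp: acd_def)
 obtain d where g: "intg (LL l r) g'" "AE x in LL l r. g x = d + prim l g' x" using assms by (auto simp: acd_def)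
 have "AE x in LL l r. f x - g x = (c - d) + prim l (%x. f' x - g' x) x"
 using f(2) g(2) AE_space by eventually_elim (simp add: prim_subtract[OF f(1) g(1)])
 from cont_rep_acd[OF intg_diff[OF f(1) g(1)] this assms(3,4)] cont_rep_acd[OF f assms(3,4)] cont_rep_acd[OF g assms(3,4)]
 show ?thesis using prim_subtract[OF f(1) g(1), of x] assms(4) by simp
qed

text \<open>Integration by parts in \<open>V = W + (V - W)\<close>, where \<open>W\<close> is the
  derivative of the flux \<open>Q\<close>. The flux need not be that of the equation solved: the
  residual \<open>V - W\<close> takes the place of the source, so the unperturbed solution can be
  compared within the perturbed equation.\<close>

lemma strong_imp_weak:
 fixes V Q W :: "real => real => 'b::euclidean_space"
 assumes V: "sqQ T V" and Q: "sqQ T Q" and W: "sqQ T W"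
 and ac: "AE t in LL 0 T. acd 0 1 (Q t) (W t)" and hp: "h10 ph ph'" and t: "0 <= t" "t <= T"
 shows "(LINT x|LI. prim 0 (%s. V s x) t *I ph x) =
 - (LINT x|LI. prim 0 (%s. Q s x) t *I ph' x) + (LINT x|LI. prim 0 (%s. V s x - W s x) t *I ph x)"
proof -
 note s = h10_sqi[OF hp] h10_sqi_deriv[OF hp]
 have VW: "sqQ T (%s x. V s x - W s x)" using sqi_diff[OF V W] by (simp add: split_def)
 define i1 i2 i3 where "i1 s = (LINT x|LI. V s x *I ph x)" and "i2 s = (LINT x|LI. Q s x *I ph' x)" and "i3 s = (LINT x|LI. (V s x - W s x) *I ph x)" for s
 note sw = inner_swap(1)[OF bb_inner V s(1) t, folded i1_def] inner_swap(1)[OF bb_inner Q s(2) t, folded i2_def] inner_swap(1)[OF bb_inner VW s(1) t, folded i3_def]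
 have T0: "0 <= T" using t by simp
 have i: "intg (LL 0 T) i1" "intg (LL 0 T) i2" "intg (LL 0 T) i3"
 unfolding i1_def[abs_def] i2_def[abs_def] i3_def[abs_def]
 by (rule inner_swap(2)[OF bb_inner V s(1) T0 order_refl], rule inner_swap(2)[OF bb_inner Q s(2) T0 order_refl],
 rule inner_swap(2)[OF bb_inner VW s(1) T0 order_refl])
 have "prim 0 i1 t = prim 0 (%s. i3 s - i2 s) t"
 proof (rule prim_cong_AE[OF _ _ _ t(2)])
 show "AE s in LL 0 T. i1 s = i3 s - i2 s"
 using ac slices(1)[OF V] slices(1)[OF W]
 proof eventually_elim
 case (elim r)
 have "i3 r = i1 r - (LINT x|LI. W r x *I ph x)"
 unfolding i3_def i1_def inner_diff_left by (rule int_diff[OF sqi_inner[OF elim(2) s(1)] sqi_inner[OF elim(3) s(1)]])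
 moreover have "i2 r = - (LINT x|LI. W r x *I ph x)"
 using h10_parts[OF bb_inner hp elim(1)] unfolding i2_def by (simp only: inner_commute)
 ultimately show ?case by linarith
 qed
 show "i1 : bm (LL 0 T)" "(%s. i3 s - i2 s) : bm (LL 0 T)"
 by (rule bm_intg[OF i(1)], rule bm_diff[OF bm_intg[OF i(3)] bm_intg[OF i(2)]])
 qed
 thus ?thesis unfolding sw prim_subtract[OF i(3,2) t(2)] by simp
qed

lemma sqi_add2: "sqQ T f ==> sqQ T g ==> sqQ T (%t x. f t x + g t x)"
 and sqi_diff2: "sqQ T f ==> sqQ T g ==> sqQ T (%t x. f t x - g t x)"
 using sqi_add[of "QM T" "cp f" "cp g"] sqi_diff[of "QM T" "cp f" "cp g"] by (simp_all add: split_def)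

lemma AE_time_iff_space:
 fixes f g :: "real => real => 'b::euclidean_space"
 assumes "cp f : bmQ T" "cp g : bmQ T"
 shows "(AE t in LL 0 T. AE x in LI. f t x = g t x) \<longleftrightarrow> (AE x in LI. AE t in LL 0 T. f t x = g t x)"
 using AE_QM_swap[OF pred_eq_if_measurable[OF assms]] by simp

lemma parabolic_const_nonneg:
 assumes "0 < T" "0 < al" "0 <= A" "0 <= L" "0 <= B"
 shows "0 <= parabolic_const T al A L B"
 unfolding parabolic_const_def Let_def
 using assms by (intro add_nonneg_nonneg mult_nonneg_nonneg divide_nonneg_pos zero_le_power2 zero_le_numeral zero_le_one exp_ge_zero) auto

lemma norm_sum9_le:
 fixes x1 :: "'a::real_normed_vector"
 shows "norm (x1 - x2 + x3 + x4 + x5 - x6 - x7 - x8 - x9) <= norm x1 + norm x2 + norm x3 + norm x4 + norm x5 + norm x6 + norm x7 + norm x8 + norm x9"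
 using norm_triangle_ineq4[of "x1 - x2 + x3 + x4 + x5 - x6 - x7 - x8" x9] norm_triangle_ineq4[of "x1 - x2 + x3 + x4 + x5 - x6 - x7" x8]
 norm_triangle_ineq4[of "x1 - x2 + x3 + x4 + x5 - x6" x7] norm_triangle_ineq4[of "x1 - x2 + x3 + x4 + x5" x6]
 norm_triangle_ineq[of "x1 - x2 + x3 + x4" x5] norm_triangle_ineq[of "x1 - x2 + x3" x4] norm_triangle_ineq[of "x1 - x2" x3] norm_triangle_ineq4[of x1 x2]
 by linarith

text \<open>Inside the root, 4 comes from the initial value \<open>p0\<close>, the term with 128
  from the data \<open>RR\<close>, the factor 2 and the summand 48 from adding the three lifting
  terms back. The outer factor 2 accounts for the two parts of the sum norm.\<close>

definition perturbation_const :: "real => real => real => real => real" where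
 "perturbation_const T al M X = 2 * sqrt (2 * (parabolic_const T al M M M * (4 + 128 * (9 + 40 * M^2 + X))) + 48)"

text \<open>Primes mark the perturbed problem. \<open>U\<close>, \<open>V\<close>, \<open>P\<close>,
  \<open>R\<close> represent the unperturbed solution with its time derivative and first two spatial
  derivatives. The number \<open>S\<close> bounds all differences of coefficients and data
  simultaneously; \<open>al\<close> and \<open>M\<close> bound the perturbed coefficients
  only.\<close>

locale perturbation =
 c: coefficients T N a b A bt q f F + c': coefficients T N' a' b' A' bt' q' f' F'
 for T N N' :: real and a b A bt a' b' A' bt' :: "real => real => real" and q q' :: "real => real" and f F f' F' :: "real => real => complex" +
 fixes al M S :: real and ax at' ax' :: "real => real => real" and u u' U V P R U' P' :: "real => real => complex"
 and u0 u0' k g0 g1 g0' g1' et0 et1 :: "real => complex"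
 assumes al: "0 < al" and M: "0 <= M" and S: "0 <= S"
 and borel: "cp ax : bm borel" "cp ax' : bm borel" "!!t x. \<bar>ax' t x\<bar> <= N'"
 and acd_time: "AE x in LI. acd 0 T (%t. A' t x) (%t. at' t x)" and acd_space: "AE t in LL 0 T. acd 0 1 (A' t) (ax' t)"
 and bounds: "AE t in LL 0 T. AE x in LI. al <= A' t x & A' t x <= M & \<bar>at' t x\<bar> <= M & \<bar>ax' t x\<bar> <= M"
 "AE x in LI. AE t in LL 0 T. al <= A' t x & A' t x <= M & \<bar>at' t x\<bar> <= M & \<bar>ax' t x\<bar> <= M"
 "AE t in LL 0 T. AE x in LI. \<bar>bt' t x\<bar> <= M & \<bar>q' x\<bar> <= M"
 and small: "AE t in LL 0 T. AE x in LI. \<bar>A' t x - A t x\<bar> <= S & \<bar>ax' t x - ax t x\<bar> <= S & \<bar>bt' t x - bt t x\<bar> <= S & \<bar>q' x - q x\<bar> <= S"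
 and u0: "sqi LI u0" "sqi LI u0'"
 and U: "sqQ T U" and V: "sqQ T V" and P: "sqQ T P" and R: "sqQ T R"
 and uU: "AE p in leb (QT T). cp u p = cp U p" and um: "cp u : bm (leb (QT T))"
 and UV: "AE x in LI. AE t in LL 0 T. U t x = u0 x + prim 0 (%s. V s x) t"
 and UP: "AE t in LL 0 T. acd 0 1 (U t) (P t)" and PR: "AE t in LL 0 T. acd 0 1 (P t) (R t)"
 and Uh: "AE t in LL 0 T. h10 (%x. U t x - lin (g0 t) (g1 t) x) (%x. P t x - (g1 t - g0 t))"
 and Veq: "AE t in LL 0 T. AE x in LI. V t x = ax t x *R P t x + A t x *R R t x - bt t x *R P t x - q x *R U t x + F t x"
 and U': "sqQ T U'" and P': "sqQ T P'"
 and uU': "AE p in leb (QT T). cp u' p = cp U' p" and um': "cp u' : bm (leb (QT T))"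
 and Uh': "AE t in LL 0 T. h10 (%x. U' t x - lin (g0' t) (g1' t) x) (%x. P' t x - (g1' t - g0' t))"
 and weak: "AE t in LL 0 T. ALL ph ph'. h10 ph ph' --> (LINT x|LI. (U' t x - u0' x) *I ph x) =
 - (LINT x|LI. prim 0 (%s. A' s x *R P' s x) t *I ph' x) + (LINT x|LI. prim 0 (%s. F' s x - bt' s x *R P' s x - q' x *R U' s x) t *I ph x)"
 and k: "acd 0 1 (%x. u0' x - u0 x) k" "sqi LI k"
 and et0: "acd 0 T (%t. g0' t - g0 t) et0" "sqi (LL 0 T) (%t. g0' t - g0 t)" "sqi (LL 0 T) et0"
 and et1: "acd 0 T (%t. g1' t - g1 t) et1" "sqi (LL 0 T) (%t. g1' t - g1 t)" "sqi (LL 0 T) et1"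
 and compat: "cont_rep 0 1 (%x. u0' x - u0 x) 0 = cont_rep 0 T (%t. g0' t - g0 t) 0"
 "cont_rep 0 1 (%x. u0' x - u0 x) 1 = cont_rep 0 T (%t. g1' t - g1 t) 0"
 and size: "n2 LI k <= S^2" "nQ T (%t x. F' t x - F t x) <= S^2" "n2 (LL 0 T) (%t. g0' t - g0 t) <= S^2"
 "n2 (LL 0 T) et0 <= S^2" "n2 (LL 0 T) (%t. g1' t - g1 t) <= S^2" "n2 (LL 0 T) et1 <= S^2"
begin

definition C0 where "C0 = cont_rep 0 T (%t. g0' t - g0 t) 0"
definition C1 where "C1 = cont_rep 0 T (%t. g1' t - g1 t) 0"
definition Ps where "Ps t x = lin (g0' t - g0 t) (g1' t - g1 t) x"
definition Pst where "Pst t x = lin (et0 t) (et1 t) x"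
definition Psx :: "real => real => complex" where "Psx t x = (g1' t - g1 t) - (g0' t - g0 t)"
text \<open>The unperturbed solution, lifted to the boundary values of the perturbed one;
  \<open>VV\<close> and \<open>PP\<close> are its derivatives. The lifting is affine in
  \<open>x\<close>, so the second spatial derivative remains \<open>R\<close>.\<close>

definition UU where "UU t x = U t x + Ps t x"
definition VV where "VV t x = V t x + Pst t x"
definition PP where "PP t x = P t x + Psx t x"
definition W where "W t x = ax' t x *R PP t x + A' t x *R R t x"
text \<open>Perturbed source and lower-order terms minus the residual of \<open>UU\<close> under the
  perturbed principal part, whose flux derivative is \<open>W\<close>.\<close>

definition G where "G t x = (F' t x - bt' t x *R P' t x - q' x *R U' t x) - (VV t x - W t x)"
definition z where "z t x = U' t x - UU t x"
definition p where "p t x = P' t x - PP t x"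
definition z0 where "z0 x = (u0' x - u0 x) - lin C0 C1 x"
definition p0 where "p0 x = k x - (C1 - C0)"
text \<open>Adding the lower-order terms of \<open>z\<close> back removes \<open>U'\<close> and
  \<open>P'\<close>, so \<open>RR\<close> contains only the data, the lifting and the fixed
  functions \<open>U\<close>, \<open>P\<close>, \<open>R\<close>, \<open>V\<close>.\<close>

definition RR where "RR t x = G t x + bt' t x *R p t x + q' x *R z t x"

lemma sqi_psi:
 "sqQ T Ps" "sqQ T Pst" "sqQ T Psx"
 "nQ T Ps <= 8 * S^2" "nQ T Pst <= 8 * S^2" "nQ T Psx <= 8 * S^2"
proof -
 note L = sqi_lin[OF et0(2) et1(2)] and Lt = sqi_lin[OF et0(3) et1(3)]
 show "sqQ T Ps" "sqQ T Pst"
 using L(1) Lt(1) by (simp_all only: Ps_def[abs_def] Pst_def[abs_def])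
 have "nQ T Ps <= 4 * (n2 (LL 0 T) (%t. g0' t - g0 t) + n2 (LL 0 T) (%t. g1' t - g1 t))"
 using L(2) by (simp only: Ps_def[abs_def])
 thus "nQ T Ps <= 8 * S^2" using size(3-6) by argo
 have "nQ T Pst <= 4 * (n2 (LL 0 T) et0 + n2 (LL 0 T) et1)"
 using Lt(2) by (simp only: Pst_def[abs_def])
 thus "nQ T Pst <= 8 * S^2" using size(3-6) by argo
 have d: "sqi (LL 0 T) (%t. (g1' t - g1 t) - (g0' t - g0 t))" by (rule sqi_diff[OF et1(2) et0(2)])
 show "sqQ T Psx" using sqi_QM_time[OF d] by (simp only: Psx_def[abs_def])
 have "nQ T Psx = n2 (LL 0 T) (%t. (g1' t - g1 t) - (g0' t - g0 t))"
 using n2_QM_time[OF d] by (simp only: Psx_def[abs_def])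
 also have "... <= 2 * n2 (LL 0 T) (%t. g1' t - g1 t) + 2 * n2 (LL 0 T) (%t. g0' t - g0 t)" by (rule n2_diff_le[OF et1(2) et0(2)])
 also have "... <= 8 * S^2" using size zero_le_power2[of S] by (linarith | argo)
 finally show "nQ T Psx <= 8 * S^2" .
qed

lemma sqi_all:
 "sqQ T UU" "sqQ T VV" "sqQ T PP" "sqQ T W"
 "sqQ T G" "sqQ T z" "sqQ T p" "sqQ T RR"
proof -
 show 1: "sqQ T UU" "sqQ T VV" "sqQ T PP"
 unfolding UU_def[abs_def] VV_def[abs_def] PP_def[abs_def] by (intro sqi_add2 U V P sqi_psi)+
 have "sqQ T (%t x. ax' t x *R PP t x)"
 proof (rule sqi_bound(1)[OF 1(3), where B = N'])
 show "cp (%t x. ax' t x *R PP t x) : bmQ T"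
 using bm_scal[OF borel_bmQ[OF borel(2)] sqi_meas[OF 1(3)]] by (simp add: split_def)
 show "AE x in QM T. norm (cp (%t x. ax' t x *R PP t x) x) <= N' * norm (cp PP x)"
 using borel(3) by (intro AE_I2) (auto simp: split_def intro: mult_r_mono)
 qed
 thus 2: "sqQ T W" unfolding W_def[abs_def] by (intro sqi_add2 c'.sqi_coefficients R)
 show 3: "sqQ T G" unfolding G_def[abs_def] by (intro sqi_diff2 c'.sqi_coefficients c'.F P' U' 1 2)
 show 4: "sqQ T z" "sqQ T p"
 unfolding z_def[abs_def] p_def[abs_def] by (intro sqi_diff2 U' P' 1)+
 show "sqQ T RR" unfolding RR_def[abs_def] by (intro sqi_add2 3 c'.sqi_coefficients 4)
qed

lemma UU_VV: "AE x in LI. AE t in LL 0 T. UU t x = (u0 x + lin C0 C1 x) + prim 0 (%s. VV s x) t"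
proof -
 have T: "0 < T" by (rule c.T)
 obtain d0 where d0: "intg (LL 0 T) et0" "AE t in LL 0 T. g0' t - g0 t = d0 + prim 0 et0 t" using et0(1) by (auto simp: acd_def)
 obtain d1 where d1: "intg (LL 0 T) et1" "AE t in LL 0 T. g1' t - g1 t = d1 + prim 0 et1 t" using et1(1) by (auto simp: acd_def)
 have C: "C0 = d0" "C1 = d1"
 using cont_rep_acd[OF d0 T, of 0] cont_rep_acd[OF d1 T, of 0] T by (simp_all add: C0_def C1_def)
 show ?thesis using UV slices(2)[OF V]
 proof eventually_elim
 case (elim x)
 show ?case using elim(1) d0(2) d1(2) AE_space
 proof eventually_elim
 case (elim t)
 hence t: "t <= T" by simp
 have i: "intg (LL 0 T) (%s. complex_of_real (1 - x) * et0 s)" "intg (LL 0 T) (%s. complex_of_real x * et1 s)"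
 "intg (LL 0 T) (%s. V s x)"
 using intg_mult[OF d0(1)] intg_mult[OF d1(1)] sqi_intg[OF \<open>sqi (LL 0 T) (%t. V t x)\<close>] by blast+
 have "prim 0 (%s. VV s x) t = prim 0 (%s. V s x) t + (complex_of_real (1 - x) * prim 0 et0 t + complex_of_real x * prim 0 et1 t)"
 unfolding VV_def Pst_def lin_def prim_add[OF i(3) intg_add[OF i(1,2)] t] prim_add[OF i(1,2) t]
 prim_bounded_linear[OF bounded_linear_mult_right d0(1) t] prim_bounded_linear[OF bounded_linear_mult_right d1(1) t] ..
 thus ?case using elim(1-3) unfolding UU_def Ps_def C by (simp add: lin_def algebra_simps)
 qed
 qed
qed

lemma UU_PP: "AE t in LL 0 T. acd 0 1 (UU t) (PP t)" and PP_R: "AE t in LL 0 T. acd 0 1 (PP t) (R t)"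
proof -
 show "AE t in LL 0 T. acd 0 1 (UU t) (PP t)"
 using UP
 proof eventually_elim
 case (elim t)
 show ?case using acd_add[OF elim acd_lin] unfolding UU_def[abs_def] PP_def[abs_def] Ps_def Psx_def .
 qed
 show "AE t in LL 0 T. acd 0 1 (PP t) (R t)"
 using PR
 proof eventually_elim
 case (elim t)
 show ?case using acd_add[OF elim acd_const] unfolding PP_def[abs_def] Psx_def add_0_right .
 qed
qed

lemma coefficient_locales:
 "AE x in LI. EX c0. lip_coef T al M M c0 (%t. A' t x) (%t. at' t x)"
 "AE t in LL 0 T. EX c0. lip_coef 1 al M M c0 (A' t) (ax' t)"
proof -
 show "AE x in LI. EX c0. lip_coef T al M M c0 (%t. A' t x) (%t. at' t x)"
 using acd_time bounds(2)
 proof eventually_elim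
 case (elim x)
 obtain c0 where c: "intg (LL 0 T) (%t. at' t x)" "AE t in LL 0 T. A' t x = c0 + prim 0 (%t. at' t x) t" using elim(1) unfolding acd_def by blast
 have "lip_coef T al M M c0 (%t. A' t x) (%t. at' t x)"
 by unfold_locales (rule c.T, rule al, rule M, rule c(1), use elim(2) in \<open>eventually_elim, blast\<close>, rule c(2), use elim(2) in "eventually_elim, blast")
 thus ?case by blast
 qed
 show "AE t in LL 0 T. EX c0. lip_coef 1 al M M c0 (A' t) (ax' t)"
 using acd_space bounds(1)
 proof eventually_elim
 case (elim t)
 obtain c0 where c: "intg LI (ax' t)" "AE x in LI. A' t x = c0 + prim 0 (ax' t) x" using elim(1) unfolding acd_def by blast
 have "lip_coef 1 al M M c0 (A' t) (ax' t)"
 by unfold_locales (rule zero_less_one, rule al, rule M, rule c(1), use elim(2) in \<open>eventually_elim, blast\<close>, rule c(2), use elim(2) in "eventually_elim, blast")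
 thus ?case by blast
 qed
qed

text \<open>The weak equation of the perturbed solution minus \<open>strong_imp_weak\<close> for
  \<open>UU\<close> with the perturbed flux \<open>Q\<close>. The equation of the unperturbed
  problem is not inserted here; it enters in the estimate of \<open>RR\<close>.\<close>

lemma weak_z: "AE t in LL 0 T. ALL ph ph'. h10 ph ph' --> (LINT x|LI. (z t x - z0 x) *I ph x) =
 - (LINT x|LI. prim 0 (%s. A' s x *R p s x) t *I ph' x) + (LINT x|LI. prim 0 (%s. G s x) t *I ph x)"
proof -
 define Q where "Q t x = A' t x *R PP t x" for t x
 define Q' where "Q' t x = A' t x *R P' t x" for t x
 define H' where "H' t x = F' t x - bt' t x *R P' t x - q' x *R U' t x" for t x
 have Q: "sqQ T Q" "sqQ T Q'" "sqQ T H'"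
 using c'.sqi_coefficients(1)[OF sqi_all(3)] c'.sqi_coefficients(1)[OF P'] sqi_diff2[OF sqi_diff2[OF c'.F c'.sqi_coefficients(2)[OF P']] c'.sqi_coefficients(3)[OF U']]
 by (simp_all only: Q_def[abs_def] Q'_def[abs_def] H'_def[abs_def])
 have QW: "AE t in LL 0 T. acd 0 1 (Q t) (W t)"
 using acd_space PP_R
 proof eventually_elim
 case (elim t)
 show ?case using acd_product[OF bounded_bilinear_scaleR elim] unfolding Q_def[abs_def] W_def[abs_def] .
 qed
 have pV: "sqi (QM T) (%(t, x). prim 0 (%s. VV s x) t)" using sqi_prim_QM[OF sqi_all(2)] c.T by simp
 have i0: "sqi LI (%x. u0 x + lin C0 C1 x)"
 by (rule sqi_add[OF u0(1) sqi_continuous]) (unfold lin_def, intro continuous_intros)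
 have mR: "cp (%t x. (u0 x + lin C0 C1 x) + prim 0 (%s. VV s x) t) : bmQ T"
 using borel_measurable_add[OF sqi_meas[OF sqi_QM_space[OF i0]] sqi_meas[OF pV]] by (simp add: split_def)
 have UVt: "AE t in LL 0 T. AE x in LI. UU t x = (u0 x + lin C0 C1 x) + prim 0 (%s. VV s x) t"
 using AE_time_iff_space[OF sqi_meas[OF sqi_all(1)] mR] UU_VV by blast
 have VW: "sqQ T (%t x. VV t x - W t x)" by (rule sqi_diff2[OF sqi_all(2,4)])
 show ?thesis
 using weak[folded Q'_def H'_def] UVt slices(1)[OF U'] slices(1)[of T "%t x. prim 0 (%s. VV s x) t", OF pV] AE_space
 proof eventually_elim
 case (elim t)
 hence t: "0 <= t" "t <= T" by auto
 show ?case
 proof (intro allI impI)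
 fix ph ph' :: "real => complex" assume hp: "h10 ph ph'"
 note s = h10_sqi[OF hp] h10_sqi_deriv[OF hp]
 note ii = sqi_inner[OF sqi_diff[OF elim(3) u0(2)] s(1)] and jj = sqi_inner[OF elim(4) s(1)]
 have "(LINT x|LI. (z t x - z0 x) *I ph x) = (LINT x|LI. (U' t x - u0' x) *I ph x - prim 0 (%s. VV s x) t *I ph x)"
 by (rule LL_cong_AE[OF _ bm_diff[OF bm_intg[OF ii] bm_intg[OF jj]]])
 (use elim(2) in "eventually_elim, simp add: z_def z0_def inner_add_left inner_diff_left")
 also have "... = (LINT x|LI. (U' t x - u0' x) *I ph x) - (LINT x|LI. prim 0 (%s. VV s x) t *I ph x)"
 by (rule int_diff[OF ii jj])
 finally have 1: "(LINT x|LI. (z t x - z0 x) *I ph x) = (LINT x|LI. (U' t x - u0' x) *I ph x) - (LINT x|LI. prim 0 (%s. VV s x) t *I ph x)" .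
 have d: "(LINT x|LI. prim 0 (%s. X s x - Y s x) t *I ps x) = (LINT x|LI. prim 0 (%s. X s x) t *I ps x) - (LINT x|LI. prim 0 (%s. Y s x) t *I ps x)"
 if X: "sqQ T X" and Y: "sqQ T Y" and ps: "sqi LI ps" for X Y :: "real => real => complex" and ps
 proof -
 note T0 = less_imp_le[OF c.T] order_refl
 have "prim 0 (%s. LINT x|LI. (X s x - Y s x) *I ps x) t = prim 0 (%s. (LINT x|LI. X s x *I ps x) - (LINT x|LI. Y s x *I ps x)) t"
 proof (rule prim_cong_AE[OF _ _ _ t(2)])
 show "AE s in LL 0 T. (LINT x|LI. (X s x - Y s x) *I ps x) = (LINT x|LI. X s x *I ps x) - (LINT x|LI. Y s x *I ps x)"
 using slices(1)[OF X] slices(1)[OF Y]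
 proof eventually_elim
 case (elim s)
 show ?case unfolding inner_diff_left by (rule int_diff[OF sqi_inner[OF elim(1) ps] sqi_inner[OF elim(2) ps]])
 qed
 qed (rule bm_intg[OF inner_swap(2)[OF bb_inner sqi_diff2[OF X Y] ps T0]],
 rule bm_diff[OF bm_intg[OF inner_swap(2)[OF bb_inner X ps T0]] bm_intg[OF inner_swap(2)[OF bb_inner Y ps T0]]])
 thus ?thesis
 unfolding inner_swap(1)[OF bb_inner sqi_diff2[OF X Y] ps t] inner_swap(1)[OF bb_inner X ps t] inner_swap(1)[OF bb_inner Y ps t]
 prim_subtract[OF inner_swap(2)[OF bb_inner X ps T0] inner_swap(2)[OF bb_inner Y ps T0] t(2)] .
 qed
 have pQ: "A' s x *R p s x = Q' s x - Q s x" for s x by (simp add: p_def Q_def Q'_def scaleR_diff_right)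
 have gH: "G s x = H' s x - (VV s x - W s x)" for s x by (simp add: G_def H'_def)
 show "(LINT x|LI. (z t x - z0 x) *I ph x) =
 - (LINT x|LI. prim 0 (%s. A' s x *R p s x) t *I ph' x) + (LINT x|LI. prim 0 (%s. G s x) t *I ph x)"
 unfolding 1 pQ gH d[OF Q(2,1) s(2)] d[OF Q(3) VW s(1)] elim(1)[rule_format, OF hp] strong_imp_weak[OF sqi_all(2) Q(1) sqi_all(4) QW hp t]
 by simp
 qed
 qed
qed

text \<open>By compatibility of both problems, the traces of \<open>u0' - u0\<close> are the initial
  values \<open>C0\<close>, \<open>C1\<close> of the boundary differences, so subtracting the
  lifting leaves a function in \<open>H_0^1\<close>. The number \<open>C1 - C0\<close> is the mean
  of \<open>k\<close>, which is bounded by the norm of \<open>k\<close>.\<close>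

lemma h10_z0: "h10 z0 p0" and n2_p0: "n2 LI p0 <= 4 * S^2"
proof -
 note tr = compat[folded C0_def C1_def]
 show "h10 z0 p0" using h10_if_traces[OF k tr] unfolding z0_def[abs_def] p0_def[abs_def] .
 obtain c where c: "intg LI k" "AE x in LI. u0' x - u0 x = c + prim 0 k x" using k(1) by (auto simp: acd_def)
 have "C1 - C0 = prim 0 k 1"
 using cont_rep_acd[OF c zero_less_one, of 0] cont_rep_acd[OF c zero_less_one, of 1] tr by simp
 hence "norm (C1 - C0) <= sqrt (n2 LI k)" using norm_prim_le_n2[OF k(2), of 1] by simp
 hence "(norm (C1 - C0))^2 <= (sqrt (n2 LI k))^2" by (rule power_mono) simp
 hence "n2 LI (%x. C1 - C0) <= n2 LI k" unfolding n2_const_LL by simp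
 moreover have "n2 LI p0 <= 2 * n2 LI k + 2 * n2 LI (%x. C1 - C0)"
 unfolding p0_def[abs_def] by (rule n2_diff_le[OF k(2) finite_measure.sqi_const[OF fin_LL]])
 ultimately show "n2 LI p0 <= 4 * S^2" using size(1) by (linarith | argo)
qed

lemma h10_z: "AE t in LL 0 T. h10 (z t) (p t)"
 using Uh' Uh
proof eventually_elim
 case (elim t)
 have "(%x. (U' t x - lin (g0' t) (g1' t) x) - (U t x - lin (g0 t) (g1 t) x)) = z t"
 by (rule ext) (simp add: z_def UU_def Ps_def lin_diff)
 moreover have "(%x. (P' t x - (g1' t - g0' t)) - (P t x - (g1 t - g0 t))) = p t"
 by (rule ext) (simp add: p_def PP_def Psx_def)
 ultimately show ?case using h10_diff[OF elim] by (simp only:)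
qed

text \<open>Once the unperturbed equation is substituted for \<open>V\<close>, every remaining term
  contains either a difference of coefficients or data, or the lifting. All of them are small with
  \<open>S\<close>, while \<open>P\<close>, \<open>R\<close> and \<open>U\<close> stay
  fixed.\<close>

lemma n2_RR: "nQ T RR <= 128 * (9 + 40 * M^2 + (4 * nQ T P + nQ T R + nQ T U)) * S^2"
proof -
 define dF where "dF t x = F' t x - F t x" for t x
 have dF: "sqQ T dF" "nQ T dF <= S^2"
 using sqi_diff2[OF c'.F c.F] size(2) by (simp_all only: dF_def[abs_def])
 \<comment> \<open>\<open>P\<close> is multiplied by the differences of \<open>ax\<close> and of
   \<open>bt\<close>, and \<open>Psx\<close> by \<open>ax'\<close> and \<open>bt'\<close>; hence the
   two factors 2. The seven entries give the factor \<open>2 ^ 7 = 128\<close>.\<close>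
 define L where "L = [(1, dF), (1, Pst), (2 * S, P), (2 * M, Psx), (S, R), (S, U), (M, Ps)]"
 have "nQ T RR <= 2 ^ length L * (\<Sum>(c, f)\<leftarrow>L. c^2 * nQ T f)"
 proof (rule AE_QM_bound(2)[OF _ sqi_meas[OF sqi_all(8)]])
 show "sqQ T f" if "(c, f) : set L" for c f
 using that dF(1) sqi_psi P R U by (auto simp: L_def)
 show "AE t in LL 0 T. AE x in LI. norm (RR t x) <= (\<Sum>(c, f)\<leftarrow>L. c * norm (f t x))"
 using Veq small bounds(1,3)
 proof eventually_elim
 case (elim t)
 thus ?case
 proof eventually_elim
 case (elim x)
 have "RR t x = dF t x - Pst t x + (ax' t x - ax t x) *R P t x + ax' t x *R Psx t x + (A' t x - A t x) *R R t x
 - (bt' t x - bt t x) *R P t x - bt' t x *R Psx t x - (q' x - q x) *R U t x - q' x *R Ps t x"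
 unfolding RR_def G_def VV_def W_def p_def z_def PP_def UU_def elim(1) dF_def by (simp add: algebra_simps)
 hence "norm (RR t x) <= norm (dF t x) + norm (Pst t x) + \<bar>ax' t x - ax t x\<bar> * norm (P t x) + \<bar>ax' t x\<bar> * norm (Psx t x) + \<bar>A' t x - A t x\<bar> * norm (R t x)
 + \<bar>bt' t x - bt t x\<bar> * norm (P t x) + \<bar>bt' t x\<bar> * norm (Psx t x) + \<bar>q' x - q x\<bar> * norm (U t x) + \<bar>q' x\<bar> * norm (Ps t x)"
 using norm_sum9_le[of "dF t x" "Pst t x" "(ax' t x - ax t x) *R P t x" "ax' t x *R Psx t x" "(A' t x - A t x) *R R t x"
 "(bt' t x - bt t x) *R P t x" "bt' t x *R Psx t x" "(q' x - q x) *R U t x" "q' x *R Ps t x"] by (simp only: norm_scaleR)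
 also have "... <= norm (dF t x) + norm (Pst t x) + S * norm (P t x) + M * norm (Psx t x) + S * norm (R t x)
 + S * norm (P t x) + M * norm (Psx t x) + S * norm (U t x) + M * norm (Ps t x)"
 using elim by (intro add_mono mult_r_mono order_refl norm_ge_zero) auto
 also have "... = (\<Sum>(c, f)\<leftarrow>L. c * norm (f t x))" by (simp add: L_def algebra_simps)
 finally show ?case .
 qed
 qed
 qed
 also have "... = 128 * (nQ T dF + nQ T Pst + (2 * S)^2 * nQ T P + (2 * M)^2 * nQ T Psx
 + S^2 * nQ T R + S^2 * nQ T U + M^2 * nQ T Ps)"
 by (simp add: L_def add.assoc)
 also have "... <= 128 * (S^2 + 8 * S^2 + (2 * S)^2 * nQ T P + (2 * M)^2 * (8 * S^2)
 + S^2 * nQ T R + S^2 * nQ T U + M^2 * (8 * S^2))"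
 by (intro mult_left_mono add_mono order_refl dF sqi_psi) auto
 \<comment> \<open>Here \<open>9 = 1 + 8\<close> comes from the source and the time derivative of
   the lifting, and \<open>40 = 4 * 8 + 8\<close> from the lifting and its spatial
   derivative.\<close>
 also have "... = 128 * (9 + 40 * M^2 + (4 * nQ T P + nQ T R + nQ T U)) * S^2"
 by (simp add: power_mult_distrib algebra_simps)
 finally show ?thesis .
qed

text \<open>The difference of the solutions is \<open>z\<close> plus the lifting, so its norms are
  those of \<open>z\<close> up to multiples of \<open>S\<close>. The second spatial derivative
  receives no contribution from the lifting.\<close>

theorem estimate:
 "H1L2_L2H2_norm T u' < \<infinity>"
 "H1L2_L2H2_norm T (%t x. u' t x - u t x) <=
 ereal (perturbation_const T al M (4 * nQ T P + nQ T R + nQ T U) * S)"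
proof -
 have T: "0 < T" by (rule c.T)
 interpret E: parabolic_estimate T al M M A' at' z p G z0 p0 ax' bt' q' RR M
 proof (unfold_locales)
 show "AE t in LL 0 T. AE x in LI. \<bar>bt' t x\<bar> <= M & \<bar>q' x\<bar> <= M & G t x = RR t x - bt' t x *R p t x - q' x *R z t x"
 using bounds(3)
 proof eventually_elim
 case (elim t) thus ?case by eventually_elim (simp add: RR_def)
 qed
 qed (rule T al M coefficient_locales sqi_all h10_z0 h10_z weak_z borel_bmQ[OF c'.A(1)] borel_bmQ[OF borel(2)])+
 obtain v r where v: "sqQ T v" and r: "sqQ T r" and zv: "AE x in LI. AE t in LL 0 T. z t x = z0 x + prim 0 (%s. v s x) t"
 and pr: "AE t in LL 0 T. acd 0 1 (p t) (r t)" and est: "nQ T z + nQ T p + nQ T v + nQ T r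
 <= parabolic_const T al M M M * (n2 LI p0 + nQ T RR)"
 using E.regularity_estimate by blast
 define v' where "v' t x = VV t x + v t x" for t x
 define r' where "r' t x = R t x + r t x" for t x
 have v'r': "sqQ T v'" "sqQ T r'"
 unfolding v'_def[abs_def] r'_def[abs_def] by (intro sqi_add2 sqi_all v R r)+
 have U'v': "AE x in LI. acd 0 T (%t. U' t x) (%t. v' t x)"
 using UU_VV zv slices(2)[OF v] slices(2)[OF sqi_all(2)]
 proof eventually_elim
 case (elim x)
 have "acd 0 T (%t. UU t x + z t x) (%t. VV t x + v t x)"
 by (rule acd_add[OF acdI[OF sqi_intg[OF elim(4)] elim(1)] acdI[OF sqi_intg[OF elim(3)] elim(2)]])
 moreover have "(%t. UU t x + z t x) = (%t. U' t x)" by (auto simp: z_def)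
 ultimately show ?case by (simp only: v'_def)
 qed
 have U'P': "AE t in LL 0 T. acd 0 1 (U' t) (P' t)"
 using UU_PP h10_z
 proof eventually_elim
 case (elim t)
 have "(%x. UU t x + z t x) = U' t" "(%x. PP t x + p t x) = P' t" by (auto simp: z_def p_def)
 thus ?case using acd_add[OF elim(1) h10_acd[OF elim(2)]] by (simp only:)
 qed
 have P'r': "AE t in LL 0 T. acd 0 1 (P' t) (r' t)"
 using PP_R pr
 proof eventually_elim
 case (elim t)
 have "(%x. PP t x + p t x) = P' t" by (auto simp: p_def)
 thus ?case using acd_add[OF elim] by (simp only: r'_def[abs_def])
 qed
 note uU1 = AE_QT_slices(1)[OF uU] and uU1' = AE_QT_slices(1)[OF uU']
 show "H1L2_L2H2_norm T u' < \<infinity>"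
 unfolding H1L2_L2H2_norm_eq[OF T U' v'r'(1) P' v'r'(2) U'v' U'P' P'r' um' uU1'] by simp
 define D where "D t x = U' t x - U t x" for t x
 define vD where "vD t x = v' t x - V t x" for t x
 define pD where "pD t x = P' t x - P t x" for t x
 define rD where "rD t x = r' t x - R t x" for t x
 have sD: "sqQ T D" "sqQ T vD" "sqQ T pD" "sqQ T rD"
 unfolding D_def[abs_def] vD_def[abs_def] pD_def[abs_def] rD_def[abs_def] by (intro sqi_diff2 U' U v'r' V P' P R)+
 have a1: "AE x in LI. acd 0 T (%t. D t x) (%t. vD t x)"
 using U'v' UV slices(2)[OF V]
 proof eventually_elim
 case (elim x)
 show ?case unfolding D_def vD_def by (rule acd_diff[OF elim(1) acdI[OF sqi_intg[OF elim(3)] elim(2)]])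
 qed
 have a2: "AE t in LL 0 T. acd 0 1 (D t) (pD t)"
 using U'P' UP unfolding D_def[abs_def] pD_def[abs_def] by eventually_elim (rule acd_diff)
 have a3: "AE t in LL 0 T. acd 0 1 (pD t) (rD t)"
 using P'r' PR unfolding rD_def[abs_def] pD_def[abs_def] by eventually_elim (rule acd_diff)
 have mD: "cp (%t x. u' t x - u t x) : bm (leb (QT T))"
 using bm_diff[OF um' um] by (simp add: split_def)
 have uD: "AE t in LL 0 T. AE x in LI. u' t x - u t x = D t x"
 using uU1 uU1'
 proof eventually_elim
 case (elim t) show ?case using elim by eventually_elim (simp add: D_def)
 qed
 have b: "nQ T D <= 2 * (8 * S^2) + 2 * nQ T z" "nQ T vD <= 2 * (8 * S^2) + 2 * nQ T v"
 "nQ T pD <= 2 * (8 * S^2) + 2 * nQ T p" "cp rD = cp r"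
 proof -
 have e: "cp D = (%y. cp Ps y + cp z y)" "cp vD = (%y. cp Pst y + cp v y)" "cp pD = (%y. cp Psx y + cp p y)"
 by (auto simp: fun_eq_iff D_def vD_def pD_def z_def v'_def p_def UU_def VV_def PP_def)
 show "nQ T D <= 2 * (8 * S^2) + 2 * nQ T z"
 using n2_add_le[OF sqi_psi(1) sqi_all(6)] sqi_psi(4) unfolding e by (linarith | argo)
 show "nQ T vD <= 2 * (8 * S^2) + 2 * nQ T v"
 using n2_add_le[OF sqi_psi(2) v] sqi_psi(5) unfolding e by (linarith | argo)
 show "nQ T pD <= 2 * (8 * S^2) + 2 * nQ T p"
 using n2_add_le[OF sqi_psi(3) sqi_all(7)] sqi_psi(6) unfolding e by (linarith | argo)
 show "cp rD = cp r" by (auto simp: fun_eq_iff rD_def r'_def)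
 qed
 define X where "X = 4 * nQ T P + nQ T R + nQ T U"
 define C where "C = parabolic_const T al M M M"
 have C: "0 <= C" unfolding C_def by (rule parabolic_const_nonneg[OF T al M M M])
 define K where "K = 2 * (C * (4 + 128 * (9 + 40 * M^2 + X))) + 48"
 have X: "0 <= X" by (simp add: X_def)
 have "C * (n2 LI p0 + nQ T RR) <= C * (4 * S^2 + 128 * (9 + 40 * M^2 + X) * S^2)"
 using n2_p0 n2_RR by (intro mult_left_mono add_mono C) (simp_all add: X_def)
 also have "... = (C * (4 + 128 * (9 + 40 * M^2 + X))) * S^2" by (simp add: algebra_simps)
 finally have est2: "nQ T z + nQ T p + nQ T v + nQ T r <= (C * (4 + 128 * (9 + 40 * M^2 + X))) * S^2"
 using est unfolding C_def by (linarith | argo)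
 define Z where "Z = nQ T D + nQ T vD + nQ T pD + nQ T rD"
 have "Z <= 2 * (nQ T z + nQ T p + nQ T v + nQ T r) + 48 * S^2"
 using b n2_nonneg[of "QM T" "cp r"] unfolding Z_def b(4) by (linarith | argo)
 also have "... <= 2 * ((C * (4 + 128 * (9 + 40 * M^2 + X))) * S^2) + 48 * S^2" using est2 by (linarith | argo)
 also have "... = K * S^2" by (simp add: K_def algebra_simps)
 finally have Z: "Z <= K * S^2" .
 have "sqrt (nQ T D + nQ T vD) <= sqrt Z" "sqrt (nQ T D + nQ T pD + nQ T rD) <= sqrt Z"
 unfolding Z_def by (rule real_sqrt_le_mono, simp)+
 moreover have "sqrt Z <= sqrt K * S" using real_sqrt_le_mono[OF Z] S by (simp add: real_sqrt_mult)
 ultimately have "sqrt (nQ T D + nQ T vD) + sqrt (nQ T D + nQ T pD + nQ T rD) <= 2 * sqrt K * S"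
 by (linarith | argo)
 thus "H1L2_L2H2_norm T (%t x. u' t x - u t x) <=
 ereal (perturbation_const T al M (4 * nQ T P + nQ T R + nQ T U) * S)"
 unfolding H1L2_L2H2_norm_eq[OF T sD a1 a2 a3 mD uD] perturbation_const_def X_def[symmetric] C_def[symmetric] K_def[symmetric] by simp
qed

end

section \<open>Convergence\<close>

lemma AE_abs_le_swap:
 fixes h :: "real => real => real"
 assumes "cp h : bm borel"
 shows "(AE t in LL 0 T. AE x in LI. \<bar>h t x\<bar> <= M) \<longleftrightarrow> (AE x in LI. AE t in LL 0 T. \<bar>h t x\<bar> <= M)"
proof -
 have "Measurable.pred (QM T) (%p. \<bar>cp h p\<bar> <= M)"
 unfolding pred_def by (rule borel_measurable_le[OF borel_measurable_abs[OF borel_bmQ[OF assms]] borel_measurable_const])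
 from AE_QM_swap[OF this] show ?thesis by simp
qed

lemma ereal_bound_imp_real:
 fixes X :: ereal
 assumes "0 <= X" "X < \<infinity>"
 obtains r where "0 <= r" "X = ereal r"
 using assms by (cases X) auto

lemma coefficient_representatives:
 assumes T: "0 < T" and a: "W1inf_norm (QT T) (cp a) < \<infinity>" and b: "Linf_bochner_norm T (W1inf_norm unit_iv) b < \<infinity>"
 and q: "Linf_norm unit_iv q < \<infinity>" and f: "L2_norm (QT T) (cp f) < \<infinity>"
 shows "EX N A At Ax bt F. coefficients T N a b A bt q f F & cp At : bm borel & cp Ax : bm borel &
 (ALL t x. \<bar>At t x\<bar> <= N) & (ALL t x. \<bar>Ax t x\<bar> <= N) & (AE p in leb (QT T). cp a p = cp A p) &
 (AE x in LI. acd 0 T (%t. A t x) (%t. At t x)) & (AE t in LL 0 T. acd 0 1 (A t) (Ax t)) &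
 (AE p in leb (QT T). cp f p = cp F p)"
proof -
 define N1 where "N1 = real_of_ereal (W1inf_norm (QT T) (cp a))"
 obtain A At Ax where A: "cp A : bm borel" "cp At : bm borel" "cp Ax : bm borel"
 "ALL t x. \<bar>A t x\<bar> <= N1 & \<bar>At t x\<bar> <= N1 & \<bar>Ax t x\<bar> <= N1" "AE p in leb (QT T). cp a p = cp A p"
 "AE x in LI. acd 0 T (%t. A t x) (%t. At t x)" "AE t in LL 0 T. acd 0 1 (A t) (Ax t)"
 using W1inf_representatives[OF a T, folded N1_def] by (elim exE conjE)
 obtain bt N2 where bt: "cp bt : bm borel" "ALL t x. \<bar>bt t x\<bar> <= N2" "AE t in LL 0 T. AE x in LI. b t x = bt t x"
 using Linf_bochner_representative[OF b T] by (elim exE conjE)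
 obtain N3 where N3: "Linf_norm unit_iv q = ereal N3"
 using ereal_bound_imp_real[OF Linf_norm_nonneg[OF not_AE_False_LL[OF zero_less_one]] q] by blast
 note q' = Linf_norm_bound[OF eq_refl[OF N3]]
 obtain F where F: "sqQ T F" "AE p in leb (QT T). cp f p = cp F p"
 using sqi_QM_of_L2_norm[OF f] by (elim exE conjE)
 define N where "N = max N1 (max N2 (max N3 0))"
 have le: "N1 <= N" "N2 <= N" "N3 <= N" "0 <= N" by (auto simp: N_def)
 have bnd: "\<bar>A t x\<bar> <= N" "\<bar>At t x\<bar> <= N" "\<bar>Ax t x\<bar> <= N" "\<bar>bt t x\<bar> <= N" for t x
 using A(4) bt(2) le by (meson order_trans)+
 have qN: "AE x in LI. \<bar>q x\<bar> <= N" using q'(2) by eventually_elim (use le in simp)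
 have "coefficients T N a b A bt q f F"
 by unfold_locales (rule T le(4) A(1) bnd AE_QT_slices(1)[OF A(5)] bt(1,3) q'(1) qN F(1) AE_QT_slices(1)[OF F(2)])+
 thus ?thesis
 by (rule_tac exI[of _ N], rule_tac exI[of _ A], rule_tac exI[of _ At], rule_tac exI[of _ Ax], rule_tac exI[of _ bt], rule_tac exI[of _ F])
 (intro conjI A allI bnd F)
qed

text \<open>Everything that stays fixed while the perturbation varies. Consequently \<open>N\<close>
  and \<open>X\<close>, the only quantities of the limit problem in the final constant, do not
  depend on \<epsilon>.\<close>

locale unperturbed = c: coefficients T N a b A bt q f F
 for T N :: real and a b A bt :: "real => real => real" and q :: "real => real" and f F :: "real => real => complex" +
 fixes da ax :: "real => real => real" and u U V P R :: "real => real => complex" and u0 ku g0 g1 kg0 kg1 :: "real => complex"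
 assumes borel: "cp da : bm borel" "cp ax : bm borel" "!!t x. \<bar>da t x\<bar> <= N" "!!t x. \<bar>ax t x\<bar> <= N"
 and aA: "AE p in leb (QT T). cp a p = cp A p"
 and acd_time: "AE x in LI. acd 0 T (%t. A t x) (%t. da t x)" and acd_space: "AE t in LL 0 T. acd 0 1 (A t) (ax t)"
 and fF: "AE p in leb (QT T). cp f p = cp F p"
 and u0: "acd 0 1 u0 ku" "sqi LI u0" "sqi LI ku"
 and g0: "acd 0 T g0 kg0" "sqi (LL 0 T) g0" "sqi (LL 0 T) kg0" and g1: "acd 0 T g1 kg1" "sqi (LL 0 T) g1" "sqi (LL 0 T) kg1"
 and compat: "cont_rep 0 1 u0 0 = cont_rep 0 T g0 0" "cont_rep 0 1 u0 1 = cont_rep 0 T g1 0"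
 and U: "sqQ T U" and V: "sqQ T V" and P: "sqQ T P" and R: "sqQ T R"
 and uU: "AE p in leb (QT T). cp u p = cp U p" and um: "cp u : bm (leb (QT T))"
 and UV: "AE x in LI. AE t in LL 0 T. U t x = u0 x + prim 0 (%s. V s x) t"
 and UP: "AE t in LL 0 T. acd 0 1 (U t) (P t)" and PR: "AE t in LL 0 T. acd 0 1 (P t) (R t)"
 and Uh: "AE t in LL 0 T. h10 (%x. U t x - lin (g0 t) (g1 t) x) (%x. P t x - (g1 t - g0 t))"
 and Veq: "AE t in LL 0 T. AE x in LI. V t x = ax t x *R P t x + A t x *R R t x - bt t x *R P t x - q x *R U t x + F t x"
begin

definition X where "X = 4 * nQ T P + nQ T R + nQ T U"

text \<open>The same estimate is used twice. With the individual bound \<open>N'\<close> and a large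
  \<open>S\<close> it yields regularity of each perturbed solution without any smallness; with
  \<open>S <= 1\<close> and the bound \<open>N + 1\<close> it yields the quantitative estimate with
  a uniform constant.\<close>

lemma perturbation_bound:
 fixes a' b' :: "real => real => real" and q' :: "real => real" and f' u' :: "real => real => complex" and u0' g0' g1' :: "real => complex"
 assumes al: "0 < al" and a': "W1inf_norm (QT T) (cp a') < \<infinity>" and b': "Linf_bochner_norm T (W1inf_norm unit_iv) b' < \<infinity>"
 and q': "Linf_norm unit_iv q' < \<infinity>" and f': "L2_norm (QT T) (cp f') < \<infinity>"
 and u0': "H_norm 1 unit_iv u0' < \<infinity>" and g0': "H_norm 1 {0<..<T} g0' < \<infinity>" and g1': "H_norm 1 {0<..<T} g1' < \<infinity>"
 and ell: "AE p in leb (QT T). al <= cp a' p"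
 and compat': "cont_rep 0 1 u0' 0 = cont_rep 0 T g0' 0" "cont_rep 0 1 u0' 1 = cont_rep 0 T g1' 0"
 and sol: "weak_solution T a' b' q' f' u0' g0' g1' u'"
 shows "H1L2_L2H2_norm T u' < \<infinity>"
 and "!!S. 0 <= S ==> S <= 1 ==> W1inf_norm (QT T) (%(t, x). a' t x - a t x) <= ereal S ==>
 Linf_bochner_norm T (W1inf_norm unit_iv) (%t x. b' t x - b t x) <= ereal S ==>
 Linf_norm unit_iv (%x. q' x - q x) <= ereal S ==> L2_norm (QT T) (%(t, x). f' t x - f t x) <= ereal S ==>
 H_norm 1 unit_iv (%x. u0' x - u0 x) <= ereal S ==> H_norm 1 {0<..<T} (%t. g0' t - g0 t) <= ereal S ==>
 H_norm 1 {0<..<T} (%t. g1' t - g1 t) <= ereal S ==>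
 H1L2_L2H2_norm T (%t x. u' t x - u t x) <= ereal (perturbation_const T al (N + 1) X * S)"
proof -
 note T = c.T
 obtain N' A' at' ax' bt' F' where c': "coefficients T N' a' b' A' bt' q' f' F'"
 and bo': "cp at' : bm borel" "cp ax' : bm borel" "ALL t x. \<bar>at' t x\<bar> <= N'" "ALL t x. \<bar>ax' t x\<bar> <= N'"
 and aA': "AE p in leb (QT T). cp a' p = cp A' p"
 and ac': "AE x in LI. acd 0 T (%t. A' t x) (%t. at' t x)" "AE t in LL 0 T. acd 0 1 (A' t) (ax' t)"
 and fF': "AE p in leb (QT T). cp f' p = cp F' p"
 using coefficient_representatives[OF T a' b' q' f'] by (elim exE conjE)
 interpret c': coefficients T N' a' b' A' bt' q' f' F' by (rule c')
 obtain ku' where ku': "acd 0 1 u0' ku'" "sqi LI u0'" "sqi LI ku'" using H_norm_1_finite[OF u0' zero_less_one] by blast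
 obtain kg0' where kg0': "acd 0 T g0' kg0'" "sqi (LL 0 T) g0'" "sqi (LL 0 T) kg0'" using H_norm_1_finite[OF g0' T] by blast
 obtain kg1' where kg1': "acd 0 T g1' kg1'" "sqi (LL 0 T) g1'" "sqi (LL 0 T) kg1'" using H_norm_1_finite[OF g1' T] by blast
 obtain U' P' where U': "sqQ T U'" "sqQ T P'" "AE p in leb (QT T). cp u' p = cp U' p"
 "AE t in LL 0 T. h10 (%x. U' t x - lin (g0' t) (g1' t) x) (%x. P' t x - (g1' t - g0' t))"
 "AE t in LL 0 T. ALL ph ph'. h10 ph ph' --> (LINT x|LI. (U' t x - u0' x) *I ph x) =
 - (LINT x|LI. prim 0 (%s. A' s x *R P' s x) t *I ph' x) + (LINT x|LI. prim 0 (%s. F' s x - bt' s x *R P' s x - q' x *R U' s x) t *I ph x)"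
 using c'.weak_solution_facts[OF sol ku'(2)] by (elim exE conjE)
 have um': "cp u' : bm (leb (QT T))"
 using sol bochner_fin(1) unfolding weak_solution_def by blast
 have ell': "AE p in leb (QT T). al <= cp A' p" using ell aA' by eventually_elim simp
 note el = AE_QM_fst[OF AE_lebesgue_on_QT[OF ell']] AE_QM_snd[OF AE_lebesgue_on_QT[OF ell']]
 define k where "k x = ku' x - ku x" for x
 define et0 where "et0 t = kg0' t - kg0 t" for t
 define et1 where "et1 t = kg1' t - kg1 t" for t
 have k: "acd 0 1 (%x. u0' x - u0 x) k" "sqi LI (%x. u0' x - u0 x)" "sqi LI k"
 unfolding k_def[abs_def] by (rule acd_diff[OF ku'(1) u0(1)], rule sqi_diff[OF ku'(2) u0(2)], rule sqi_diff[OF ku'(3) u0(3)])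
 have e0: "acd 0 T (%t. g0' t - g0 t) et0" "sqi (LL 0 T) (%t. g0' t - g0 t)" "sqi (LL 0 T) et0"
 unfolding et0_def[abs_def] by (rule acd_diff[OF kg0'(1) g0(1)], rule sqi_diff[OF kg0'(2) g0(2)], rule sqi_diff[OF kg0'(3) g0(3)])
 have e1: "acd 0 T (%t. g1' t - g1 t) et1" "sqi (LL 0 T) (%t. g1' t - g1 t)" "sqi (LL 0 T) et1"
 unfolding et1_def[abs_def] by (rule acd_diff[OF kg1'(1) g1(1)], rule sqi_diff[OF kg1'(2) g1(2)], rule sqi_diff[OF kg1'(3) g1(3)])
 have cm: "cont_rep 0 1 (%x. u0' x - u0 x) 0 = cont_rep 0 T (%t. g0' t - g0 t) 0" "cont_rep 0 1 (%x. u0' x - u0 x) 1 = cont_rep 0 T (%t. g1' t - g1 t) 0"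
 using cont_rep_diff[OF ku'(1) u0(1) zero_less_one, of 0] cont_rep_diff[OF ku'(1) u0(1) zero_less_one, of 1]
 cont_rep_diff[OF kg0'(1) g0(1) T, of 0] cont_rep_diff[OF kg1'(1) g1(1) T, of 0] T compat compat' by simp_all
 have core: "H1L2_L2H2_norm T u' < \<infinity> & H1L2_L2H2_norm T (%t x. u' t x - u t x) <= ereal (perturbation_const T al M X * S)"
 if MS: "0 <= M" "0 <= S"
 and bA: "AE t in LL 0 T. AE x in LI. \<bar>A' t x\<bar> <= M" and bt: "AE x in LI. AE t in LL 0 T. \<bar>at' t x\<bar> <= M" and bx: "AE t in LL 0 T. AE x in LI. \<bar>ax' t x\<bar> <= M"
 and bb: "AE t in LL 0 T. AE x in LI. \<bar>bt' t x\<bar> <= M" and bq: "AE x in LI. \<bar>q' x\<bar> <= M"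
 and sA: "AE t in LL 0 T. AE x in LI. \<bar>A' t x - A t x\<bar> <= S" and sx: "AE t in LL 0 T. AE x in LI. \<bar>ax' t x - ax t x\<bar> <= S"
 and sb: "AE t in LL 0 T. AE x in LI. \<bar>bt' t x - bt t x\<bar> <= S" and sq: "AE x in LI. \<bar>q' x - q x\<bar> <= S"
 and size: "n2 LI k <= S^2" "nQ T (%t x. F' t x - F t x) <= S^2" "n2 (LL 0 T) (%t. g0' t - g0 t) <= S^2"
 "n2 (LL 0 T) et0 <= S^2" "n2 (LL 0 T) (%t. g1' t - g1 t) <= S^2" "n2 (LL 0 T) et1 <= S^2" for M S
 proof -
 have B1: "AE t in LL 0 T. AE x in LI. al <= A' t x & A' t x <= M & \<bar>at' t x\<bar> <= M & \<bar>ax' t x\<bar> <= M"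
 using el(1) bA bt[folded AE_abs_le_swap[OF bo'(1)]] bx
 proof eventually_elim
 case (elim t) show ?case using elim by eventually_elim auto
 qed
 have B2: "AE x in LI. AE t in LL 0 T. al <= A' t x & A' t x <= M & \<bar>at' t x\<bar> <= M & \<bar>ax' t x\<bar> <= M"
 using el(2) bA[unfolded AE_abs_le_swap[OF c'.A(1)]] bt bx[unfolded AE_abs_le_swap[OF bo'(2)]]
 proof eventually_elim
 case (elim x) show ?case using elim by eventually_elim auto
 qed
 have B3: "AE t in LL 0 T. AE x in LI. \<bar>bt' t x\<bar> <= M & \<bar>q' x\<bar> <= M"
 using bb
 proof eventually_elim
 case (elim t) show ?case using elim bq by eventually_elim blast
 qed
 have B4: "AE t in LL 0 T. AE x in LI. \<bar>A' t x - A t x\<bar> <= S & \<bar>ax' t x - ax t x\<bar> <= S & \<bar>bt' t x - bt t x\<bar> <= S & \<bar>q' x - q x\<bar> <= S"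
 using sA sx sb
 proof eventually_elim
 case (elim t) show ?case using elim sq by eventually_elim blast
 qed
 have ax'N: "\<bar>ax' t x\<bar> <= N'" for t x using bo'(4) by blast
 interpret perturbation T N N' a b A bt a' b' A' bt' q q' f F f' F' al M S ax at' ax' u u' U V P R U' P' u0 u0' k g0 g1 g0' g1' et0 et1
 by unfold_locales (rule al MS borel(2) bo'(2) ax'N ac' B1 B2 B3 B4 u0(2) ku'(2) U V P R uU um UV UP PR Uh Veq U' um' k(1,3) e0 e1 cm size)+
 show ?thesis using estimate unfolding X_def by blast
 qed
 have N0: "0 <= N" "0 <= N'" using c.N c'.N by auto
 define E where "E = n2 LI k + nQ T (%t x. F' t x - F t x) + n2 (LL 0 T) (%t. g0' t - g0 t) + n2 (LL 0 T) et0 + n2 (LL 0 T) (%t. g1' t - g1 t) + n2 (LL 0 T) et1"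
 have E: "n2 LI k <= E" "nQ T (%t x. F' t x - F t x) <= E" "n2 (LL 0 T) (%t. g0' t - g0 t) <= E"
 "n2 (LL 0 T) et0 <= E" "n2 (LL 0 T) (%t. g1' t - g1 t) <= E" "n2 (LL 0 T) et1 <= E" by (simp_all add: E_def)
 \<comment> \<open>Large enough to bound all differences of coefficients and data, whatever their
   size.\<close>
 define S1 where "S1 = N + N' + sqrt E"
 have E0: "0 <= E" by (simp add: E_def)
 have S1: "N + N' <= S1" "0 <= S1" "sqrt E <= S1" using N0 E0 by (simp_all add: S1_def)
 have ES: "E <= S1^2" using power_mono[OF S1(3), of 2] E0 by simp
 have t2: "\<bar>y - y'\<bar> <= S1" if "\<bar>y\<bar> <= N'" "\<bar>y'\<bar> <= N" for y y' :: real using that S1(1) by linarith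
 show "H1L2_L2H2_norm T u' < \<infinity>"
 proof (rule core[of N' S1, THEN conjunct1])
 show "AE x in LI. \<bar>q' x - q x\<bar> <= S1" using c.q(2) c'.q(2) by eventually_elim (rule t2)
 show "AE x in LI. \<bar>q' x\<bar> <= N'" by (rule c'.q(2))
 qed (use E ES S1 N0 bo' borel t2 c.A(2) c'.A(2) c.bt(2) c'.bt(2) in "auto intro: order_trans")
 fix S :: real
 assume S: "0 <= S" "S <= 1" and sa: "W1inf_norm (QT T) (%(t, x). a' t x - a t x) <= ereal S"
 and sb: "Linf_bochner_norm T (W1inf_norm unit_iv) (%t x. b' t x - b t x) <= ereal S"
 and sq: "Linf_norm unit_iv (%x. q' x - q x) <= ereal S" and sf: "L2_norm (QT T) (%(t, x). f' t x - f t x) <= ereal S"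
 and su: "H_norm 1 unit_iv (%x. u0' x - u0 x) <= ereal S" and sg0: "H_norm 1 {0<..<T} (%t. g0' t - g0 t) <= ereal S"
 and sg1: "H_norm 1 {0<..<T} (%t. g1' t - g1 t) <= ereal S"
 have lt: "ereal S < \<infinity>" by simp
 have toreal: "real_of_ereal Y <= S" if "Y <= ereal S" for Y using that S by (cases Y) auto
 define a'' where "a'' t x = a' t x - a t x" for t x
 have sa': "W1inf_norm (QT T) (cp a'') <= ereal S" using sa unfolding a''_def[abs_def] .
 define Nd where "Nd = real_of_ereal (W1inf_norm (QT T) (cp a''))"
 have Nd: "Nd <= S" unfolding Nd_def by (rule toreal[OF sa'])
 \<comment> \<open>The derivatives of \<open>A'\<close> and \<open>A\<close> were represented
   separately. By uniqueness their differences agree almost everywhere with \<open>Dt\<close> and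
   \<open>Dx\<close>, which obey the norm of the difference.\<close>
 obtain D Dt Dx where D: "ALL t x. \<bar>D t x\<bar> <= Nd & \<bar>Dt t x\<bar> <= Nd & \<bar>Dx t x\<bar> <= Nd" "AE p in leb (QT T). cp a'' p = cp D p"
 "AE x in LI. acd 0 T (%t. D t x) (%t. Dt t x)" "AE t in LL 0 T. acd 0 1 (D t) (Dx t)"
 using W1inf_representatives[OF le_less_trans[OF sa' lt] T, folded Nd_def] by (elim exE conjE)
 have Db: "\<bar>D t x\<bar> <= S" "\<bar>Dt t x\<bar> <= S" "\<bar>Dx t x\<bar> <= S" for t x using D(1) Nd by (meson order_trans)+
 have dA: "AE p in leb (QT T). cp (%t x. A' t x - A t x) p = cp D p"
 using D(2) aA aA' by eventually_elim (auto simp: a''_def split: prod.splits)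
 have dAt: "AE x in LI. AE t in LL 0 T. \<bar>at' t x - da t x\<bar> <= S"
 using AE_QT_slices(2)[OF dA] ac'(1) acd_time D(3)
 proof eventually_elim
 case (elim x)
 have "AE t in LL 0 T. at' t x - da t x = Dt t x" by (rule acd_unique[OF acd_AE_cong[OF acd_diff[OF elim(2,3)] elim(1)] elim(4) T])
 thus ?case by eventually_elim (use Db in simp)
 qed
 have dAx: "AE t in LL 0 T. AE x in LI. \<bar>ax' t x - ax t x\<bar> <= S"
 using AE_QT_slices(1)[OF dA] ac'(2) acd_space D(4)
 proof eventually_elim
 case (elim t)
 have "AE x in LI. ax' t x - ax t x = Dx t x" by (rule acd_unique[OF acd_AE_cong[OF acd_diff[OF elim(2,3)] elim(1)] elim(4) zero_less_one])
 thus ?case by eventually_elim (use Db in simp)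
 qed
 have dA': "AE t in LL 0 T. AE x in LI. \<bar>A' t x - A t x\<bar> <= S"
 using AE_QT_slices(1)[OF dA]
 proof eventually_elim
 case (elim t) thus ?case by eventually_elim (use Db in simp)
 qed
 have db: "AE t in LL 0 T. AE x in LI. \<bar>bt' t x - bt t x\<bar> <= S"
 using Linf_bochner_bound(3)[OF le_less_trans[OF sb lt] T] c.bbt c'.bbt
 proof eventually_elim
 case (elim t) show ?case using elim by eventually_elim (use toreal[OF sb] in auto)
 qed
 have dq: "AE x in LI. \<bar>q' x - q x\<bar> <= S" using Linf_norm_bound(2)[OF sq] by simp
 \<comment> \<open>Because \<open>S <= 1\<close>, the perturbed coefficients obey the fixed bound
   \<open>N + 1\<close>; this makes the constant uniform.\<close>
 have tri: "\<bar>y\<bar> <= N + 1" if "\<bar>y - y'\<bar> <= S" "\<bar>y'\<bar> <= N" for y y' :: real using that S by linarith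
 have sz: "y <= S^2 & y' <= S^2" if "ereal (sqrt (y + y')) <= ereal S" "0 <= y" "0 <= y'" for y y'
 proof -
 have "sqrt (y + y') <= S" using that(1) by simp
 from power_mono[OF this, of 2] that show ?thesis by simp
 qed
 note su' = sz[OF su[unfolded H_norm_1_eq[OF k zero_less_one]] n2_nonneg n2_nonneg]
 and sg0' = sz[OF sg0[unfolded H_norm_1_eq[OF e0 T]] n2_nonneg n2_nonneg] and sg1' = sz[OF sg1[unfolded H_norm_1_eq[OF e1 T]] n2_nonneg n2_nonneg]
 have sF: "nQ T (%t x. F' t x - F t x) <= S^2"
 proof -
 obtain G where G: "sqQ T G" "AE p in leb (QT T). cp (%t x. f' t x - f t x) p = cp G p"
 "L2_norm (QT T) (cp (%t x. f' t x - f t x)) = ereal (sqrt (nQ T G))"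
 using sqi_QM_of_L2_norm[OF le_less_trans[OF sf lt]] by (elim exE conjE)
 have "AE p in leb (QT T). cp (%t x. F' t x - F t x) p = cp G p"
 using G(2) fF fF' by eventually_elim (auto split: prod.splits)
 from n2_cong[OF AE_lebesgue_on_QT[OF this] sqi_meas[OF sqi_diff2[OF c'.F c.F]] sqi_meas[OF G(1)]]
 show ?thesis using sz[of "nQ T G" 0] sf unfolding G(3) by simp
 qed
 have bnd: "AE t in LL 0 T. AE x in LI. \<bar>h' t x\<bar> <= N + 1"
 if "AE t in LL 0 T. AE x in LI. \<bar>h' t x - h t x\<bar> <= S" "!!t x. \<bar>h t x\<bar> <= N" for h h'
 using that(1)
 proof eventually_elim
 case (elim t) thus ?case by eventually_elim (rule tri[OF _ that(2)])
 qed
 show "H1L2_L2H2_norm T (%t x. u' t x - u t x) <= ereal (perturbation_const T al (N + 1) X * S)"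
 proof (rule core[of "N + 1" S, THEN conjunct2])
 show "AE x in LI. AE t in LL 0 T. \<bar>at' t x\<bar> <= N + 1"
 using dAt
 proof eventually_elim
 case (elim x) thus ?case by eventually_elim (rule tri[OF _ borel(3)])
 qed
 show "AE x in LI. \<bar>q' x\<bar> <= N + 1" using dq c.q(2) by eventually_elim (rule tri)
 show "0 <= N + 1" using N0 by simp
 qed (rule S dA' dAx db dq sF su'[THEN conjunct2] sg0'[THEN conjunct1] sg0'[THEN conjunct2] sg1'[THEN conjunct1] sg1'[THEN conjunct2]
 bnd[OF dA' c.A(2)] bnd[OF dAx borel(4)] bnd[OF db c.bt(2)])+
qed

end

lemma L2_norm_nonneg: "0 <= L2_norm S f"
 by (simp add: L2_norm_def)

lemma H1L2_L2H2_norm_nonneg: "0 <= H1L2_L2H2_norm T u"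
 unfolding H1L2_L2H2_norm_def
 by (rule add_nonneg_nonneg) (simp_all add: H1L2_norm_def L2_bochner_norm_def L2_time_norm_def L2_norm_nonneg)

lemma perturbation_const_nonneg:
 assumes "0 < T" "0 < al" "0 <= M" "0 <= X"
 shows "0 <= perturbation_const T al M X"
 unfolding perturbation_const_def using parabolic_const_nonneg[OF assms(1,2,3,3,3)] assms
 by (intro mult_nonneg_nonneg real_sqrt_ge_zero add_nonneg_nonneg) auto

theorem theorem3p4:
  fixes T \<alpha>0 \<alpha> :: real
    and a b :: "real \<Rightarrow> real \<Rightarrow> real" and q :: "real \<Rightarrow> real"
    and f u :: "real \<Rightarrow> real \<Rightarrow> complex" and u0 g0 g1 :: "real \<Rightarrow> complex"
    and ae be :: "real \<Rightarrow> real \<Rightarrow> real \<Rightarrow> real" and qe :: "real \<Rightarrow> real \<Rightarrow> real"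
    and fe ue :: "real \<Rightarrow> real \<Rightarrow> real \<Rightarrow> complex" and u0e g0e g1e :: "real \<Rightarrow> real \<Rightarrow> complex"
  assumes "T > 0"
    and "W1inf_norm (QT T) (case_prod a) < \<infinity>"
    and "\<alpha>0 > 0" and "AE p in lebesgue_on (QT T). case_prod a p \<ge> \<alpha>0"
    and "Linf_bochner_norm T (W1inf_norm unit_iv) b < \<infinity>"
    and "Linf_norm unit_iv q < \<infinity>"
    and "L2_norm (QT T) (case_prod f) < \<infinity>"
    and "H_norm 1 unit_iv u0 < \<infinity>"
    and "H_norm 1 {0<..<T} g0 < \<infinity>" and "H_norm 1 {0<..<T} g1 < \<infinity>"
    and "cont_rep 0 1 u0 0 = cont_rep 0 T g0 0" and "cont_rep 0 1 u0 1 = cont_rep 0 T g1 0"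
    and "strong_solution T a b q f u0 g0 g1 u"
    and "\<And>\<epsilon>. \<epsilon> \<in> {0<..1} \<Longrightarrow> W1inf_norm (QT T) (case_prod (ae \<epsilon>)) < \<infinity>"
    and "\<And>\<epsilon>. \<epsilon> \<in> {0<..1} \<Longrightarrow> Linf_bochner_norm T (W1inf_norm unit_iv) (be \<epsilon>) < \<infinity>"
    and "\<And>\<epsilon>. \<epsilon> \<in> {0<..1} \<Longrightarrow> Linf_norm unit_iv (qe \<epsilon>) < \<infinity>"
    and "\<And>\<epsilon>. \<epsilon> \<in> {0<..1} \<Longrightarrow> L2_norm (QT T) (case_prod (fe \<epsilon>)) < \<infinity>"
    and "\<And>\<epsilon>. \<epsilon> \<in> {0<..1} \<Longrightarrow> H_norm 1 unit_iv (u0e \<epsilon>) < \<infinity>"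
    and "\<And>\<epsilon>. \<epsilon> \<in> {0<..1} \<Longrightarrow> H_norm 1 {0<..<T} (g0e \<epsilon>) < \<infinity>"
    and "\<And>\<epsilon>. \<epsilon> \<in> {0<..1} \<Longrightarrow> H_norm 1 {0<..<T} (g1e \<epsilon>) < \<infinity>"
    and "0 < \<alpha>" and "\<alpha> \<le> \<alpha>0"
    and "\<And>\<epsilon>. \<epsilon> \<in> {0<..1} \<Longrightarrow> AE p in lebesgue_on (QT T). case_prod (ae \<epsilon>) p \<ge> \<alpha>"
    and "((\<lambda>\<epsilon>. W1inf_norm (QT T) (\<lambda>(t, x). ae \<epsilon> t x - a t x)) \<longlongrightarrow> 0) (at_right 0)"
    and "((\<lambda>\<epsilon>. Linf_bochner_norm T (W1inf_norm unit_iv) (\<lambda>t x. be \<epsilon> t x - b t x)) \<longlongrightarrow> 0) (at_right 0)"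
    and "((\<lambda>\<epsilon>. Linf_norm unit_iv (\<lambda>x. qe \<epsilon> x - q x)) \<longlongrightarrow> 0) (at_right 0)"
    and "((\<lambda>\<epsilon>. L2_norm (QT T) (\<lambda>(t, x). fe \<epsilon> t x - f t x)) \<longlongrightarrow> 0) (at_right 0)"
    and "((\<lambda>\<epsilon>. H_norm 1 unit_iv (\<lambda>x. u0e \<epsilon> x - u0 x)) \<longlongrightarrow> 0) (at_right 0)"
    and "((\<lambda>\<epsilon>. H_norm 1 {0<..<T} (\<lambda>t. g0e \<epsilon> t - g0 t)) \<longlongrightarrow> 0) (at_right 0)"
    and "((\<lambda>\<epsilon>. H_norm 1 {0<..<T} (\<lambda>t. g1e \<epsilon> t - g1 t)) \<longlongrightarrow> 0) (at_right 0)"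
    and "\<And>\<epsilon>. \<epsilon> \<in> {0<..1} \<Longrightarrow> cont_rep 0 1 (u0e \<epsilon>) 0 = cont_rep 0 T (g0e \<epsilon>) 0"
    and "\<And>\<epsilon>. \<epsilon> \<in> {0<..1} \<Longrightarrow> cont_rep 0 1 (u0e \<epsilon>) 1 = cont_rep 0 T (g1e \<epsilon>) 0"
    and "\<And>\<epsilon>. \<epsilon> \<in> {0<..1} \<Longrightarrow>
           weak_solution T (ae \<epsilon>) (be \<epsilon>) (qe \<epsilon>) (fe \<epsilon>) (u0e \<epsilon>) (g0e \<epsilon>) (g1e \<epsilon>) (ue \<epsilon>)"
  shows "(\<forall>\<epsilon>\<in>{0<..1}. H1L2_L2H2_norm T (ue \<epsilon>) < \<infinity>) \<and>
    ((\<lambda>\<epsilon>. H1L2_L2H2_norm T (\<lambda>t x. ue \<epsilon> t x - u t x)) \<longlongrightarrow> 0) (at_right 0)"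
proof -
 note T = assms(1)
 obtain N A At Ax \<beta> F where c: "coefficients T N a b A \<beta> q f F" and bo: "cp At : bm borel" "cp Ax : bm borel"
 "ALL t x. \<bar>At t x\<bar> <= N" "ALL t x. \<bar>Ax t x\<bar> <= N" and aA: "AE p in leb (QT T). cp a p = cp A p"
 and ac: "AE x in LI. acd 0 T (%t. A t x) (%t. At t x)" "AE t in LL 0 T. acd 0 1 (A t) (Ax t)"
 and fF: "AE p in leb (QT T). cp f p = cp F p"
 using coefficient_representatives[OF T assms(2,5,6,7)] by (elim exE conjE)
 interpret c: coefficients T N a b A \<beta> q f F by (rule c)
 obtain ku where ku: "acd 0 1 u0 ku" "sqi LI u0" "sqi LI ku" using H_norm_1_finite[OF assms(8) zero_less_one] by blast
 obtain kg0 where kg0: "acd 0 T g0 kg0" "sqi (LL 0 T) g0" "sqi (LL 0 T) kg0" using H_norm_1_finite[OF assms(9) T] by blast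
 obtain kg1 where kg1: "acd 0 T g1 kg1" "sqi (LL 0 T) g1" "sqi (LL 0 T) kg1" using H_norm_1_finite[OF assms(10) T] by blast
 obtain U V P R where U: "sqQ T U" "sqQ T V" "sqQ T P" "sqQ T R"
 "AE p in leb (QT T). cp u p = cp U p" "AE x in LI. AE t in LL 0 T. U t x = u0 x + prim 0 (%s. V s x) t"
 "AE t in LL 0 T. acd 0 1 (U t) (P t)" "AE t in LL 0 T. acd 0 1 (P t) (R t)"
 "AE t in LL 0 T. h10 (%x. U t x - lin (g0 t) (g1 t) x) (%x. P t x - (g1 t - g0 t))"
 "AE t in LL 0 T. AE x in LI. V t x = Ax t x *R P t x + A t x *R R t x - \<beta> t x *R P t x - q x *R U t x + F t x"
 using c.strong_solution_facts[OF assms(13) ku(2) ac(2)] by (elim exE conjE)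
 have um: "cp u : bm (leb (QT T))"
 using assms(13) bochner_fin(1) unfolding strong_solution_def has_time_deriv_def by blast
 have bd: "\<bar>At t x\<bar> <= N" "\<bar>Ax t x\<bar> <= N" for t x using bo(3,4) by blast+
 interpret u: unperturbed T N a b A \<beta> q f F At Ax u U V P R u0 ku g0 g1 kg0 kg1
 by unfold_locales (rule bo(1,2) bd aA ac fF ku kg0 kg1 assms(11,12) U um)+
 note bound = u.perturbation_bound[OF assms(21) assms(14) assms(15) assms(16) assms(17) assms(18) assms(19) assms(20) assms(23) assms(31) assms(32) assms(33)]
 define K where "K = perturbation_const T \<alpha> (N + 1) u.X"
 have K: "0 <= K" unfolding K_def by (rule perturbation_const_nonneg[OF T assms(21)]) (use c.N in "simp_all add: u.X_def")
 have "((%\<epsilon>. H1L2_L2H2_norm T (%t x. ue \<epsilon> t x - u t x)) \<longlongrightarrow> 0) (at_right 0)"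
 proof (rule order_tendstoI)
 fix y :: ereal assume "y < 0"
 thus "\<forall>\<^sub>F \<epsilon> in at_right 0. y < H1L2_L2H2_norm T (%t x. ue \<epsilon> t x - u t x)"
 by (intro always_eventually allI less_le_trans[OF _ H1L2_L2H2_norm_nonneg])
 next
 fix y :: ereal assume "0 < y"
 then obtain d where d: "0 < ereal d" "ereal d < y" using ereal_dense2 by blast
 \<comment> \<open>The denominator \<open>K + 1\<close> also covers \<open>K = 0\<close>, and the
   minimum with 1 keeps the perturbed coefficients below the uniform bound.\<close>
 define S where "S = min 1 (d / (K + 1))"
 have S: "0 < S" "S <= 1" using d(1) K by (auto simp: S_def)
 have "K * S <= (K + 1) * (d / (K + 1))" by (rule mult_mono) (use K d(1) S in "auto simp: S_def")
 hence KS: "K * S <= d" using K by simp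
 have S0: "0 < ereal S" using S by simp
 have e: "\<forall>\<^sub>F \<epsilon> in at_right (0::real). \<epsilon> : {0<..1}" by (rule eventually_at_rightI[of 0 1]) auto
 show "\<forall>\<^sub>F \<epsilon> in at_right 0. H1L2_L2H2_norm T (%t x. ue \<epsilon> t x - u t x) < y"
 using e order_tendstoD(2)[OF assms(24) S0] order_tendstoD(2)[OF assms(25) S0] order_tendstoD(2)[OF assms(26) S0] order_tendstoD(2)[OF assms(27) S0]
 order_tendstoD(2)[OF assms(28) S0] order_tendstoD(2)[OF assms(29) S0] order_tendstoD(2)[OF assms(30) S0]
 proof eventually_elim
 case (elim \<epsilon>)
 note e = elim(1)
 have "H1L2_L2H2_norm T (%t x. ue \<epsilon> t x - u t x) <= ereal (K * S)"
 unfolding K_def using elim(2-8)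
 by (intro bound(2)[OF e e e e e e e e e e e less_imp_le[OF S(1)] S(2)] less_imp_le)
 also have "... <= ereal d" using KS by simp
 also have "... < y" by (rule d(2))
 finally show ?case .
 qed
 qed
 thus ?thesis using bound(1) by blast
qed

end
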